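(* The decision problem MSP (Modal Split Problem) is $\mathbf{NP}$-complete, even when restricted to instances with $w(e)=1$ for all $e\in E$, $m=1$ (one public transportation mode), $D(u,v)=1$ for all $u\ne v$, and $\eta_1=\tau_1=1$.
   Context: Modal Split Problem: data. A directed, weighted graph $G=(V,E,w)$ with $w:E\to\mathbb{R}_{\ge 0}$; a budget $B>0$; a demand $D:V^2\to\mathbb{N}_{\ge 0}$ with $D(v,v)=0$; a number $m$ of public transportation modes; and for each mode $i=0,\dots,m$ a travel time $\tau_i$, an energy consumption $\eta_i$, a cost $c_i$ (all nonnegative, per unit of distance, the last two per vehicle) and a positive capacity $k_i$ per vehicle. Mode $0$ is private transport, with $c_0=0$ and $k_0=1$; it is allowed on every edge without capacity constraint. For complexity purposes all numbers in an instance are rationals encoded in binary. The commodities are $K=\{(s,t)\in V^2: D(s,t)>0\}$. A layout is a map $L:E\to\mathbb{N}^m$ (with $0\in\mathbb{N}$); it is feasible if $\sum_{e}w(e)\sum_{i=1}^m c_iL(e)_i\le B$. For each $\kappa=(s,t)\in K$, a flow is a map $F_\kappa:E\to\mathbb{R}_{\ge 0}$ such that for every $v$ the inflow minus the outflow, $\sum_{e\in \mathrm{in}(v)}F_\kappa(e)-\sum_{e\in \mathrm{out}(v)}F_\kappa(e)$, equals $0$ if $v\ne s,t$, equals $D(s,t)$ if $v=t$, and equals $-D(s,t)$ if $v=s$. A modal split consists of maps $M_\kappa:E\to[0,1]^{m+1}$, $\kappa\in K$, with $\sum_{i=0}^m M_\kappa(e)_i=1$ for all $e$; it is feasible if $\sum_{\kappa\in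 K}F_\kappa(e)M_\kappa(e)_i\le k_iL(e)_i$ for all $e\in E$ and $i=1,\dots,m$. Put $F(e)=\sum_\kappa F_\kappa(e)$ and $M(e)_i=\frac{1}{F(e)}\sum_\kappa F_\kappa(e)M_\kappa(e)_i$ if $F(e)>0$, and $M(e)=(1,0,\dots,0)$ otherwise. A feasible solution is a triple $(F,L,M)$ of flows, a feasible layout and a feasible modal split. Total travel time: $\mathrm{T}(F,L,M)=\sum_e w(e)\sum_{i=0}^m\tau_iF(e)M(e)_i$. Total energy consumption: $\mathrm{H}(F,L,M)=\sum_e w(e)\bigl(\eta_0F(e)M(e)_0+\sum_{i=1}^m\eta_iL(e)_i\bigr)$. Decision problem MSP. Instance: a directed, weighted graph $G=(V,E,w)$ with $w:E\to\mathbb{R}_{\ge 0}$, a budget $B>0$, a demand $D:V^2\to\mathbb{N}_{\ge 0}$ with $D(v,v)=0$, a number $m$ of public transportation modes, and mode data $\tau_i,\eta_i,c_i\ge 0$, $k_i>0$ for $i=0,\dots,m$ with $c_0=0$ and $k_0=1$, together with $a,b\ge 0$. Question: does there exist a feasible solution $(F,L,M)$ with $\mathrm{T}(F,L,M)\le a$ and $\mathrm{H}(F,L,M)\le b$? *)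

theory Defs
  imports
    "Graph_Theory.Pair_Digraph"
    "HOL-Computational_Algebra.Polynomial"
    Complex_Main
begin

section \<open>Polynomial time and NP\<close>

text \<open>
  Deterministic Turing machines with finitely many two-way infinite tapes.  States and tape symbols
  are natural numbers below \<open>num_states\<close> and \<open>num_symbols\<close>.  State 0 is initial, state 1 is the
  only halting state; symbol 0 is the blank, symbols 1 and 2 stand for the input bits
  False and True.  The transition function maps a non-halting state and the list of scanned symbols
  to the next state and, for each tape, the symbol written and the head movement.
\<close>

datatype direction = Left | Stay | Right

fun offset :: "direction \<Rightarrow> int" where
  "offset Left = -1"
| "offset Stay = 0"
| "offset Right = 1"

record tm =
  num_tapes :: nat
  num_states :: nat
  num_symbols :: nat
  transition :: "nat \<Rightarrow> nat list \<Rightarrow> nat \<times> (nat \<times> direction) list"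

definition turing_machine :: "tm \<Rightarrow> bool" where
  "turing_machine M \<longleftrightarrow>
     1 \<le> num_tapes M \<and> 2 \<le> num_states M \<and> 3 \<le> num_symbols M \<and>
     (\<forall>q rs. q < num_states M \<and> q \<noteq> 1 \<and> length rs = num_tapes M \<and> set rs \<subseteq> {..<num_symbols M} \<longrightarrow>
        (case transition M q rs of (q', acts) \<Rightarrow>
           q' < num_states M \<and> length acts = num_tapes M \<and> fst ` set acts \<subseteq> {..<num_symbols M}))"

type_synonym tape = "int \<Rightarrow> nat"

text \<open>A configuration consists of the state and, for each tape, its contents and head position.\<close>

type_synonym config = "nat \<times> (tape \<times> int) list"

definition step :: "tm \<Rightarrow> config \<Rightarrow> config" where
  "step M c = (case c of (q, ts) \<Rightarrow>
     if q = 1 then c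
     else (case transition M q (map (\<lambda>(t, h). t h) ts) of (q', acts) \<Rightarrow>
       (q', map2 (\<lambda>(t, h) (a, d). (t(h := a), h + offset d)) ts acts)))"

definition tape_of :: "bool list \<Rightarrow> tape" where
  "tape_of x = (\<lambda>j. if 0 \<le> j \<and> j < int (length x) then (if x ! nat j then 2 else 1) else 0)"

definition initial_config :: "tm \<Rightarrow> bool list \<Rightarrow> config" where
  "initial_config M x = (0, (tape_of x, 0) # replicate (num_tapes M - 1) (tape_of [], 0))"

text \<open>Both the input and the output are found on the first tape.\<close>

definition computes_within :: "tm \<Rightarrow> (bool list \<Rightarrow> bool list) \<Rightarrow> (nat \<Rightarrow> nat) \<Rightarrow> bool" where
  "computes_within M f T \<longleftrightarrow>
     (\<forall>x. \<exists>n \<le> T (length x). \<exists>h ts. (step M ^^ n) (initial_config M x) = (1, (tape_of (f x), h) # ts))"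

definition polytime_computable :: "(bool list \<Rightarrow> bool list) \<Rightarrow> bool" where
  "polytime_computable f \<longleftrightarrow>
     (\<exists>M (p :: nat poly). turing_machine M \<and> computes_within M f (poly p))"

definition class_P :: "bool list set set" where
  "class_P = {A. polytime_computable (\<lambda>x. [x \<in> A])}"

text \<open>The string \<open>x\<close> in self-delimiting form, so that the pair of \<open>x\<close> and \<open>u\<close> can be represented by
  \<open>delimit x @ u\<close>.\<close>

definition delimit :: "bool list \<Rightarrow> bool list" where
  "delimit x = concat (map (\<lambda>b. [True, b]) x) @ [False]"

definition class_NP :: "bool list set set" where
  "class_NP = {A. \<exists>R \<in> class_P. \<exists>p :: nat poly.
     \<forall>x. x \<in> A \<longleftrightarrow> (\<exists>u. length u \<le> poly p (length x) \<and> delimit x @ u \<in> R)}"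

definition polytime_reducible :: "bool list set \<Rightarrow> bool list set \<Rightarrow> bool" where
  "polytime_reducible A B \<longleftrightarrow> (\<exists>f. polytime_computable f \<and> (\<forall>x. x \<in> A \<longleftrightarrow> f x \<in> B))"

definition NP_complete :: "bool list set \<Rightarrow> bool" where
  "NP_complete A \<longleftrightarrow> A \<in> class_NP \<and> (\<forall>B \<in> class_NP. polytime_reducible B A)"


section \<open>The Modal Split Problem\<close>

text \<open>
  Mode 0 is private transport, modes \<open>1, \<dots>, modes P\<close> are the public ones.  The values of
  \<open>weight\<close> off the arcs, of \<open>demand\<close> off pairs of vertices, and of the mode data beyond
  \<open>modes P\<close> are irrelevant.
\<close>

record 'v msp_instance =
  graph :: "'v pair_pre_digraph"
  weight :: "'v \<times> 'v \<Rightarrow> rat"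
  budget :: rat
  demand :: "'v \<times> 'v \<Rightarrow> nat"
  modes :: nat
  travel_time :: "nat \<Rightarrow> rat"
  energy :: "nat \<Rightarrow> rat"
  cost :: "nat \<Rightarrow> rat"
  capacity :: "nat \<Rightarrow> rat"
  time_bound :: rat
  energy_bound :: rat

definition valid_instance :: "'v msp_instance \<Rightarrow> bool" where
  "valid_instance P \<longleftrightarrow>
     pair_fin_digraph (graph P) \<and>
     (\<forall>e \<in> parcs (graph P). 0 \<le> weight P e) \<and>
     0 < budget P \<and>
     (\<forall>v \<in> pverts (graph P). demand P (v, v) = 0) \<and>
     (\<forall>i \<in> {0..modes P}. 0 \<le> travel_time P i \<and> 0 \<le> energy P i \<and> 0 \<le> cost P i \<and> 0 < capacity P i) \<and>
     cost P 0 = 0 \<and> capacity P 0 = 1 \<and>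
     0 \<le> time_bound P \<and> 0 \<le> energy_bound P"

definition commodities :: "'v msp_instance \<Rightarrow> ('v \<times> 'v) set" where
  "commodities P = {\<kappa> \<in> pverts (graph P) \<times> pverts (graph P). 0 < demand P \<kappa>}"

type_synonym 'v flows = "'v \<times> 'v \<Rightarrow> 'v \<times> 'v \<Rightarrow> real"
type_synonym 'v layout = "'v \<times> 'v \<Rightarrow> nat \<Rightarrow> nat"
type_synonym 'v modal_split = "'v \<times> 'v \<Rightarrow> 'v \<times> 'v \<Rightarrow> nat \<Rightarrow> real"

definition is_flow :: "'v msp_instance \<Rightarrow> 'v \<times> 'v \<Rightarrow> ('v \<times> 'v \<Rightarrow> real) \<Rightarrow> bool" where
  "is_flow P \<kappa> f \<longleftrightarrow>
     (\<forall>e \<in> parcs (graph P). 0 \<le> f e) \<and>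
     (\<forall>v \<in> pverts (graph P).
        (\<Sum>e \<in> in_arcs (with_proj (graph P)) v. f e) - (\<Sum>e \<in> out_arcs (with_proj (graph P)) v. f e) =
        (if v = snd \<kappa> then real (demand P \<kappa>)
         else if v = fst \<kappa> then - real (demand P \<kappa>)
         else 0))"

definition feasible_layout :: "'v msp_instance \<Rightarrow> 'v layout \<Rightarrow> bool" where
  "feasible_layout P L \<longleftrightarrow>
     (\<Sum>e \<in> parcs (graph P). weight P e * (\<Sum>i = 1..modes P. cost P i * of_nat (L e i))) \<le> budget P"

definition is_modal_split :: "'v msp_instance \<Rightarrow> 'v modal_split \<Rightarrow> bool" where
  "is_modal_split P M \<longleftrightarrow>
     (\<forall>\<kappa> \<in> commodities P. \<forall>e \<in> parcs (graph P).
        (\<forall>i \<in> {0..modes P}. M \<kappa> e i \<in> {0..1}) \<and> (\<Sum>i = 0..modes P. M \<kappa> e i) = 1)"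

definition feasible_modal_split ::
  "'v msp_instance \<Rightarrow> 'v flows \<Rightarrow> 'v layout \<Rightarrow> 'v modal_split \<Rightarrow> bool" where
  "feasible_modal_split P F L M \<longleftrightarrow>
     is_modal_split P M \<and>
     (\<forall>e \<in> parcs (graph P). \<forall>i \<in> {1..modes P}.
        (\<Sum>\<kappa> \<in> commodities P. F \<kappa> e * M \<kappa> e i) \<le> of_rat (capacity P i) * real (L e i))"

definition feasible_solution ::
  "'v msp_instance \<Rightarrow> 'v flows \<Rightarrow> 'v layout \<Rightarrow> 'v modal_split \<Rightarrow> bool" where
  "feasible_solution P F L M \<longleftrightarrow>
     (\<forall>\<kappa> \<in> commodities P. is_flow P \<kappa> (F \<kappa>)) \<and> feasible_layout P L \<and> feasible_modal_split P F L M"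

definition total_flow :: "'v msp_instance \<Rightarrow> 'v flows \<Rightarrow> 'v \<times> 'v \<Rightarrow> real" where
  "total_flow P F e = (\<Sum>\<kappa> \<in> commodities P. F \<kappa> e)"

definition mean_split :: "'v msp_instance \<Rightarrow> 'v flows \<Rightarrow> 'v modal_split \<Rightarrow> 'v \<times> 'v \<Rightarrow> nat \<Rightarrow> real" where
  "mean_split P F M e i =
     (if total_flow P F e > 0
      then 1 / total_flow P F e * (\<Sum>\<kappa> \<in> commodities P. F \<kappa> e * M \<kappa> e i)
      else if i = 0 then 1 else 0)"

definition total_time :: "'v msp_instance \<Rightarrow> 'v flows \<Rightarrow> 'v layout \<Rightarrow> 'v modal_split \<Rightarrow> real" where
  "total_time P F L M =
     (\<Sum>e \<in> parcs (graph P). of_rat (weight P e) *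
        (\<Sum>i = 0..modes P. of_rat (travel_time P i) * total_flow P F e * mean_split P F M e i))"

definition total_energy :: "'v msp_instance \<Rightarrow> 'v flows \<Rightarrow> 'v layout \<Rightarrow> 'v modal_split \<Rightarrow> real" where
  "total_energy P F L M =
     (\<Sum>e \<in> parcs (graph P). of_rat (weight P e) *
        (of_rat (energy P 0) * total_flow P F e * mean_split P F M e 0 +
         (\<Sum>i = 1..modes P. of_rat (energy P i) * real (L e i))))"

definition yes_instance :: "'v msp_instance \<Rightarrow> bool" where
  "yes_instance P \<longleftrightarrow>
     (\<exists>F L M. feasible_solution P F L M \<and>
        total_time P F L M \<le> of_rat (time_bound P) \<and> total_energy P F L M \<le> of_rat (energy_bound P))"

definition restricted_instance :: "'v msp_instance \<Rightarrow> bool" where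
  "restricted_instance P \<longleftrightarrow>
     (\<forall>e \<in> parcs (graph P). weight P e = 1) \<and>
     modes P = 1 \<and>
     (\<forall>u \<in> pverts (graph P). \<forall>v \<in> pverts (graph P). u \<noteq> v \<longrightarrow> demand P (u, v) = 1) \<and>
     energy P 1 = 1 \<and> travel_time P 1 = 1"


section \<open>MSP as a language\<close>

text \<open>
  As inputs of Turing machines, instances have vertex set \<open>{..<n}\<close>.  Such an instance is serialised as
  a list of natural numbers (the matrix of arc weights and demands row by row, nonnegative rationals
  as reduced fractions), each of which is written in self-delimiting binary, least significant bit
  first.
\<close>

fun binary :: "nat \<Rightarrow> bool list" where
  "binary n = (if n = 0 then [] else odd n # binary (n div 2))"

declare binary.simps [simp del]

definition fraction :: "rat \<Rightarrow> nat list" where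
  "fraction q = (case quotient_of q of (a, b) \<Rightarrow> [nat a, nat b])"

definition serialise :: "nat msp_instance \<Rightarrow> nat list" where
  "serialise P =
     (let n = card (pverts (graph P)) in
      [n, modes P] @
      concat (map (\<lambda>e. (if e \<in> parcs (graph P) then 1 # fraction (weight P e) else [0]) @ [demand P e])
        (List.product [0..<n] [0..<n])) @
      concat (map (\<lambda>i. fraction (travel_time P i) @ fraction (energy P i) @
                       fraction (cost P i) @ fraction (capacity P i)) [0..<Suc (modes P)]) @
      fraction (budget P) @ fraction (time_bound P) @ fraction (energy_bound P))"

definition encode :: "nat msp_instance \<Rightarrow> bool list" where
  "encode P = concat (map (\<lambda>k. delimit (binary k)) (serialise P))"

definition instances :: "nat msp_instance set" where
  "instances = {P. valid_instance P \<and> (\<exists>n. pverts (graph P) = {..<n})}"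

definition MSP :: "bool list set" where
  "MSP = encode ` {P \<in> instances. yes_instance P}"

definition restricted_MSP :: "bool list set" where
  "restricted_MSP = encode ` {P \<in> instances. restricted_instance P \<and> yes_instance P}"

text \<open>The encoding is faithful: it determines an instance up to the irrelevant values above.\<close>

definition same_data :: "'v msp_instance \<Rightarrow> 'v msp_instance \<Rightarrow> bool" where
  "same_data P Q \<longleftrightarrow>
     graph P = graph Q \<and> modes P = modes Q \<and>
     (\<forall>e \<in> parcs (graph P). weight P e = weight Q e) \<and>
     (\<forall>e \<in> pverts (graph P) \<times> pverts (graph P). demand P e = demand Q e) \<and>
     (\<forall>i \<in> {0..modes P}. travel_time P i = travel_time Q i \<and> energy P i = energy Q i \<and>
        cost P i = cost Q i \<and> capacity P i = capacity Q i) \<and>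
     budget P = budget Q \<and> time_bound P = time_bound Q \<and> energy_bound P = energy_bound Q"

lemma same_data_yes_instance:
  assumes "same_data P Q" "yes_instance P"
  shows "yes_instance Q"
proof -
  note d = assms(1)[unfolded same_data_def]
  have g: "graph P = graph Q" and m: "modes P = modes Q" using d by auto
  have w: "\<And>e. e \<in> parcs (graph Q) \<Longrightarrow> weight P e = weight Q e"
    and D: "\<And>e. e \<in> pverts (graph Q) \<times> pverts (graph Q) \<Longrightarrow> demand P e = demand Q e"
    and M: "\<And>i. i \<le> modes Q \<Longrightarrow> travel_time P i = travel_time Q i \<and> energy P i = energy Q i \<and>
        cost P i = cost Q i \<and> capacity P i = capacity Q i"
    using d by auto
  have K: "commodities P = commodities Q"
    using D unfolding commodities_def g by fastforce
  have fl: "is_flow P \<kappa> f = is_flow Q \<kappa> f" if "\<kappa> \<in> commodities Q" for \<kappa> f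
    using that D[of \<kappa>] unfolding is_flow_def g by (simp add: commodities_def)
  have lay: "feasible_layout P = feasible_layout Q"
    unfolding feasible_layout_def fun_eq_iff g m
    using d w M by simp
  have ms: "feasible_modal_split P = feasible_modal_split Q"
    unfolding feasible_modal_split_def is_modal_split_def fun_eq_iff g m K
    using M by simp
  have tf: "total_flow P = total_flow Q"
    unfolding total_flow_def fun_eq_iff K by simp
  have mn: "mean_split P = mean_split Q"
    unfolding mean_split_def fun_eq_iff K tf by simp
  have T: "total_time P = total_time Q"
    unfolding total_time_def fun_eq_iff g m tf mn
    using w M by simp
  have H: "total_energy P = total_energy Q"
    unfolding total_energy_def fun_eq_iff g m tf mn
    using w M by simp
  have fs: "feasible_solution P = feasible_solution Q"
    unfolding feasible_solution_def fun_eq_iff K lay ms using fl by auto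
  show ?thesis
    using assms(2) d unfolding yes_instance_def fs T H by auto
qed

lemma delimit_append_eq: "delimit x @ r = delimit y @ s \<longleftrightarrow> x = y \<and> r = s"
proof (induction x arbitrary: y)
  case Nil
  show ?case by (cases y) (auto simp: delimit_def)
next
  case (Cons b x)
  then show ?case by (cases y) (auto simp: delimit_def)
qed

lemma binary_eq: "binary k = binary l \<longleftrightarrow> k = l"
proof (induction k arbitrary: l rule: less_induct)
  case (less k)
  show ?case
  proof (cases "k = 0 \<or> l = 0")
    case True
    then show ?thesis by (auto simp: binary.simps[of k] binary.simps[of l] binary.simps[of 0])
  next
    case False
    then have "binary k = binary l \<longleftrightarrow> odd k = odd l \<and> k div 2 = l div 2"
      using less[of "k div 2" "l div 2"]
      by (simp add: binary.simps[of k] binary.simps[of l])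
    also have "\<dots> \<longleftrightarrow> k = l" by presburger
    finally show ?thesis .
  qed
qed

lemma concat_delimit_eq:
  "concat (map (\<lambda>k. delimit (binary k)) xs) = concat (map (\<lambda>k. delimit (binary k)) ys) \<longleftrightarrow> xs = ys"
proof (induction xs arbitrary: ys)
  case Nil
  show ?case by (cases ys) (auto simp: delimit_def)
next
  case (Cons x xs)
  show ?case
  proof (cases ys)
    case Nil
    then show ?thesis by (auto simp: delimit_def)
  next
    case (Cons y zs)
    then show ?thesis using Cons.IH[of zs] by (simp add: delimit_append_eq binary_eq)
  qed
qed

lemma fraction_append_eq:
  assumes "0 \<le> q" "0 \<le> q'"
  shows "fraction q @ r = fraction q' @ s \<longleftrightarrow> q = q' \<and> r = s"
proof -
  obtain a b a' b' where q: "quotient_of q = (a, b)" "quotient_of q' = (a', b')"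
    by (metis surj_pair)
  have b: "b > 0" "b' > 0" using q quotient_of_denom_pos by blast+
  have e: "q = of_int a / of_int b" "q' = of_int a' / of_int b'"
    using q quotient_of_div by blast+
  have "a \<ge> 0" "a' \<ge> 0"
    using assms(1,2) b unfolding e by (simp_all add: zero_le_divide_iff)
  then have "fraction q @ r = fraction q' @ s \<longleftrightarrow> a = a' \<and> b = b' \<and> r = s"
    using b by (simp add: fraction_def q(1) q(2) eq_nat_nat_iff)
  moreover have "q = q' \<longleftrightarrow> a = a' \<and> b = b'" by (metis q e prod.inject)
  ultimately show ?thesis by simp
qed

lemma concat_map_append_eq:
  assumes "\<And>x r s. x \<in> set xs \<Longrightarrow> f x @ r = g x @ s \<Longrightarrow> A x \<and> r = s"
    and "concat (map f xs) @ r = concat (map g xs) @ s"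
  shows "(\<forall>x \<in> set xs. A x) \<and> r = s"
  using assms
proof (induction xs)
  case (Cons x xs)
  have hd: "A x \<and> concat (map f xs) @ r = concat (map g xs) @ s"
    using Cons.prems(1)[of x] Cons.prems(2) by simp
  have "(\<forall>x \<in> set xs. A x) \<and> r = s"
    by (rule Cons.IH[OF _ conjunct2[OF hd]]) (rule Cons.prems(1), simp_all)
  then show ?case using hd by simp
qed simp

lemma encode_same_data:
  assumes P: "P \<in> instances" and Q: "Q \<in> instances" and eq: "encode P = encode Q"
  shows "same_data P Q"
proof -
  obtain n n' where n: "pverts (graph P) = {..<n}" "pverts (graph Q) = {..<n'}"
    and v: "valid_instance P" "valid_instance Q"
    using P Q by (auto simp: instances_def)
  let ?m = "\<lambda>P i. fraction (travel_time P i) @ fraction (energy P i) @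
                       fraction (cost P i) @ fraction (capacity P i)"
  let ?e = "\<lambda>P e. (if e \<in> parcs (graph P) then 1 # fraction (weight P e) else [0]) @ [demand P e]"
  let ?t = "\<lambda>P. fraction (budget P) @ fraction (time_bound P) @ fraction (energy_bound P)"
  have ser: "serialise P = serialise Q" using eq unfolding encode_def concat_delimit_eq .
  then have nn: "n' = n" and mm: "modes Q = modes P"
    unfolding serialise_def n by (simp_all add: Let_def del: upt_Suc)
  from ser have s: "concat (map (?e P) (List.product [0..<n] [0..<n])) @
        concat (map (?m P) [0..<Suc (modes P)]) @ ?t P =
      concat (map (?e Q) (List.product [0..<n] [0..<n])) @
        concat (map (?m Q) [0..<Suc (modes P)]) @ ?t Q"
    unfolding serialise_def n nn mm Let_def card_lessThan append_assoc append_Cons append_Nil list.inject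
    by blast
  have 1: "((e \<in> parcs (graph P) \<longleftrightarrow> e \<in> parcs (graph Q)) \<and>
        (e \<in> parcs (graph P) \<longrightarrow> weight P e = weight Q e) \<and> demand P e = demand Q e) \<and> r = s"
    if "?e P e @ r = ?e Q e @ s" for e r s
  proof (cases "e \<in> parcs (graph P)")
    case True
    then have Qe: "e \<in> parcs (graph Q)" using that by (auto split: if_splits)
    have "0 \<le> weight P e" "0 \<le> weight Q e" using v True Qe by (auto simp: valid_instance_def)
    then show ?thesis
      using that True Qe fraction_append_eq[of "weight P e" "weight Q e" "demand P e # r" "demand Q e # s"] by auto
  next
    case False
    then show ?thesis using that by (auto split: if_splits)
  qed
  have s1: "(\<forall>e \<in> set (List.product [0..<n] [0..<n]). (e \<in> parcs (graph P) \<longleftrightarrow> e \<in> parcs (graph Q)) \<and>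
        (e \<in> parcs (graph P) \<longrightarrow> weight P e = weight Q e) \<and> demand P e = demand Q e) \<and>
      concat (map (?m P) [0..<Suc (modes P)]) @ ?t P = concat (map (?m Q) [0..<Suc (modes P)]) @ ?t Q"
    by (rule concat_map_append_eq[OF _ s]) (rule 1)
  have 2: "(travel_time P i = travel_time Q i \<and> energy P i = energy Q i \<and>
      cost P i = cost Q i \<and> capacity P i = capacity Q i) \<and> r = s"
    if "i \<in> set [0..<Suc (modes P)]" "?m P i @ r = ?m Q i @ s" for i r s
  proof -
    have "i \<in> {0..modes P}" "i \<in> {0..modes Q}" using that(1) mm by auto
    then have "0 \<le> travel_time P i" "0 \<le> energy P i" "0 \<le> cost P i" "0 \<le> capacity P i"
      "0 \<le> travel_time Q i" "0 \<le> energy Q i" "0 \<le> cost Q i" "0 \<le> capacity Q i"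
      using v unfolding valid_instance_def by (blast intro: less_imp_le)+
    then show ?thesis using that(2) by (simp add: fraction_append_eq)
  qed
  have s2: "(\<forall>i \<in> set [0..<Suc (modes P)]. travel_time P i = travel_time Q i \<and> energy P i = energy Q i \<and>
      cost P i = cost Q i \<and> capacity P i = capacity Q i) \<and> ?t P = ?t Q"
    by (rule concat_map_append_eq[OF _ conjunct2[OF s1]]) (rule 2)
  have nonneg: "0 \<le> budget P" "0 \<le> time_bound P" "0 \<le> energy_bound P"
      "0 \<le> budget Q" "0 \<le> time_bound Q" "0 \<le> energy_bound Q"
    using v by (auto simp: valid_instance_def)
  have "fraction (budget P) @ fraction (time_bound P) @ fraction (energy_bound P) @ [] =
      fraction (budget Q) @ fraction (time_bound Q) @ fraction (energy_bound Q) @ []"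
    using s2 by simp
  then have t: "budget P = budget Q" "time_bound P = time_bound Q" "energy_bound P = energy_bound Q"
    by (simp_all only: fraction_append_eq nonneg)
  have sub: "parcs (graph P) \<subseteq> {..<n} \<times> {..<n}" "parcs (graph Q) \<subseteq> {..<n} \<times> {..<n}"
    using v n nn
    by (auto simp: valid_instance_def pair_fin_digraph_def
        dest: pair_wf_digraph.in_arcsD1 pair_wf_digraph.in_arcsD2)
  have E: "e \<in> parcs (graph P) \<longleftrightarrow> e \<in> parcs (graph Q)" if "e \<in> {..<n} \<times> {..<n}" for e
    using s1 that by (auto simp: atLeast0LessThan)
  then have "parcs (graph P) = parcs (graph Q)" using sub by blast
  then have g: "graph P = graph Q" using n nn by (simp add: pair_pre_digraph.equality)
  have "weight P e = weight Q e" if "e \<in> parcs (graph P)" for e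
    using s1 sub that by (auto simp: atLeast0LessThan)
  moreover have "demand P e = demand Q e" if "e \<in> pverts (graph P) \<times> pverts (graph P)" for e
    using s1 that n by (auto simp: atLeast0LessThan)
  moreover have "travel_time P i = travel_time Q i \<and> energy P i = energy Q i \<and>
      cost P i = cost Q i \<and> capacity P i = capacity Q i" if "i \<in> {0..modes P}" for i
    using conjunct1[OF s2] that by (simp add: less_Suc_eq_le del: upt_Suc)
  ultimately show ?thesis
    unfolding same_data_def using g mm t by simp
qed

lemma encode_in_MSP_iff:
  assumes "P \<in> instances"
  shows "encode P \<in> MSP \<longleftrightarrow> yes_instance P"
proof
  assume "encode P \<in> MSP"
  then obtain Q where "Q \<in> instances" "yes_instance Q" "encode P = encode Q"
    unfolding MSP_def by (elim imageE CollectE conjE)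
  then show "yes_instance P"
    using encode_same_data[of Q P] same_data_yes_instance[of Q P] assms by simp
next
  assume "yes_instance P"
  then show "encode P \<in> MSP"
    unfolding MSP_def using assms by (intro imageI CollectI conjI)
qed

end

theory Submission
  imports Defs "Jordan_Normal_Form.Determinant"
begin

text \<open>
  A language is shown to be polynomial-time decidable, and a reduction to be computable, by composing
  functions on binary trees: a small set of tree functions, closed under composition and under
  iteration with polynomially bounded intermediate values, is compiled to programs that manipulate
  stacks, and these are compiled to Turing machines.

  Membership in NP: in terms of the products of flow and split, the conditions on a solution with a
  given layout are linear.  Cancelling cycles bounds the flow of each commodity on each arc by its
  demand, hence a layout with numbers of polynomial length suffices.  By Cramer's rule, a feasible
  linear system has a solution whose entries are fractions of polynomial length.

  Hardness: as in the Cook-Levin theorem, the computations of a verifier are the satisfying assignments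
  of a set of clauses, and a set of clauses is satisfiable if and only if its clauses and the pairs
  \<open>{a, \<not> a}\<close> are hit by as many literals as there are atoms.  Hitting sets reduce to MSP: the vertices
  are a root, the elements, and many copies of each set.  Every element is joined with the root in
  both directions and with the sets that contain it, and every set has an arc to the root.  The energy
  bound permits as many public arcs as the hitting set may have elements, so that the travel time is
  within its bound if and only if, for each set, one of the arcs from the root to its elements is public.
\<close>

section \<open>Structured tape programs\<close>

text \<open>\<open>class_P\<close> and \<open>class_NP\<close> speak of machines, so each function
  used must in the end be a machine with a time bound. Both directions need many such functions,
  hence a calculus whose closure properties replace all later arguments about machines. In the
  membership part, fixing the layout leaves a linear system, but the entries of the layout occur in
  its right-hand sides. They must therefore be bounded before a small solution of the system is of
  any use. The verifier does not parse its input: the certificate contains the instance, whose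
  serialisation is compared with the input. In the hardness part the demand is 1 between all pairs,
  so traffic unrelated to the hitting set cannot be switched off. It is drowned instead: with 64 *
  (number of elements + 1) copies of each set, the pairs of copies dominate the total time. Such a
  pair needs time 5 if the target is hit, namely 2 to the root, 1 by public transport to an element
  and 2 to the copy, and it needs 6 if the target is not hit.\<close>

datatype com =
    Act nat "nat option" direction
  | Seq com com
  | If nat "nat set" com com
  | While nat "nat set" com

type_synonym store = "nat \<Rightarrow> tape \<times> int"

definition scan :: "store \<Rightarrow> nat \<Rightarrow> nat" where
  "scan s r = fst (s r) (snd (s r))"

definition act :: "nat \<Rightarrow> nat option \<Rightarrow> direction \<Rightarrow> store \<Rightarrow> store" where
  "act r a d s = s(r := ((case a of None \<Rightarrow> fst (s r) | Some b \<Rightarrow> (fst (s r))(snd (s r) := b)), snd (s r) + offset d))"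

text \<open>Entering a sequence, choosing a branch and testing a loop cost 1 as well, so that the
  count is exactly the number of steps of the machine built below.\<close>

inductive exec :: "com \<Rightarrow> store \<Rightarrow> nat \<Rightarrow> store \<Rightarrow> bool" where
  exec_Act: "exec (Act r a d) s 1 (act r a d s)"
| exec_Seq: "exec c s m s1 \<Longrightarrow> exec c' s1 n s2 \<Longrightarrow> exec (Seq c c') s (Suc (m + n)) s2"
| exec_If: "exec (if scan s r \<in> A then c else c') s m s1 \<Longrightarrow> exec (If r A c c') s (Suc m) s1"
| exec_While_False: "scan s r \<notin> A \<Longrightarrow> exec (While r A c) s 1 s"
| exec_While_True: "scan s r \<in> A \<Longrightarrow> exec c s m s1 \<Longrightarrow> exec (While r A c) s1 n s2 \<Longrightarrow>
    exec (While r A c) s (Suc (m + n)) s2"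

primrec wf_com :: "nat \<Rightarrow> com \<Rightarrow> bool" where
  "wf_com k (Act r a d) \<longleftrightarrow> r < k \<and> (\<forall>b. a = Some b \<longrightarrow> b < 3)"
| "wf_com k (Seq c c') \<longleftrightarrow> wf_com k c \<and> wf_com k c'"
| "wf_com k (If r A c c') \<longleftrightarrow> r < k \<and> wf_com k c \<and> wf_com k c'"
| "wf_com k (While r A c) \<longleftrightarrow> r < k \<and> wf_com k c"

text \<open>The control state of the machine that runs a program is the stack of programs still to be run.\<close>

fun next_control :: "com list \<Rightarrow> nat list \<Rightarrow> com list" where
  "next_control [] rs = []"
| "next_control (Act r a d # K) rs = K"
| "next_control (Seq c c' # K) rs = c # c' # K"
| "next_control (If r A c c' # K) rs = (if rs ! r \<in> A then c else c') # K"
| "next_control (While r A c # K) rs = (if rs ! r \<in> A then c # While r A c # K else K)"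

fun next_act :: "com list \<Rightarrow> nat \<Rightarrow> nat \<Rightarrow> nat \<times> direction" where
  "next_act (Act r a d # K) i v = (if i = r then (case a of None \<Rightarrow> v | Some b \<Rightarrow> b, d) else (v, Stay))"
| "next_act _ i v = (v, Stay)"

fun next_store :: "com list \<Rightarrow> store \<Rightarrow> store" where
  "next_store (Act r a d # K) s = act r a d s"
| "next_store _ s = s"

text \<open>The stacks met while \<open>c\<close> runs on top of \<open>K\<close>, without the final
  \<open>K\<close>. A loop body returns to the loop itself, so stacks do not grow with the number of
  rounds and finitely many states suffice.\<close>

primrec controls :: "com \<Rightarrow> com list \<Rightarrow> com list set" where
  "controls (Act r a d) K = {Act r a d # K}"
| "controls (Seq c c') K = insert (Seq c c' # K) (controls c (c' # K) \<union> controls c' K)"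
| "controls (If r A c c') K = insert (If r A c c' # K) (controls c K \<union> controls c' K)"
| "controls (While r A c) K = insert (While r A c # K) (controls c (While r A c # K))"

lemma finite_controls: "finite (controls c K)"
  by (induction c arbitrary: K) auto

lemma self_in_controls: "c # K \<in> controls c K"
  by (cases c) auto

lemma next_in_controls:
  "L \<in> controls c K \<Longrightarrow> next_control L rs \<in> insert K (controls c K)"
proof (induction c arbitrary: K)
  case (Seq c c')
  have "next_control L rs \<in> insert (c' # K) (controls c (c' # K))" if "L \<in> controls c (c' # K)"
    using Seq.IH(1)[OF that] .
  moreover have "next_control L rs \<in> insert K (controls c' K)" if "L \<in> controls c' K"
    using Seq.IH(2)[OF that] .
  ultimately show ?case
    using Seq.prems self_in_controls[of c "c' # K"] self_in_controls[of c' K] unfolding controls.simps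
    by (elim insertE UnE) auto
next
  case (If r A c c')
  have "next_control L rs \<in> insert K (controls c K)" if "L \<in> controls c K"
    using If.IH(1)[OF that] .
  moreover have "next_control L rs \<in> insert K (controls c' K)" if "L \<in> controls c' K"
    using If.IH(2)[OF that] .
  ultimately show ?case
    using If.prems self_in_controls[of c K] self_in_controls[of c' K] unfolding controls.simps
    by (elim insertE UnE) auto
next
  case (While r A c)
  have "next_control L rs \<in> insert (While r A c # K) (controls c (While r A c # K))"
    if "L \<in> controls c (While r A c # K)"
    using While.IH[OF that] .
  then show ?case
    using While.prems self_in_controls[of c "While r A c # K"] unfolding controls.simps
    by (elim insertE UnE) auto
qed auto

lemma controls_wf:
  "L \<in> controls c K \<Longrightarrow> wf_com k c \<Longrightarrow> (\<forall>c' \<in> set K. wf_com k c') \<Longrightarrow> (\<forall>c' \<in> set L. wf_com k c')"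
proof (induction c arbitrary: K)
  case (Seq c c')
  have "\<forall>c'' \<in> set L. wf_com k c''" if "L \<in> controls c (c' # K)"
    using Seq.IH(1)[OF that] Seq.prems by simp
  moreover have "\<forall>c'' \<in> set L. wf_com k c''" if "L \<in> controls c' K"
    using Seq.IH(2)[OF that] Seq.prems by simp
  ultimately show ?case using Seq.prems unfolding controls.simps by (elim insertE UnE) auto
next
  case (If r A c c')
  have "\<forall>c'' \<in> set L. wf_com k c''" if "L \<in> controls c K"
    using If.IH(1)[OF that] If.prems by simp
  moreover have "\<forall>c'' \<in> set L. wf_com k c''" if "L \<in> controls c' K"
    using If.IH(2)[OF that] If.prems by simp
  ultimately show ?case using If.prems unfolding controls.simps by (elim insertE UnE) auto
next
  case (While r A c)
  have "\<forall>c'' \<in> set L. wf_com k c''" if "L \<in> controls c (While r A c # K)"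
    using While.IH[OF that] While.prems by simp
  then show ?case using While.prems unfolding controls.simps by (elim insertE UnE) auto
qed auto

section \<open>Simulation of programs by Turing machines\<close>

definition com_step :: "com list \<times> store \<Rightarrow> nat \<Rightarrow> com list \<times> store" where
  "com_step x k = (next_control (fst x) (map (scan (snd x)) [0..<k]), next_store (fst x) (snd x))"

lemma exec_com_step:
  assumes "exec c s t s'" "wf_com k c"
  shows "((\<lambda>x. com_step x k) ^^ t) (c # K, s) = (K, s')"
  using assms
proof (induction arbitrary: K rule: exec.induct)
  case (exec_Seq c s m s1 c' n s2)
  then show ?case by (simp add: com_step_def funpow_add add.commute[of m] funpow_swap1 del: funpow.simps(2) add: funpow_Suc_right)
next
  case (exec_If s r A c c' m s1)
  then show ?case by (auto simp: com_step_def simp del: funpow.simps(2) simp add: funpow_Suc_right)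
next
  case (exec_While_True s r A c m s1 n s2)
  then show ?case by (simp add: com_step_def funpow_add add.commute[of m] del: funpow.simps(2) add: funpow_Suc_right)
qed (simp_all add: com_step_def)

text \<open>\<open>\<phi>\<close> numbers the control stacks in \<open>Q\<close>. Numbers that it
  skips get a dummy transition, because \<open>turing_machine\<close> constrains all states below
  \<open>num_states\<close>.\<close>

definition com_tm :: "nat \<Rightarrow> (com list \<Rightarrow> nat) \<Rightarrow> com list set \<Rightarrow> tm" where
  "com_tm k \<phi> Q = \<lparr>num_tapes = k, num_states = Suc (Max (\<phi> ` Q)), num_symbols = 3,
     transition = (\<lambda>q rs. if q \<in> \<phi> ` Q
       then (\<phi> (next_control (inv_into Q \<phi> q) rs), map (\<lambda>i. next_act (inv_into Q \<phi> q) i (rs ! i)) [0..<k])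
       else (0, map (\<lambda>i. (rs ! i, Stay)) [0..<k]))\<rparr>"

lemma next_act_less:
  assumes "\<forall>c \<in> set L. wf_com k c" "v < 3"
  shows "fst (next_act L i v) < 3"
  using assms by (cases "(L, i, v)" rule: next_act.cases) (auto split: option.splits)

lemma com_tm_step:
  assumes Q: "finite Q" "inj_on \<phi> Q" "\<phi> [] = 1" "[] \<in> Q" and L: "L \<in> Q" "L \<noteq> []"
  shows "step (com_tm k \<phi> Q) (\<phi> L, map s [0..<k]) =
    (\<phi> (fst (com_step (L, s) k)), map (snd (com_step (L, s) k)) [0..<k])"
proof -
  have inv: "inv_into Q \<phi> (\<phi> L) = L" using Q L by simp
  have ne: "\<phi> L \<noteq> 1" using Q L by (metis inj_onD)
  have m: "map (\<lambda>(t, h). t h) (map s [0..<k]) = map (scan s) [0..<k]"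
    by (simp add: scan_def case_prod_beta)
  have n: "map (\<lambda>i. next_act L i (map (scan s) [0..<k] ! i)) [0..<k] = map (\<lambda>i. next_act L i (scan s i)) [0..<k]"
    by simp
  have z: "map2 f (map g xs) (map h xs) = map (\<lambda>x. f (g x) (h x)) xs" for f g h and xs :: "nat list"
    by (induction xs) auto
  have st: "(case s i of (t, h) \<Rightarrow> (case next_act L i (scan s i) of (a, d) \<Rightarrow> (t(h := a), h + offset d))) = next_store L s i" for i
    by (cases "(L, i, scan s i)" rule: next_act.cases) (auto simp: act_def scan_def split: option.splits prod.splits)
  have z': "map2 (\<lambda>(t, h) (a, d). (t(h := a), h + offset d)) (map s [0..<k]) (map (\<lambda>i. next_act L i (scan s i)) [0..<k]) =
      map (next_store L s) [0..<k]"
    unfolding z st[symmetric] by (simp add: case_prod_beta)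
  show ?thesis
    unfolding step_def prod.case if_not_P[OF ne] m
    using L by (simp add: com_tm_def inv com_step_def n z' del: map_map cong: map_cong)
qed

lemma com_tm_run:
  assumes c: "wf_com k c" "1 \<le> k"
  shows "\<exists>M. turing_machine M \<and> num_tapes M = k \<and>
    (\<forall>s t s'. exec c s t s' \<longrightarrow> (\<exists>n\<le>t. (step M ^^ n) (0, map s [0..<k]) = (1, map s' [0..<k])))"
proof -
  define Q where "Q = insert [] (controls c [])"
  have fQ: "finite Q" by (simp add: Q_def finite_controls)
  obtain g :: "com list \<Rightarrow> nat" where g: "inj_on g Q"
    using finite_imp_inj_to_nat_seg[OF fQ] by blast
  \<comment> \<open>0 and 1 are reserved for the initial and the halting state, here the stacks
    \<open>[c]\<close> and \<open>[]\<close>; the shift by 2 keeps all other stacks away from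
    them.\<close>
  define \<phi> where "\<phi> L = (if L = [c] then 0 else if L = [] then 1 else g L + 2)" for L
  have i\<phi>: "inj_on \<phi> Q" using g by (auto simp: inj_on_def \<phi>_def)
  have cQ: "[c] \<in> Q" by (simp add: Q_def self_in_controls)
  have nQ: "[] \<in> Q" by (simp add: Q_def)
  have p: "\<phi> [] = 1" "\<phi> [c] = 0" by (simp_all add: \<phi>_def)
  have nx: "next_control L rs \<in> Q" if "L \<in> Q" for L rs
    using that next_in_controls[of L c "[]" rs] by (auto simp: Q_def)
  have wfQ: "\<forall>c' \<in> set L. wf_com k c'" if "L \<in> Q" for L
    using that controls_wf[of L c "[]" k] c by (auto simp: Q_def)
  let ?M = "com_tm k \<phi> Q"
  have le: "\<phi> L \<le> Max (\<phi> ` Q)" if "L \<in> Q" for L using that fQ by simp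
  have tm: "turing_machine ?M"
    unfolding turing_machine_def
  proof (intro conjI allI impI)
    show "1 \<le> num_tapes ?M" using c by (simp add: com_tm_def)
    show "2 \<le> num_states ?M" using le[OF nQ] p by (simp add: com_tm_def)
    show "3 \<le> num_symbols ?M" by (simp add: com_tm_def)
    fix q rs assume a: "q < num_states ?M \<and> q \<noteq> 1 \<and> length rs = num_tapes ?M \<and> set rs \<subseteq> {..<num_symbols ?M}"
    then have rs: "length rs = k" "\<And>i. i < k \<Longrightarrow> rs ! i < 3"
      using nth_mem[of _ rs] by (auto simp: com_tm_def subset_iff)
    show "case transition ?M q rs of (q', acts) \<Rightarrow>
           q' < num_states ?M \<and> length acts = num_tapes ?M \<and> fst ` set acts \<subseteq> {..<num_symbols ?M}"
    proof (cases "q \<in> \<phi> ` Q")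
      case True
      then obtain L where L: "L \<in> Q" "q = \<phi> L" by auto
      then have "inv_into Q \<phi> q = L" using i\<phi> by simp
      then show ?thesis using rs L le[OF nx[OF L(1)], of rs] True next_act_less[OF wfQ[OF L(1)]]
        by (auto simp: com_tm_def less_Suc_eq_le)
    next
      case False
      then show ?thesis using rs by (auto simp: com_tm_def)
    qed
  qed
  have stp: "step ?M (\<phi> (fst x), map (snd x) [0..<k]) = (\<phi> (fst (com_step x k)), map (snd (com_step x k)) [0..<k])"
    if "fst x \<in> Q" for x
  proof (cases "fst x = []")
    case True
    then show ?thesis using p by (simp add: step_def com_step_def)
  next
    case False
    then show ?thesis using com_tm_step[OF fQ i\<phi> p(1) nQ that False, of k "snd x"] by simp
  qed
  have run: "fst (((\<lambda>x. com_step x k) ^^ n) x) \<in> Q \<and> (step ?M ^^ n) (\<phi> (fst x), map (snd x) [0..<k]) =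
      (\<phi> (fst (((\<lambda>x. com_step x k) ^^ n) x)), map (snd (((\<lambda>x. com_step x k) ^^ n) x)) [0..<k])"
    if "fst x \<in> Q" for x n
  proof (induction n)
    case (Suc n)
    then have "fst (com_step (((\<lambda>x. com_step x k) ^^ n) x) k) \<in> Q" using nx by (simp add: com_step_def)
    then show ?case using Suc stp[of "((\<lambda>x. com_step x k) ^^ n) x"] by simp
  qed (use that in simp)
  have "(step ?M ^^ t) (0, map s [0..<k]) = (1, map s' [0..<k])" if "exec c s t s'" for s t s'
    using run[of "([c], s)" t] exec_com_step[OF that c(1), of "[]"] cQ p by simp
  then show ?thesis using tm by (intro exI[of _ ?M]) (auto simp: com_tm_def)
qed

text \<open>Only the contents of tape 0 matter at the end: \<open>computes_within\<close> leaves its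
  head position and the other tapes open.\<close>

lemma polytime_computable_if_exec:
  fixes p :: "nat poly"
  assumes c: "wf_com k c" "1 \<le> k"
    and ex: "\<And>x. \<exists>t s'. t \<le> poly p (length x) \<and>
      exec c (\<lambda>r. if r = 0 then (tape_of x, 0) else (tape_of [], 0)) t s' \<and> fst (s' 0) = tape_of (f x)"
  shows "polytime_computable f"
proof -
  obtain M where M: "turing_machine M" "num_tapes M = k"
    and run: "\<And>s t s'. exec c s t s' \<Longrightarrow> \<exists>n\<le>t. (step M ^^ n) (0, map s [0..<k]) = (1, map s' [0..<k])"
    using com_tm_run[OF c] by metis
  have up: "[0..<k] = 0 # [1..<k]" using c(2) by (simp add: upt_conv_Cons)
  have "computes_within M f (poly p)"
    unfolding computes_within_def
  proof
    fix x
    let ?s = "\<lambda>r::nat. if r = 0 then (tape_of x, 0::int) else (tape_of [], 0)"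
    obtain t s' where t: "t \<le> poly p (length x)" "exec c ?s t s'" "fst (s' 0) = tape_of (f x)"
      using ex by metis
    obtain n where n: "n \<le> t" "(step M ^^ n) (0, map ?s [0..<k]) = (1, map s' [0..<k])" using run[OF t(2)] by blast
    have "map ?s [1..<k] = replicate (k - 1) (tape_of [], 0)"
      by (intro nth_equalityI) auto
    then have "initial_config M x = (0, map ?s [0..<k])"
      by (simp add: initial_config_def M(2) up)
    then have "(step M ^^ n) (initial_config M x) = (1, (tape_of (f x), snd (s' 0)) # map s' [1..<k])"
      using n(2) t(3) up by (metis (no_types, lifting) list.map(2) prod.collapse)
    then show "\<exists>n\<le>poly p (length x). \<exists>h ts. (step M ^^ n) (initial_config M x) = (1, (tape_of (f x), h) # ts)"
      using n(1) t(1) by (meson le_trans)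
  qed
  then show ?thesis using M(1) unfolding polytime_computable_def by blast
qed

section \<open>Polynomially bounded functions\<close>

text \<open>The coefficients are natural numbers. Monotonicity allows one bound to be substituted
  into another.\<close>

lemma poly_nat_mono: "m \<le> n \<Longrightarrow> poly p m \<le> poly p n" for p :: "nat poly"
  by (induction p) (auto intro!: add_mono mult_mono)

text \<open>Domination by a polynomial instead of equality: running times can then be bounded by
  arbitrary expressions without naming the polynomial.\<close>

definition polyb :: "(nat \<Rightarrow> nat) \<Rightarrow> bool" where
  "polyb f \<longleftrightarrow> (\<exists>p :: nat poly. \<forall>n. f n \<le> poly p n)"

lemma polyb_const: "polyb (\<lambda>n. c)"
  unfolding polyb_def by (rule exI[of _ "[:c:]"]) simp

lemma polyb_id: "polyb (\<lambda>n. n)"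
  unfolding polyb_def by (rule exI[of _ "[:0, 1:]"]) simp

lemma polyb_add: "polyb f \<Longrightarrow> polyb g \<Longrightarrow> polyb (\<lambda>n. f n + g n)"
  unfolding polyb_def by (metis add_mono poly_add)

lemma polyb_mult: "polyb f \<Longrightarrow> polyb g \<Longrightarrow> polyb (\<lambda>n. f n * g n)"
  unfolding polyb_def by (metis mult_le_mono poly_mult)

lemma polyb_Suc: "polyb f \<Longrightarrow> polyb (\<lambda>n. Suc (f n))"
  using polyb_add[OF polyb_const[of 1]] by simp

lemma polyb_poly: "polyb f \<Longrightarrow> polyb (\<lambda>n. poly p (f n))"
proof -
  assume "polyb f"
  then obtain q where "\<forall>n. f n \<le> poly q n" unfolding polyb_def by blast
  then have "\<forall>n. poly p (f n) \<le> poly (pcompose p q) n" by (simp add: poly_pcompose poly_nat_mono)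
  then show ?thesis unfolding polyb_def by blast
qed

lemma polyb_power: "polyb f \<Longrightarrow> polyb (\<lambda>n. f n ^ k)"
  by (induction k) (simp_all add: polyb_const polyb_mult)

lemmas polyb_intros = polyb_const polyb_id polyb_add polyb_mult polyb_Suc polyb_poly polyb_power


section \<open>Stack programs\<close>

text \<open>A tape holds a stack if it is blank except for the contents of the stack, which extend from the
  head (top of the stack) to the right.  Tape 0 is reserved for input and output.\<close>

definition stk :: "tape \<times> int \<Rightarrow> bool list \<Rightarrow> bool" where
  "stk th xs \<longleftrightarrow> (\<forall>j. fst th j = tape_of xs (j - snd th))"

definition runs :: "com \<Rightarrow> (nat \<Rightarrow> bool list) \<Rightarrow> nat \<Rightarrow> (nat \<Rightarrow> bool list) \<Rightarrow> bool" where
  "runs c \<rho> T \<rho>' \<longleftrightarrow> (\<forall>s. (\<forall>r\<ge>1. stk (s r) (\<rho> r)) \<longrightarrow>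
     (\<exists>t s'. t \<le> T \<and> exec c s t s' \<and> (\<forall>r\<ge>1. stk (s' r) (\<rho>' r)) \<and> s' 0 = s 0))"

definition bsym :: "bool \<Rightarrow> nat" where "bsym b = (if b then 2 else 1)"

definition push :: "nat \<Rightarrow> bool \<Rightarrow> com" where
  "push r b = Seq (Act r None Left) (Act r (Some (bsym b)) Stay)"

text \<open>The cell is erased before the head leaves it, since \<open>stk\<close> requires blanks
  outside the stack.\<close>

definition pop :: "nat \<Rightarrow> com" where
  "pop r = Act r (Some 0) Right"

lemma tape_of_Nil: "tape_of [] j = 0"
  by (simp add: tape_of_def)

lemma tape_of_Cons: "tape_of (b # xs) j = (if j = 0 then bsym b else tape_of xs (j - 1))"
  by (auto simp: tape_of_def bsym_def nth_Cons' nat_diff_distrib)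

lemma tape_of_neg: "j < 0 \<Longrightarrow> tape_of xs j = 0"
  by (simp add: tape_of_def)

lemma wf_push[simp]: "wf_com k (push r b) \<longleftrightarrow> r < k"
  by (simp add: push_def bsym_def)

lemma wf_pop[simp]: "wf_com k (pop r) \<longleftrightarrow> r < k"
  by (simp add: pop_def)

lemma scan_stk: "stk (s r) xs \<Longrightarrow> scan s r = tape_of xs 0"
  by (simp add: stk_def scan_def)

lemma runs_mono: "runs c \<rho> T \<rho>' \<Longrightarrow> T \<le> T' \<Longrightarrow> runs c \<rho> T' \<rho>'"
  unfolding runs_def by (meson le_trans)

lemma stk_push: "stk (t, h) xs \<Longrightarrow> stk (t(h - 1 := bsym b), h - 1) (b # xs)"
  by (auto simp: stk_def tape_of_Cons tape_of_neg)

lemma stk_pop: "stk (t, h) (b # xs) \<Longrightarrow> stk (t(h := 0), h + 1) xs"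
  by (auto simp: stk_def tape_of_Cons tape_of_neg algebra_simps)

lemma runs_push: "1 \<le> r \<Longrightarrow> runs (push r b) \<rho> 3 (\<rho>(r := b # \<rho> r))"
  unfolding runs_def
proof (intro allI impI)
  fix s assume r: "1 \<le> r" and s: "\<forall>r\<ge>1. stk (s r) (\<rho> r)"
  let ?s' = "act r (Some (bsym b)) Stay (act r None Left s)"
  have "exec (push r b) s (Suc (1 + 1)) ?s'"
    unfolding push_def by (rule exec_Seq; rule exec_Act)
  moreover have "stk (?s' r) (b # \<rho> r)"
    using stk_push[of "fst (s r)" "snd (s r)" "\<rho> r" b] r s by (simp add: act_def)
  ultimately show "\<exists>t s'. t \<le> 3 \<and> exec (push r b) s t s' \<and> (\<forall>ra\<ge>1. stk (s' ra) ((\<rho>(r := b # \<rho> r)) ra)) \<and> s' 0 = s 0"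
    using r s by (intro exI[of _ 3] exI[of _ ?s']) (auto simp: act_def numeral_3_eq_3)
qed

lemma runs_pop: "1 \<le> r \<Longrightarrow> \<rho> r = b # w \<Longrightarrow> runs (pop r) \<rho> 1 (\<rho>(r := w))"
  unfolding runs_def
proof (intro allI impI)
  fix s assume r: "1 \<le> r" "\<rho> r = b # w" and s: "\<forall>r\<ge>1. stk (s r) (\<rho> r)"
  let ?s' = "act r (Some 0) Right s"
  have "exec (pop r) s 1 ?s'"
    unfolding pop_def by (rule exec_Act)
  moreover have "stk (s r) (b # w)" using r s by metis
  then have "stk (?s' r) w"
    using stk_pop[of "fst (s r)" "snd (s r)" b w] by (simp add: act_def)
  ultimately show "\<exists>t s'. t \<le> 1 \<and> exec (pop r) s t s' \<and> (\<forall>ra\<ge>1. stk (s' ra) ((\<rho>(r := w)) ra)) \<and> s' 0 = s 0"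
    using r s by (intro exI[of _ 1] exI[of _ ?s']) (auto simp: act_def)
qed

lemma runs_nop: "runs (Act 1 None Stay) \<rho> 1 \<rho>"
  unfolding runs_def
proof (intro allI impI)
  fix s assume s: "\<forall>r\<ge>1. stk (s r) (\<rho> r)"
  have "act 1 None Stay s = s" by (simp add: act_def)
  then have "exec (Act 1 None Stay) s 1 s" using exec_Act[of 1 None Stay s] by simp
  then show "\<exists>t s'. t \<le> 1 \<and> exec (Act 1 None Stay) s t s' \<and> (\<forall>r\<ge>1. stk (s' r) (\<rho> r)) \<and> s' 0 = s 0"
    using s by blast
qed

lemma runs_Seq: "runs c \<rho> m \<rho>1 \<Longrightarrow> runs c' \<rho>1 n \<rho>2 \<Longrightarrow> runs (Seq c c') \<rho> (Suc (m + n)) \<rho>2"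
  unfolding runs_def
proof (intro allI impI)
  fix s assume 1: "\<forall>s. (\<forall>r\<ge>1. stk (s r) (\<rho> r)) \<longrightarrow> (\<exists>t s'. t \<le> m \<and> exec c s t s' \<and> (\<forall>r\<ge>1. stk (s' r) (\<rho>1 r)) \<and> s' 0 = s 0)"
    and 2: "\<forall>s. (\<forall>r\<ge>1. stk (s r) (\<rho>1 r)) \<longrightarrow> (\<exists>t s'. t \<le> n \<and> exec c' s t s' \<and> (\<forall>r\<ge>1. stk (s' r) (\<rho>2 r)) \<and> s' 0 = s 0)"
    and s: "\<forall>r\<ge>1. stk (s r) (\<rho> r)"
  obtain t1 s1 where a: "t1 \<le> m" "exec c s t1 s1" "\<forall>r\<ge>1. stk (s1 r) (\<rho>1 r)" "s1 0 = s 0" using 1 s by blast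
  obtain t2 s2 where b: "t2 \<le> n" "exec c' s1 t2 s2" "\<forall>r\<ge>1. stk (s2 r) (\<rho>2 r)" "s2 0 = s1 0" using 2 a by blast
  show "\<exists>t s'. t \<le> Suc (m + n) \<and> exec (Seq c c') s t s' \<and> (\<forall>r\<ge>1. stk (s' r) (\<rho>2 r)) \<and> s' 0 = s 0"
    using a b exec_Seq[OF a(2) b(2)] by (intro exI[of _ "Suc (t1 + t2)"] exI[of _ s2]) simp
qed

lemma runs_If:
  "1 \<le> r \<Longrightarrow> runs (if tape_of (\<rho> r) 0 \<in> A then c else c') \<rho> m \<rho>' \<Longrightarrow> runs (If r A c c') \<rho> (Suc m) \<rho>'"
  unfolding runs_def by (metis Suc_le_mono exec_If scan_stk)

lemma runs_While_False: "1 \<le> r \<Longrightarrow> tape_of (\<rho> r) 0 \<notin> A \<Longrightarrow> runs (While r A c) \<rho> 1 \<rho>"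
  unfolding runs_def by (metis exec_While_False le_refl scan_stk)

lemma runs_While_True:
  assumes "1 \<le> r" "tape_of (\<rho> r) 0 \<in> A" "runs c \<rho> m \<rho>1" "runs (While r A c) \<rho>1 n \<rho>2"
  shows "runs (While r A c) \<rho> (Suc (m + n)) \<rho>2"
  unfolding runs_def
proof (intro allI impI)
  fix s assume s: "\<forall>r\<ge>1. stk (s r) (\<rho> r)"
  obtain t1 s1 where a: "t1 \<le> m" "exec c s t1 s1" "\<forall>r\<ge>1. stk (s1 r) (\<rho>1 r)" "s1 0 = s 0"
    using assms(3) s unfolding runs_def by blast
  obtain t2 s2 where b: "t2 \<le> n" "exec (While r A c) s1 t2 s2" "\<forall>r\<ge>1. stk (s2 r) (\<rho>2 r)" "s2 0 = s1 0"
    using assms(4) a unfolding runs_def by blast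
  have "scan s r \<in> A" using s assms(1,2) scan_stk by metis
  then show "\<exists>t s'. t \<le> Suc (m + n) \<and> exec (While r A c) s t s' \<and> (\<forall>r\<ge>1. stk (s' r) (\<rho>2 r)) \<and> s' 0 = s 0"
    using a b exec_While_True[OF _ a(2) b(2)] by (intro exI[of _ "Suc (t1 + t2)"] exI[of _ s2]) simp
qed

lemma top_in: "tape_of (b # xs) 0 \<in> {2} \<longleftrightarrow> b"
  by (simp add: tape_of_Cons bsym_def)

lemma runs_If_top:
  assumes "1 \<le> r" "\<rho> r = b # w" "runs (if b then c else c') \<rho> m \<rho>'"
  shows "runs (If r {2} c c') \<rho> (Suc m) \<rho>'"
  by (rule runs_If) (use assms top_in in auto)

lemma runs_While_top:
  assumes "1 \<le> r" "\<rho> r = True # w" "runs c \<rho> m \<rho>1" "runs (While r {2} c) \<rho>1 n \<rho>2"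
  shows "runs (While r {2} c) \<rho> (Suc (m + n)) \<rho>2"
  by (rule runs_While_True) (use assms top_in[of True w] in auto)

primrec pushes :: "(nat \<times> bool) list \<Rightarrow> com" where
  "pushes [] = Act 1 None Stay"
| "pushes (x # l) = Seq (push (fst x) (snd x)) (pushes l)"

lemma wf_pushes[simp]: "1 < k \<Longrightarrow> wf_com k (pushes l) \<longleftrightarrow> (\<forall>x \<in> set l. fst x < k)"
  by (induction l) auto

lemma runs_pushes:
  "\<forall>x \<in> set l. 1 \<le> fst x \<Longrightarrow> runs (pushes l) \<rho> (4 * length l + 1)
    (\<lambda>r. rev (map snd (filter (\<lambda>x. fst x = r) l)) @ \<rho> r)"
proof (induction l arbitrary: \<rho>)
  case Nil
  show ?case using runs_nop[of \<rho>] by simp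
next
  case (Cons x l)
  have "runs (pushes l) (\<rho>(fst x := snd x # \<rho> (fst x))) (4 * length l + 1)
    (\<lambda>r. rev (map snd (filter (\<lambda>x. fst x = r) l)) @ (\<rho>(fst x := snd x # \<rho> (fst x))) r)"
    by (rule Cons.IH[of "\<rho>(fst x := snd x # \<rho> (fst x))"]) (use Cons.prems in simp)
  also have "(\<lambda>r. rev (map snd (filter (\<lambda>x. fst x = r) l)) @ (\<rho>(fst x := snd x # \<rho> (fst x))) r) =
      (\<lambda>r. rev (map snd (filter (\<lambda>x. fst x = r) (x # l))) @ \<rho> r)"
    by (auto simp: fun_eq_iff)
  finally have *: "runs (pushes l) (\<rho>(fst x := snd x # \<rho> (fst x))) (4 * length l + 1)
      (\<lambda>r. rev (map snd (filter (\<lambda>x. fst x = r) (x # l))) @ \<rho> r)" .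
  show ?case
    unfolding pushes.simps by (rule runs_mono[OF runs_Seq[OF runs_push *]]) (use Cons.prems in auto)
qed


section \<open>Moving trees between stacks\<close>

datatype tree = Leaf | Node tree tree

text \<open>Preorder (Polish) notation delimits itself: a tree on top of a stack ends without a
  separator, whatever lies below it.\<close>

primrec code :: "tree \<Rightarrow> bool list" where
  "code Leaf = [False]"
| "code (Node a b) = True # code a @ code b"

definition tsize :: "tree \<Rightarrow> nat" where "tsize t = length (code t)"

lemma tsize_simps[simp]: "tsize Leaf = 1" "tsize (Node a b) = Suc (tsize a + tsize b)"
  by (simp_all add: tsize_def)

lemma tsize_pos: "0 < tsize t" by (cases t) auto

lemma code_append_eq: "code a @ v = code b @ w \<longleftrightarrow> a = b \<and> v = w"
proof (induction a arbitrary: b v w)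
  case Leaf
  then show ?case by (cases b) auto
next
  case (Node a1 a2)
  then show ?case by (cases b) auto
qed

text \<open>\<open>take_tree i\<close> moves the tree on top of stack \<open>i\<close> to stack 1, bit by bit and hence reversed, and
  puts the number of its bits on stack 2 in unary.  Stack 3 counts the subtrees still to be read.\<close>

definition take_loop :: "nat \<Rightarrow> com" where
  "take_loop i = While 3 {2} (If i {2}
     (Seq (pop i) (Seq (push 1 True) (Seq (push 2 True) (push 3 True))))
     (Seq (pop i) (Seq (push 1 False) (Seq (push 2 True) (pop 3)))))"

definition take_tree :: "nat \<Rightarrow> com" where
  "take_tree i = Seq (push 3 False) (Seq (push 3 True) (Seq (push 2 False) (Seq (take_loop i) (pop 3))))"

text \<open>The rest of the run of the loop is a hypothesis, with arbitrary time and final stacks.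
  This lets the run for the left subtree be followed by that for the right subtree within one and
  the same loop.\<close>

lemma runs_take_loop:
  assumes "4 \<le> i" "\<rho> i = code t @ w" "\<rho> 3 = True # d"
    and "runs (take_loop i) (\<rho>(i := w, 1 := rev (code t) @ \<rho> 1, 2 := replicate (tsize t) True @ \<rho> 2, 3 := d)) T \<rho>'"
  shows "runs (take_loop i) \<rho> (T + 16 * tsize t) \<rho>'"
  using assms
proof (induction t arbitrary: w d \<rho> T)
  case Leaf
  let ?r1 = "\<rho>(i := w)" let ?r2 = "?r1(1 := False # \<rho> 1)" let ?r3 = "?r2(2 := True # \<rho> 2)" let ?r4 = "?r3(3 := d)"
  have 1: "runs (pop i) \<rho> 1 ?r1" using Leaf by (intro runs_pop) auto
  have 2: "runs (push 1 False) ?r1 3 ?r2" using runs_push[of 1 False ?r1] Leaf by simp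
  have 3: "runs (push 2 True) ?r2 3 ?r3" using runs_push[of 2 True ?r2] Leaf by simp
  have 4: "runs (pop 3) ?r3 1 ?r4" using Leaf by (intro runs_pop[of _ _ True]) auto
  have r: "\<rho>(i := w, 1 := rev (code Leaf) @ \<rho> 1, 2 := replicate (tsize Leaf) True @ \<rho> 2, 3 := d) = ?r4"
    by simp
  have b: "runs (If i {2} (Seq (pop i) (Seq (push 1 True) (Seq (push 2 True) (push 3 True))))
     (Seq (pop i) (Seq (push 1 False) (Seq (push 2 True) (pop 3))))) \<rho> 12 ?r4"
    by (rule runs_mono[OF runs_If_top[of i \<rho> False w]])
      (use Leaf runs_Seq[OF 1 runs_Seq[OF 2 runs_Seq[OF 3 4]]] in auto)
  have "runs (take_loop i) \<rho> (Suc (12 + T)) \<rho>'"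
    unfolding take_loop_def
    by (rule runs_While_top[OF _ Leaf.prems(3) b]) (use Leaf.prems(4)[unfolded r] in \<open>simp_all only: take_loop_def\<close>)
  then show ?case by (rule runs_mono) simp
next
  case (Node t1 t2)
  let ?r1 = "\<rho>(i := code t1 @ code t2 @ w)" let ?r2 = "?r1(1 := True # \<rho> 1)"
  let ?r3 = "?r2(2 := True # \<rho> 2)" let ?r4 = "?r3(3 := True # True # d)"
  have 1: "runs (pop i) \<rho> 1 ?r1" using Node.prems by (intro runs_pop) auto
  have 2: "runs (push 1 True) ?r1 3 ?r2" using runs_push[of 1 True ?r1] Node.prems by simp
  have 3: "runs (push 2 True) ?r2 3 ?r3" using runs_push[of 2 True ?r2] Node.prems by simp
  have 4: "runs (push 3 True) ?r3 3 ?r4" using runs_push[of 3 True ?r3] Node.prems by simp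
  have b: "runs (If i {2} (Seq (pop i) (Seq (push 1 True) (Seq (push 2 True) (push 3 True))))
     (Seq (pop i) (Seq (push 1 False) (Seq (push 2 True) (pop 3))))) \<rho> 14 ?r4"
    by (rule runs_mono[OF runs_If_top[of i \<rho> True "code t1 @ code t2 @ w"]])
      (use Node.prems runs_Seq[OF 1 runs_Seq[OF 2 runs_Seq[OF 3 4]]] in auto)
  let ?r5 = "?r4(i := code t2 @ w, 1 := rev (code t1) @ ?r4 1, 2 := replicate (tsize t1) True @ ?r4 2, 3 := True # d)"
  let ?r6 = "?r5(i := w, 1 := rev (code t2) @ ?r5 1, 2 := replicate (tsize t2) True @ ?r5 2, 3 := d)"
  have r: "?r6 = \<rho>(i := w, 1 := rev (code (Node t1 t2)) @ \<rho> 1, 2 := replicate (tsize (Node t1 t2)) True @ \<rho> 2, 3 := d)"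
  proof -
    have "replicate (tsize t2) True @ replicate (tsize t1) True @ True # \<rho> 2 =
        replicate (tsize t2 + (tsize t1 + 1)) True @ \<rho> 2"
      by (simp only: replicate_add append_assoc One_nat_def replicate_Suc replicate_0 append_Cons append_Nil)
    also have "tsize t2 + (tsize t1 + 1) = tsize (Node t1 t2)" by simp
    finally show ?thesis using Node.prems(1) by (simp add: fun_eq_iff del: tsize_simps)
  qed
  have "runs (take_loop i) ?r5 (T + 16 * tsize t2) \<rho>'"
    by (rule Node.IH(2)[of _ w d]) (use Node.prems(1-3) Node.prems(4)[folded r] in \<open>simp_all only:, simp_all\<close>)
  moreover have "?r5 = ?r4(i := code t2 @ w, 1 := rev (code t1) @ ?r4 1, 2 := replicate (tsize t1) True @ ?r4 2, 3 := True # d)"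
    by (rule refl)
  ultimately have "runs (take_loop i) ?r4 (T + 16 * tsize t2 + 16 * tsize t1) \<rho>'"
    by (intro Node.IH(1)[of ?r4 "code t2 @ w" "True # d", OF Node.prems(1)])
      (use Node.prems(1) in \<open>simp_all only:, simp_all\<close>)
  then have "runs (take_loop i) \<rho> (Suc (14 + (T + 16 * tsize t2 + 16 * tsize t1))) \<rho>'"
    unfolding take_loop_def
    by (intro runs_While_top[OF _ Node.prems(3) b]) (simp_all only: take_loop_def)
  then show ?case by (rule runs_mono) simp
qed

lemma runs_take_tree:
  assumes "4 \<le> i" "\<rho> i = code t @ w"
  shows "runs (take_tree i) \<rho> (16 * tsize t + 15)
    (\<rho>(i := w, 1 := rev (code t) @ \<rho> 1, 2 := replicate (tsize t) True @ False # \<rho> 2))"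
proof -
  \<comment> \<open>The \<open>False\<close> bits pushed on stacks 2 and 3 are sentinels: they stop
    the unary counters whatever lies below.\<close>
  let ?r1 = "\<rho>(3 := False # \<rho> 3)" let ?r2 = "?r1(3 := True # False # \<rho> 3)" let ?r3 = "?r2(2 := False # \<rho> 2)"
  let ?r4 = "?r3(i := w, 1 := rev (code t) @ \<rho> 1, 2 := replicate (tsize t) True @ False # \<rho> 2, 3 := False # \<rho> 3)"
  have 1: "runs (push 3 False) \<rho> 3 ?r1" using runs_push[of 3] by simp
  have 2: "runs (push 3 True) ?r1 3 ?r2" using runs_push[of 3 True ?r1] by simp
  have 3: "runs (push 2 False) ?r2 3 ?r3" using runs_push[of 2 False ?r2] by simp
  have "runs (take_loop i) ?r4 1 ?r4"
    unfolding take_loop_def by (rule runs_While_False) (auto simp: tape_of_Cons bsym_def)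
  then have 4: "runs (take_loop i) ?r3 (1 + 16 * tsize t) ?r4"
    by (intro runs_take_loop[of i _ t w "False # \<rho> 3"]) (use assms in auto)
  have 5: "runs (pop 3) ?r4 1 (?r4(3 := \<rho> 3))" by (rule runs_pop) auto
  have e: "?r4(3 := \<rho> 3) = \<rho>(i := w, 1 := rev (code t) @ \<rho> 1, 2 := replicate (tsize t) True @ False # \<rho> 2)"
    using assms(1) by (auto simp: fun_eq_iff)
  show ?thesis
    unfolding take_tree_def e[symmetric]
    by (rule runs_mono[OF runs_Seq[OF 1 runs_Seq[OF 2 runs_Seq[OF 3 runs_Seq[OF 4 5]]]]]) simp
qed

text \<open>\<open>put e\<close> consumes what \<open>take_tree\<close> produced and performs the pushes \<open>e b\<close> for each bit \<open>b\<close>,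
  last bit first.\<close>

definition put_loop :: "(bool \<Rightarrow> (nat \<times> bool) list) \<Rightarrow> com" where
  "put_loop e = While 2 {2} (Seq (pop 2) (If 1 {2} (Seq (pop 1) (pushes (e True))) (Seq (pop 1) (pushes (e False)))))"

definition put :: "(bool \<Rightarrow> (nat \<times> bool) list) \<Rightarrow> com" where
  "put e = Seq (put_loop e) (pop 2)"

text \<open>What stack \<open>r\<close> gains. Bits are processed last first, so the blocks lie in
  the order of \<open>xs\<close>; within a block the latest push lies on top, whence
  \<open>rev\<close>.\<close>

definition emitted :: "(bool \<Rightarrow> (nat \<times> bool) list) \<Rightarrow> nat \<Rightarrow> bool list \<Rightarrow> bool list" where
  "emitted e r xs = concat (map (\<lambda>b. rev (map snd (filter (\<lambda>x. fst x = r) (e b)))) xs)"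

lemma runs_put_loop:
  assumes "\<forall>b. \<forall>x \<in> set (e b). 4 \<le> fst x" "\<forall>b. length (e b) \<le> K"
    and "\<rho> 1 = rev xs @ v" "\<rho> 2 = replicate (length xs) True @ False # w"
  shows "runs (put_loop e) \<rho> (length xs * (4 * K + 7) + 1)
    ((\<lambda>r. emitted e r xs @ \<rho> r)(1 := v, 2 := False # w))"
  using assms(3,4)
proof (induction xs arbitrary: \<rho> rule: rev_induct)
  case Nil
  have e: "(\<lambda>r. emitted e r [] @ \<rho> r)(1 := v, 2 := False # w) = \<rho>"
    using Nil by (auto simp: emitted_def fun_eq_iff)
  show ?case
    unfolding e unfolding put_loop_def
    by (rule runs_mono[OF runs_While_False]) (use Nil in \<open>auto simp: tape_of_Cons bsym_def\<close>)
next
  case (snoc b xs)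
  let ?r1 = "\<rho>(2 := replicate (length xs) True @ False # w)" let ?r2 = "?r1(1 := rev xs @ v)"
  let ?r3 = "\<lambda>r. rev (map snd (filter (\<lambda>x. fst x = r) (e b))) @ ?r2 r"
  have 1: "runs (pop 2) \<rho> 1 ?r1" by (rule runs_pop[of _ _ True]) (use snoc.prems in auto)
  have 2: "runs (pop 1) ?r1 1 ?r2" by (rule runs_pop[of _ _ b]) (use snoc.prems in auto)
  have 3: "runs (pushes (e b)) ?r2 (4 * K + 1) ?r3"
    by (rule runs_mono[OF runs_pushes]) (use assms(1,2) in \<open>auto dest!: spec[of _ b] bspec\<close>)
  have 4: "runs (If 1 {2} (Seq (pop 1) (pushes (e True))) (Seq (pop 1) (pushes (e False)))) ?r1 (4 * K + 4) ?r3"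
    by (rule runs_mono[OF runs_If_top[of 1 _ b "rev xs @ v"]])
      (use snoc.prems runs_Seq[OF 2 3] in auto)
  have f: "filter (\<lambda>x. fst x = r) (e b) = []" if "r < 4" for r
    using assms(1) that by (force simp: filter_empty_conv)
  have "runs (put_loop e) ?r3 (length xs * (4 * K + 7) + 1) ((\<lambda>r. emitted e r xs @ ?r3 r)(1 := v, 2 := False # w))"
    by (rule snoc.IH[of ?r3]) (use f[of 1] f[of 2] in simp_all)
  also have "(\<lambda>r. emitted e r xs @ ?r3 r)(1 := v, 2 := False # w) =
      (\<lambda>r. emitted e r (xs @ [b]) @ \<rho> r)(1 := v, 2 := False # w)"
    by (auto simp: fun_eq_iff emitted_def)
  finally have *: "runs (put_loop e) ?r3 (length xs * (4 * K + 7) + 1)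
      ((\<lambda>r. emitted e r (xs @ [b]) @ \<rho> r)(1 := v, 2 := False # w))" .
  have "runs (put_loop e) \<rho> (Suc (Suc (1 + (4 * K + 4)) + (length xs * (4 * K + 7) + 1)))
      ((\<lambda>r. emitted e r (xs @ [b]) @ \<rho> r)(1 := v, 2 := False # w))"
    unfolding put_loop_def
    by (rule runs_While_top[OF _ _ runs_Seq[OF 1 4]])
      (use snoc.prems(2) *[unfolded put_loop_def] in \<open>simp_all only:, simp_all\<close>)
  then show ?case by (rule runs_mono) simp
qed

lemma runs_put:
  assumes "\<forall>b. \<forall>x \<in> set (e b). 4 \<le> fst x" "\<forall>b. length (e b) \<le> K"
    and "\<rho> 1 = rev xs @ v" "\<rho> 2 = replicate (length xs) True @ False # w"
  shows "runs (put e) \<rho> (length xs * (4 * K + 7) + 3) ((\<lambda>r. emitted e r xs @ \<rho> r)(1 := v, 2 := w))"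
proof -
  have "runs (pop 2) ((\<lambda>r. emitted e r xs @ \<rho> r)(1 := v, 2 := False # w)) 1
     ((\<lambda>r. emitted e r xs @ \<rho> r)(1 := v, 2 := False # w, 2 := w))"
    by (rule runs_pop) auto
  from runs_Seq[OF runs_put_loop[OF assms] this] show ?thesis
    unfolding put_def fun_upd_upd by (rule runs_mono) simp
qed

text \<open>This copies the tree on top of stack \<open>i\<close> if \<open>i\<close> is among \<open>js\<close>, and deletes it if \<open>js\<close> is empty.\<close>

definition move :: "nat \<Rightarrow> nat list \<Rightarrow> com" where
  "move i js = Seq (take_tree i) (put (\<lambda>b. map (\<lambda>j. (j, b)) js))"

lemma emitted_move: "distinct js \<Longrightarrow> emitted (\<lambda>b. map (\<lambda>j. (j, b)) js) r xs = (if r \<in> set js then xs else [])"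
proof -
  assume d: "distinct js"
  have "filter (\<lambda>x. fst x = r) (map (\<lambda>j. (j, b)) js) = (if r \<in> set js then [(r, b)] else [])" for b :: bool
    using d by (induction js) auto
  then show ?thesis by (simp add: emitted_def)
qed

lemma wf_take_tree[simp]: "wf_com k (take_tree i) \<longleftrightarrow> 3 < k \<and> i < k"
  by (auto simp: take_tree_def take_loop_def)

lemma wf_put[simp]: "2 < k \<Longrightarrow> wf_com k (put e) \<longleftrightarrow> (\<forall>b. \<forall>x \<in> set (e b). fst x < k)"
  by (auto simp: put_def put_loop_def all_bool_eq)

lemma wf_move[simp]: "wf_com k (move i js) \<longleftrightarrow> 3 < k \<and> i < k \<and> (\<forall>j \<in> set js. j < k)"
  by (auto simp: move_def)

lemma runs_move:
  assumes "4 \<le> i" "\<rho> i = code t @ w" "distinct js" "\<forall>j \<in> set js. 4 \<le> j" "length js \<le> 2"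
  shows "runs (move i js) \<rho> (31 * tsize t + 19) (\<lambda>r. (if r \<in> set js then code t else []) @ (\<rho>(i := w)) r)"
proof -
  let ?r = "\<rho>(i := w, 1 := rev (code t) @ \<rho> 1, 2 := replicate (tsize t) True @ False # \<rho> 2)"
  let ?e = "\<lambda>b. map (\<lambda>j. (j, b)) js"
  have 1: "runs (take_tree i) \<rho> (16 * tsize t + 15) ?r" by (rule runs_take_tree) (use assms in auto)
  have 2: "runs (put ?e) ?r (length (code t) * (4 * 2 + 7) + 3) ((\<lambda>r. emitted ?e r (code t) @ ?r r)(1 := \<rho> 1, 2 := \<rho> 2))"
    by (rule runs_put[of ?e 2 ?r "code t" "\<rho> 1" "\<rho> 2"]) (use assms in \<open>auto simp: tsize_def\<close>)
  have e: "(\<lambda>r. emitted ?e r (code t) @ ?r r)(1 := \<rho> 1, 2 := \<rho> 2) =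
      (\<lambda>r. (if r \<in> set js then code t else []) @ (\<rho>(i := w)) r)"
    using assms by (auto simp: fun_eq_iff emitted_move)
  have "runs (move i js) \<rho> (Suc ((16 * tsize t + 15) + (length (code t) * (4 * 2 + 7) + 3)))
      (\<lambda>r. (if r \<in> set js then code t else []) @ (\<rho>(i := w)) r)"
    using runs_Seq[OF 1 2] unfolding e move_def .
  then show ?thesis
    by (elim runs_mono) (simp add: tsize_def)
qed

section \<open>Polynomial-time functions on trees\<close>

lemma runs_mv:
  assumes "4 \<le> i" "4 \<le> j" "i \<noteq> j" "\<rho> i = code t @ w"
  shows "runs (move i [j]) \<rho> (31 * tsize t + 19) (\<rho>(i := w, j := code t @ \<rho> j))"
proof -
  have "(\<lambda>r. (if r \<in> set [j] then code t else []) @ (\<rho>(i := w)) r) = \<rho>(i := w, j := code t @ \<rho> j)"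
    using assms by (auto simp: fun_eq_iff)
  then show ?thesis using runs_move[of i \<rho> t w "[j]"] assms by simp
qed

lemma runs_copy:
  assumes "4 \<le> i" "4 \<le> j" "i \<noteq> j" "\<rho> i = code t @ w"
  shows "runs (move i [i, j]) \<rho> (31 * tsize t + 19) (\<rho>(j := code t @ \<rho> j))"
proof -
  have "(\<lambda>r. (if r \<in> set [i, j] then code t else []) @ (\<rho>(i := w)) r) = \<rho>(j := code t @ \<rho> j)"
    using assms by (auto simp: fun_eq_iff)
  then show ?thesis using runs_move[of i \<rho> t w "[i, j]"] assms by simp
qed

lemma runs_delete:
  assumes "4 \<le> i" "\<rho> i = code t @ w"
  shows "runs (move i []) \<rho> (31 * tsize t + 19) (\<rho>(i := w))"
proof -
  have "(\<lambda>r. (if r \<in> set [] then code t else []) @ (\<rho>(i := w)) r) = \<rho>(i := w)" by (simp add: fun_eq_iff)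
  then show ?thesis using runs_move[of i \<rho> t w "[]"] assms by (simp del: fun_upd_apply)
qed

text \<open>Tape 0 is for input and output, 1 to 3 serve to move trees, 4 holds argument and result,
  5 and 6 save intermediate trees. Everything below the argument is preserved, so the same seven
  tapes serve nested computations. The size of the result is bounded as well, because in a
  composition the outer function is charged for it.\<close>

definition PT :: "(tree \<Rightarrow> tree) \<Rightarrow> bool" where
  "PT f \<longleftrightarrow> (\<exists>c p. wf_com 7 c \<and> (\<forall>t. tsize (f t) \<le> poly p (tsize t)) \<and>
     (\<forall>t w \<rho>. \<rho> 4 = code t @ w \<longrightarrow> runs c \<rho> (poly p (tsize t)) (\<rho>(4 := code (f t) @ w))))"

lemma PT_I:
  assumes "wf_com 7 c" "polyb S" "polyb T" "\<And>t. tsize (f t) \<le> S (tsize t)"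
    and "\<And>t w \<rho>. \<rho> 4 = code t @ w \<Longrightarrow> runs c \<rho> (T (tsize t)) (\<rho>(4 := code (f t) @ w))"
  shows "PT f"
proof -
  obtain p where p: "\<And>n. S n + T n \<le> poly p n"
    using polyb_add[OF assms(2,3)] unfolding polyb_def by blast
  have "tsize (f t) \<le> poly p (tsize t)" for t
    using assms(4)[of t] p[of "tsize t"] by linarith
  moreover have "runs c \<rho> (poly p (tsize t)) (\<rho>(4 := code (f t) @ w))" if "\<rho> 4 = code t @ w" for t w \<rho>
    using assms(5)[where t = t and w = w and \<rho> = \<rho>, OF that] by (rule runs_mono) (use p[of "tsize t"] in linarith)
  ultimately show ?thesis unfolding PT_def using assms(1) by blast
qed

lemma PT_E:
  assumes "PT f"
  obtains c p where "wf_com 7 c" "\<And>t. tsize (f t) \<le> poly p (tsize t)"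
    "\<And>t w \<rho>. \<rho> 4 = code t @ w \<Longrightarrow> runs c \<rho> (poly p (tsize t)) (\<rho>(4 := code (f t) @ w))"
  using assms unfolding PT_def by blast

lemma PT_id: "PT (\<lambda>t. t)"
proof (rule PT_I[of "Act 1 None Stay" "\<lambda>n. n" "\<lambda>n. 1"])
  fix t w and \<rho> :: "nat \<Rightarrow> bool list" assume "\<rho> 4 = code t @ w"
  then show "runs (Act 1 None Stay) \<rho> 1 (\<rho>(4 := code t @ w))" using runs_nop[of \<rho>] by (metis fun_upd_triv)
qed (auto intro: polyb_intros)

lemma PT_comp:
  assumes "PT f" "PT g"
  shows "PT (\<lambda>t. f (g t))"
proof -
  obtain cf p where f: "wf_com 7 cf" "\<And>t. tsize (f t) \<le> poly p (tsize t)"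
    "\<And>t w \<rho>. \<rho> 4 = code t @ w \<Longrightarrow> runs cf \<rho> (poly p (tsize t)) (\<rho>(4 := code (f t) @ w))"
    using PT_E[OF assms(1)] by metis
  obtain cg q where g: "wf_com 7 cg" "\<And>t. tsize (g t) \<le> poly q (tsize t)"
    "\<And>t w \<rho>. \<rho> 4 = code t @ w \<Longrightarrow> runs cg \<rho> (poly q (tsize t)) (\<rho>(4 := code (g t) @ w))"
    using PT_E[OF assms(2)] by metis
  show ?thesis
  proof (rule PT_I[of "Seq cg cf" "\<lambda>n. poly p (poly q n)" "\<lambda>n. Suc (poly q n + poly p (poly q n))"])
    show "tsize (f (g t)) \<le> poly p (poly q (tsize t))" for t
      using f(2)[of "g t"] poly_nat_mono[OF g(2)[of t], of p] by linarith
    fix t w and \<rho> :: "nat \<Rightarrow> bool list" assume r: "\<rho> 4 = code t @ w"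
    have 2: "runs cf (\<rho>(4 := code (g t) @ w)) (poly p (tsize (g t))) (\<rho>(4 := code (g t) @ w, 4 := code (f (g t)) @ w))"
      by (rule f(3)) simp
    have "runs (Seq cg cf) \<rho> (Suc (poly q (tsize t) + poly p (tsize (g t)))) (\<rho>(4 := code (f (g t)) @ w))"
      using runs_Seq[OF g(3)[where t = t and w = w and \<rho> = \<rho>, OF r] 2] by simp
    then show "runs (Seq cg cf) \<rho> (Suc (poly q (tsize t) + poly p (poly q (tsize t)))) (\<rho>(4 := code (f (g t)) @ w))"
      by (rule runs_mono) (simp add: g(2) poly_nat_mono)
  qed (use f(1) g(1) in \<open>auto intro!: polyb_intros\<close>)
qed

lemma PT_const: "PT (\<lambda>t. u)"
proof (rule PT_I[of "Seq (move 4 []) (pushes (map (Pair 4) (rev (code u))))" "\<lambda>n. tsize u"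
      "\<lambda>n. Suc ((31 * n + 19) + (4 * tsize u + 1))"])
  fix t w and \<rho> :: "nat \<Rightarrow> bool list" assume r: "\<rho> 4 = code t @ w"
  let ?l = "map (Pair 4) (rev (code u)) :: (nat \<times> bool) list"
  have 1: "runs (move 4 []) \<rho> (31 * tsize t + 19) (\<rho>(4 := w))" by (rule runs_delete) (use r in auto)
  have f: "filter (\<lambda>x. fst x = r) (map (Pair 4) xs) = (if r = 4 then map (Pair 4) xs else [])" for r :: nat and xs :: "bool list"
    by (induction xs) auto
  have "(\<lambda>r. rev (map snd (filter (\<lambda>x. fst x = r) ?l)) @ (\<rho>(4 := w)) r) = \<rho>(4 := code u @ w)"
    unfolding f by (auto simp: fun_eq_iff o_def)
  then have 2: "runs (pushes ?l) (\<rho>(4 := w)) (4 * tsize u + 1) (\<rho>(4 := code u @ w))"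
    using runs_pushes[of ?l "\<rho>(4 := w)"] by (simp add: tsize_def)
  show "runs (Seq (move 4 []) (pushes ?l)) \<rho> (Suc ((31 * tsize t + 19) + (4 * tsize u + 1))) (\<rho>(4 := code u @ w))"
    by (rule runs_Seq[OF 1 2])
qed (auto intro!: polyb_intros)

lemma PT_pair:
  assumes "PT f" "PT g"
  shows "PT (\<lambda>t. Node (f t) (g t))"
proof -
  obtain cf p where f: "wf_com 7 cf" "\<And>t. tsize (f t) \<le> poly p (tsize t)"
    "\<And>t w \<rho>. \<rho> 4 = code t @ w \<Longrightarrow> runs cf \<rho> (poly p (tsize t)) (\<rho>(4 := code (f t) @ w))"
    using PT_E[OF assms(1)] by metis
  obtain cg q where g: "wf_com 7 cg" "\<And>t. tsize (g t) \<le> poly q (tsize t)"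
    "\<And>t w \<rho>. \<rho> 4 = code t @ w \<Longrightarrow> runs cg \<rho> (poly q (tsize t)) (\<rho>(4 := code (g t) @ w))"
    using PT_E[OF assms(2)] by metis
  let ?c = "Seq (move 4 [4, 5]) (Seq cf (Seq (move 4 [6]) (Seq (move 5 [4]) (Seq cg (Seq (move 6 [4]) (push 4 True))))))"
  let ?T = "\<lambda>n. 2 * (31 * n + 19) + 2 * (31 * poly p n + 19) + poly p n + poly q n + 9"
  show ?thesis
  proof (rule PT_I[of ?c "\<lambda>n. Suc (poly p n + poly q n)" ?T])
    show "tsize (Node (f t) (g t)) \<le> Suc (poly p (tsize t) + poly q (tsize t))" for t
      using f(2)[of t] g(2)[of t] by simp
    fix t w and \<rho> :: "nat \<Rightarrow> bool list" assume r: "\<rho> 4 = code t @ w"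
    \<comment> \<open>The second function needs the argument again: stack 5 keeps a copy of it while
      \<open>cf\<close> runs, and stack 6 keeps the result of \<open>cf\<close> while
      \<open>cg\<close> runs.\<close>
    let ?r1 = "\<rho>(5 := code t @ \<rho> 5)"
    let ?r2 = "?r1(4 := code (f t) @ w)"
    let ?r3 = "?r2(4 := w, 6 := code (f t) @ ?r2 6)"
    let ?r4 = "?r3(5 := \<rho> 5, 4 := code t @ ?r3 4)"
    let ?r5 = "?r4(4 := code (g t) @ w)"
    let ?r6 = "?r5(6 := \<rho> 6, 4 := code (f t) @ ?r5 4)"
    let ?r7 = "?r6(4 := True # ?r6 4)"
    have 1: "runs (move 4 [4, 5]) \<rho> (31 * tsize t + 19) ?r1" by (rule runs_copy) (use r in auto)
    have 2: "runs cf ?r1 (poly p (tsize t)) ?r2" by (rule f(3)) (use r in auto)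
    have 3: "runs (move 4 [6]) ?r2 (31 * tsize (f t) + 19) ?r3" by (rule runs_mv) auto
    have 4: "runs (move 5 [4]) ?r3 (31 * tsize t + 19) ?r4" by (rule runs_mv) auto
    have 5: "runs cg ?r4 (poly q (tsize t)) ?r5" by (rule g(3)) auto
    have 6: "runs (move 6 [4]) ?r5 (31 * tsize (f t) + 19) ?r6" by (rule runs_mv) auto
    have 7: "runs (push 4 True) ?r6 3 ?r7" by (rule runs_push) simp
    have e: "?r7 = \<rho>(4 := code (Node (f t) (g t)) @ w)" by (auto simp: fun_eq_iff)
    note R = runs_Seq[OF 1 runs_Seq[OF 2 runs_Seq[OF 3 runs_Seq[OF 4 runs_Seq[OF 5 runs_Seq[OF 6 7]]]]]]
    show "runs ?c \<rho> (?T (tsize t)) (\<rho>(4 := code (Node (f t) (g t)) @ w))"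
      unfolding e[symmetric] by (rule runs_mono[OF R]) (use f(2)[of t] in simp)
  qed (use f(1) g(1) in \<open>auto intro!: polyb_intros\<close>)
qed

fun left :: "tree \<Rightarrow> tree" where "left Leaf = Leaf" | "left (Node a b) = a"
fun right :: "tree \<Rightarrow> tree" where "right Leaf = Leaf" | "right (Node a b) = b"

lemma PT_left: "PT left"
proof (rule PT_I[of "If 4 {2} (Seq (pop 4) (Seq (move 4 [5]) (Seq (move 4 []) (move 5 [4])))) (Act 1 None Stay)"
      "\<lambda>n. n" "\<lambda>n. 93 * n + 100"])
  fix t w and \<rho> :: "nat \<Rightarrow> bool list" assume r: "\<rho> 4 = code t @ w"
  show "runs (If 4 {2} (Seq (pop 4) (Seq (move 4 [5]) (Seq (move 4 []) (move 5 [4])))) (Act 1 None Stay))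
      \<rho> (93 * tsize t + 100) (\<rho>(4 := code (left t) @ w))"
  proof (cases t)
    case Leaf
    then have e: "\<rho>(4 := code (left t) @ w) = \<rho>" using r by (auto simp: fun_eq_iff)
    show ?thesis
      unfolding e by (rule runs_mono[OF runs_If_top[of 4 \<rho> False w]]) (use r Leaf runs_nop[of \<rho>] in auto)
  next
    case (Node a b)
    let ?r1 = "\<rho>(4 := code a @ code b @ w)"
    let ?r2 = "?r1(4 := code b @ w, 5 := code a @ ?r1 5)"
    let ?r3 = "?r2(4 := w)"
    let ?r4 = "?r3(5 := \<rho> 5, 4 := code a @ ?r3 4)"
    have 1: "runs (pop 4) \<rho> 1 ?r1" by (rule runs_pop[of _ _ True]) (use r Node in auto)
    have 2: "runs (move 4 [5]) ?r1 (31 * tsize a + 19) ?r2" by (rule runs_mv) auto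
    have 3: "runs (move 4 []) ?r2 (31 * tsize b + 19) ?r3" by (rule runs_delete) auto
    have 4: "runs (move 5 [4]) ?r3 (31 * tsize a + 19) ?r4" by (rule runs_mv) auto
    have e: "?r4 = \<rho>(4 := code (left t) @ w)" using Node by (auto simp: fun_eq_iff)
    show ?thesis
      unfolding e[symmetric]
      by (rule runs_mono[OF runs_If_top[of 4 \<rho> True "code a @ code b @ w"]], simp, use r Node in simp)
        (simp only: if_True, rule runs_Seq[OF 1 runs_Seq[OF 2 runs_Seq[OF 3 4]]], use Node in simp)
  qed
next
  show "tsize (left t) \<le> tsize t" for t by (cases t) auto
qed (auto intro!: polyb_intros)

lemma PT_right: "PT right"
proof (rule PT_I[of "If 4 {2} (Seq (pop 4) (move 4 [])) (Act 1 None Stay)"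
      "\<lambda>n. n" "\<lambda>n. 93 * n + 100"])
  fix t w and \<rho> :: "nat \<Rightarrow> bool list" assume r: "\<rho> 4 = code t @ w"
  show "runs (If 4 {2} (Seq (pop 4) (move 4 [])) (Act 1 None Stay)) \<rho> (93 * tsize t + 100) (\<rho>(4 := code (right t) @ w))"
  proof (cases t)
    case Leaf
    then have e: "\<rho>(4 := code (right t) @ w) = \<rho>" using r by (auto simp: fun_eq_iff)
    show ?thesis
      unfolding e by (rule runs_mono[OF runs_If_top[of 4 \<rho> False w]]) (use r Leaf runs_nop[of \<rho>] in auto)
  next
    case (Node a b)
    let ?r1 = "\<rho>(4 := code a @ code b @ w)"
    let ?r2 = "?r1(4 := code b @ w)"
    have 1: "runs (pop 4) \<rho> 1 ?r1" by (rule runs_pop[of _ _ True]) (use r Node in auto)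
    have 2: "runs (move 4 []) ?r1 (31 * tsize a + 19) ?r2" by (rule runs_delete) auto
    have e: "?r2 = \<rho>(4 := code (right t) @ w)" using Node by (auto simp: fun_eq_iff)
    show ?thesis
      unfolding e[symmetric]
      by (rule runs_mono[OF runs_If_top[of 4 \<rho> True "code a @ code b @ w"]], simp, use r Node in simp)
        (simp only: if_True, rule runs_Seq[OF 1 2], use Node in simp)
  qed
next
  show "tsize (right t) \<le> tsize t" for t by (cases t) auto
qed (auto intro!: polyb_intros)

lemma PT_if:
  assumes "PT h" "PT f" "PT g"
  shows "PT (\<lambda>t. if h t = Leaf then g t else f t)"
proof -
  obtain ch o' where h: "wf_com 7 ch" "\<And>t. tsize (h t) \<le> poly o' (tsize t)"
    "\<And>t w \<rho>. \<rho> 4 = code t @ w \<Longrightarrow> runs ch \<rho> (poly o' (tsize t)) (\<rho>(4 := code (h t) @ w))"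
    using PT_E[OF assms(1)] by metis
  obtain cf p where f: "wf_com 7 cf" "\<And>t. tsize (f t) \<le> poly p (tsize t)"
    "\<And>t w \<rho>. \<rho> 4 = code t @ w \<Longrightarrow> runs cf \<rho> (poly p (tsize t)) (\<rho>(4 := code (f t) @ w))"
    using PT_E[OF assms(2)] by metis
  obtain cg q where g: "wf_com 7 cg" "\<And>t. tsize (g t) \<le> poly q (tsize t)"
    "\<And>t w \<rho>. \<rho> 4 = code t @ w \<Longrightarrow> runs cg \<rho> (poly q (tsize t)) (\<rho>(4 := code (g t) @ w))"
    using PT_E[OF assms(3)] by metis
  let ?b = "\<lambda>c. Seq (move 4 []) (Seq (move 5 [4]) c)"
  let ?c = "Seq (move 4 [4, 5]) (Seq ch (If 4 {2} (?b cf) (?b cg)))"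
  let ?T = "\<lambda>n. 2 * (31 * n + 19) + (31 * poly o' n + 19) + poly o' n + poly p n + poly q n + 10"
  show ?thesis
  proof (rule PT_I[of ?c "\<lambda>n. poly p n + poly q n" ?T])
    show "tsize (if h t = Leaf then g t else f t) \<le> poly p (tsize t) + poly q (tsize t)" for t
      using f(2)[of t] g(2)[of t] by simp
    fix t w and \<rho> :: "nat \<Rightarrow> bool list" assume r: "\<rho> 4 = code t @ w"
    let ?r1 = "\<rho>(5 := code t @ \<rho> 5)"
    let ?r2 = "?r1(4 := code (h t) @ w)"
    let ?r3 = "?r2(4 := w)"
    let ?r4 = "?r3(5 := \<rho> 5, 4 := code t @ ?r3 4)"
    have 1: "runs (move 4 [4, 5]) \<rho> (31 * tsize t + 19) ?r1" by (rule runs_copy) (use r in auto)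
    have 2: "runs ch ?r1 (poly o' (tsize t)) ?r2" by (rule h(3)) (use r in auto)
    have 3: "runs (move 4 []) ?r2 (31 * tsize (h t) + 19) ?r3" by (rule runs_delete) auto
    have 4: "runs (move 5 [4]) ?r3 (31 * tsize t + 19) ?r4" by (rule runs_mv) auto
    have 5: "runs cf ?r4 (poly p (tsize t)) (?r4(4 := code (f t) @ w))" by (rule f(3)) auto
    have 6: "runs cg ?r4 (poly q (tsize t)) (?r4(4 := code (g t) @ w))" by (rule g(3)) auto
    have e: "?r4(4 := code x @ w) = \<rho>(4 := code x @ w)" for x by (auto simp: fun_eq_iff)
    let ?T' = "Suc ((31 * tsize (h t) + 19) + Suc ((31 * tsize t + 19) + (poly p (tsize t) + poly q (tsize t))))"
    obtain b v where bv: "code (h t) = b # v" "b \<longleftrightarrow> h t \<noteq> Leaf" by (cases "h t") auto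
    have "runs (if b then ?b cf else ?b cg) ?r2 ?T' (\<rho>(4 := code (if h t = Leaf then g t else f t) @ w))"
    proof (cases "h t = Leaf")
      case True
      have "runs (?b cg) ?r2 ?T' (?r4(4 := code (g t) @ w))"
        by (rule runs_mono[OF runs_Seq[OF 3 runs_Seq[OF 4 6]]]) simp
      then show ?thesis using True bv e[of "g t"] by simp
    next
      case False
      have "runs (?b cf) ?r2 ?T' (?r4(4 := code (f t) @ w))"
        by (rule runs_mono[OF runs_Seq[OF 3 runs_Seq[OF 4 5]]]) simp
      then show ?thesis using False bv e[of "f t"] by simp
    qed
    then have 7: "runs (If 4 {2} (?b cf) (?b cg)) ?r2 (Suc ?T') (\<rho>(4 := code (if h t = Leaf then g t else f t) @ w))"
      by (intro runs_If_top[of 4 ?r2 b "v @ w"]) (use bv in auto)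
    show "runs ?c \<rho> (?T (tsize t)) (\<rho>(4 := code (if h t = Leaf then g t else f t) @ w))"
      by (rule runs_mono[OF runs_Seq[OF 1 runs_Seq[OF 2 7]]]) (use h(2)[of t] in simp)
  qed (use h(1) f(1) g(1) in \<open>auto intro!: polyb_intros\<close>)
qed

text \<open>A polynomial-time function can only be iterated along the right spine of a tree if all intermediate
  values, collected in \<open>stages s n b\<close>, have polynomial size.\<close>

primrec foldT :: "(tree \<Rightarrow> tree) \<Rightarrow> tree \<Rightarrow> tree \<Rightarrow> tree" where
  "foldT s Leaf b = b"
| "foldT s (Node a n) b = foldT s n (s (Node a b))"

primrec stages :: "(tree \<Rightarrow> tree) \<Rightarrow> tree \<Rightarrow> tree \<Rightarrow> tree set" where
  "stages s Leaf b = {b}"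
| "stages s (Node a n) b = insert b (stages s n (s (Node a b)))"

lemma foldT_in_stages: "foldT s n b \<in> stages s n b"
  by (induction n arbitrary: b) auto

definition fold_body :: "com \<Rightarrow> com" where
  "fold_body c = Seq (pop 5) (Seq (move 5 [4]) (Seq (push 4 True) c))"

lemma runs_fold_loop:
  assumes s: "\<And>t w \<rho>. \<rho> 4 = code t @ w \<Longrightarrow> runs c \<rho> (poly p (tsize t)) (\<rho>(4 := code (s t) @ w))"
    and "\<rho> 5 = code n @ v" "\<rho> 4 = code b @ w" "tsize n \<le> N" "\<forall>x \<in> stages s n b. tsize x \<le> B"
  shows "runs (While 5 {2} (fold_body c)) \<rho> (tsize n * (31 * N + poly p (Suc (N + B)) + 30))
    (\<rho>(4 := code (foldT s n b) @ w, 5 := False # v))"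
  using assms(2-)
proof (induction n arbitrary: \<rho> b)
  case Leaf
  then have e: "\<rho>(4 := code (foldT s Leaf b) @ w, 5 := False # v) = \<rho>" by (auto simp: fun_eq_iff)
  have "runs (While 5 {2} (fold_body c)) \<rho> 1 \<rho>"
    by (rule runs_While_False) (use Leaf in \<open>auto simp: tape_of_Cons bsym_def\<close>)
  then show ?case unfolding e by (rule runs_mono) simp
next
  case (Node a n)
  let ?r1 = "\<rho>(5 := code a @ code n @ v)"
  let ?r2 = "?r1(5 := code n @ v, 4 := code a @ ?r1 4)"
  let ?r3 = "?r2(4 := True # ?r2 4)"
  let ?r4 = "?r3(4 := code (s (Node a b)) @ w)"
  have 1: "runs (pop 5) \<rho> 1 ?r1" by (rule runs_pop[of _ _ True]) (use Node.prems in auto)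
  have 2: "runs (move 5 [4]) ?r1 (31 * tsize a + 19) ?r2" by (rule runs_mv) auto
  have 3: "runs (push 4 True) ?r2 3 ?r3" by (rule runs_push) simp
  have 4: "runs c ?r3 (poly p (tsize (Node a b))) ?r4" by (rule s) (use Node.prems in auto)
  have B: "tsize b \<le> B" using Node.prems(4) by simp
  have "poly p (tsize (Node a b)) \<le> poly p (Suc (N + B))"
    by (rule poly_nat_mono) (use Node.prems B in simp)
  then have 5: "runs (fold_body c) \<rho> (31 * N + poly p (Suc (N + B)) + 29) ?r4"
    unfolding fold_body_def
    by (intro runs_mono[OF runs_Seq[OF 1 runs_Seq[OF 2 runs_Seq[OF 3 4]]]]) (use Node.prems in simp)
  have "runs (While 5 {2} (fold_body c)) ?r4 (tsize n * (31 * N + poly p (Suc (N + B)) + 30))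
      (?r4(4 := code (foldT s n (s (Node a b))) @ w, 5 := False # v))"
    by (rule Node.IH(2)) (use Node.prems in auto)
  also have "?r4(4 := code (foldT s n (s (Node a b))) @ w, 5 := False # v) =
      \<rho>(4 := code (foldT s (Node a n) b) @ w, 5 := False # v)"
    by (auto simp: fun_eq_iff)
  finally have 6: "runs (While 5 {2} (fold_body c)) ?r4 (tsize n * (31 * N + poly p (Suc (N + B)) + 30))
      (\<rho>(4 := code (foldT s (Node a n) b) @ w, 5 := False # v))" .
  show ?case
    by (rule runs_mono[OF runs_While_top[OF _ _ 5 6, of "code a @ code n @ v"]]) (use Node.prems in auto)
qed

lemma PT_fold:
  assumes "PT s" "PT g" "PT h" "polyb B" "\<And>t x. x \<in> stages s (g t) (h t) \<Longrightarrow> tsize x \<le> B (tsize t)"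
  shows "PT (\<lambda>t. foldT s (g t) (h t))"
proof -
  obtain c p where s: "wf_com 7 c"
    "\<And>t w \<rho>. \<rho> 4 = code t @ w \<Longrightarrow> runs c \<rho> (poly p (tsize t)) (\<rho>(4 := code (s t) @ w))"
    using PT_E[OF assms(1)] by metis
  obtain cg q where g: "wf_com 7 cg" "\<And>t. tsize (Node (g t) (h t)) \<le> poly q (tsize t)"
    "\<And>t w \<rho>. \<rho> 4 = code t @ w \<Longrightarrow> runs cg \<rho> (poly q (tsize t)) (\<rho>(4 := code (Node (g t) (h t)) @ w))"
    using PT_E[OF PT_pair[OF assms(2,3)]] by metis
  let ?c = "Seq cg (Seq (pop 4) (Seq (move 4 [5]) (Seq (While 5 {2} (fold_body c)) (pop 5))))"
  let ?T = "\<lambda>n. poly q n + (31 * poly q n + 19) + poly q n * (31 * poly q n + poly p (Suc (poly q n + B n)) + 30) + 6"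
  show ?thesis
  proof (rule PT_I[of ?c B ?T])
    show "tsize (foldT s (g t) (h t)) \<le> B (tsize t)" for t
      using assms(5) foldT_in_stages by blast
    fix t w and \<rho> :: "nat \<Rightarrow> bool list" assume r: "\<rho> 4 = code t @ w"
    let ?r1 = "\<rho>(4 := code (Node (g t) (h t)) @ w)"
    let ?r2 = "?r1(4 := code (g t) @ code (h t) @ w)"
    let ?r3 = "?r2(4 := code (h t) @ w, 5 := code (g t) @ ?r2 5)"
    let ?r4 = "?r3(4 := code (foldT s (g t) (h t)) @ w, 5 := False # \<rho> 5)"
    let ?r5 = "?r4(5 := \<rho> 5)"
    have N: "tsize (g t) \<le> poly q (tsize t)" using g(2)[of t] by simp
    have 1: "runs cg \<rho> (poly q (tsize t)) ?r1" by (rule g(3)[where t = t and w = w and \<rho> = \<rho>, OF r])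
    have 2: "runs (pop 4) ?r1 1 ?r2" by (rule runs_pop[of _ _ True]) auto
    have 3: "runs (move 4 [5]) ?r2 (31 * tsize (g t) + 19) ?r3" by (rule runs_mv) auto
    have 4: "runs (While 5 {2} (fold_body c)) ?r3
        (tsize (g t) * (31 * poly q (tsize t) + poly p (Suc (poly q (tsize t) + B (tsize t))) + 30)) ?r4"
      by (rule runs_fold_loop[OF s(2)]) (use N assms(5) in auto)
    have 5: "runs (pop 5) ?r4 1 ?r5" by (rule runs_pop[of _ _ False]) auto
    have e: "?r5 = \<rho>(4 := code (foldT s (g t) (h t)) @ w)" by (auto simp: fun_eq_iff)
    have "tsize (g t) * (31 * poly q (tsize t) + poly p (Suc (poly q (tsize t) + B (tsize t))) + 30) \<le>
      poly q (tsize t) * (31 * poly q (tsize t) + poly p (Suc (poly q (tsize t) + B (tsize t))) + 30)"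
      using N by (rule mult_le_mono1)
    note K = this
    show "runs ?c \<rho> (?T (tsize t)) (\<rho>(4 := code (foldT s (g t) (h t)) @ w))"
      unfolding e[symmetric]
      by (rule runs_mono[OF runs_Seq[OF 1 runs_Seq[OF 2 runs_Seq[OF 3 runs_Seq[OF 4 5]]]]]) (use N K in linarith)
  qed (use g(1) s(1) assms(4) in \<open>auto intro!: polyb_intros simp: fold_body_def\<close>)
qed

text \<open>The bits of the code of a tree as a tree; this gives access to a list that is as long as the
  input is large, and allows us to compare trees.\<close>

definition flat :: "tree \<Rightarrow> tree" where
  "flat t = foldr (\<lambda>b. Node (if b then Node Leaf Leaf else Leaf)) (code t) Leaf"

lemma PT_flat: "PT flat"
proof -
  \<comment> \<open>In the code of the new list, a bit becomes the \<open>True\<close> of a list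
    cell followed by the code of the bit, which is \<open>True, False, False\<close> or just
    \<open>False\<close>. The pushes are this block in reverse order.\<close>
  let ?e = "\<lambda>b. if b then [(4, False), (4, False), (4, True), (4, True)] else [(4::nat, False), (4, True)]"
  let ?c = "Seq (take_tree 4) (Seq (push 4 False) (put ?e))"
  have cd: "code (foldr (\<lambda>b. Node (if b then Node Leaf Leaf else Leaf)) xs Leaf) = emitted ?e 4 xs @ [False]" for xs
    by (induction xs) (auto simp: emitted_def)
  have em: "emitted ?e r xs = []" if "r \<noteq> 4" for r xs
    using that by (induction xs) (auto simp: emitted_def)
  have len: "length (emitted ?e 4 xs) \<le> 4 * length xs" for xs
    by (induction xs) (auto simp: emitted_def)
  show ?thesis
  proof (rule PT_I[of ?c "\<lambda>n. 4 * n + 1" "\<lambda>n. (16 * n + 15) + (n * 23 + 3) + 6"])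
    show "tsize (flat t) \<le> 4 * tsize t + 1" for t
      using len[of "code t"] unfolding flat_def tsize_def cd by simp
    fix t w and \<rho> :: "nat \<Rightarrow> bool list" assume r: "\<rho> 4 = code t @ w"
    let ?r1 = "\<rho>(4 := w, 1 := rev (code t) @ \<rho> 1, 2 := replicate (tsize t) True @ False # \<rho> 2)"
    let ?r2 = "?r1(4 := False # ?r1 4)"
    let ?r3 = "(\<lambda>r. emitted ?e r (code t) @ ?r2 r)(1 := \<rho> 1, 2 := \<rho> 2)"
    have 1: "runs (take_tree 4) \<rho> (16 * tsize t + 15) ?r1" by (rule runs_take_tree) (use r in auto)
    have 2: "runs (push 4 False) ?r1 3 ?r2" by (rule runs_push) simp
    have 3: "runs (put ?e) ?r2 (length (code t) * (4 * 4 + 7) + 3) ?r3"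
      by (rule runs_put[of ?e 4 ?r2 "code t" "\<rho> 1" "\<rho> 2"]) (auto simp: tsize_def split: if_splits)
    have e: "?r3 = \<rho>(4 := code (flat t) @ w)"
      by (auto simp: fun_eq_iff em flat_def cd)
    show "runs ?c \<rho> ((16 * tsize t + 15) + (tsize t * 23 + 3) + 6) (\<rho>(4 := code (flat t) @ w))"
      unfolding e[symmetric]
      by (rule runs_mono[OF runs_Seq[OF 1 runs_Seq[OF 2 3]]]) (simp add: tsize_def)
  qed (auto intro!: polyb_intros split: if_splits)
qed

section \<open>Polynomial-time functions on encoded data\<close>

text \<open>\<open>dec\<close> is total, so a tree that is no code also stands for some value. That
  normalising such trees takes polynomial time lets a function that is right on codes be extended to
  all trees.\<close>

class enc =
  fixes enc :: "'a \<Rightarrow> tree" and dec :: "tree \<Rightarrow> 'a"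
  assumes dec_enc[simp]: "dec (enc x) = x" and PT_norm: "PT (\<lambda>t. enc (dec t))"

lemma enc_eq_iff[simp]: "enc x = enc y \<longleftrightarrow> x = y"
  by (metis dec_enc)

section \<open>Polynomial-time functions and size bounds on encoded types\<close>

definition fp :: "('a::enc \<Rightarrow> 'b::enc) \<Rightarrow> bool" where
  "fp f \<longleftrightarrow> PT (\<lambda>t. enc (f (dec t)))"

definition esz :: "'a::enc \<Rightarrow> nat" where "esz x = tsize (enc x)"

lemma esz_pos: "0 < esz x"
  by (simp add: esz_def tsize_pos)

text \<open>It suffices to compute correctly on codes: the tree is first replaced by the code of
  what it decodes to.\<close>

lemma fpI: "PT g \<Longrightarrow> (\<And>x. g (enc x) = enc (f x)) \<Longrightarrow> fp f"
  for f :: "'a::enc \<Rightarrow> 'b::enc"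
  unfolding fp_def using PT_comp[of g "\<lambda>t. enc (dec t :: 'a)", OF _ PT_norm] by simp

definition pb :: "('a::enc \<Rightarrow> nat) \<Rightarrow> bool" where
  "pb f \<longleftrightarrow> (\<exists>p :: nat poly. \<forall>x. f x \<le> poly p (esz x))"

lemma pb_polyb: "polyb g \<Longrightarrow> (\<And>x. f x \<le> g (esz x)) \<Longrightarrow> pb f"
  unfolding pb_def polyb_def by (meson le_trans)

lemma pb_const: "pb (\<lambda>x. c)"
  by (rule pb_polyb[OF polyb_const]) (rule order_refl)

lemma pb_add: "pb f \<Longrightarrow> pb g \<Longrightarrow> pb (\<lambda>x. f x + g x)"
  unfolding pb_def by (metis add_mono poly_add)

lemma pb_mult: "pb f \<Longrightarrow> pb g \<Longrightarrow> pb (\<lambda>x. f x * g x)"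
  unfolding pb_def by (metis mult_le_mono poly_mult)

lemma pb_Suc: "pb f \<Longrightarrow> pb (\<lambda>x. Suc (f x))"
  using pb_add[OF pb_const[of 1]] by simp

lemma pb_power: "pb f \<Longrightarrow> pb (\<lambda>x. f x ^ k)"
  by (induction k) (simp_all add: pb_const pb_mult)

lemma pb_le: "pb g \<Longrightarrow> (\<And>x. f x \<le> g x) \<Longrightarrow> pb f"
  unfolding pb_def by (meson le_trans)

lemma pb_poly: "pb f \<Longrightarrow> pb (\<lambda>x. poly p (f x))"
proof -
  assume "pb f"
  then obtain q where q: "\<forall>x. f x \<le> poly q (esz x)" unfolding pb_def by blast
  have "polyb (\<lambda>n. poly p (poly q n))" by (intro polyb_intros)
  then show ?thesis by (rule pb_polyb) (simp add: q poly_nat_mono)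
qed

lemma pb_esz: "fp f \<Longrightarrow> pb (\<lambda>x. esz (f x))"
proof -
  assume "fp f"
  then obtain p where p: "\<And>t. tsize (enc (f (dec t))) \<le> poly p (tsize t)"
    unfolding fp_def by (metis PT_E)
  have "tsize (enc (f x)) \<le> poly p (tsize (enc x))" for x
    using p[of "enc x"] by simp
  then show ?thesis unfolding pb_def esz_def by blast
qed

named_theorems fp_intro

lemma fp_id[fp_intro]: "fp (\<lambda>x. x)"
  by (rule fpI[OF PT_id]) simp

lemma fp_const[fp_intro]: "fp (\<lambda>x. c)"
  by (rule fpI[OF PT_const]) simp

lemma fp_comp: "fp f \<Longrightarrow> fp g \<Longrightarrow> fp (\<lambda>x. f (g x))"
  unfolding fp_def by (drule (1) PT_comp) simp

lemmas pb_intros = pb_const pb_add pb_mult pb_Suc pb_power pb_poly pb_esz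

instantiation tree :: enc
begin
definition "enc_tree (t :: tree) = t"
definition "dec_tree (t :: tree) = t"
instance by standard (simp_all add: enc_tree_def dec_tree_def PT_id)
end

instantiation unit :: enc
begin
definition "enc_unit (x :: unit) = Leaf"
definition "dec_unit (t :: tree) = ()"
instance by standard (simp_all add: enc_unit_def dec_unit_def PT_const)
end

instantiation bool :: enc
begin
definition "enc_bool b = (if b then Node Leaf Leaf else Leaf)"
definition "dec_bool t \<longleftrightarrow> t \<noteq> Leaf"
instance
proof
  have "(\<lambda>t. enc (dec t :: bool)) = (\<lambda>t. if t = Leaf then Leaf else Node Leaf Leaf)"
    by (auto simp: enc_bool_def dec_bool_def)
  then show "PT (\<lambda>t. enc (dec t :: bool))"
    using PT_if[OF PT_id PT_const PT_const] by simp
qed (simp add: enc_bool_def dec_bool_def)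
end

instantiation prod :: (enc, enc) enc
begin
definition "enc_prod p = Node (enc (fst p)) (enc (snd p))"
definition "dec_prod t = (dec (left t), dec (right t))"
instance
proof
  show "PT (\<lambda>t. enc (dec t :: 'a \<times> 'b))"
    unfolding enc_prod_def dec_prod_def fst_conv snd_conv
    by (intro PT_pair PT_comp[OF PT_norm[where 'a = 'a] PT_left] PT_comp[OF PT_norm[where 'a = 'b] PT_right])
qed (simp add: enc_prod_def dec_prod_def)
end

lemma enc_Pair: "enc (a, b) = Node (enc a) (enc b)"
  by (simp add: enc_prod_def)

lemma esz_Pair[simp]: "esz (a, b) = Suc (esz a + esz b)"
  by (simp add: esz_def enc_Pair)

lemma fp_Pair[fp_intro]: "fp f \<Longrightarrow> fp g \<Longrightarrow> fp (\<lambda>x. (f x, g x))"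
  unfolding fp_def enc_Pair by (rule PT_pair)

lemma fp_fst[fp_intro]: "fp f \<Longrightarrow> fp (\<lambda>x. fst (f x))"
  by (rule fp_comp[of fst]) (rule fpI[OF PT_left], auto simp: enc_prod_def)

lemma fp_snd[fp_intro]: "fp f \<Longrightarrow> fp (\<lambda>x. snd (f x))"
  by (rule fp_comp[of snd]) (rule fpI[OF PT_right], auto simp: enc_prod_def)

lemma fp_If[fp_intro]:
  assumes "fp P" "fp f" "fp g"
  shows "fp (\<lambda>x. if P x then f x else g x)"
proof -
  have "(\<lambda>t. enc (if P (dec t) then f (dec t) else g (dec t))) =
      (\<lambda>t. if enc (P (dec t)) = Leaf then enc (g (dec t)) else enc (f (dec t)))"
    by (auto simp: enc_bool_def)
  then show ?thesis using PT_if[OF assms[unfolded fp_def]] unfolding fp_def by simp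
qed

lemma fp_not[fp_intro]: "fp P \<Longrightarrow> fp (\<lambda>x. \<not> P x)"
proof -
  assume "fp P"
  then have "fp (\<lambda>x. if P x then False else True)" by (intro fp_If fp_const)
  moreover have "(\<lambda>x. if P x then False else True) = (\<lambda>x. \<not> P x)" by auto
  ultimately show ?thesis by simp
qed

lemma fp_conj[fp_intro]: "fp P \<Longrightarrow> fp Q \<Longrightarrow> fp (\<lambda>x. P x \<and> Q x)"
proof -
  assume "fp P" "fp Q"
  then have "fp (\<lambda>x. if P x then Q x else False)" by (intro fp_If fp_const)
  moreover have "(\<lambda>x. if P x then Q x else False) = (\<lambda>x. P x \<and> Q x)" by auto
  ultimately show ?thesis by simp
qed

lemma fp_disj[fp_intro]: "fp P \<Longrightarrow> fp Q \<Longrightarrow> fp (\<lambda>x. P x \<or> Q x)"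
  using fp_not[OF fp_conj[OF fp_not fp_not, of P Q]] by simp

lemma fp_imp[fp_intro]: "fp P \<Longrightarrow> fp Q \<Longrightarrow> fp (\<lambda>x. P x \<longrightarrow> Q x)"
  unfolding imp_conv_disj by (intro fp_disj fp_not)


subsection \<open>Lists\<close>

primrec mapT :: "(tree \<Rightarrow> tree) \<Rightarrow> tree \<Rightarrow> tree" where
  "mapT f Leaf = Leaf"
| "mapT f (Node a b) = Node (f a) (mapT f b)"

lemma stages_add:
  assumes "x \<in> stages s n b" "\<And>a b. tsize a \<le> tsize n \<Longrightarrow> tsize (s (Node a b)) \<le> tsize b + K"
  shows "tsize x \<le> tsize b + tsize n * K"
  using assms
proof (induction n arbitrary: b)
  case (Node a n)
  show ?case
  proof (cases "x = b")
    case False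
    then have "x \<in> stages s n (s (Node a b))" using Node.prems by simp
    then have "tsize x \<le> tsize (s (Node a b)) + tsize n * K"
      by (rule Node.IH(2)) (simp add: Node.prems(2))
    also have "tsize (s (Node a b)) \<le> tsize b + K" by (rule Node.prems(2)) simp
    finally show ?thesis by (simp add: algebra_simps)
  qed simp
qed simp

text \<open>Iteration along the spine produces the images in reverse order. A second iteration,
  whose step is the identity, is list reversal and restores the order.\<close>

lemma PT_mapT:
  assumes "PT f" shows "PT (mapT f)"
proof -
  let ?s = "\<lambda>t. Node (f (left t)) (right t)"
  obtain p where p: "\<And>t. tsize (f t) \<le> poly p (tsize t)" using PT_E[OF assms] by metis
  have s: "PT ?s" by (intro PT_pair PT_comp[OF assms PT_left] PT_right)
  have 1: "PT (\<lambda>t. foldT ?s t Leaf)"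
  proof (rule PT_fold[OF s PT_id PT_const, of "\<lambda>n. 1 + n * (poly p n + 1)"])
    fix t x assume "x \<in> stages ?s t Leaf"
    then have "tsize x \<le> tsize Leaf + tsize t * (poly p (tsize t) + 1)"
    proof (rule stages_add)
      fix a b assume "tsize a \<le> tsize t"
      then show "tsize (?s (Node a b)) \<le> tsize b + (poly p (tsize t) + 1)"
        using le_trans[OF p[of a] poly_nat_mono[of "tsize a" "tsize t" p]] by simp
    qed
    then show "tsize x \<le> 1 + tsize t * (poly p (tsize t) + 1)" by simp
  qed (intro polyb_intros)
  have 2: "PT (\<lambda>t. foldT (\<lambda>t. t) t Leaf)"
  proof (rule PT_fold[OF PT_id PT_id PT_const, of "\<lambda>n. 1 + n * (n + 1)"])
    fix t x assume "x \<in> stages (\<lambda>t. t) t Leaf"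
    then have "tsize x \<le> tsize Leaf + tsize t * (tsize t + 1)" by (rule stages_add) simp
    then show "tsize x \<le> 1 + tsize t * (tsize t + 1)" by simp
  qed (intro polyb_intros)
  have 3: "foldT (\<lambda>t. t) (foldT ?s t u) v = foldT (\<lambda>t. t) u (foldT (\<lambda>t. t) (foldT ?s t Leaf) v)" for t u v
  proof (induction t arbitrary: u v)
    case (Node a t)
    show ?case using Node.IH(2)[of "Node (f a) u" v] Node.IH(2)[of "Node (f a) Leaf" v] by simp
  qed simp
  have 4: "foldT (\<lambda>t. t) (foldT ?s t Leaf) Leaf = mapT f t" for t
    by (induction t) (simp_all add: 3[of _ "Node _ Leaf"])
  show ?thesis using PT_comp[OF 2 1] by (simp add: 4)
qed

primrec dec_spine :: "tree \<Rightarrow> 'a::enc list" where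
  "dec_spine Leaf = []"
| "dec_spine (Node a b) = dec a # dec_spine b"

instantiation list :: (enc) enc
begin
definition "enc_list xs = foldr (\<lambda>x. Node (enc x)) xs Leaf"
definition "dec_list = dec_spine"
instance
proof
  show "dec (enc xs) = xs" for xs :: "'a list"
    by (induction xs) (auto simp: enc_list_def dec_list_def)
  have "enc (dec t :: 'a list) = mapT (\<lambda>t. enc (dec t :: 'a)) t" for t
    by (induction t) (auto simp: enc_list_def dec_list_def)
  then show "PT (\<lambda>t. enc (dec t :: 'a list))" using PT_mapT[OF PT_norm[where 'a = 'a]] by simp
qed
end

lemma enc_Nil[simp]: "enc [] = Leaf" and enc_Cons[simp]: "enc (x # xs) = Node (enc x) (enc xs)"
  by (simp_all add: enc_list_def)

lemma esz_Nil[simp]: "esz [] = 1" and esz_Cons[simp]: "esz (x # xs) = Suc (esz x + esz xs)"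
  by (simp_all add: esz_def)

lemma esz_append: "esz (xs @ ys) + 1 = esz xs + esz ys"
  by (induction xs) auto

lemma esz_mem: "x \<in> set xs \<Longrightarrow> esz x \<le> esz xs"
  by (induction xs) auto

lemma length_le_esz: "length xs \<le> esz xs"
  by (induction xs) auto

lemma esz_list_le: "(\<And>x. x \<in> set xs \<Longrightarrow> esz x \<le> K) \<Longrightarrow> esz xs \<le> length xs * (K + 1) + 1"
proof (induction xs)
  case (Cons x xs)
  have "esz x \<le> K" "esz xs \<le> length xs * (K + 1) + 1" using Cons by auto
  then show ?case by simp
qed simp

lemma esz_rev: "esz (rev xs) = esz xs"
proof (induction xs)
  case (Cons x xs)
  then show ?case using esz_append[of "rev xs" "[x]"] by simp
qed simp

lemma fp_Cons[fp_intro]: "fp f \<Longrightarrow> fp g \<Longrightarrow> fp (\<lambda>x. f x # g x)"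
  unfolding fp_def enc_Cons by (rule PT_pair)

lemma fp_tl[fp_intro]: "fp f \<Longrightarrow> fp (\<lambda>x. tl (f x))"
proof (rule fp_comp[of tl], rule fpI[OF PT_right])
  show "right (enc xs) = enc (tl xs)" for xs :: "'b list" by (cases xs) auto
qed

lemma fp_null: "fp f \<Longrightarrow> fp (\<lambda>x. f x = [])"
proof (rule fp_comp[of "\<lambda>l. l = []"], rule fpI[OF PT_if[OF PT_id PT_const PT_const]])
  show "(if enc xs = Leaf then Node Leaf Leaf else Leaf) = enc (xs = [])" for xs :: "'b list"
    by (cases xs) (auto simp: enc_bool_def)
qed

lemma fp_hd[fp_intro]: "fp f \<Longrightarrow> fp (\<lambda>x. hd (f x))"
proof (rule fp_comp[of hd], rule fpI[OF PT_if[OF PT_id PT_left PT_const]])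
  show "(if enc xs = Leaf then enc (hd [] :: 'b) else left (enc xs)) = enc (hd xs)" for xs :: "'b list"
    by (cases xs) auto
qed

lemma fp_case_list[fp_intro]:
  assumes "fp l" "fp f" "fp (\<lambda>z. g (fst z) (fst (snd z)) (snd (snd z)))"
  shows "fp (\<lambda>x. case l x of [] \<Rightarrow> f x | a # b \<Rightarrow> g x a b)"
proof -
  have "(\<lambda>x. case l x of [] \<Rightarrow> f x | a # b \<Rightarrow> g x a b) =
      (\<lambda>x. if l x = [] then f x else g x (hd (l x)) (tl (l x)))"
    by (auto split: list.splits)
  moreover have "fp (\<lambda>x. g x (hd (l x)) (tl (l x)))"
    using fp_comp[OF assms(3), of "\<lambda>x. (x, hd (l x), tl (l x))"] assms(1) by (simp add: fp_intro)
  ultimately show ?thesis using assms by (simp add: fp_If fp_null)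
qed

text \<open>The step of \<open>foldT\<close> sees only the current element and the accumulator. The
  parameter \<open>x\<close> is therefore carried along inside the accumulator and dropped at the
  end. The bound concerns the values that really occur, those after a prefix of the list.\<close>

lemma fp_fold:
  fixes s :: "'x::enc \<Rightarrow> 'a::enc \<Rightarrow> 'b::enc \<Rightarrow> 'b"
  assumes s: "fp (\<lambda>z. s (fst z) (fst (snd z)) (snd (snd z)))" and l: "fp l" and i: "fp i"
    and B: "pb B" "\<And>x ys zs. l x = ys @ zs \<Longrightarrow> esz (fold (s x) ys (i x)) \<le> B x"
  shows "fp (\<lambda>x. fold (s x) (l x) (i x))"
proof -
  let ?G = "\<lambda>t. enc ((\<lambda>z. s (fst z) (fst (snd z)) (snd (snd z))) (dec t))"
  let ?S = "\<lambda>t. Node (left (right t)) (?G (Node (left (right t)) (Node (left t) (right (right t)))))"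
  have lr: "PT (\<lambda>t. left (right t))" by (rule PT_comp[OF PT_left PT_right])
  have rr: "PT (\<lambda>t. right (right t))" by (rule PT_comp[OF PT_right PT_right])
  have "PT ?G" using s unfolding fp_def .
  from PT_comp[OF this PT_pair[OF lr PT_pair[OF PT_left rr]]]
  have S: "PT ?S" by (rule PT_pair[OF lr])
  have step: "?S (Node (enc a) (Node (enc x) (enc b))) = Node (enc x) (enc (s x a b))" for x a b
    using dec_enc[of "(x, a, b)"] unfolding enc_Pair by simp
  have f: "foldT ?S (enc xs) (Node (enc x) (enc b)) = Node (enc x) (enc (fold (s x) xs b))" for x xs b
    by (induction xs arbitrary: b) (simp_all add: step del: left.simps right.simps)
  have st: "\<exists>ys zs. xs = ys @ zs \<and> y = Node (enc x) (enc (fold (s x) ys b))"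
    if "y \<in> stages ?S (enc xs) (Node (enc x) (enc b))" for y x xs b
    using that
  proof (induction xs arbitrary: b)
    case (Cons a xs)
    show ?case
    proof (cases "y = Node (enc x) (enc b)")
      case True
      then show ?thesis by - (rule exI[of _ "[]"], simp)
    next
      case False
      then have "y \<in> stages ?S (enc xs) (Node (enc x) (enc (s x a b)))"
        using Cons.prems by (simp add: step del: left.simps right.simps)
      then obtain ys zs where "xs = ys @ zs" "y = Node (enc x) (enc (fold (s x) ys (s x a b)))"
        using Cons.IH by blast
      then show ?thesis by - (rule exI[of _ "a # ys"], simp)
    qed
  next
    case Nil
    then show ?case by - (rule exI[of _ "[]"], simp)
  qed
  obtain p where p: "\<And>x. B x \<le> poly p (esz x)" using B(1) unfolding pb_def by blast
  obtain q where q: "\<And>t. tsize (enc (dec t :: 'x)) \<le> poly q (tsize t)" using PT_E[OF PT_norm[where 'a = 'x]] by metis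
  have "PT (\<lambda>t. foldT ?S (enc (l (dec t))) (Node (enc (dec t :: 'x)) (enc (i (dec t)))))"
  proof (rule PT_fold[OF S, of _ _ "\<lambda>n. Suc (poly q n + poly p (poly q n))"])
    show "PT (\<lambda>t. enc (l (dec t)))" using l unfolding fp_def .
    show "PT (\<lambda>t. Node (enc (dec t :: 'x)) (enc (i (dec t))))" using i PT_pair[OF PT_norm] unfolding fp_def by blast
    fix t y assume "y \<in> stages ?S (enc (l (dec t))) (Node (enc (dec t :: 'x)) (enc (i (dec t))))"
    then obtain ys zs where "l (dec t) = ys @ zs" "y = Node (enc (dec t :: 'x)) (enc (fold (s (dec t)) ys (i (dec t))))"
      using st by blast
    then have "tsize y \<le> Suc (tsize (enc (dec t :: 'x)) + B (dec t))" using B(2) by (simp add: esz_def)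
    also have "\<dots> \<le> Suc (poly q (tsize t) + poly p (poly q (tsize t)))"
      using q[of t] le_trans[OF p[of "dec t"] poly_nat_mono[of "esz (dec t :: 'x)" "poly q (tsize t)" p]]
      by (simp add: esz_def)
    finally show "tsize y \<le> Suc (poly q (tsize t) + poly p (poly q (tsize t)))" .
  qed (intro polyb_intros)
  from PT_comp[OF PT_right this] show ?thesis unfolding fp_def f by simp
qed

text \<open>If the growth per step is bounded independently of the accumulator, then the growths add
  up to at most the length times that bound. Repeated doubling, in contrast, needs the direct bound
  of \<open>fp_fold\<close>.\<close>

lemma fp_fold_add:
  fixes s :: "'x::enc \<Rightarrow> 'a::enc \<Rightarrow> 'b::enc \<Rightarrow> 'b"
  assumes s: "fp (\<lambda>z. s (fst z) (fst (snd z)) (snd (snd z)))" and l: "fp l" and i: "fp i"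
    and K: "pb K" "\<And>x a b. a \<in> set (l x) \<Longrightarrow> esz (s x a b) \<le> esz b + K x"
  shows "fp (\<lambda>x. fold (s x) (l x) (i x))"
proof (rule fp_fold[OF s l i, of "\<lambda>x. esz (i x) + esz (l x) * K x"])
  show "pb (\<lambda>x. esz (i x) + esz (l x) * K x)" by (intro pb_intros i l K)
  fix x ys zs assume e: "l x = ys @ zs"
  have "esz (fold (s x) ys b) \<le> esz b + length ys * K x" if "set ys \<subseteq> set (l x)" for b
    using that
  proof (induction ys arbitrary: b)
    case (Cons a ys)
    then have "esz (fold (s x) ys (s x a b)) \<le> esz (s x a b) + length ys * K x" by simp
    then show ?case using K(2)[of a x b] Cons.prems by simp
  qed simp
  then have "esz (fold (s x) ys (i x)) \<le> esz (i x) + length ys * K x" using e by simp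
  also have "length ys * K x \<le> esz (l x) * K x"
    using length_le_esz[of "l x"] e by (intro mult_le_mono1) simp
  finally show "esz (fold (s x) ys (i x)) \<le> esz (i x) + esz (l x) * K x" by simp
qed

lemma fp_rev[fp_intro]: "fp l \<Longrightarrow> fp (\<lambda>x. rev (l x))"
proof -
  assume l: "fp l"
  have "fp (\<lambda>x. fold Cons (l x) [])"
    by (rule fp_fold_add[where K = "\<lambda>x. Suc (esz (l x))"])
      (auto intro!: fp_intro pb_intros l simp: esz_mem)
  then show ?thesis by (simp add: fold_Cons_rev)
qed

lemma fp_append[fp_intro]: "fp l \<Longrightarrow> fp m \<Longrightarrow> fp (\<lambda>x. l x @ m x)"
proof -
  assume l: "fp l" "fp m"
  have "fp (\<lambda>x. fold Cons (rev (l x)) (m x))"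
    by (rule fp_fold_add[where K = "\<lambda>x. Suc (esz (l x))"])
      (auto intro!: fp_intro pb_intros l simp: esz_mem)
  then show ?thesis by (simp add: fold_Cons_rev)
qed

lemma pb_esz_mem:
  assumes "fp (\<lambda>z. f (fst z) (snd z))" "fp l"
  obtains K where "pb K" "\<And>x a. a \<in> set (l x) \<Longrightarrow> esz (f x a) \<le> K x"
proof -
  obtain p where p: "\<And>z. esz (f (fst z) (snd z)) \<le> poly p (esz z)"
    using pb_esz[OF assms(1)] unfolding pb_def by blast
  show ?thesis
  proof
    show "pb (\<lambda>x. poly p (Suc (esz x + esz (l x))))" by (intro pb_intros fp_intro assms)
    fix x a assume "a \<in> set (l x)"
    then show "esz (f x a) \<le> poly p (Suc (esz x + esz (l x)))"
      using le_trans[OF p[of "(x, a)"] poly_nat_mono] esz_mem by force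
  qed
qed

lemma fp_map[fp_intro]:
  assumes f: "fp (\<lambda>z. f (fst z) (snd z))" and l: "fp l"
  shows "fp (\<lambda>x. map (f x) (l x))"
proof -
  obtain K where K: "pb K" "\<And>x a. a \<in> set (l x) \<Longrightarrow> esz (f x a) \<le> K x"
    by (rule pb_esz_mem[OF f l]) (rule that)
  have "fp (\<lambda>z. f (fst z) (fst (snd z)))"
    using fp_comp[OF f, of "\<lambda>z. (fst z, fst (snd z))"] by (simp add: fp_intro)
  then have "fp (\<lambda>x. fold (\<lambda>a b. f x a # b) (l x) [])"
    by (intro fp_fold_add[where K = "\<lambda>x. Suc (K x)"]) (auto intro!: fp_intro pb_intros l K simp: K)
  moreover have "fold (\<lambda>a b. f x a # b) xs ys = rev (map (f x) xs) @ ys" for x xs ys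
    by (induction xs arbitrary: ys) auto
  ultimately show ?thesis using fp_rev by fastforce
qed

lemma fp_concat[fp_intro]: "fp l \<Longrightarrow> fp (\<lambda>x. concat (l x))"
proof -
  assume l: "fp l"
  have e: "esz (a @ b) \<le> esz b + esz a" for a b :: "'b list" using esz_append[of a b] by simp
  have "fp (\<lambda>x. fold (@) (rev (l x)) [])"
    by (rule fp_fold_add[where K = "\<lambda>x. esz (l x)"])
      (auto intro!: fp_intro pb_intros l intro: le_trans[OF e] simp: esz_mem)
  moreover have "fold (@) (rev xs) [] = concat xs" for xs :: "'b list list"
    by (induction xs) auto
  ultimately show ?thesis by simp
qed

lemma fp_filter[fp_intro]:
  assumes P: "fp (\<lambda>z. P (fst z) (snd z))" and l: "fp l"
  shows "fp (\<lambda>x. filter (P x) (l x))"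
proof -
  have "fp (\<lambda>x. concat (map (\<lambda>a. if P x a then [a] else []) (l x)))"
    by (intro fp_intro P l)
  moreover have "concat (map (\<lambda>a. if P x a then [a] else []) xs) = filter (P x) xs" for x xs
    by (induction xs) auto
  ultimately show ?thesis by simp
qed

lemma fp_list_all[fp_intro]:
  assumes "fp (\<lambda>z. P (fst z) (snd z))" "fp l"
  shows "fp (\<lambda>x. \<forall>a \<in> set (l x). P x a)"
proof -
  have "fp (\<lambda>x. filter (\<lambda>a. \<not> P x a) (l x) = [])"
    by (intro fp_null fp_filter fp_not assms)
  then show ?thesis by (simp add: filter_empty_conv)
qed

lemma fp_list_ex[fp_intro]:
  assumes "fp (\<lambda>z. P (fst z) (snd z))" "fp l"
  shows "fp (\<lambda>x. \<exists>a \<in> set (l x). P x a)"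
  using fp_not[OF fp_list_all[OF fp_not[OF assms(1)] assms(2)]] by simp

lemma fp_product[fp_intro]: "fp l \<Longrightarrow> fp m \<Longrightarrow> fp (\<lambda>x. List.product (l x) (m x))"
proof -
  assume l: "fp l" and m: "fp m"
  have "fp (\<lambda>z. m (fst z))" by (rule fp_comp[OF m]) (intro fp_intro)
  then have "fp (\<lambda>x. concat (map (\<lambda>a. map (\<lambda>b. (a, b)) (m x)) (l x)))"
    by (intro fp_intro l)
  then show ?thesis by (simp add: product_concat_map)
qed

definition bits :: "'a::enc \<Rightarrow> bool list" where "bits x = code (enc x)"

lemma fp_bits[fp_intro]: "fp f \<Longrightarrow> fp (\<lambda>x. bits (f x))"
proof (rule fp_comp[of bits], rule fpI[OF PT_flat])
  show "flat (enc x) = enc (bits x)" for x :: 'b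
    unfolding flat_def bits_def enc_list_def enc_bool_def by simp
qed

lemma length_bits: "length (bits x) = esz x"
  by (simp add: bits_def esz_def tsize_def)

lemma bits_eq_iff: "bits x = bits y \<longleftrightarrow> x = y"
  using code_append_eq[of "enc x" "[]" "enc y" "[]"] by (simp add: bits_def)

text \<open>Equality is decided on the bits of the codes, uniformly in the type: one bit list is
  read while the other is consumed. The state \<open>(False, [])\<close> records a mismatch and is
  absorbing.\<close>

lemma fp_eq[fp_intro]:
  assumes "fp f" "fp g" shows "fp (\<lambda>x. f x = g x)"
proof -
  let ?s = "\<lambda>(a::bool) (r::bool \<times> bool list). if fst r \<and> snd r \<noteq> [] \<and> (if a then hd (snd r) else \<not> hd (snd r)) then (True, tl (snd r)) else (False, [])"
  have F: "fold ?s xs (False, []) = (False, [])" for xs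
    by (induction xs) auto
  have e: "fold ?s xs (True, ys) = (True, []) \<longleftrightarrow> xs = ys" for xs ys
  proof (induction xs arbitrary: ys)
    case (Cons a xs)
    then show ?case by (cases ys) (auto simp: F)
  qed auto
  have "fp (\<lambda>x. fold ?s (bits (f x)) (True, bits (g x)))"
  proof (rule fp_fold_add[where K = "\<lambda>x. 10"])
    have tl: "esz (tl xs) \<le> esz xs" for xs :: "bool list" by (cases xs) auto
    show "esz (?s a b) \<le> esz b + 10" for a b
      using tl[of "snd b"] by (cases b) (auto simp: esz_def enc_bool_def enc_Pair)
  qed (intro fp_intro fp_null assms pb_intros)+
  from fp_fst[OF this] fp_null[OF fp_snd[OF this]]
  have "fp (\<lambda>x. fst (fold ?s (bits (f x)) (True, bits (g x))) \<and> snd (fold ?s (bits (f x)) (True, bits (g x))) = [])"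
    by (rule fp_conj)
  moreover have "(fst r \<and> snd r = []) \<longleftrightarrow> r = (True, [])" for r :: "bool \<times> bool list" by (cases r) auto
  ultimately show ?thesis by (simp add: e bits_eq_iff)
qed

subsection \<open>Natural numbers in binary\<close>

primrec val :: "bool list \<Rightarrow> nat" where
  "val [] = 0"
| "val (b # bs) = of_bool b + 2 * val bs"

text \<open>As the least significant bit comes first, the redundant zeros are at the end of the
  list.\<close>

definition strip :: "bool list \<Rightarrow> bool list" where
  "strip bs = fold (\<lambda>b acc. if \<not> b \<and> acc = [] then [] else b # acc) (rev bs) []"

lemma binary_0[simp]: "binary 0 = []"
  by (simp add: binary.simps)

lemma binary_pos: "n \<noteq> 0 \<Longrightarrow> binary n = odd n # binary (n div 2)"
  by (simp add: binary.simps)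

lemma binary_eq_Nil[simp]: "binary n = [] \<longleftrightarrow> n = 0"
  by (subst binary.simps) simp

lemma val_binary[simp]: "val (binary n) = n"
proof (induction n rule: less_induct)
  case (less n)
  show ?case
  proof (cases "n = 0")
    case False
    then have "val (binary n) = of_bool (odd n) + 2 * (n div 2)"
      using less[of "n div 2"] by (simp add: binary_pos)
    then show ?thesis by (auto elim: oddE)
  qed simp
qed

lemma strip_Cons: "strip (b # bs) = (if \<not> b \<and> strip bs = [] then [] else b # strip bs)"
  by (simp add: strip_def)

lemma binary_val: "binary (val bs) = strip bs"
proof (induction bs)
  case (Cons b bs)
  show ?case
  proof (cases "val (b # bs) = 0")
    case True
    then have v: "val bs = 0" "\<not> b" by (auto split: if_splits)
    then have "strip bs = []" "\<not> b" using Cons.IH by simp_all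
    then show ?thesis using True by (simp add: strip_Cons)
  next
    case False
    have "odd (val (b # bs)) = b" "val (b # bs) div 2 = val bs" by auto
    then have "binary (val (b # bs)) = b # strip bs" using binary_pos[OF False] Cons.IH by simp
    moreover have "b \<or> strip bs \<noteq> []" using False unfolding Cons.IH[symmetric] by (cases b) auto
    ultimately show ?thesis by (auto simp: strip_Cons)
  qed
qed (simp add: strip_def)

lemma esz_bool[simp]: "esz b = (if b then 3 else 1)"
  by (simp add: esz_def enc_bool_def)

lemma fp_strip: "fp strip"
proof -
  have "fp (\<lambda>bs. fold (\<lambda>b acc. if \<not> b \<and> acc = [] then [] else b # acc) (rev bs) [])"
    by (rule fp_fold_add[where K = "\<lambda>_. 10"]) (auto intro!: fp_intro fp_null pb_intros)
  then show ?thesis unfolding strip_def .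
qed

instantiation nat :: enc
begin
definition "enc_nat n = enc (binary n)"
definition "dec_nat t = val (dec t)"
instance
proof
  show "dec (enc n) = n" for n :: nat by (simp add: enc_nat_def dec_nat_def)
  show "PT (\<lambda>t. enc (dec t :: nat))"
    using fp_strip unfolding fp_def enc_nat_def dec_nat_def binary_val .
qed
end

lemma fp_binary[fp_intro]: "fp f \<Longrightarrow> fp (\<lambda>x. binary (f x))"
  by (rule fp_comp[of binary]) (rule fpI[OF PT_id], simp add: enc_nat_def)

lemma fp_val[fp_intro]: "fp f \<Longrightarrow> fp (\<lambda>x. val (f x))"
proof (rule fp_comp[of val], rule fpI[OF fp_strip[unfolded fp_def]])
  show "enc (strip (dec (enc xs))) = enc (val xs)" for xs by (simp add: enc_nat_def binary_val)
qed

lemma length_binary_le: "length (binary n) \<le> k \<longleftrightarrow> n < 2 ^ k"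
proof (induction k arbitrary: n)
  case (Suc k)
  show ?case
  proof (cases "n = 0")
    case False
    then have "length (binary n) \<le> Suc k \<longleftrightarrow> n div 2 < 2 ^ k" using Suc by (simp add: binary_pos)
    also have "\<dots> \<longleftrightarrow> n < 2 ^ Suc k" by (simp add: div_less_iff_less_mult mult.commute)
    finally show ?thesis .
  qed simp
qed simp

lemma less_power_binary: "n < 2 ^ length (binary n)"
  using length_binary_le[of n "length (binary n)"] by simp

lemma length_binary_mono: "m \<le> n \<Longrightarrow> length (binary m) \<le> length (binary n)"
  using length_binary_le less_power_binary le_less_trans by blast

lemma length_binary_add: "length (binary (m + n)) \<le> length (binary m) + length (binary n) + 1"
proof -
  let ?a = "length (binary m)" and ?b = "length (binary n)"
  have "m < 2 ^ (?a + ?b)" "n < 2 ^ (?a + ?b)"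
    using less_power_binary[of m] less_power_binary[of n] power_increasing[of ?a "?a + ?b" "2::nat"]
      power_increasing[of ?b "?a + ?b" "2::nat"] by linarith+
  then show ?thesis unfolding length_binary_le by simp
qed

lemma length_binary_mult: "length (binary (m * n)) \<le> length (binary m) + length (binary n)"
  unfolding length_binary_le power_add
  using less_power_binary[of m] less_power_binary[of n] by (intro mult_strict_mono) auto

lemma length_binary_self: "length (binary n) \<le> n"
  unfolding length_binary_le by simp

lemma esz_bool_list: "2 * length bs + 1 \<le> esz bs" "esz bs \<le> 4 * length bs + 1" for bs :: "bool list"
  by (induction bs) auto

lemma esz_nat: "esz n = esz (binary n)" for n :: nat
  by (simp add: esz_def enc_nat_def)

lemma esz_nat_le: "esz n \<le> 4 * length (binary n) + 1" for n :: nat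
  unfolding esz_nat by (rule esz_bool_list)

lemma length_binary_le_esz: "length (binary n) \<le> esz n" for n :: nat
  using esz_bool_list(1)[of "binary n"] unfolding esz_nat by simp

text \<open>The state consists of the carry, the unread bits of the second summand, and the bits of
  the sum found so far, the latest one first.\<close>

definition full_add :: "bool \<Rightarrow> bool \<times> bool list \<times> bool list \<Rightarrow> bool \<times> bool list \<times> bool list" where
  "full_add a s = (let c = fst s; r = fst (snd s); h = (if r = [] then False else hd r) in
     ((a \<and> h) \<or> (a \<and> c) \<or> (h \<and> c), tl r, (a \<noteq> (h \<noteq> c)) # snd (snd s)))"

lemma val_append: "val (xs @ ys) = val xs + 2 ^ length xs * val ys"
  by (induction xs) (auto simp: algebra_simps)

lemma val_False[simp]: "val (map (\<lambda>_. False) xs) = 0"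
  by (induction xs) auto

text \<open>Invariant of addition: the bits already produced, plus the carry and the unread bits at
  their proper weight, have a constant value.\<close>

lemma fold_full_add:
  assumes "fold full_add zs (c, r, out) = (c', r', out')"
  shows "r' = drop (length zs) r \<and> length out' = length out + length zs \<and>
    val (rev out') + 2 ^ length out' * (of_bool c' + val r') = val (rev out) + 2 ^ length out * (val zs + of_bool c + val r)"
  using assms
proof (induction zs arbitrary: c r out)
  case (Cons a zs)
  define h where "h = (if r = [] then False else hd r)"
  have r: "val r = of_bool h + 2 * val (tl r)" by (cases r) (auto simp: h_def)
  have "fold full_add zs ((a \<and> h) \<or> (a \<and> c) \<or> (h \<and> c), tl r, (a \<noteq> (h \<noteq> c)) # out) = (c', r', out')"
    using Cons.prems unfolding fold_Cons o_apply full_add_def[of a] Let_def fst_conv snd_conv h_def .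
  note IH = Cons.IH[OF this]
  have "val (rev out') + 2 ^ length out' * (of_bool c' + val r') =
      val (rev out) + 2 ^ length out * (val (a # zs) + of_bool c + val r)"
    unfolding IH[THEN conjunct2, THEN conjunct2] r by (cases a; cases h; cases c) (simp_all add: val_append algebra_simps)
  then show ?case using IH by (simp add: drop_Suc)
qed simp_all

lemma fp_add[fp_intro]:
  assumes "fp f" "fp g" shows "fp (\<lambda>x. f x + g x :: nat)"
proof -
  \<comment> \<open>The first summand is padded by as many zeros as the second has bits, so that the
    latter is used up, and by one more zero that absorbs the last carry.\<close>
  let ?zs = "\<lambda>x. binary (f x) @ map (\<lambda>_. False) (binary (g x)) @ [False]"
  let ?F = "\<lambda>x. fold full_add (?zs x) (False, binary (g x), [])"
  have "fp (\<lambda>z. full_add (fst (snd z)) (snd (snd z)))"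
    unfolding full_add_def Let_def by (intro fp_intro fp_null)
  then have F: "fp ?F"
  proof (rule fp_fold_add[where K = "\<lambda>_. 20"])
    show "esz (full_add a b) \<le> esz b + 20" for a b
    proof -
      have "esz (tl xs) \<le> esz xs" for xs :: "bool list" by (cases xs) auto
      from this[of "fst (snd b)"] show ?thesis by (cases b) (auto simp: full_add_def Let_def)
    qed
    show "fp ?zs" by (rule fp_append[OF _ fp_append[OF fp_comp[of "map (\<lambda>_. False)"]]]) (intro fp_intro assms)+
  qed (intro fp_intro assms pb_intros)+
  have "val (rev (snd (snd (?F x)))) = f x + g x" for x
  proof -
    obtain c' r' out' where e: "?F x = (c', r', out')" by (metis surj_pair)
    have L: "length out' = length (?zs x)" using fold_full_add[OF e] by simp
    have z: "val (?zs x) = f x" by (simp add: val_append)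
    have r': "r' = []" using fold_full_add[OF e] by simp
    have s: "val (rev out') + 2 ^ length out' * of_bool c' = f x + g x"
      using fold_full_add[OF e, THEN conjunct2, THEN conjunct2] unfolding r' z by simp
    have "length (binary (f x + g x)) \<le> length out'"
      unfolding L using length_binary_add[of "f x" "g x"] by simp
    then have "f x + g x < 2 ^ length out'" unfolding length_binary_le .
    then have "\<not> c'" using s by (cases c') auto
    then show ?thesis using s e by simp
  qed
  moreover have "fp (\<lambda>x. val (rev (snd (snd (?F x)))))" by (intro fp_intro F)
  ultimately show ?thesis by simp
qed

lemma fp_Suc[fp_intro]: "fp f \<Longrightarrow> fp (\<lambda>x. Suc (f x))"
  using fp_add[OF _ fp_const[of 1]] by simp

lemma fp_mult[fp_intro]:
  assumes "fp f" "fp g" shows "fp (\<lambda>x. f x * g x :: nat)"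
proof -
  \<comment> \<open>Horner's scheme from the most significant bit. Each intermediate value is
    \<open>g x\<close> times a leading part of \<open>f x\<close>, hence at most the product; this
    controls the doublings.\<close>
  let ?s = "\<lambda>x b acc. acc + acc + (if b then g x else 0)"
  have v: "fold (?s x) (rev bs) 0 = val bs * g x" for x bs
    by (induction bs) (auto simp: algebra_simps)
  have g: "fp (\<lambda>z. g (fst z))" by (rule fp_comp[OF assms(2)]) (intro fp_intro)
  have "fp (\<lambda>x. fold (?s x) (rev (binary (f x))) 0)"
  proof (rule fp_fold[where B = "\<lambda>x. 4 * (esz (f x) + esz (g x)) + 1"])
    show "fp (\<lambda>z. ?s (fst z) (fst (snd z)) (snd (snd z)))"
      by (intro fp_intro g)
    fix x ys zs assume e: "rev (binary (f x)) = ys @ zs"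
    have eq: "binary (f x) = rev zs @ rev ys" using e by (metis rev_append rev_rev_ident)
    have "fold (?s x) ys 0 = val (rev ys) * g x" using v[of x "rev ys"] by simp
    also have "\<dots> \<le> f x * g x"
    proof (rule mult_le_mono1)
      have "val (binary (f x)) = val (rev zs) + 2 ^ length (rev zs) * val (rev ys)"
        unfolding eq val_append ..
      moreover have "1 * val (rev ys) \<le> 2 ^ length (rev zs) * val (rev ys)" by (rule mult_le_mono1) simp
      ultimately show "val (rev ys) \<le> f x" unfolding val_binary by linarith
    qed
    finally have L: "length (binary (fold (?s x) ys 0)) \<le> length (binary (f x)) + length (binary (g x))"
      by (intro le_trans[OF length_binary_mono length_binary_mult])
    have "esz r \<le> 4 * (esz (f x) + esz (g x)) + 1"
      if "length (binary r) \<le> length (binary (f x)) + length (binary (g x))" for r :: nat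
      proof -
      have "length (binary r) \<le> esz (f x) + esz (g x)"
        by (rule le_trans[OF that add_mono[OF length_binary_le_esz length_binary_le_esz]])
      then have "4 * length (binary r) + 1 \<le> 4 * (esz (f x) + esz (g x)) + 1" by simp
      with esz_nat_le[of r] show ?thesis by (rule le_trans)
    qed
    from this[OF L] show "esz (fold (?s x) ys 0) \<le> 4 * (esz (f x) + esz (g x)) + 1" .
  qed (intro fp_intro assms pb_intros)+
  then show ?thesis by (simp add: v)
qed

lemma fp_le[fp_intro]:
  assumes "fp f" "fp g" shows "fp (\<lambda>x. f x \<le> (g x :: nat))"
proof -
  let ?h = "\<lambda>r. if r = [] then False else hd r"
  \<comment> \<open>Comparison from the least significant bit: at every position where the bits
    differ, the flag is overwritten by the bit of \<open>g x\<close>, so the most significant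
    difference decides.\<close>
  let ?s = "\<lambda>(a::bool) (s::bool \<times> bool list). (if a \<longleftrightarrow> ?h (snd s) then fst s else ?h (snd s), tl (snd s))"
  let ?zs = "\<lambda>x. binary (f x) @ map (\<lambda>_. False) (binary (g x))"
  have bit: "(if v = w then (if a = h then l else h) else v < w) =
      (if of_bool a + 2 * v = of_bool h + 2 * w then l else of_bool a + 2 * v < of_bool h + 2 * w)" for v w :: nat and a h l
    by (cases a; cases h; simp; presburger)
  have i: "fst (fold ?s zs (l, r)) \<longleftrightarrow> (if val zs = val (take (length zs) r) then l else val zs < val (take (length zs) r))" for zs l r
  proof (induction zs arbitrary: l r)
    case (Cons a zs)
    have r: "val (take (length (a # zs)) r) = of_bool (?h r) + 2 * val (take (length zs) (tl r))"
      by (cases r) auto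
    have "fst (fold ?s (a # zs) (l, r)) = fst (fold ?s zs (if a \<longleftrightarrow> ?h r then l else ?h r, tl r))"
      by simp
    also have "\<dots> \<longleftrightarrow> (if val zs = val (take (length zs) (tl r)) then (if a \<longleftrightarrow> ?h r then l else ?h r)
        else val zs < val (take (length zs) (tl r)))" by (rule Cons.IH)
    also have "\<dots> \<longleftrightarrow> (if val (a # zs) = val (take (length (a # zs)) r) then l else val (a # zs) < val (take (length (a # zs)) r))"
      unfolding r val.simps(2) by (rule bit)
    finally show ?case .
  qed simp
  have "fp (\<lambda>x. fold ?s (?zs x) (True, binary (g x)))"
  proof (rule fp_fold_add[where K = "\<lambda>_. 20"])
    show "esz (?s a b) \<le> esz b + 20" for a b
    proof -
      have "esz (tl xs) \<le> esz xs" for xs :: "bool list" by (cases xs) auto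
      from this[of "snd b"] show ?thesis by (cases b) auto
    qed
    show "fp ?zs" by (rule fp_append[OF _ fp_comp[of "map (\<lambda>_. False)"]]) (intro fp_intro assms)+
  qed (intro fp_intro fp_null assms pb_intros)+
  note F = this
  have "fst (fold ?s (?zs x) (True, binary (g x))) \<longleftrightarrow> f x \<le> g x" for x
    unfolding i by (auto simp: val_append)
  with fp_fst[OF F] show ?thesis by (simp only:)
qed

lemma fp_less[fp_intro]: "fp f \<Longrightarrow> fp g \<Longrightarrow> fp (\<lambda>x. f x < (g x :: nat))"
  using fp_not[OF fp_le, of g f] by (simp add: not_le)

lemma fp_length[fp_intro]: "fp l \<Longrightarrow> fp (\<lambda>x. length (l x))"
proof -
  assume l: "fp l"
  have "fold (\<lambda>_ n. Suc n) xs n = length xs + n" for xs :: "'b list" and n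
    by (induction xs arbitrary: n) auto
  moreover have "fp (\<lambda>x. fold (\<lambda>_ n. Suc n) (l x) 0)"
  proof (rule fp_fold[where B = "\<lambda>x. 4 * esz (l x) + 1"])
    fix x ys zs assume "l x = ys @ zs"
    then have "length ys \<le> esz (l x)" using length_le_esz[of "l x"] by simp
    then show "esz (fold (\<lambda>_ n. Suc n) ys 0) \<le> 4 * esz (l x) + 1"
      using calculation[of ys 0] esz_nat_le[of "length ys"] length_binary_self[of "length ys"] by simp
  qed (intro fp_intro l pb_intros)+
  ultimately show ?thesis by simp
qed

lemma fp_sum_list[fp_intro]: "fp l \<Longrightarrow> fp (\<lambda>x. sum_list (l x) :: nat)"
proof -
  assume l: "fp l"
  have L: "length (binary (sum_list ys)) \<le> esz ys" for ys :: "nat list"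
  proof (induction ys)
    case (Cons a ys)
    then show ?case using length_binary_add[of a "sum_list ys"] length_binary_le_esz[of a] by simp
  qed simp
  have S: "fold (+) ys 0 = sum_list ys" for ys :: "nat list"
    by (simp add: fold_plus_sum_list_rev)
  have "fp (\<lambda>x. fold (+) (l x) 0)"
  proof (rule fp_fold[where B = "\<lambda>x. 4 * esz (l x) + 1"])
    fix x ys zs assume "l x = ys @ zs"
    then have "esz ys \<le> esz (l x)" using esz_append[of ys zs] esz_pos[of zs] by simp
    then show "esz (fold (+) ys 0) \<le> 4 * esz (l x) + 1"
      using L[of ys] esz_nat_le[of "sum_list ys"] unfolding S by linarith
  qed (intro fp_intro l pb_intros)+
  then show ?thesis by (simp add: S)
qed

lemma fp_index_list: "fp l \<Longrightarrow> fp (\<lambda>x. [0..<length (l x)])"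
proof -
  assume l: "fp l"
  have F: "fold (\<lambda>_ s. (Suc (fst s), fst s # snd s)) ys (0, []) = (length ys, rev [0..<length ys])" for ys :: "'b list"
    by (induction ys rule: rev_induct) auto
  have "fp (\<lambda>x. fold (\<lambda>_ s. (Suc (fst s), fst s # snd s)) (l x) (0, []))"
  proof (rule fp_fold[where B = "\<lambda>x. Suc (4 * esz (l x) + 1 + (esz (l x) * (4 * esz (l x) + 2) + 1))"])
    fix x ys zs assume "l x = ys @ zs"
    then have le: "length ys \<le> esz (l x)" using length_le_esz[of "l x"] by simp
    have n: "esz k \<le> 4 * esz (l x) + 1" if "k \<le> length ys" for k
      using that le esz_nat_le[of k] length_binary_self[of k] by linarith
    have "esz [0..<length ys] \<le> length [0..<length ys] * (4 * esz (l x) + 1 + 1) + 1"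
      by (rule esz_list_le, rule n) simp
    also have "\<dots> \<le> esz (l x) * (4 * esz (l x) + 2) + 1"
      unfolding length_upt minus_nat.diff_0 using mult_le_mono1[OF le, of "4 * esz (l x) + 2"] by simp
    finally show "esz (fold (\<lambda>_ s. (Suc (fst s), fst s # snd s)) ys (0, [])) \<le>
        Suc (4 * esz (l x) + 1 + (esz (l x) * (4 * esz (l x) + 2) + 1))"
      unfolding F using n[of "length ys"] by (simp add: esz_rev)
  qed (intro fp_intro l pb_intros)+
  from fp_rev[OF fp_snd[OF this]] show ?thesis by (simp add: F)
qed

text \<open>A clock: numbers are binary, so iteration can only be driven by a list, and this
  provides lists of any prescribed polynomial length.\<close>

lemma fp_long_list: "\<exists>u :: 'a::enc \<Rightarrow> unit list. fp u \<and> (\<forall>x. length (u x) = poly p (esz x))"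
proof (induction p)
  case 0
  show ?case by (rule exI[of _ "\<lambda>_. []"]) (simp add: fp_const)
next
  case (pCons a p)
  then obtain u :: "'a \<Rightarrow> unit list" where u: "fp u" "\<And>x. length (u x) = poly p (esz x)" by blast
  have "fp (\<lambda>z. u (fst z))" by (rule fp_comp[OF u(1)]) (intro fp_intro)
  then have "fp (\<lambda>x. replicate a () @ concat (map (\<lambda>_. u x) (bits x)))"
    by (intro fp_intro)
  moreover have "length (replicate a () @ concat (map (\<lambda>_. u x) (bits x))) = poly (pCons a p) (esz x)" for x
    by (simp add: length_concat u(2) map_replicate_const length_bits sum_list_replicate o_def)
  ultimately show ?case by blast
qed

text \<open>A number may be exponential in its size; \<open>pb f\<close> ensures that the range has
  polynomial length, and the clock then contains all of its members.\<close>

lemma fp_upt: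
  assumes f: "fp f" and b: "pb f"
  shows "fp (\<lambda>x. [0..<f x])"
proof -
  obtain p where p: "\<And>x. f x \<le> poly p (esz x)" using b unfolding pb_def by blast
  obtain u :: "'a \<Rightarrow> unit list" where u: "fp u" "\<And>x. length (u x) = poly p (esz x)" using fp_long_list by blast
  have "fp (\<lambda>z. f (fst z))" by (rule fp_comp[OF f]) (intro fp_intro)
  then have "fp (\<lambda>x. filter (\<lambda>i. i < f x) [0..<length (u x)])"
    by (intro fp_intro fp_index_list u)
  moreover have "filter (\<lambda>i. i < m) [0..<n] = [0..<m]" if "m \<le> n" for m n :: nat
    using that by (induction n) (auto simp: le_Suc_eq)
  ultimately show ?thesis using p u(2) by simp
qed

text \<open>Lookup with a specified value out of range, so that a traversal of the list computes it
  for every index.\<close>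

definition nth_default :: "'a \<Rightarrow> 'a list \<Rightarrow> nat \<Rightarrow> 'a" where
  "nth_default d l i = (if i < length l then l ! i else d)"

lemma fp_nth_default[fp_intro]:
  assumes "fp d" "fp l" "fp i"
  shows "fp (\<lambda>x. nth_default (d x) (l x) (i x))"
proof -
  let ?s = "\<lambda>x a s. (Suc (fst s), if fst s = i x then a else snd s)"
  have F: "fold (?s x) ys (0, d x) = (length ys, nth_default (d x) ys (i x))" for x ys
    by (induction ys rule: rev_induct) (auto simp: nth_default_def nth_append)
  have i: "fp (\<lambda>z. i (fst z))" by (rule fp_comp[OF assms(3)]) (intro fp_intro)
  have "fp (\<lambda>x. fold (?s x) (l x) (0, d x))"
  proof (rule fp_fold[where B = "\<lambda>x. Suc (4 * esz (l x) + 1 + (esz (l x) + esz (d x)))"])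
    fix x ys zs assume e: "l x = ys @ zs"
    then have "length ys \<le> esz (l x)" using length_le_esz[of "l x"] by simp
    then have 1: "esz (length ys) \<le> 4 * esz (l x) + 1"
      using esz_nat_le[of "length ys"] length_binary_self[of "length ys"] by linarith
    have "esz (nth_default (d x) ys (i x)) \<le> esz (l x) + esz (d x)"
      using e by (auto simp: nth_default_def intro!: trans_le_add1 esz_mem)
    then show "esz (fold (?s x) ys (0, d x)) \<le> Suc (4 * esz (l x) + 1 + (esz (l x) + esz (d x)))"
      unfolding F using 1 by simp
  qed (intro fp_intro assms i pb_intros)+
  from fp_snd[OF this] show ?thesis unfolding F by simp
qed

section \<open>From tree functions to Turing machines\<close>

text \<open>The counterpart of \<open>runs\<close> for programs that read the input or write the
  output: contents and head of tape 0 are tracked exactly.\<close>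

definition runs_io :: "com \<Rightarrow> tape \<times> int \<Rightarrow> (nat \<Rightarrow> bool list) \<Rightarrow> nat \<Rightarrow> tape \<times> int \<Rightarrow> (nat \<Rightarrow> bool list) \<Rightarrow> bool" where
  "runs_io c th \<rho> T th' \<rho>' \<longleftrightarrow> (\<forall>s. s 0 = th \<and> (\<forall>r\<ge>1. stk (s r) (\<rho> r)) \<longrightarrow>
     (\<exists>t s'. t \<le> T \<and> exec c s t s' \<and> (\<forall>r\<ge>1. stk (s' r) (\<rho>' r)) \<and> s' 0 = th'))"

lemma runs_io: "runs c \<rho> T \<rho>' \<Longrightarrow> runs_io c th \<rho> T th \<rho>'"
  unfolding runs_def runs_io_def by metis

lemma runs_io_mono: "runs_io c th \<rho> T th' \<rho>' \<Longrightarrow> T \<le> T' \<Longrightarrow> runs_io c th \<rho> T' th' \<rho>'"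
  unfolding runs_io_def
proof (intro allI impI)
  fix s assume "\<forall>s. s 0 = th \<and> (\<forall>r\<ge>1. stk (s r) (\<rho> r)) \<longrightarrow>
     (\<exists>t s'. t \<le> T \<and> exec c s t s' \<and> (\<forall>r\<ge>1. stk (s' r) (\<rho>' r)) \<and> s' 0 = th')"
    and "T \<le> T'" and "s 0 = th \<and> (\<forall>r\<ge>1. stk (s r) (\<rho> r))"
  then obtain t s' where "t \<le> T" "exec c s t s' \<and> (\<forall>r\<ge>1. stk (s' r) (\<rho>' r)) \<and> s' 0 = th'" by blast
  then show "\<exists>t s'. t \<le> T' \<and> exec c s t s' \<and> (\<forall>r\<ge>1. stk (s' r) (\<rho>' r)) \<and> s' 0 = th'"
    using \<open>T \<le> T'\<close> by (intro exI[of _ t] exI[of _ s']) simp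
qed

lemma runs_io_Seq:
  assumes "runs_io c th \<rho> m th1 \<rho>1" "runs_io c' th1 \<rho>1 n th2 \<rho>2"
  shows "runs_io (Seq c c') th \<rho> (Suc (m + n)) th2 \<rho>2"
  unfolding runs_io_def
proof (intro allI impI)
  fix s assume s: "s 0 = th \<and> (\<forall>r\<ge>1. stk (s r) (\<rho> r))"
  obtain t1 s1 where a: "t1 \<le> m" "exec c s t1 s1" "(\<forall>r\<ge>1. stk (s1 r) (\<rho>1 r)) \<and> s1 0 = th1"
    using assms(1) s unfolding runs_io_def by blast
  obtain t2 s2 where b: "t2 \<le> n" "exec c' s1 t2 s2" "(\<forall>r\<ge>1. stk (s2 r) (\<rho>2 r)) \<and> s2 0 = th2"
    using assms(2) a unfolding runs_io_def by blast
  show "\<exists>t s'. t \<le> Suc (m + n) \<and> exec (Seq c c') s t s' \<and> (\<forall>r\<ge>1. stk (s' r) (\<rho>2 r)) \<and> s' 0 = th2"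
    using a b exec_Seq[OF a(2) b(2)] by (intro exI[of _ "Suc (t1 + t2)"] exI[of _ s2]) simp
qed

lemma runs_io_Act:
  "runs_io (Act 0 a d) (t, h) \<rho> 1 ((case a of None \<Rightarrow> t | Some b \<Rightarrow> t(h := b)), h + offset d) \<rho>"
  unfolding runs_io_def
proof (intro allI impI)
  fix s :: store assume s: "s 0 = (t, h) \<and> (\<forall>r\<ge>1. stk (s r) (\<rho> r))"
  show "\<exists>ta s'. ta \<le> 1 \<and> exec (Act 0 a d) s ta s' \<and> (\<forall>r\<ge>1. stk (s' r) (\<rho> r)) \<and>
      s' 0 = ((case a of None \<Rightarrow> t | Some b \<Rightarrow> t(h := b)), h + offset d)"
    using s by (intro exI[of _ 1] exI[of _ "act 0 a d s"] conjI exec_Act) (auto simp: act_def split: option.split)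
qed

lemma runs_io_If:
  assumes "runs_io (if (if r = 0 then t h else tape_of (\<rho> r) 0) \<in> A then c else c') (t, h) \<rho> m th' \<rho>'"
  shows "runs_io (If r A c c') (t, h) \<rho> (Suc m) th' \<rho>'"
  unfolding runs_io_def
proof (intro allI impI)
  fix s assume s: "s 0 = (t, h) \<and> (\<forall>r\<ge>1. stk (s r) (\<rho> r))"
  then have "scan s r = (if r = 0 then t h else tape_of (\<rho> r) 0)"
    using scan_stk[of s r "\<rho> r"] by (cases r) (auto simp: scan_def)
  moreover obtain ta s' where "ta \<le> m" "exec (if (if r = 0 then t h else tape_of (\<rho> r) 0) \<in> A then c else c') s ta s'"
    "(\<forall>r\<ge>1. stk (s' r) (\<rho>' r)) \<and> s' 0 = th'"
    using assms s unfolding runs_io_def by blast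
  ultimately show "\<exists>ta s'. ta \<le> Suc m \<and> exec (If r A c c') s ta s' \<and> (\<forall>r\<ge>1. stk (s' r) (\<rho>' r)) \<and> s' 0 = th'"
    using exec_If[of s r A c c' ta s'] by (intro exI[of _ "Suc ta"] exI[of _ s']) simp
qed

lemma runs_io_If_top:
  assumes "1 \<le> r" "\<rho> r = b # w" "runs_io (if b then c else c') (t, h) \<rho> m th' \<rho>'"
  shows "runs_io (If r {2} c c') (t, h) \<rho> (Suc m) th' \<rho>'"
  by (rule runs_io_If) (use assms top_in[of b w] in auto)

lemma runs_io_While_False:
  assumes "(if r = 0 then t h else tape_of (\<rho> r) 0) \<notin> A"
  shows "runs_io (While r A c) (t, h) \<rho> 1 (t, h) \<rho>"
  unfolding runs_io_def
proof (intro allI impI)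
  fix s assume s: "s 0 = (t, h) \<and> (\<forall>r\<ge>1. stk (s r) (\<rho> r))"
  then have "scan s r = (if r = 0 then t h else tape_of (\<rho> r) 0)"
    using scan_stk[of s r "\<rho> r"] by (cases r) (auto simp: scan_def)
  then have "exec (While r A c) s 1 s" using assms by (intro exec_While_False) simp
  then show "\<exists>ta s'. ta \<le> 1 \<and> exec (While r A c) s ta s' \<and> (\<forall>r\<ge>1. stk (s' r) (\<rho> r)) \<and> s' 0 = (t, h)"
    using s by (intro exI[of _ 1] exI[of _ s]) simp
qed

lemma runs_io_While_True:
  assumes "(if r = 0 then t h else tape_of (\<rho> r) 0) \<in> A"
    "runs_io c (t, h) \<rho> m th1 \<rho>1" "runs_io (While r A c) th1 \<rho>1 n th2 \<rho>2"
  shows "runs_io (While r A c) (t, h) \<rho> (Suc (m + n)) th2 \<rho>2"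
  unfolding runs_io_def
proof (intro allI impI)
  fix s assume s: "s 0 = (t, h) \<and> (\<forall>r\<ge>1. stk (s r) (\<rho> r))"
  obtain t1 s1 where a: "t1 \<le> m" "exec c s t1 s1" "(\<forall>r\<ge>1. stk (s1 r) (\<rho>1 r)) \<and> s1 0 = th1"
    using assms(2) s unfolding runs_io_def by blast
  obtain t2 s2 where b: "t2 \<le> n" "exec (While r A c) s1 t2 s2" "(\<forall>r\<ge>1. stk (s2 r) (\<rho>2 r)) \<and> s2 0 = th2"
    using assms(3) a unfolding runs_io_def by blast
  have "scan s r = (if r = 0 then t h else tape_of (\<rho> r) 0)"
    using s scan_stk[of s r "\<rho> r"] by (cases r) (auto simp: scan_def)
  then show "\<exists>t s'. t \<le> Suc (m + n) \<and> exec (While r A c) s t s' \<and> (\<forall>r\<ge>1. stk (s' r) (\<rho>2 r)) \<and> s' 0 = th2"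
    using a b exec_While_True[OF _ a(2) b(2)] assms(1) by (intro exI[of _ "Suc (t1 + t2)"] exI[of _ s2]) simp
qed

definition read_loop :: com where
  "read_loop = While 0 {1, 2} (Seq (If 0 {2} (push 1 True) (push 1 False)) (Seq (push 2 True) (Act 0 (Some 0) Right)))"

lemma runs_read_loop:
  "runs_io read_loop (\<lambda>j. tape_of xs (j - h), h) \<rho> (12 * length xs + 1) (\<lambda>_. 0, h + int (length xs))
    (\<rho>(1 := rev xs @ \<rho> 1, 2 := replicate (length xs) True @ \<rho> 2))"
proof (induction xs arbitrary: h \<rho>)
  case Nil
  have e: "\<rho>(1 := rev [] @ \<rho> 1, 2 := replicate (length []) True @ \<rho> 2) = \<rho>" by (simp add: fun_eq_iff)
  show ?case
    unfolding e unfolding read_loop_def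
    using runs_io_While_False[of 0 "\<lambda>_. 0" h \<rho> "{1, 2}"] by (simp add: tape_of_Nil)
next
  case (Cons b xs)
  let ?t = "\<lambda>j. tape_of (b # xs) (j - h)"
  let ?r1 = "\<rho>(1 := b # \<rho> 1)" let ?r2 = "?r1(2 := True # ?r1 2)"
  have top: "?t h = bsym b" by (simp add: tape_of_Cons)
  have 1: "runs_io (If 0 {2} (push 1 True) (push 1 False)) (?t, h) \<rho> (Suc 3) (?t, h) ?r1"
  proof (rule runs_io_If)
    show "runs_io (if (if 0 = 0 then ?t h else tape_of (\<rho> 0) 0) \<in> {2} then push 1 True else push 1 False) (?t, h) \<rho> 3 (?t, h) ?r1"
      unfolding top using runs_io[OF runs_push[of 1 b \<rho>], of "(?t, h)"] by (cases b) (simp_all add: bsym_def)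
  qed
  have 2: "runs_io (push 2 True) (?t, h) ?r1 3 (?t, h) ?r2"
    by (rule runs_io[OF runs_push]) simp
  have t': "?t(h := 0) = (\<lambda>j. tape_of xs (j - (h + 1)))"
    by (auto simp: fun_eq_iff tape_of_Cons tape_of_neg algebra_simps)
  have 3: "runs_io (Act 0 (Some 0) Right) (?t, h) ?r2 1 (\<lambda>j. tape_of xs (j - (h + 1)), h + 1) ?r2"
    using runs_io_Act[of "Some 0" Right ?t h ?r2] by (simp add: t')
  let ?r3 = "?r2(1 := rev xs @ ?r2 1, 2 := replicate (length xs) True @ ?r2 2)"
  have e: "?r3 = \<rho>(1 := rev (b # xs) @ \<rho> 1, 2 := replicate (length (b # xs)) True @ \<rho> 2)"
    by (auto simp: fun_eq_iff replicate_app_Cons_same)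
  have h: "h + 1 + int (length xs) = h + int (length (b # xs))" by simp
  have 4: "runs_io read_loop (\<lambda>j. tape_of xs (j - (h + 1)), h + 1) ?r2 (12 * length xs + 1) (\<lambda>_. 0, h + int (length (b # xs))) ?r3"
    using Cons[of "h + 1" ?r2] unfolding h .
  have "?t h \<in> {1, 2}" unfolding top by (simp add: bsym_def)
  then have "runs_io read_loop (?t, h) \<rho> (Suc (Suc (Suc 3 + Suc (3 + 1)) + (12 * length xs + 1)))
      (\<lambda>_. 0, h + int (length (b # xs))) ?r3"
    unfolding read_loop_def
    by (intro runs_io_While_True[OF _ runs_io_Seq[OF 1 runs_io_Seq[OF 2 3]] 4[unfolded read_loop_def]]) (simp only: refl if_True)
  then show ?case unfolding e by (rule runs_io_mono) simp
qed

text \<open>Besides coding the bits, the loop brings the head of tape 0 back to where the input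
  began, since the output has to start in the same cell.\<close>

definition back_loop :: com where
  "back_loop = While 2 {2} (Seq (pop 2) (Seq (Act 0 None Left) (If 1 {2}
     (Seq (pop 1) (pushes [(4, False), (4, False), (4, True), (4, True)])) (Seq (pop 1) (pushes [(4, False), (4, True)])))))"

lemma code_enc_Cons: "code (enc (b # ys)) = (if b then [True, True, False, False] else [True, False]) @ code (enc ys)"
  for ys :: "bool list"
  by (simp add: enc_bool_def)

lemma runs_back_loop:
  assumes "\<rho> 1 = rev xs @ v" "\<rho> 2 = replicate (length xs) True" "\<rho> 4 = code (enc ys)"
  shows "runs_io back_loop (\<lambda>_. 0, h + int (length xs)) \<rho> (30 * length xs + 1) (\<lambda>_. 0, h)
    (\<rho>(1 := v, 2 := [], 4 := code (enc (xs @ ys))))"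
  using assms
proof (induction xs arbitrary: \<rho> ys rule: rev_induct)
  case Nil
  have e: "\<rho>(1 := v, 2 := [], 4 := code (enc ([] @ ys))) = \<rho>" using Nil by (auto simp: fun_eq_iff)
  show ?case
    unfolding e unfolding back_loop_def
    using runs_io_While_False[of 2 "\<lambda>_. 0" h \<rho> "{2}"] Nil by (simp add: tape_of_Nil)
next
  case (snoc b xs)
  let ?z = "\<lambda>_::int. 0::nat" let ?h = "h + int (length (xs @ [b]))"
  let ?r1 = "\<rho>(2 := replicate (length xs) True)" let ?r2 = "?r1(1 := rev xs @ v)"
  let ?r3 = "?r2(4 := code (enc (b # ys)))"
  let ?e = "if b then [(4, False), (4, False), (4, True), (4, True)] else [(4::nat, False), (4, True)]"
  have 1: "runs_io (pop 2) (?z, ?h) \<rho> 1 (?z, ?h) ?r1"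
    by (rule runs_io[OF runs_pop[of _ _ True]]) (use snoc.prems in auto)
  have 2: "runs_io (Act 0 None Left) (?z, ?h) ?r1 1 (?z, h + int (length xs)) ?r1"
    using runs_io_Act[of None Left ?z ?h ?r1] by simp
  have 3: "runs (pop 1) ?r1 1 ?r2"
    by (rule runs_pop[of _ _ b]) (use snoc.prems in auto)
  have e: "(\<lambda>r. rev (map snd (filter (\<lambda>x. fst x = r) ?e)) @ ?r2 r) = ?r3"
    using snoc.prems by (auto simp: fun_eq_iff code_enc_Cons simp del: enc_Cons)
  have 4: "runs (pushes ?e) ?r2 17 ?r3"
    using runs_pushes[of ?e ?r2] unfolding e by (rule runs_mono) auto
  have "runs (If 1 {2} (Seq (pop 1) (pushes [(4, False), (4, False), (4, True), (4, True)])) (Seq (pop 1) (pushes [(4, False), (4, True)])))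
      ?r1 (Suc (Suc (1 + 17))) ?r3"
    by (rule runs_If_top[of 1 _ b "rev xs @ v"]) (use snoc.prems runs_Seq[OF 3 4] in auto)
  note 5 = runs_io_Seq[OF 1 runs_io_Seq[OF 2 runs_io[OF this]]]
  have "runs_io back_loop (?z, h + int (length xs)) ?r3 (30 * length xs + 1) (?z, h)
      (?r3(1 := v, 2 := [], 4 := code (enc (xs @ b # ys))))"
    by (rule snoc.IH) auto
  also have "?r3(1 := v, 2 := [], 4 := code (enc (xs @ b # ys))) = \<rho>(1 := v, 2 := [], 4 := code (enc ((xs @ [b]) @ ys)))"
    by (auto simp: fun_eq_iff)
  finally have 6: "runs_io back_loop (?z, h + int (length xs)) ?r3 (30 * length xs + 1) (?z, h)
      (\<rho>(1 := v, 2 := [], 4 := code (enc ((xs @ [b]) @ ys))))" .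
  have "runs_io back_loop (?z, ?h) \<rho> (Suc (Suc (1 + Suc (1 + (Suc (Suc (1 + 17))))) + (30 * length xs + 1))) (?z, h)
      (\<rho>(1 := v, 2 := [], 4 := code (enc ((xs @ [b]) @ ys))))"
    unfolding back_loop_def
    by (rule runs_io_While_True[OF _ 5 6[unfolded back_loop_def]]) (use snoc.prems in \<open>simp add: tape_of_Cons bsym_def\<close>)
  then show ?case by (rule runs_io_mono) simp
qed

definition write_loop :: com where
  "write_loop = While 4 {2} (Seq (pop 4) (If 4 {2}
     (Seq (pop 4) (Seq (pop 4) (Seq (pop 4) (Act 0 (Some 2) Right)))) (Seq (pop 4) (Act 0 (Some 1) Right))))"

lemma tape_of_snoc: "(tape_of zs)(int (length zs) := bsym b) = tape_of (zs @ [b])"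
  by (auto simp: fun_eq_iff tape_of_def bsym_def nth_append)

lemma runs_write_loop:
  assumes "\<rho> 4 = code (enc ys) @ w"
  shows "runs_io write_loop (tape_of zs, int (length zs)) \<rho> (15 * length ys + 1)
    (tape_of (zs @ ys), int (length (zs @ ys))) (\<rho>(4 := False # w))"
  using assms
proof (induction ys arbitrary: \<rho> zs)
  case Nil
  have e: "\<rho>(4 := False # w) = \<rho>" using Nil by (auto simp: fun_eq_iff)
  show ?case
    unfolding e unfolding write_loop_def
    using runs_io_While_False[of 4 "tape_of zs" "int (length zs)" \<rho> "{2}"] Nil by (simp add: tape_of_Cons bsym_def)
next
  case (Cons b ys)
  let ?h = "int (length zs)" let ?t = "tape_of zs"
  let ?r1 = "\<rho>(4 := code (enc b) @ code (enc ys) @ w)" let ?r4 = "\<rho>(4 := code (enc ys) @ w)"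
  have 1: "runs_io (pop 4) (?t, ?h) \<rho> 1 (?t, ?h) ?r1"
    by (rule runs_io[OF runs_pop[of _ _ True]]) (use Cons.prems in auto)
  have 2: "runs_io (Act 0 (Some (bsym b)) Right) (?t, ?h) ?r4 1 (tape_of (zs @ [b]), int (length (zs @ [b]))) ?r4"
    using runs_io_Act[of "Some (bsym b)" Right ?t ?h ?r4] by (simp add: tape_of_snoc add.commute)
  have 3: "runs_io (If 4 {2} (Seq (pop 4) (Seq (pop 4) (Seq (pop 4) (Act 0 (Some 2) Right)))) (Seq (pop 4) (Act 0 (Some 1) Right)))
      (?t, ?h) ?r1 (Suc 7) (tape_of (zs @ [b]), int (length (zs @ [b]))) ?r4"
  proof (cases b)
    case True
    let ?r2 = "?r1(4 := False # False # code (enc ys) @ w)" let ?r3 = "?r2(4 := False # code (enc ys) @ w)"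
    have a: "runs (pop 4) ?r1 1 ?r2" by (rule runs_pop[of _ _ True]) (use True in \<open>auto simp: enc_bool_def\<close>)
    have b: "runs (pop 4) ?r2 1 ?r3" by (rule runs_pop[of _ _ False]) auto
    have c: "runs (pop 4) ?r3 1 (?r3(4 := code (enc ys) @ w))" by (rule runs_pop[of _ _ False]) auto
    have e: "?r3(4 := code (enc ys) @ w) = ?r4" by (auto simp: fun_eq_iff)
    note R = runs_io_Seq[OF runs_io[OF a] runs_io_Seq[OF runs_io[OF b] runs_io_Seq[OF runs_io[OF c[unfolded e]] 2]]]
    show ?thesis
      by (rule runs_io_mono[OF runs_io_If_top[of 4 _ True "False # False # code (enc ys) @ w"]], simp, use True in \<open>simp add: enc_bool_def\<close>)
        (simp only: if_True, rule R[unfolded bsym_def if_P[OF True]], simp)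
  next
    case False
    have a: "runs (pop 4) ?r1 1 (?r1(4 := code (enc ys) @ w))" by (rule runs_pop[of _ _ False]) (use False in \<open>auto simp: enc_bool_def\<close>)
    have e: "?r1(4 := code (enc ys) @ w) = ?r4" by (auto simp: fun_eq_iff)
    note R = runs_io_Seq[OF runs_io[OF a[unfolded e]] 2]
    show ?thesis
      by (rule runs_io_mono[OF runs_io_If_top[of 4 _ False "code (enc ys) @ w"]], simp, use False in \<open>simp add: enc_bool_def\<close>)
        (simp only: if_False, rule R[unfolded bsym_def if_not_P[OF False]], simp)
  qed
  have "runs_io write_loop (tape_of (zs @ [b]), int (length (zs @ [b]))) ?r4 (15 * length ys + 1)
    (tape_of ((zs @ [b]) @ ys), int (length ((zs @ [b]) @ ys))) (?r4(4 := False # w))"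
    by (rule Cons.IH) simp
  then have 4: "runs_io write_loop (tape_of (zs @ [b]), int (length (zs @ [b]))) ?r4 (15 * length ys + 1)
    (tape_of (zs @ b # ys), int (length (zs @ b # ys))) (\<rho>(4 := False # w))"
    by simp
  have "runs_io write_loop (?t, ?h) \<rho> (Suc (Suc (1 + Suc 7) + (15 * length ys + 1)))
     (tape_of (zs @ b # ys), int (length (zs @ b # ys))) (\<rho>(4 := False # w))"
    unfolding write_loop_def
    by (rule runs_io_While_True[OF _ runs_io_Seq[OF 1 3] 4[unfolded write_loop_def]])
      (use Cons.prems in \<open>simp add: tape_of_Cons bsym_def\<close>)
  then show ?case by (rule runs_io_mono) simp
qed

theorem polytime_computable_if_fp:
  assumes "fp f" shows "polytime_computable f"
proof -
  obtain c p where c: "wf_com 7 c" "\<And>t. tsize (enc (f (dec t))) \<le> poly p (tsize t)"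
    "\<And>t w \<rho>. \<rho> 4 = code t @ w \<Longrightarrow> runs c \<rho> (poly p (tsize t)) (\<rho>(4 := code (enc (f (dec t))) @ w))"
    using PT_E[OF assms[unfolded fp_def]] by metis
  let ?c = "Seq read_loop (Seq (push 4 False) (Seq back_loop (Seq c write_loop)))"
  \<comment> \<open>\<open>4 * n + 1\<close> bounds the size of the code of \<open>n\<close> bits;
    the length of the output is at most the size of its code, hence the second use of
    \<open>p\<close>.\<close>
  let ?T = "\<lambda>n. 42 * n + 20 + poly p (4 * n + 1) + 15 * poly p (4 * n + 1)"
  have "polyb ?T" by (intro polyb_intros)
  then obtain q :: "nat poly" where q: "\<And>n. ?T n \<le> poly q n" unfolding polyb_def by blast
  show ?thesis
  proof (rule polytime_computable_if_exec[where k = 7 and c = ?c and p = q])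
    show "wf_com 7 ?c" using c(1) by (simp add: read_loop_def back_loop_def write_loop_def)
    fix x
    let ?s = "\<lambda>r::nat. if r = 0 then (tape_of x, 0::int) else (tape_of [], 0)"
    let ?r0 = "\<lambda>_::nat. [] :: bool list" let ?n = "length x"
    let ?r1 = "?r0(1 := rev x @ ?r0 1, 2 := replicate ?n True @ ?r0 2)"
    let ?r2 = "?r1(4 := False # ?r1 4)"
    let ?r3 = "?r2(1 := [], 2 := [], 4 := code (enc (x @ [])))"
    let ?r4 = "?r3(4 := code (enc (f (dec (enc x)))) @ [])"
    have 1: "runs_io read_loop (tape_of x, 0) ?r0 (12 * ?n + 1) (\<lambda>_. 0, int ?n) ?r1"
      using runs_read_loop[of x 0 ?r0] by simp
    have 2: "runs_io (push 4 False) (\<lambda>_. 0, int ?n) ?r1 3 (\<lambda>_. 0, int ?n) ?r2"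
      by (rule runs_io[OF runs_push]) simp
    have 3: "runs_io back_loop (\<lambda>_. 0, int ?n) ?r2 (30 * ?n + 1) (\<lambda>_. 0, 0) ?r3"
      using runs_back_loop[of ?r2 x "[]" "[]" 0] by simp
    have 4: "runs c ?r3 (poly p (tsize (enc x))) ?r4" by (rule c(3)) simp
    have 5: "runs_io write_loop (tape_of [], int (length ([] :: bool list))) ?r4 (15 * length (f x) + 1)
        (tape_of ([] @ f x), int (length ([] @ f x))) (?r4(4 := False # []))"
      by (rule runs_write_loop[of ?r4 "f x" "[]" "[]"]) simp
    have z: "(\<lambda>_. 0, 0) = (tape_of [], int (length ([] :: bool list)))" by (simp add: tape_of_def fun_eq_iff)
    note R = runs_io_Seq[OF 1 runs_io_Seq[OF 2 runs_io_Seq[OF 3[unfolded z] runs_io_Seq[OF runs_io[OF 4] 5]]]]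
    have s0: "?s 0 = (tape_of x, 0) \<and> (\<forall>r\<ge>1. stk (?s r) (?r0 r))" by (simp add: stk_def tape_of_Nil)
    obtain t s' where t: "t \<le> Suc (12 * ?n + 1 + Suc (3 + Suc (30 * ?n + 1 + Suc (poly p (tsize (enc x)) + (15 * length (f x) + 1)))))"
      "exec ?c ?s t s'" "s' 0 = (tape_of ([] @ f x), int (length ([] @ f x)))"
      using mp[OF spec[OF R[unfolded runs_io_def], of ?s] s0] by (elim exE conjE) simp
    have a: "poly p (tsize (enc x)) \<le> poly p (4 * ?n + 1)"
      using esz_bool_list(2)[of x] by (intro poly_nat_mono) (simp add: esz_def)
    have b: "length (f x) \<le> poly p (tsize (enc x))"
      using c(2)[of "enc x"] length_le_esz[of "f x"] by (simp add: esz_def)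
    have "t \<le> ?T ?n" using t(1) a b by linarith
    then have "t \<le> poly q ?n" using q[of ?n] by (rule le_trans)
    then show "\<exists>t s'. t \<le> poly q ?n \<and> exec ?c ?s t s' \<and> fst (s' 0) = tape_of (f x)"
      using t(2,3) by (intro exI[of _ t] exI[of _ s'] conjI) simp_all
  qed simp
qed


section \<open>Membership in NP\<close>

text \<open>An automaton with two flags: whether the delimiter has been passed, and whether the next
  bit belongs to the first string. Both strings are collected in reverse order.\<close>

definition undelimit :: "bool list \<Rightarrow> (bool \<times> bool) \<times> bool list \<times> bool list" where
  "undelimit z = fold (\<lambda>b s.
     if fst (fst s) then (fst s, fst (snd s), b # snd (snd s))
     else if snd (fst s) then ((False, False), b # fst (snd s), snd (snd s))
     else if b then ((False, True), snd s) else ((True, False), snd s)) z ((False, False), [], [])"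

lemma undelimit: "undelimit (delimit x @ u) = ((True, False), rev x, rev u)"
proof -
  let ?s = "\<lambda>b s. if fst (fst s) then (fst s, fst (snd s), b # snd (snd s))
     else if snd (fst s) then ((False, False), b # fst (snd s), snd (snd s))
     else if b then ((False, True), snd s) else ((True, False), snd s)"
  have 1: "fold ?s (concat (map (\<lambda>b. [True, b]) x)) ((False, False), xs, us) = ((False, False), rev x @ xs, us)" for xs us
    by (induction x arbitrary: xs) auto
  have 2: "fold ?s u ((True, False), xs, us) = ((True, False), xs, rev u @ us)" for xs us
    by (induction u arbitrary: us) auto
  show ?thesis unfolding undelimit_def delimit_def by (simp add: 1 2)
qed

lemma fp_undelimit: "fp undelimit"
  unfolding undelimit_def
proof (rule fp_fold_add[where K = "\<lambda>_. 20"])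
  show "esz (if fst (fst s) then (fst s, fst (snd s), b # snd (snd s))
     else if snd (fst s) then ((False, False), b # fst (snd s), snd (snd s))
     else if b then ((False, True), snd s) else ((True, False), snd s)) \<le> esz s + 20"
    for b and s :: "(bool \<times> bool) \<times> bool list \<times> bool list"
    by (cases s) auto
qed (intro fp_intro pb_intros)+

text \<open>Preorder notation is read from right to left: \<open>False\<close> pushes a leaf, and
  \<open>True\<close> joins the two topmost trees, the left subtree being on top. Malformed input is
  tolerated, as any result will do there.\<close>

definition parse_step :: "bool \<Rightarrow> tree list \<Rightarrow> tree list" where
  "parse_step b s = (if b then (case s of [] \<Rightarrow> [] | t # s' \<Rightarrow> (case s' of [] \<Rightarrow> [] | u # s'' \<Rightarrow> Node t u # s'')) else Leaf # s)"

definition parse_tree :: "bool list \<Rightarrow> tree" where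
  "parse_tree xs = hd (fold parse_step xs [] @ [Leaf])"

lemma parse_tree: "parse_tree (rev (code t)) = t"
proof -
  have "fold parse_step (rev (code t)) s = t # s" for s
    by (induction t arbitrary: s) (simp_all add: parse_step_def)
  then show ?thesis by (simp add: parse_tree_def)
qed

lemma fp_Node[fp_intro]: "fp f \<Longrightarrow> fp g \<Longrightarrow> fp (\<lambda>x. Node (f x) (g x))"
  unfolding fp_def enc_tree_def by (rule PT_pair)

lemma fp_parse_tree: "fp parse_tree"
  unfolding parse_tree_def
proof (intro fp_intro fp_fold_add[where K = "\<lambda>_. 10"])
  show "fp (\<lambda>z. parse_step (fst (snd z)) (snd (snd z)))" unfolding parse_step_def by (intro fp_intro)
  show "esz (parse_step a b) \<le> esz b + 10" for a b
    by (auto simp: parse_step_def esz_def enc_tree_def split: list.split)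
qed (intro pb_intros)

lemma fp_dec: "fp (dec :: tree \<Rightarrow> 'a::enc)"
  by (rule fpI[OF PT_norm[where 'a = 'a]]) (simp add: enc_tree_def)

text \<open>Certificates of any encoded type replace strings. Every string decodes to some
  certificate, and soundness holds for all of them; completeness uses the code of a certificate of
  polynomial size.\<close>

theorem class_NP_I:
  fixes V :: "bool list \<times> 'c::enc \<Rightarrow> bool"
  assumes V: "fp V" and sound: "\<And>x c. V (x, c) \<Longrightarrow> x \<in> A"
    and complete: "\<And>x. x \<in> A \<Longrightarrow> \<exists>c. esz c \<le> poly p (length x) \<and> V (x, c)"
  shows "A \<in> class_NP"
proof -
  let ?D = "\<lambda>z. V (rev (fst (snd (undelimit z))), dec (parse_tree (snd (snd (undelimit z)))))"
  have "fp (\<lambda>z. parse_tree (snd (snd (undelimit z))))"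
    by (rule fp_comp[OF fp_parse_tree]) (intro fp_intro fp_undelimit)
  then have "fp (\<lambda>z. dec (parse_tree (snd (snd (undelimit z)))) :: 'c)"
    by (rule fp_comp[OF fp_dec])
  then have "fp ?D" by (intro fp_comp[OF V] fp_intro fp_undelimit)
  then have "fp (\<lambda>z. [?D z])" by (intro fp_intro)
  then have P: "{z. ?D z} \<in> class_P" unfolding class_P_def using polytime_computable_if_fp by simp
  have D: "?D (delimit x @ u) \<longleftrightarrow> V (x, dec (parse_tree (rev u)))" for x u by (simp add: undelimit)
  have "x \<in> A \<longleftrightarrow> (\<exists>u. length u \<le> poly p (length x) \<and> delimit x @ u \<in> {z. ?D z})" for x
  proof
    assume "x \<in> A"
    then obtain c where c: "esz c \<le> poly p (length x)" "V (x, c)" using complete by blast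
    show "\<exists>u. length u \<le> poly p (length x) \<and> delimit x @ u \<in> {z. ?D z}"
      using c by (intro exI[of _ "code (enc c)"]) (simp add: D parse_tree esz_def tsize_def)
  next
    assume "\<exists>u. length u \<le> poly p (length x) \<and> delimit x @ u \<in> {z. ?D z}"
    then show "x \<in> A" using sound unfolding mem_Collect_eq D by blast
  qed
  then show ?thesis using P unfolding class_NP_def by blast
qed

section \<open>Small solutions of linear systems\<close>

text \<open>Leibniz's formula has \<open>fact k\<close> terms, each a product of \<open>k\<close>
  entries.\<close>

lemma det_bound:
  fixes A :: "int mat"
  assumes A: "A \<in> carrier_mat k k" and B: "\<And>i j. i < k \<Longrightarrow> j < k \<Longrightarrow> \<bar>A $$ (i, j)\<bar> \<le> B"
  shows "\<bar>det A\<bar> \<le> fact k * B ^ k"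
proof -
  have "\<bar>det A\<bar> \<le> (\<Sum>p \<in> {p. p permutes {0..<k}}. \<bar>signof p * (\<Prod>i = 0..<k. A $$ (i, p i))\<bar>)"
    unfolding det_def'[OF A] by (rule sum_abs)
  also have "\<dots> \<le> (\<Sum>p \<in> {p. p permutes {0..<k}}. B ^ k)"
  proof (rule sum_mono)
    fix p assume "p \<in> {p. p permutes {0..<k}}"
    then have p: "p i < k" if "i < k" for i using that permutes_in_image[of p "{0..<k}" i] by simp
    have "\<bar>signof p * (\<Prod>i = 0..<k. A $$ (i, p i))\<bar> = (\<Prod>i = 0..<k. \<bar>A $$ (i, p i)\<bar>)"
      by (simp add: abs_mult abs_prod sign_def)
    also have "\<dots> \<le> (\<Prod>i = 0..<k. B)" by (rule prod_mono) (use B p in auto)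
    finally show "\<bar>signof p * (\<Prod>i = 0..<k. A $$ (i, p i))\<bar> \<le> B ^ k" by simp
  qed
  also have "\<dots> = fact k * B ^ k" by (simp add: card_permutations[of "{0..<k}" k])
  finally show ?thesis .
qed

text \<open>If \<open>v\<close> were positive somewhere, then moving from \<open>x\<close> against
  \<open>v\<close> until the first entry reaches 0 would give a solution of smaller support. For
  \<open>v\<close> and \<open>- v\<close> together this says that the columns in the support are
  independent.\<close>

lemma minimal_support_independent:
  fixes A :: "'r \<Rightarrow> 'v \<Rightarrow> real"
  assumes fin: "finite X" and nonneg: "\<forall>j \<in> X. 0 \<le> x j" and sol: "\<forall>i \<in> R. (\<Sum>j \<in> X. A i j * x j) = b i"
    and min: "\<And>y. \<forall>j \<in> X. 0 \<le> y j \<Longrightarrow> \<forall>i \<in> R. (\<Sum>j \<in> X. A i j * y j) = b i \<Longrightarrow>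
      card {j \<in> X. x j \<noteq> 0} \<le> card {j \<in> X. y j \<noteq> 0}"
    and ker: "\<forall>i \<in> R. (\<Sum>j \<in> X. A i j * v j) = 0" and supp: "\<forall>j \<in> X. x j = 0 \<longrightarrow> v j = 0"
  shows "\<forall>j \<in> X. v j \<le> 0"
proof (rule ccontr)
  assume "\<not> ?thesis"
  then have ne: "{j \<in> X. v j > 0} \<noteq> {}" by auto
  define e where "e = Min ((\<lambda>j. x j / v j) ` {j \<in> X. v j > 0})"
  have fin': "finite ((\<lambda>j. x j / v j) ` {j \<in> X. v j > 0})" using fin by simp
  have "e \<in> (\<lambda>j. x j / v j) ` {j \<in> X. v j > 0}" unfolding e_def by (rule Min_in[OF fin']) (use ne in simp)
  then obtain l where l: "l \<in> X" "v l > 0" "e = x l / v l" by auto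
  have e0: "0 \<le> e" using l nonneg by simp
  have le: "e * v j \<le> x j" if "j \<in> X" for j
  proof (cases "v j > 0")
    case True
    then have "e \<le> x j / v j" unfolding e_def using that by (intro Min_le[OF fin']) auto
    then show ?thesis using True by (simp add: field_simps)
  next
    case False
    then have "e * v j \<le> 0" using e0 by (simp add: mult_nonneg_nonpos)
    then show ?thesis using nonneg that by force
  qed
  let ?y = "\<lambda>j. x j - e * v j"
  have "\<forall>i \<in> R. (\<Sum>j \<in> X. A i j * ?y j) = b i"
  proof
    fix i assume i: "i \<in> R"
    have "(\<Sum>j \<in> X. A i j * ?y j) = (\<Sum>j \<in> X. A i j * x j) - e * (\<Sum>j \<in> X. A i j * v j)"
      by (simp add: right_diff_distrib sum_subtractf sum_distrib_left algebra_simps)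
    then show "(\<Sum>j \<in> X. A i j * ?y j) = b i" using i sol ker by simp
  qed
  then have "card {j \<in> X. x j \<noteq> 0} \<le> card {j \<in> X. ?y j \<noteq> 0}" using le by (intro min) auto
  moreover have "{j \<in> X. ?y j \<noteq> 0} \<subset> {j \<in> X. x j \<noteq> 0}"
  proof
    show "{j \<in> X. ?y j \<noteq> 0} \<subseteq> {j \<in> X. x j \<noteq> 0}" using supp by auto
    have "?y l = 0" using l by simp
    moreover have "x l \<noteq> 0" using l supp by force
    ultimately show "{j \<in> X. ?y j \<noteq> 0} \<noteq> {j \<in> X. x j \<noteq> 0}" using l(1) by blast
  qed
  then have "card {j \<in> X. ?y j \<noteq> 0} < card {j \<in> X. x j \<noteq> 0}"
    using fin by (intro psubset_card_mono) auto
  ultimately show False by simp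
qed

text \<open>A solution of minimal support is determined by its support, and Cramer's rule, applied to the
  Gram matrix of the columns in the support, bounds its entries.\<close>

theorem small_rational_solution:
  fixes A :: "'r \<Rightarrow> 'v \<Rightarrow> int" and b :: "'r \<Rightarrow> int" and x :: "'v \<Rightarrow> real"
  assumes fin: "finite X" "finite R"
    and nonneg: "\<forall>j \<in> X. 0 \<le> x j" and sol: "\<forall>i \<in> R. (\<Sum>j \<in> X. real_of_int (A i j) * x j) = real_of_int (b i)"
    and bound: "\<forall>i \<in> R. \<forall>j \<in> X. \<bar>A i j\<bar> \<le> int U" "\<forall>i \<in> R. \<bar>b i\<bar> \<le> int U"
  defines "W \<equiv> fact (card X) * (card R * U ^ 2 + 1) ^ card X"
  shows "\<exists>(p :: 'v \<Rightarrow> nat) q. 1 \<le> q \<and> q \<le> W \<and> (\<forall>j \<in> X. p j \<le> W) \<and>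
    (\<forall>i \<in> R. (\<Sum>j \<in> X. A i j * int (p j)) = b i * int q)"
proof -
  let ?sol = "\<lambda>y. (\<forall>j \<in> X. 0 \<le> y j) \<and> (\<forall>i \<in> R. (\<Sum>j \<in> X. real_of_int (A i j) * y j) = real_of_int (b i))"
  have "\<exists>y. ?sol y \<and> (\<forall>z. ?sol z \<longrightarrow> card {j \<in> X. y j \<noteq> (0::real)} \<le> card {j \<in> X. z j \<noteq> 0})"
    using nonneg sol by (intro ex_has_least_nat[of ?sol x "\<lambda>y. card {j \<in> X. y j \<noteq> (0::real)}"]) blast
  then obtain y where y: "\<forall>j \<in> X. 0 \<le> y j" "\<forall>i \<in> R. (\<Sum>j \<in> X. real_of_int (A i j) * y j) = real_of_int (b i)"
    and min: "\<And>z. \<forall>j \<in> X. 0 \<le> z j \<Longrightarrow> \<forall>i \<in> R. (\<Sum>j \<in> X. real_of_int (A i j) * z j) = real_of_int (b i) \<Longrightarrow>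
      card {j \<in> X. y j \<noteq> 0} \<le> card {j \<in> X. z j \<noteq> 0}"
    by blast
  define S where "S = {j \<in> X. y j \<noteq> 0}"
  define k where "k = card S"
  have S: "finite S" "S \<subseteq> X" using fin by (auto simp: S_def)
  have kX: "k \<le> card X" unfolding k_def using S fin by (intro card_mono) auto
  obtain h where h: "bij_betw h {0..<k} S" using ex_bij_betw_nat_finite[OF S(1)] unfolding k_def by blast
  have hS: "h a \<in> S" if "a < k" for a using h that by (auto simp: bij_betw_def)
  have hinj: "inj_on h {0..<k}" using h by (simp add: bij_betw_def)
  have sumS: "(\<Sum>j \<in> X. f j) = (\<Sum>a = 0..<k. f (h a))" if "\<And>j. j \<in> X \<Longrightarrow> j \<notin> S \<Longrightarrow> f j = 0" for f :: "'v \<Rightarrow> real"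
  proof -
    have "(\<Sum>j \<in> X. f j) = (\<Sum>j \<in> S. f j)" using S fin that by (intro sum.mono_neutral_right) auto
    also have "\<dots> = (\<Sum>a = 0..<k. f (h a))" using sum.reindex_bij_betw[OF h] by metis
    finally show ?thesis .
  qed
  \<comment> \<open>The columns in the support need not form a square matrix. Multiplication by the
    transpose yields a system with as many equations as unknowns.\<close>
  define Gi where "Gi = mat k k (\<lambda>(a, c). \<Sum>i \<in> R. A i (h a) * A i (h c))"
  define bi where "bi = vec k (\<lambda>a. \<Sum>i \<in> R. A i (h a) * b i)"
  define G where "G = map_mat real_of_int Gi"
  define Y where "Y = vec k (\<lambda>a. y (h a))"
  have car: "Gi \<in> carrier_mat k k" "G \<in> carrier_mat k k" "Y \<in> carrier_vec k" "bi \<in> carrier_vec k"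
    by (simp_all add: Gi_def G_def Y_def bi_def)
  have Gv: "(G *\<^sub>v v) $ a = (\<Sum>i \<in> R. of_int (A i (h a)) * (\<Sum>c = 0..<k. of_int (A i (h c)) * v $ c))"
    if "v \<in> carrier_vec k" "a < k" for v a
  proof -
    have "(G *\<^sub>v v) $ a = (\<Sum>c = 0..<k. (\<Sum>i \<in> R. of_int (A i (h a)) * of_int (A i (h c))) * v $ c)"
      using that by (auto simp: G_def Gi_def scalar_prod_def intro!: sum.cong)
    also have "\<dots> = (\<Sum>i \<in> R. of_int (A i (h a)) * (\<Sum>c = 0..<k. of_int (A i (h c)) * v $ c))"
      unfolding sum_distrib_left sum_distrib_right by (subst sum.swap) (simp add: mult.assoc)
    finally show ?thesis .
  qed
  have GY: "G *\<^sub>v Y = map_vec real_of_int bi"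
  proof (rule eq_vecI)
    fix a assume "a < dim_vec (map_vec real_of_int bi)"
    then have a: "a < k" by (simp add: bi_def)
    have "(\<Sum>c = 0..<k. of_int (A i (h c)) * Y $ c) = real_of_int (b i)" if "i \<in> R" for i
    proof -
      have "(\<Sum>j \<in> X. real_of_int (A i j) * y j) = (\<Sum>c = 0..<k. of_int (A i (h c)) * y (h c))"
        by (rule sumS) (auto simp: S_def)
      then show ?thesis using y(2) that by (simp add: Y_def)
    qed
    then show "(G *\<^sub>v Y) $ a = map_vec real_of_int bi $ a"
      using Gv[OF car(3) a] a by (simp add: bi_def)
  qed (simp add: G_def Gi_def bi_def)
  have det: "det G \<noteq> 0"
  proof
    assume "det G = 0"
    then obtain v where v: "v \<in> carrier_vec k" "v \<noteq> 0\<^sub>v k" "G *\<^sub>v v = 0\<^sub>v k"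
      using det_0_iff_vec_prod_zero[OF car(2)] by blast
    let ?A = "\<lambda>i. \<Sum>c = 0..<k. of_int (A i (h c)) * v $ c"
    \<comment> \<open>The quadratic form of the Gram matrix is a sum of squares, so the combination
      of columns given by \<open>v\<close> vanishes. Minimality of the support then leaves no sign
      for an entry of \<open>v\<close>.\<close>
    have "0 = (\<Sum>a = 0..<k. v $ a * (G *\<^sub>v v) $ a)" using v(3) by simp
    also have "\<dots> = (\<Sum>a = 0..<k. \<Sum>i \<in> R. v $ a * of_int (A i (h a)) * ?A i)"
      using Gv[OF v(1)] by (simp add: sum_distrib_left mult.assoc)
    also have "\<dots> = (\<Sum>i \<in> R. ?A i * ?A i)"
      by (subst sum.swap) (simp add: sum_distrib_right mult.commute)
    finally have "(\<Sum>i \<in> R. ?A i * ?A i) = 0" by simp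
    then have A0: "?A i = 0" if "i \<in> R" for i
      using that sum_nonneg_eq_0_iff[OF fin(2), of "\<lambda>i. ?A i * ?A i"] by simp
    let ?v = "\<lambda>j. if j \<in> S then v $ (inv_into {0..<k} h j) else 0"
    have vh: "?v (h a) = v $ a" if "a < k" for a using that hS hinj by simp
    have "(\<Sum>j \<in> X. real_of_int (A i j) * ?v j) = ?A i" for i
    proof -
      have "(\<Sum>j \<in> X. real_of_int (A i j) * ?v j) = (\<Sum>c = 0..<k. of_int (A i (h c)) * ?v (h c))"
        by (rule sumS) simp
      then show ?thesis using vh by simp
    qed
    then have ker: "\<forall>i \<in> R. (\<Sum>j \<in> X. real_of_int (A i j) * ?v j) = 0" using A0 by simp
    then have ker': "\<forall>i \<in> R. (\<Sum>j \<in> X. real_of_int (A i j) * - ?v j) = 0" by (simp add: sum_negf)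
    have "\<forall>j \<in> X. ?v j \<le> 0"
      by (rule minimal_support_independent[OF fin(1) y min ker]) (auto simp: S_def)
    moreover have "\<forall>j \<in> X. - ?v j \<le> 0"
      by (rule minimal_support_independent[OF fin(1) y min ker']) (auto simp: S_def)
    ultimately have "?v j = 0" if "j \<in> X" for j using that by force
    then have "v $ a = 0" if "a < k" for a using vh[OF that] hS[OF that] S(2) by force
    then have "v = 0\<^sub>v k" using v(1) by (intro eq_vecI) auto
    then show False using v(2) by simp
  qed
  define D where "D = det Gi"
  define N where "N a = det (replace_col Gi bi a)" for a
  have "det G = of_int D" unfolding G_def D_def by (rule of_int_hom.hom_det)
  then have D0: "D \<noteq> 0" using det by simp
  have cramer: "of_int (N a) = y (h a) * of_int D" if a: "a < k" for a
  proof -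
    have "map_mat real_of_int (replace_col Gi bi a) = replace_col G (map_vec real_of_int bi) a"
      using car by (intro eq_matI) (auto simp: replace_col_def G_def)
    then have "of_int (N a) = det (replace_col G (G *\<^sub>v Y) a)"
      unfolding N_def GY by (simp flip: of_int_hom.hom_det)
    also have "\<dots> = Y $ a * det G" by (rule cramer_lemma_mat[OF car(2,3) a])
    finally show ?thesis using a \<open>det G = of_int D\<close> by (simp add: Y_def)
  qed
  have U: "\<bar>\<Sum>i \<in> R. f i * g i\<bar> \<le> int (card R * U ^ 2)"
    if "\<And>i. i \<in> R \<Longrightarrow> \<bar>f i\<bar> \<le> int U" "\<And>i. i \<in> R \<Longrightarrow> \<bar>g i\<bar> \<le> int U" for f g
  proof -
    have "\<bar>\<Sum>i \<in> R. f i * g i\<bar> \<le> (\<Sum>i \<in> R. \<bar>f i * g i\<bar>)" by (rule sum_abs)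
    also have "\<dots> \<le> (\<Sum>i \<in> R. int U * int U)"
      by (rule sum_mono) (auto simp: abs_mult intro!: mult_mono that)
    finally show ?thesis by (simp add: power2_eq_square)
  qed
  have Gb: "\<bar>Gi $$ (a, c)\<bar> \<le> int (card R * U ^ 2 + 1)" if "a < k" "c < k" for a c
    using U[of "\<lambda>i. A i (h a)" "\<lambda>i. A i (h c)"] bound(1) hS that S(2) by (force simp: Gi_def)
  have bb: "\<bar>bi $ a\<bar> \<le> int (card R * U ^ 2 + 1)" if "a < k" for a
    using U[of "\<lambda>i. A i (h a)" b] bound hS that S(2) by (force simp: bi_def)
  \<comment> \<open>The entries of the Gram matrix are sums of \<open>card R\<close> products. The
    added 1 makes the base positive, so that the power is monotone in the exponent.\<close>
  have W: "fact k * int (card R * U ^ 2 + 1) ^ k \<le> int W"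
  proof -
    have "fact k * (card R * U ^ 2 + 1) ^ k \<le> W"
      unfolding W_def by (intro mult_le_mono fact_mono power_increasing kX) auto
    then have "int (fact k * (card R * U ^ 2 + 1) ^ k) \<le> int W" by (simp only: of_nat_le_iff)
    then show ?thesis by simp
  qed
  have DW: "\<bar>D\<bar> \<le> int W" unfolding D_def using det_bound[OF car(1) Gb] W by linarith
  have NW: "\<bar>N a\<bar> \<le> int W" if "a < k" for a
  proof -
    have "\<bar>N a\<bar> \<le> fact k * int (card R * U ^ 2 + 1) ^ k"
      unfolding N_def by (rule det_bound) (use car(1) Gb bb in \<open>auto simp: replace_col_def\<close>)
    then show ?thesis using W by linarith
  qed
  let ?g = "inv_into {0..<k} h"
  \<comment> \<open>By Cramer's rule each entry is a quotient of determinants. As the solution is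
    nonnegative, the absolute values of numerator and denominator have the same quotient.\<close>
  define p where "p j = (if j \<in> S then nat \<bar>N (?g j)\<bar> else 0)" for j
  define q where "q = nat \<bar>D\<bar>"
  have g: "?g j < k" "h (?g j) = j" if "j \<in> S" for j
  proof -
    have "j \<in> h ` {0..<k}" using that h by (simp add: bij_betw_def)
    then show "?g j < k" "h (?g j) = j" using inv_into_into[of j h "{0..<k}"] f_inv_into_f[of j h "{0..<k}"] by auto
  qed
  have py: "real (p j) = y j * real q" if j: "j \<in> X" for j
  proof (cases "j \<in> S")
    case True
    have "real_of_int \<bar>N (?g j)\<bar> = \<bar>y j * of_int D\<bar>" using cramer[OF g(1)[OF True]] g(2)[OF True] by simp
    also have "\<dots> = y j * real_of_int \<bar>D\<bar>" using y(1) j by (simp add: abs_mult)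
    finally show ?thesis using True by (simp add: p_def q_def)
  next
    case False
    then show ?thesis using j by (simp add: p_def S_def)
  qed
  have "(\<Sum>j \<in> X. A i j * int (p j)) = b i * int q" if i: "i \<in> R" for i
  proof -
    have "real_of_int (\<Sum>j \<in> X. A i j * int (p j)) = (\<Sum>j \<in> X. real_of_int (A i j) * y j) * real q"
      by (simp add: py sum_distrib_right mult.assoc)
    also have "\<dots> = real_of_int (b i * int q)" using y(2) i by simp
    finally show ?thesis by (simp only: of_int_eq_iff)
  qed
  moreover have "1 \<le> q" "q \<le> W" using D0 DW by (simp_all add: q_def)
  moreover have "p j \<le> W" if "j \<in> X" for j
    using NW[OF g(1)] by (simp add: p_def nat_le_iff)
  ultimately show ?thesis by blast
qed

section \<open>Bounded solutions of the Modal Split Problem\<close>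

definition net_flow :: "('v \<times> 'v) set \<Rightarrow> ('v \<times> 'v \<Rightarrow> real) \<Rightarrow> 'v \<Rightarrow> real" where
  "net_flow E f v = (\<Sum>e \<in> {e \<in> E. snd e = v}. f e) - (\<Sum>e \<in> {e \<in> E. fst e = v}. f e)"

lemma net_flow_add: "net_flow E (\<lambda>e. f e + g e) v = net_flow E f v + net_flow E g v"
  by (simp add: net_flow_def sum.distrib)

lemma net_flow_diff: "net_flow E (\<lambda>e. f e - c * g e) v = net_flow E f v - c * net_flow E g v"
  by (simp add: net_flow_def sum_subtractf sum_distrib_left right_diff_distrib)

lemma net_flow_cong: "(\<And>e. e \<in> E \<Longrightarrow> f e = g e) \<Longrightarrow> net_flow E f v = net_flow E g v"
  unfolding net_flow_def by (intro arg_cong2[of _ _ _ _ "(-)"] sum.cong) auto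

lemma net_flow_arc:
  assumes "finite E" "(a, b) \<in> E"
  shows "net_flow E (\<lambda>e. of_bool (e = (a, b))) v = of_bool (v = b) - of_bool (v = a)"
proof -
  have e: "{e \<in> E. snd e = v} \<inter> {(a, b)} = (if v = b then {(a, b)} else {})"
    "{e \<in> E. fst e = v} \<inter> {(a, b)} = (if v = a then {(a, b)} else {})"
    using assms(2) by auto
  have "finite {e \<in> E. snd e = v}" "finite {e \<in> E. fst e = v}" using assms(1) by auto
  then show ?thesis unfolding net_flow_def by (simp add: sum_of_bool_eq e)
qed

text \<open>The sum of the indicators of the arcs of a walk, with multiplicity. A closed walk yields
  a circulation, which is what cancelling a cycle requires.\<close>

lemma circulation_from_walk:
  assumes "(x, y) \<in> S\<^sup>+" "S \<subseteq> E" "finite E"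
  shows "\<exists>c :: 'v \<times> 'v \<Rightarrow> real. (\<forall>e. 0 \<le> c e) \<and> (\<forall>e. c e \<noteq> 0 \<longrightarrow> e \<in> S) \<and> (\<exists>e. c e \<noteq> 0) \<and>
    (\<forall>v. net_flow E c v = of_bool (v = y) - of_bool (v = x))"
  using assms(1)
proof (induction rule: trancl_induct)
  have net: "net_flow E (\<lambda>e. of_bool (e = (y, z))) v = of_bool (v = z) - of_bool (v = y)" if "(y, z) \<in> S" for y z v
    using that assms(2,3) by (intro net_flow_arc) auto
  {
    case (base y)
    show ?case
      using base net[OF base] by (intro exI[of _ "\<lambda>e. of_bool (e = (x, y))"]) auto
  next
    case (step y z)
    then obtain c :: "'v \<times> 'v \<Rightarrow> real" where c: "\<forall>e. 0 \<le> c e" "\<forall>e. c e \<noteq> 0 \<longrightarrow> e \<in> S" "\<exists>e. c e \<noteq> 0"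
      "\<forall>v. net_flow E c v = of_bool (v = y) - of_bool (v = x)" by blast
    let ?c = "\<lambda>e. c e + of_bool (e = (y, z))"
    have "\<forall>v. net_flow E ?c v = of_bool (v = z) - of_bool (v = x)"
      unfolding net_flow_add using c(4) net[OF step(2)] by simp
    moreover have "\<exists>e. ?c e \<noteq> 0" using c(1) by (intro exI[of _ "(y, z)"]) (simp add: add_nonneg_eq_0_iff)
    moreover have "\<forall>e. ?c e \<noteq> 0 \<longrightarrow> e \<in> S" using c(2) step(2) by auto
    moreover have "\<forall>e. 0 \<le> ?c e" using c(1) by simp
    ultimately show ?case by (intro exI[of _ ?c] conjI)
  }
qed

text \<open>Arcs with both ends in \<open>A\<close> contribute to two of the summands and cancel, so
  only the cut remains.\<close>

lemma sum_net_flow: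
  assumes "finite E" "finite A"
  shows "(\<Sum>v \<in> A. net_flow E f v) = (\<Sum>e \<in> {e \<in> E. snd e \<in> A \<and> fst e \<notin> A}. f e) - (\<Sum>e \<in> {e \<in> E. fst e \<in> A \<and> snd e \<notin> A}. f e)"
proof -
  have s: "(\<Sum>v \<in> A. \<Sum>e \<in> {e \<in> E. g e = v}. f e) = (\<Sum>e \<in> {e \<in> E. g e \<in> A}. f e)" for g
  proof -
    have "(\<Sum>v \<in> A. \<Sum>e \<in> {e \<in> E. g e = v}. f e) = sum f (\<Union>v \<in> A. {e \<in> E. g e = v})"
      using assms by (intro sum.UNION_disjoint[symmetric]) auto
    also have "(\<Union>v \<in> A. {e \<in> E. g e = v}) = {e \<in> E. g e \<in> A}" by auto
    finally show ?thesis .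
  qed
  have p: "sum f {e \<in> E. g e \<in> A} = sum f {e \<in> E. g e \<in> A \<and> h e \<notin> A} + sum f {e \<in> E. g e \<in> A \<and> h e \<in> A}" for g h :: "'a \<times> 'a \<Rightarrow> 'a"
    using assms by (subst sum.union_disjoint[symmetric]) (auto intro!: sum.cong)
  have "{e \<in> E. fst e \<in> A \<and> snd e \<in> A} = {e \<in> E. snd e \<in> A \<and> fst e \<in> A}" by auto
  then show ?thesis
    unfolding net_flow_def sum_subtractf s using p[of snd fst] p[of fst snd] by simp
qed

text \<open>Cancelling cycles makes the support of a flow acyclic.  The set of all vertices that reach the
  tail of an arc \<open>e\<close> through the support is then left through \<open>e\<close> and never entered.\<close>

lemma acyclic_flow:
  fixes D :: real
  assumes fin: "finite E" "finite V" and E: "E \<subseteq> V \<times> V" and D: "0 \<le> D"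
    and f: "\<forall>e \<in> E. 0 \<le> f e" and d: "\<forall>v \<in> V. net_flow E f v = (if v = t then D else if v = s then - D else 0)"
  shows "\<exists>g. (\<forall>e \<in> E. 0 \<le> g e \<and> g e \<le> f e \<and> g e \<le> D) \<and> (\<forall>v \<in> V. net_flow E g v = net_flow E f v)"
proof -
  let ?P = "\<lambda>g. (\<forall>e \<in> E. 0 \<le> g e \<and> g e \<le> f e) \<and> (\<forall>v \<in> V. net_flow E g v = net_flow E f v)"
  have "\<exists>g. ?P g \<and> (\<forall>h. ?P h \<longrightarrow> card {e \<in> E. g e \<noteq> 0} \<le> card {e \<in> E. h e \<noteq> 0})"
    using f by (intro ex_has_least_nat[of ?P f "\<lambda>g. card {e \<in> E. g e \<noteq> 0}"]) auto
  then obtain g where g: "\<forall>e \<in> E. 0 \<le> g e \<and> g e \<le> f e" "\<forall>v \<in> V. net_flow E g v = net_flow E f v"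
    and min: "\<And>h. ?P h \<Longrightarrow> card {e \<in> E. g e \<noteq> 0} \<le> card {e \<in> E. h e \<noteq> 0}" by blast
  define S where "S = {e \<in> E. g e \<noteq> 0}"
  have S: "S \<subseteq> E" "finite S" using fin by (auto simp: S_def)
  have acyc: "(x, x) \<notin> S\<^sup>+" for x
  proof
    assume "(x, x) \<in> S\<^sup>+"
    from circulation_from_walk[OF this S(1) fin(1)] obtain c :: "'a \<times> 'a \<Rightarrow> real"
      where c: "\<forall>e. 0 \<le> c e" "\<forall>e. c e \<noteq> 0 \<longrightarrow> e \<in> S" "\<exists>e. c e \<noteq> 0" "\<forall>v. net_flow E c v = 0" by auto
    let ?C = "{e. c e \<noteq> 0}"
    have C: "finite ?C" "?C \<noteq> {}" "?C \<subseteq> S" using c S by (auto intro: finite_subset[of _ S])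
    \<comment> \<open>The largest multiple of the circulation that can be subtracted: the flow
      becomes 0 on some arc \<open>l\<close>, contradicting the minimality of the support.\<close>
    define m where "m = Min ((\<lambda>e. g e / c e) ` ?C)"
    have "m \<in> (\<lambda>e. g e / c e) ` ?C" unfolding m_def by (rule Min_in) (use C in auto)
    then obtain l where l: "c l \<noteq> 0" "m = g l / c l" by auto
    have lS: "l \<in> S" using l c by blast
    have m0: "0 \<le> m" using l lS g(1) c(1)[rule_format, of l] S(1) by (auto intro!: divide_nonneg_nonneg)
    have m: "m * c e \<le> g e" if "e \<in> E" for e
    proof (cases "c e = 0")
      case True
      then show ?thesis using g(1) that by simp
    next
      case False
      then have "m \<le> g e / c e" "0 < c e" unfolding m_def using C c(1)[rule_format, of e] by (auto intro!: Min_le)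
      then show ?thesis by (simp add: pos_le_divide_eq)
    qed
    let ?h = "\<lambda>e. g e - m * c e"
    have "?P ?h"
    proof (intro conjI ballI)
      fix e assume e: "e \<in> E"
      show "0 \<le> ?h e" using m[OF e] by simp
      have "0 \<le> m * c e" using m0 c(1)[rule_format, of e] by simp
      then show "?h e \<le> f e" using g(1) e by force
    next
      fix v assume "v \<in> V"
      then show "net_flow E ?h v = net_flow E f v" unfolding net_flow_diff using g(2) c(4) by simp
    qed
    then have "card S \<le> card {e \<in> E. ?h e \<noteq> 0}" unfolding S_def by (rule min)
    moreover have "{e \<in> E. ?h e \<noteq> 0} \<subseteq> S - {l}"
      using c(2) l by (auto simp: S_def)
    then have "card {e \<in> E. ?h e \<noteq> 0} < card S"
      using lS S(2) by (metis (no_types, lifting) Diff_subset card_Diff1_less card_mono finite_Diff le_less_trans)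
    ultimately show False by simp
  qed
  have "g e \<le> D" if e: "e \<in> E" for e
  proof (cases "g e = 0")
    case False
    obtain u v where uv: "e = (u, v)" by force
    define A where "A = {a \<in> V. (a, u) \<in> S\<^sup>*}"
    have finA: "finite A" using fin by (simp add: A_def)
    have eS: "(u, v) \<in> S" using False e uv by (simp add: S_def)
    have "u \<in> A" using e E uv by (auto simp: A_def)
    moreover have "v \<notin> A"
    proof
      assume "v \<in> A"
      then have "(u, u) \<in> S\<^sup>+" using eS by (auto simp: A_def intro: rtrancl_into_trancl2)
      then show False using acyc by blast
    qed
    ultimately have e': "e \<in> {e \<in> E. fst e \<in> A \<and> snd e \<notin> A}" using e uv by simp
    have "(\<Sum>e \<in> {e \<in> E. snd e \<in> A \<and> fst e \<notin> A}. g e) = 0"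
    proof (rule sum.neutral, rule ballI)
      fix e' assume h: "e' \<in> {e \<in> E. snd e \<in> A \<and> fst e \<notin> A}"
      obtain a b where ab: "e' = (a, b)" by force
      show "g e' = 0"
      proof (rule ccontr)
        assume "g e' \<noteq> 0"
        then have "(a, b) \<in> S" "a \<in> V" using h ab E by (auto simp: S_def)
        then have "a \<in> A" using h ab by (auto simp: A_def intro: converse_rtrancl_into_rtrancl)
        then show False using h ab by simp
      qed
    qed
    then have "(\<Sum>e \<in> {e \<in> E. fst e \<in> A \<and> snd e \<notin> A}. g e) = - (\<Sum>v \<in> A. net_flow E g v)"
      using sum_net_flow[OF fin(1) finA, of g] by simp
    also have "(\<Sum>v \<in> A. net_flow E g v) = (\<Sum>v \<in> A. if v = t then D else if v = s then - D else 0)"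
      using g(2) d by (intro sum.cong) (auto simp: A_def)
    \<comment> \<open>The source is the only vertex with a negative net flow, so the sum over
      \<open>A\<close> is at least \<open>- D\<close>.\<close>
    also have "\<dots> \<ge> (\<Sum>v \<in> A. if v = s then - D else 0)" using D by (intro sum_mono) auto
    then have "- (\<Sum>v \<in> A. if v = t then D else if v = s then - D else 0) \<le> D"
      using finA D by (auto simp: sum.delta split: if_splits)
    finally have *: "(\<Sum>e \<in> {e \<in> E. fst e \<in> A \<and> snd e \<notin> A}. g e) \<le> D" .
    have "g e \<le> (\<Sum>e \<in> {e \<in> E. fst e \<in> A \<and> snd e \<notin> A}. g e)"
      by (rule member_le_sum[OF e']) (use g(1) fin in auto)
    then show ?thesis using * by simp
  qed (use D in simp)
  then show ?thesis using g by blast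
qed

text \<open>The products \<open>F\<^sub>\<kappa>(e) M\<^sub>\<kappa>(e)\<^sub>i\<close> turn the problem into a linear one.\<close>

definition mode_flow :: "'v msp_instance \<Rightarrow> 'v layout \<Rightarrow> ('v \<times> 'v \<Rightarrow> 'v \<times> 'v \<Rightarrow> nat \<Rightarrow> real) \<Rightarrow> bool" where
  "mode_flow P L G \<longleftrightarrow>
     (\<forall>\<kappa> \<in> commodities P. \<forall>e \<in> parcs (graph P). \<forall>i \<in> {0..modes P}. 0 \<le> G \<kappa> e i) \<and>
     (\<forall>\<kappa> \<in> commodities P. \<forall>v \<in> pverts (graph P). net_flow (parcs (graph P)) (\<lambda>e. \<Sum>i = 0..modes P. G \<kappa> e i) v =
        (if v = snd \<kappa> then real (demand P \<kappa>) else if v = fst \<kappa> then - real (demand P \<kappa>) else 0)) \<and>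
     feasible_layout P L \<and>
     (\<forall>e \<in> parcs (graph P). \<forall>i \<in> {1..modes P}. (\<Sum>\<kappa> \<in> commodities P. G \<kappa> e i) \<le> of_rat (capacity P i) * real (L e i)) \<and>
     (\<Sum>e \<in> parcs (graph P). of_rat (weight P e) * (\<Sum>i = 0..modes P. of_rat (travel_time P i) * (\<Sum>\<kappa> \<in> commodities P. G \<kappa> e i)))
       \<le> real_of_rat (time_bound P) \<and>
     (\<Sum>e \<in> parcs (graph P). of_rat (weight P e) * (of_rat (energy P 0) * (\<Sum>\<kappa> \<in> commodities P. G \<kappa> e 0) +
       (\<Sum>i = 1..modes P. of_rat (energy P i) * real (L e i)))) \<le> real_of_rat (energy_bound P)"

lemma is_flow_iff_net_flow:
  "is_flow P \<kappa> f \<longleftrightarrow> (\<forall>e \<in> parcs (graph P). 0 \<le> f e) \<and> (\<forall>v \<in> pverts (graph P). net_flow (parcs (graph P)) f v =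
     (if v = snd \<kappa> then real (demand P \<kappa>) else if v = fst \<kappa> then - real (demand P \<kappa>) else 0))"
  unfolding is_flow_def net_flow_def in_arcs_def out_arcs_def by simp

lemma finite_commodities: "valid_instance P \<Longrightarrow> finite (commodities P)"
  unfolding commodities_def valid_instance_def
  by (auto dest!: pair_fin_digraph.pair_finite_verts)

text \<open>If the total flow on an arc is 0, then so is the flow of each commodity, and the default
  value in \<open>mean_split\<close> has no effect on the product.\<close>

lemma total_flow_mean_split:
  assumes "finite (commodities P)" "\<forall>\<kappa> \<in> commodities P. 0 \<le> F \<kappa> e"
  shows "total_flow P F e * mean_split P F M e i = (\<Sum>\<kappa> \<in> commodities P. F \<kappa> e * M \<kappa> e i)"
proof (cases "total_flow P F e > 0")
  case True
  then show ?thesis by (simp add: mean_split_def)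
next
  case False
  then have z: "total_flow P F e = 0" using assms(2) by (simp add: total_flow_def order_antisym sum_nonneg not_less)
  then have "F \<kappa> e = 0" if "\<kappa> \<in> commodities P" for \<kappa>
    using that assms unfolding total_flow_def by (simp add: sum_nonneg_eq_0_iff)
  then show ?thesis using z by simp
qed

text \<open>From left to right multiply flow and split. Conversely, the flow is the sum over the
  modes and the split is the quotient; where the flow vanishes, the split is put on mode 0 to be a
  split at all.\<close>

lemma yes_instance_iff_mode_flow:
  assumes "valid_instance P"
  shows "yes_instance P \<longleftrightarrow> (\<exists>L G. mode_flow P L G)"
proof
  note finK = finite_commodities[OF assms]
  assume "yes_instance P"
  then obtain F L M where fs: "feasible_solution P F L M" and T: "total_time P F L M \<le> of_rat (time_bound P)"
    and H: "total_energy P F L M \<le> of_rat (energy_bound P)" unfolding yes_instance_def by blast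
  let ?G = "\<lambda>\<kappa> e i. F \<kappa> e * M \<kappa> e i"
  have F: "is_flow P \<kappa> (F \<kappa>)" if "\<kappa> \<in> commodities P" for \<kappa> using fs that by (simp add: feasible_solution_def)
  have F0: "0 \<le> F \<kappa> e" if "\<kappa> \<in> commodities P" "e \<in> parcs (graph P)" for \<kappa> e using F[OF that(1)] that by (simp add: is_flow_def)
  have M: "is_modal_split P M" using fs by (simp add: feasible_solution_def feasible_modal_split_def)
  have sM: "(\<Sum>i = 0..modes P. ?G \<kappa> e i) = F \<kappa> e" if "\<kappa> \<in> commodities P" "e \<in> parcs (graph P)" for \<kappa> e
    using M that by (simp add: is_modal_split_def flip: sum_distrib_left)
  have tm: "total_flow P F e * mean_split P F M e i = (\<Sum>\<kappa> \<in> commodities P. ?G \<kappa> e i)" if "e \<in> parcs (graph P)" for e i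
    by (rule total_flow_mean_split[OF finK]) (use F0 that in auto)
  have tm': "x * total_flow P F e * mean_split P F M e i = x * (\<Sum>\<kappa> \<in> commodities P. ?G \<kappa> e i)" if "e \<in> parcs (graph P)" for e i x
    using tm[OF that] by (simp add: mult.assoc)
  have "mode_flow P L ?G"
    unfolding mode_flow_def
  proof (intro conjI ballI)
    fix \<kappa> e i assume "\<kappa> \<in> commodities P" "e \<in> parcs (graph P)" "i \<in> {0..modes P}"
    then show "0 \<le> ?G \<kappa> e i" using F0 M by (auto simp: is_modal_split_def)
  next
    fix \<kappa> v assume k: "\<kappa> \<in> commodities P" and v: "v \<in> pverts (graph P)"
    have "net_flow (parcs (graph P)) (\<lambda>e. \<Sum>i = 0..modes P. ?G \<kappa> e i) v = net_flow (parcs (graph P)) (F \<kappa>) v"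
      by (rule net_flow_cong) (use sM k in auto)
    then show "net_flow (parcs (graph P)) (\<lambda>e. \<Sum>i = 0..modes P. ?G \<kappa> e i) v =
        (if v = snd \<kappa> then real (demand P \<kappa>) else if v = fst \<kappa> then - real (demand P \<kappa>) else 0)"
      using F[OF k] v by (simp add: is_flow_iff_net_flow)
  next
    show "feasible_layout P L" using fs by (simp add: feasible_solution_def)
  next
    fix e i assume "e \<in> parcs (graph P)" "i \<in> {1..modes P}"
    then show "(\<Sum>\<kappa> \<in> commodities P. ?G \<kappa> e i) \<le> of_rat (capacity P i) * real (L e i)"
      using fs by (simp add: feasible_solution_def feasible_modal_split_def)
  next
    show "(\<Sum>e \<in> parcs (graph P). of_rat (weight P e) * (\<Sum>i = 0..modes P. of_rat (travel_time P i) * (\<Sum>\<kappa> \<in> commodities P. ?G \<kappa> e i)))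
       \<le> real_of_rat (time_bound P)"
      using T unfolding total_time_def by (simp add: tm' cong: sum.cong)
  next
    show "(\<Sum>e \<in> parcs (graph P). of_rat (weight P e) * (of_rat (energy P 0) * (\<Sum>\<kappa> \<in> commodities P. ?G \<kappa> e 0) +
       (\<Sum>i = 1..modes P. of_rat (energy P i) * real (L e i)))) \<le> real_of_rat (energy_bound P)"
      using H unfolding total_energy_def by (simp add: tm' cong: sum.cong)
  qed
  then show "\<exists>L G. mode_flow P L G" by blast
next
  note finK = finite_commodities[OF assms]
  assume "\<exists>L G. mode_flow P L G"
  then obtain L G where LG: "mode_flow P L G" by blast
  note g = LG[unfolded mode_flow_def]
  define F where "F \<kappa> e = (\<Sum>i = 0..modes P. G \<kappa> e i)" for \<kappa> e
  define M where "M \<kappa> e i = (if F \<kappa> e = 0 then of_bool (i = 0) else G \<kappa> e i / F \<kappa> e)" for \<kappa> e and i :: nat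
  have G0: "0 \<le> G \<kappa> e i" if "\<kappa> \<in> commodities P" "e \<in> parcs (graph P)" "i \<le> modes P" for \<kappa> e i
    using g that by auto
  have F0: "0 \<le> F \<kappa> e" if "\<kappa> \<in> commodities P" "e \<in> parcs (graph P)" for \<kappa> e
    unfolding F_def using G0 that by (intro sum_nonneg) auto
  have FM: "F \<kappa> e * M \<kappa> e i = G \<kappa> e i" if "\<kappa> \<in> commodities P" "e \<in> parcs (graph P)" "i \<le> modes P" for \<kappa> e i
  proof (cases "F \<kappa> e = 0")
    case True
    then have "\<forall>i \<in> {0..modes P}. G \<kappa> e i = 0"
      unfolding F_def using G0 that by (subst (asm) sum_nonneg_eq_0_iff) auto
    then show ?thesis using True that by simp
  qed (simp add: M_def)
  have sG: "(\<Sum>\<kappa> \<in> commodities P. F \<kappa> e * M \<kappa> e i) = (\<Sum>\<kappa> \<in> commodities P. G \<kappa> e i)" if "e \<in> parcs (graph P)" "i \<le> modes P" for e i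
    by (rule sum.cong) (use FM that in auto)
  have tm': "x * total_flow P F e * mean_split P F M e i = x * (\<Sum>\<kappa> \<in> commodities P. G \<kappa> e i)" if "e \<in> parcs (graph P)" "i \<le> modes P" for e i x
    using total_flow_mean_split[OF finK, of F e M i] F0 sG that by (simp add: mult.assoc)
  have "feasible_solution P F L M"
    unfolding feasible_solution_def feasible_modal_split_def is_modal_split_def
  proof (intro conjI ballI)
    fix \<kappa> assume "\<kappa> \<in> commodities P"
    then show "is_flow P \<kappa> (F \<kappa>)"
      using g F0 unfolding is_flow_iff_net_flow F_def by simp
  next
    show "feasible_layout P L" using g by blast
  next
    fix \<kappa> e i assume h: "\<kappa> \<in> commodities P" "e \<in> parcs (graph P)" "i \<in> {0..modes P}"
    have "G \<kappa> e i \<le> F \<kappa> e" unfolding F_def using h G0 by (intro member_le_sum) auto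
    then show "M \<kappa> e i \<in> {0..1}" using F0[OF h(1,2)] G0[OF h(1,2), of i] h(3) by (auto simp: M_def divide_le_eq)
  next
    fix \<kappa> e assume h: "\<kappa> \<in> commodities P" "e \<in> parcs (graph P)"
    show "(\<Sum>i = 0..modes P. M \<kappa> e i) = 1"
    proof (cases "F \<kappa> e = 0")
      case True
      then have "(\<Sum>i = 0..modes P. M \<kappa> e i) = (\<Sum>i = 0..modes P. if i = 0 then 1 else 0)"
        by (intro sum.cong) (auto simp: M_def)
      also have "\<dots> = 1" by (simp only: sum.delta finite_atLeastAtMost) simp
      finally show ?thesis .
    next
      case False
      then show ?thesis by (simp add: M_def F_def flip: sum_divide_distrib)
    qed
  next
    fix e i assume "e \<in> parcs (graph P)" "i \<in> {1..modes P}"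
    then show "(\<Sum>\<kappa> \<in> commodities P. F \<kappa> e * M \<kappa> e i) \<le> of_rat (capacity P i) * real (L e i)"
      using g sG by simp
  qed
  moreover have "total_time P F L M = (\<Sum>e \<in> parcs (graph P). of_rat (weight P e) *
      (\<Sum>i = 0..modes P. of_rat (travel_time P i) * (\<Sum>\<kappa> \<in> commodities P. G \<kappa> e i)))"
    unfolding total_time_def
    by (rule sum.cong[OF refl], rule arg_cong2[of _ _ _ _ "(*)", OF refl], rule sum.cong[OF refl]) (simp add: tm')
  then have "total_time P F L M \<le> of_rat (time_bound P)" using g by simp
  moreover have "total_energy P F L M \<le> of_rat (energy_bound P)"
    using g unfolding total_energy_def by (simp add: tm' cong: sum.cong)
  ultimately show "yes_instance P" unfolding yes_instance_def by blast
qed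

text \<open>Replacing each flow by an acyclic one below it, scaling all modes alike, and then using
  as few vehicles as possible decreases every quantity that is bounded above. Rounding up adds at
  most one vehicle per arc and mode, whence the summand \<open>capacity P i\<close>.\<close>

lemma bounded_mode_flow:
  assumes valid: "valid_instance P" and LG: "mode_flow P L G"
  shows "\<exists>L G. mode_flow P L G \<and> (\<forall>e \<in> parcs (graph P). \<forall>i \<in> {1..modes P}.
    of_rat (capacity P i) * real (L e i) \<le> real (\<Sum>\<kappa> \<in> commodities P. demand P \<kappa>) + of_rat (capacity P i))"
proof -
  note g = LG[unfolded mode_flow_def]
  let ?E = "parcs (graph P)" and ?V = "pverts (graph P)" and ?K = "commodities P" and ?m = "modes P"
  have fd: "pair_fin_digraph (graph P)" using valid by (simp add: valid_instance_def)
  interpret pair_fin_digraph "graph P" by (rule fd)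
  have fin: "finite ?E" "finite ?V" using pair_finite_arcs pair_finite_verts by auto
  have EV: "?E \<subseteq> ?V \<times> ?V" using in_arcsD1 in_arcsD2 by auto
  note finK = finite_commodities[OF valid]
  define F where "F \<kappa> e = (\<Sum>i = 0..?m. G \<kappa> e i)" for \<kappa> e
  have G0: "0 \<le> G \<kappa> e i" if "\<kappa> \<in> ?K" "e \<in> ?E" "i \<le> ?m" for \<kappa> e i
    using g that by auto
  have F0: "0 \<le> F \<kappa> e" if "\<kappa> \<in> ?K" "e \<in> ?E" for \<kappa> e
    unfolding F_def using G0 that by (intro sum_nonneg) auto
  have "\<forall>\<kappa> \<in> ?K. \<exists>f. (\<forall>e \<in> ?E. 0 \<le> f e \<and> f e \<le> F \<kappa> e \<and> f e \<le> real (demand P \<kappa>)) \<and>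
      (\<forall>v \<in> ?V. net_flow ?E f v = net_flow ?E (F \<kappa>) v)"
  proof
    fix \<kappa> assume k: "\<kappa> \<in> ?K"
    show "\<exists>f. (\<forall>e \<in> ?E. 0 \<le> f e \<and> f e \<le> F \<kappa> e \<and> f e \<le> real (demand P \<kappa>)) \<and>
      (\<forall>v \<in> ?V. net_flow ?E f v = net_flow ?E (F \<kappa>) v)"
      by (rule acyclic_flow[OF fin EV, of _ _ "snd \<kappa>" "fst \<kappa>"]) (use k F0 g in \<open>auto simp: F_def\<close>)
  qed
  then obtain F' where F': "\<And>\<kappa> e. \<kappa> \<in> ?K \<Longrightarrow> e \<in> ?E \<Longrightarrow> 0 \<le> F' \<kappa> e \<and> F' \<kappa> e \<le> F \<kappa> e \<and> F' \<kappa> e \<le> real (demand P \<kappa>)"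
    and net: "\<And>\<kappa> v. \<kappa> \<in> ?K \<Longrightarrow> v \<in> ?V \<Longrightarrow> net_flow ?E (F' \<kappa>) v = net_flow ?E (F \<kappa>) v"
    by metis
  \<comment> \<open>Where \<open>F\<close> vanishes, so does \<open>F'\<close>, and the quotient is
    0 by convention; hence the modes sum to \<open>F'\<close> there too.\<close>
  define G' where "G' \<kappa> e i = F' \<kappa> e / F \<kappa> e * G \<kappa> e i" for \<kappa> e i
  have ratio: "0 \<le> F' \<kappa> e / F \<kappa> e \<and> F' \<kappa> e / F \<kappa> e \<le> 1" if "\<kappa> \<in> ?K" "e \<in> ?E" for \<kappa> e
    using F'[OF that] by (auto simp: divide_le_eq)
  have G': "0 \<le> G' \<kappa> e i \<and> G' \<kappa> e i \<le> G \<kappa> e i" if "\<kappa> \<in> ?K" "e \<in> ?E" "i \<le> ?m" for \<kappa> e i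
    unfolding G'_def using ratio[OF that(1,2)] G0[OF that]
    by (intro conjI mult_nonneg_nonneg mult_left_le_one_le) auto
  have sG': "(\<Sum>i = 0..?m. G' \<kappa> e i) = F' \<kappa> e" if "\<kappa> \<in> ?K" "e \<in> ?E" for \<kappa> e
  proof -
    have "(\<Sum>i = 0..?m. G' \<kappa> e i) = F' \<kappa> e / F \<kappa> e * F \<kappa> e"
      unfolding G'_def F_def by (simp only: sum_distrib_left)
    then show ?thesis using F'[OF that] by auto
  qed
  have GF: "G' \<kappa> e i \<le> real (demand P \<kappa>)" if "\<kappa> \<in> ?K" "e \<in> ?E" "i \<le> ?m" for \<kappa> e i
  proof -
    have "G' \<kappa> e i \<le> (\<Sum>i = 0..?m. G' \<kappa> e i)" using that G' by (intro member_le_sum) auto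
    then show ?thesis using sG'[OF that(1,2)] F'[OF that(1,2)] by linarith
  qed
  have S0: "0 \<le> (\<Sum>\<kappa> \<in> ?K. G' \<kappa> e i)" if "e \<in> ?E" "i \<le> ?m" for e i
    using G' that by (intro sum_nonneg) auto
  have SD: "(\<Sum>\<kappa> \<in> ?K. G' \<kappa> e i) \<le> real (\<Sum>\<kappa> \<in> ?K. demand P \<kappa>)" if "e \<in> ?E" "i \<le> ?m" for e i
    unfolding of_nat_sum using GF that by (intro sum_mono) auto
  have SG: "(\<Sum>\<kappa> \<in> ?K. G' \<kappa> e i) \<le> (\<Sum>\<kappa> \<in> ?K. G \<kappa> e i)" if "e \<in> ?E" "i \<le> ?m" for e i
    using G' that by (intro sum_mono) auto
  have pos: "0 \<le> weight P e" if "e \<in> ?E" for e using valid that by (simp add: valid_instance_def)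
  have pos': "0 \<le> travel_time P i" "0 \<le> energy P i" "0 \<le> cost P i" "0 < capacity P i" if "i \<le> ?m" for i
    using valid that by (auto simp: valid_instance_def)
  \<comment> \<open>The ceiling stays below the given layout because the entries of the latter are
    integers that satisfy the capacity constraint for a larger flow.\<close>
  define L' where "L' e i = nat \<lceil>(\<Sum>\<kappa> \<in> ?K. G' \<kappa> e i) / of_rat (capacity P i)\<rceil>" for e i
  have L'L: "L' e i \<le> L e i" if "e \<in> ?E" "i \<in> {1..?m}" for e i
  proof -
    have "(\<Sum>\<kappa> \<in> ?K. G' \<kappa> e i) \<le> of_rat (capacity P i) * real (L e i)"
      using SG[of e i] g that by force
    then have "(\<Sum>\<kappa> \<in> ?K. G' \<kappa> e i) / of_rat (capacity P i) \<le> real (L e i)"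
      using pos'(4)[of i] that by (simp add: divide_le_eq mult.commute)
    then show ?thesis unfolding L'_def by (simp add: ceiling_le_iff nat_le_iff)
  qed
  have "mode_flow P L' G'"
    unfolding mode_flow_def
  proof (intro conjI ballI)
    show "0 \<le> G' \<kappa> e i" if "\<kappa> \<in> ?K" "e \<in> ?E" "i \<in> {0..?m}" for \<kappa> e i using G' that by simp
    fix \<kappa> v assume k: "\<kappa> \<in> ?K" and v: "v \<in> ?V"
    have "net_flow ?E (\<lambda>e. \<Sum>i = 0..?m. G' \<kappa> e i) v = net_flow ?E (F' \<kappa>) v"
      by (rule net_flow_cong) (use sG' k in auto)
    then show "net_flow ?E (\<lambda>e. \<Sum>i = 0..?m. G' \<kappa> e i) v =
        (if v = snd \<kappa> then real (demand P \<kappa>) else if v = fst \<kappa> then - real (demand P \<kappa>) else 0)"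
      using net[OF k v] g k v unfolding F_def by simp
  next
    have "(\<Sum>e \<in> ?E. weight P e * (\<Sum>i = 1..?m. cost P i * of_nat (L' e i))) \<le>
        (\<Sum>e \<in> ?E. weight P e * (\<Sum>i = 1..?m. cost P i * of_nat (L e i)))"
      using L'L pos pos' by (intro sum_mono mult_left_mono) auto
    then show "feasible_layout P L'" using g unfolding feasible_layout_def by simp
  next
    fix e i assume "e \<in> ?E" "i \<in> {1..?m}"
    then have "(\<Sum>\<kappa> \<in> ?K. G' \<kappa> e i) / of_rat (capacity P i) \<le> real (L' e i)"
      unfolding L'_def using real_nat_ceiling_ge by blast
    then show "(\<Sum>\<kappa> \<in> ?K. G' \<kappa> e i) \<le> of_rat (capacity P i) * real (L' e i)"
      using pos'(4)[of i] \<open>i \<in> {1..?m}\<close> by (simp add: divide_le_eq mult.commute)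
  next
    have "(\<Sum>e \<in> ?E. of_rat (weight P e) * (\<Sum>i = 0..?m. of_rat (travel_time P i) * (\<Sum>\<kappa> \<in> ?K. G' \<kappa> e i))) \<le>
        (\<Sum>e \<in> ?E. real_of_rat (weight P e) * (\<Sum>i = 0..?m. of_rat (travel_time P i) * (\<Sum>\<kappa> \<in> ?K. G \<kappa> e i)))"
      by (rule sum_mono, rule mult_left_mono, rule sum_mono, rule mult_left_mono, rule SG) (use pos pos' in auto)
    then show "(\<Sum>e \<in> ?E. of_rat (weight P e) * (\<Sum>i = 0..?m. of_rat (travel_time P i) * (\<Sum>\<kappa> \<in> ?K. G' \<kappa> e i)))
       \<le> real_of_rat (time_bound P)" using g by linarith
  next
    have "(\<Sum>e \<in> ?E. of_rat (weight P e) * (of_rat (energy P 0) * (\<Sum>\<kappa> \<in> ?K. G' \<kappa> e 0) +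
       (\<Sum>i = 1..?m. of_rat (energy P i) * real (L' e i)))) \<le>
      (\<Sum>e \<in> ?E. real_of_rat (weight P e) * (of_rat (energy P 0) * (\<Sum>\<kappa> \<in> ?K. G \<kappa> e 0) +
       (\<Sum>i = 1..?m. of_rat (energy P i) * real (L e i))))"
      by (rule sum_mono, rule mult_left_mono, rule add_mono, rule mult_left_mono, rule SG)
        (use pos pos' L'L in \<open>auto intro!: sum_mono mult_left_mono\<close>)
    then show "(\<Sum>e \<in> ?E. of_rat (weight P e) * (of_rat (energy P 0) * (\<Sum>\<kappa> \<in> ?K. G' \<kappa> e 0) +
       (\<Sum>i = 1..?m. of_rat (energy P i) * real (L' e i)))) \<le> real_of_rat (energy_bound P)" using g by linarith
  qed
  moreover have "of_rat (capacity P i) * real (L' e i) \<le> real (\<Sum>\<kappa> \<in> ?K. demand P \<kappa>) + of_rat (capacity P i)"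
    if "e \<in> ?E" "i \<in> {1..?m}" for e i
  proof -
    have c: "0 < real_of_rat (capacity P i)" using pos'(4)[of i] that by simp
    have "0 \<le> (\<Sum>\<kappa> \<in> ?K. G' \<kappa> e i) / of_rat (capacity P i)" using S0[of e i] that c by simp
    then have "real (L' e i) \<le> (\<Sum>\<kappa> \<in> ?K. G' \<kappa> e i) / of_rat (capacity P i) + 1"
      unfolding L'_def by linarith
    then have "of_rat (capacity P i) * real (L' e i) \<le> of_rat (capacity P i) * ((\<Sum>\<kappa> \<in> ?K. G' \<kappa> e i) / of_rat (capacity P i) + 1)"
      using c by (intro mult_left_mono) auto
    also have "\<dots> = (\<Sum>\<kappa> \<in> ?K. G' \<kappa> e i) + of_rat (capacity P i)" using c by (simp add: field_simps)
    finally show ?thesis using SD[of e i] that by simp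
  qed
  ultimately show ?thesis by blast
qed

text \<open>Each inequality gets a slack variable, so the system of equations has at most
  \<open>card X + card R\<close> unknowns.\<close>

lemma small_rational_solution_le:
  fixes A :: "'r \<Rightarrow> 'v \<Rightarrow> int" and b :: "'r \<Rightarrow> int" and x :: "'v \<Rightarrow> real"
  assumes fin: "finite X" "finite R" and Le: "Le \<subseteq> R"
    and nonneg: "\<forall>j \<in> X. 0 \<le> x j"
    and eq: "\<forall>i \<in> R - Le. (\<Sum>j \<in> X. real_of_int (A i j) * x j) = real_of_int (b i)"
    and le: "\<forall>i \<in> Le. (\<Sum>j \<in> X. real_of_int (A i j) * x j) \<le> real_of_int (b i)"
    and bound: "\<forall>i \<in> R. \<forall>j \<in> X. \<bar>A i j\<bar> \<le> int U" "\<forall>i \<in> R. \<bar>b i\<bar> \<le> int U" "1 \<le> U"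
  defines "n \<equiv> card X + card R"
  shows "\<exists>(p :: 'v \<Rightarrow> nat) q. 1 \<le> q \<and> q \<le> fact n * (card R * U ^ 2 + 1) ^ n \<and>
    (\<forall>j \<in> X. p j \<le> fact n * (card R * U ^ 2 + 1) ^ n) \<and>
    (\<forall>i \<in> R - Le. (\<Sum>j \<in> X. A i j * int (p j)) = b i * int q) \<and>
    (\<forall>i \<in> Le. (\<Sum>j \<in> X. A i j * int (p j)) \<le> b i * int q)"
proof -
  define X' where "X' = Inl ` X \<union> Inr ` Le"
  define A' where "A' i j = (case j of Inl j \<Rightarrow> A i j | Inr l \<Rightarrow> of_bool (i = l))" for i :: 'r and j :: "'v + 'r"
  define x' where "x' j = (case j of Inl j \<Rightarrow> x j | Inr l \<Rightarrow> real_of_int (b l) - (\<Sum>j \<in> X. real_of_int (A l j) * x j))" for j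
  have finLe: "finite Le" using Le fin(2) by (rule finite_subset)
  have finX': "finite X'" using fin finLe by (simp add: X'_def)
  have split: "(\<Sum>j \<in> X'. f j) = (\<Sum>j \<in> X. f (Inl j)) + (\<Sum>l \<in> Le. f (Inr l))" for f :: "'v + 'r \<Rightarrow> 'c::comm_monoid_add"
    unfolding X'_def using fin(1) finLe by (subst sum.union_disjoint) (auto simp: sum.reindex)
  have card: "card X' = card X + card Le"
    unfolding X'_def using fin(1) finLe by (subst card_Un_disjoint) (auto simp: card_image)
  have d: "(\<Sum>l \<in> Le. of_bool (i = l) * f l) = (if i \<in> Le then f i else 0)" for i and f :: "'r \<Rightarrow> 'c::comm_ring_1"
    using finLe by (simp add: sum.delta' flip: of_bool_def)
  have sol: "\<forall>i \<in> R. (\<Sum>j \<in> X'. real_of_int (A' i j) * x' j) = real_of_int (b i)"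
  proof
    fix i assume i: "i \<in> R"
    have "(\<Sum>j \<in> X'. real_of_int (A' i j) * x' j) = (\<Sum>j \<in> X. real_of_int (A i j) * x j) +
        (if i \<in> Le then real_of_int (b i) - (\<Sum>j \<in> X. real_of_int (A i j) * x j) else 0)"
      unfolding split A'_def x'_def sum.case d[of i "\<lambda>l. real_of_int (b l) - (\<Sum>j \<in> X. real_of_int (A l j) * x j)", symmetric]
      by simp
    then show "(\<Sum>j \<in> X'. real_of_int (A' i j) * x' j) = real_of_int (b i)" using i eq by auto
  qed
  have nn: "\<forall>j \<in> X'. 0 \<le> x' j" using nonneg le by (auto simp: X'_def x'_def)
  have bd: "\<forall>i \<in> R. \<forall>j \<in> X'. \<bar>A' i j\<bar> \<le> int U" using bound(1,3) by (auto simp: X'_def A'_def)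
  obtain p q where pq: "1 \<le> q" "q \<le> fact (card X') * (card R * U ^ 2 + 1) ^ card X'"
    "\<forall>j \<in> X'. p j \<le> fact (card X') * (card R * U ^ 2 + 1) ^ card X'"
    "\<forall>i \<in> R. (\<Sum>j \<in> X'. A' i j * int (p j)) = b i * int q"
    using small_rational_solution[OF finX' fin(2) nn sol bd bound(2)] by blast
  have "card X' \<le> n" unfolding card n_def using card_mono[OF fin(2) Le] by simp
  then have W: "fact (card X') * (card R * U ^ 2 + 1) ^ card X' \<le> (fact n * (card R * U ^ 2 + 1) ^ n :: nat)"
    by (intro mult_le_mono fact_mono power_increasing) auto
  have s: "(\<Sum>j \<in> X. A i j * int (p (Inl j))) + (if i \<in> Le then int (p (Inr i)) else 0) = b i * int q" if "i \<in> R" for i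
    using pq(4)[rule_format, OF that] unfolding split A'_def sum.case d .
  show ?thesis
  proof (intro exI[of _ "\<lambda>j. p (Inl j)"] exI[of _ q] conjI ballI)
    show "q \<le> fact n * (card R * U\<^sup>2 + 1) ^ n" using pq(2) W by (rule le_trans)
    show "p (Inl j) \<le> fact n * (card R * U\<^sup>2 + 1) ^ n" if "j \<in> X" for j
      using pq(3) that by (intro le_trans[OF _ W]) (simp add: X'_def)
    show "(\<Sum>j \<in> X. A i j * int (p (Inl j))) = b i * int q" if "i \<in> R - Le" for i using s[of i] that by simp
    show "(\<Sum>j \<in> X. A i j * int (p (Inl j))) \<le> b i * int q" if "i \<in> Le" for i using s[of i] that Le by auto
  qed (rule pq(1))
qed

section \<open>The integral linear system of an instance with a given layout\<close>

datatype 'v row = Flow_row "'v \<times> 'v" 'v | Cap_row "'v \<times> 'v" nat | Time_row | Energy_row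

text \<open>A common denominator \<open>\<Delta>\<close> of all data makes every constraint one
  between natural numbers, which the verifier can check.\<close>

locale scaled_msp =
  fixes P :: "'v msp_instance" and \<Delta> :: nat and W :: "'v \<times> 'v \<Rightarrow> nat" and T H C Q :: "nat \<Rightarrow> nat" and B a b :: nat
  assumes valid: "valid_instance P" and scale: "1 \<le> \<Delta>"
    and weight: "\<And>e. e \<in> parcs (graph P) \<Longrightarrow> weight P e = of_nat (W e) / of_nat \<Delta>"
    and travel_time: "\<And>i. i \<le> modes P \<Longrightarrow> travel_time P i = of_nat (T i) / of_nat \<Delta>"
    and energy: "\<And>i. i \<le> modes P \<Longrightarrow> energy P i = of_nat (H i) / of_nat \<Delta>"
    and cost: "\<And>i. i \<le> modes P \<Longrightarrow> cost P i = of_nat (C i) / of_nat \<Delta>"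
    and capacity: "\<And>i. i \<le> modes P \<Longrightarrow> capacity P i = of_nat (Q i) / of_nat \<Delta>"
    and budget: "budget P = of_nat B / of_nat \<Delta>"
    and time_bound: "time_bound P = of_nat a / of_nat \<Delta>"
    and energy_bound: "energy_bound P = of_nat b / of_nat \<Delta>"
begin

abbreviation "E \<equiv> parcs (graph P)"
abbreviation "K \<equiv> commodities P"
abbreviation "m \<equiv> modes P"

text \<open>The constraints of \<open>mode_flow\<close> for the flows \<open>g / q\<close>, cleared
  of denominators. Products of two scaled data carry \<open>\<Delta>\<close> twice and a bound
  carries it once, hence the factor \<open>\<Delta>\<close> on the right; the factor
  \<open>q\<close> accompanies every term without \<open>g\<close> where flows occur.\<close>

definition int_solution :: "nat \<Rightarrow> 'v layout \<Rightarrow> ('v \<times> 'v \<Rightarrow> 'v \<times> 'v \<Rightarrow> nat \<Rightarrow> nat) \<Rightarrow> bool" where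
  "int_solution q L g \<longleftrightarrow>
     (\<forall>\<kappa> \<in> K. \<forall>v \<in> pverts (graph P). int (\<Sum>e \<in> {e \<in> E. snd e = v}. \<Sum>i = 0..m. g \<kappa> e i) -
        int (\<Sum>e \<in> {e \<in> E. fst e = v}. \<Sum>i = 0..m. g \<kappa> e i) =
        (if v = snd \<kappa> then int (demand P \<kappa> * q) else if v = fst \<kappa> then - int (demand P \<kappa> * q) else 0)) \<and>
     (\<Sum>e \<in> E. W e * (\<Sum>i = 1..m. C i * L e i)) \<le> B * \<Delta> \<and>
     (\<forall>e \<in> E. \<forall>i \<in> {1..m}. \<Delta> * (\<Sum>\<kappa> \<in> K. g \<kappa> e i) \<le> Q i * L e i * q) \<and>
     (\<Sum>e \<in> E. W e * (\<Sum>i = 0..m. T i * (\<Sum>\<kappa> \<in> K. g \<kappa> e i))) \<le> a * \<Delta> * q \<and>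
     (\<Sum>e \<in> E. W e * (H 0 * (\<Sum>\<kappa> \<in> K. g \<kappa> e 0) + (\<Sum>i = 1..m. H i * L e i * q))) \<le> b * \<Delta> * q"

lemma of_rat_scaled: "real_of_rat (of_nat k / of_nat \<Delta>) = real k / real \<Delta>"
  by (simp add: of_rat_divide)

lemmas real_data = weight[THEN arg_cong[of _ _ real_of_rat], unfolded of_rat_scaled]
  travel_time[THEN arg_cong[of _ _ real_of_rat], unfolded of_rat_scaled]
  energy[THEN arg_cong[of _ _ real_of_rat], unfolded of_rat_scaled]
  capacity[THEN arg_cong[of _ _ real_of_rat], unfolded of_rat_scaled]
  time_bound[THEN arg_cong[of _ _ real_of_rat], unfolded of_rat_scaled]
  energy_bound[THEN arg_cong[of _ _ real_of_rat], unfolded of_rat_scaled]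

lemma layout_iff: "feasible_layout P L \<longleftrightarrow> (\<Sum>e \<in> E. W e * (\<Sum>i = 1..m. C i * L e i)) \<le> B * \<Delta>"
proof -
  have "(\<Sum>e \<in> E. weight P e * (\<Sum>i = 1..m. cost P i * of_nat (L e i))) =
      (\<Sum>e \<in> E. (of_nat (W e) / of_nat \<Delta>) * (\<Sum>i = 1..m. (of_nat (C i) / of_nat \<Delta>) * of_nat (L e i)))"
    by (rule sum.cong[OF refl]) (simp add: weight cost)
  also have "\<dots> = of_nat (\<Sum>e \<in> E. W e * (\<Sum>i = 1..m. C i * L e i)) / (of_nat \<Delta> * of_nat \<Delta>)"
    by (simp add: sum_divide_distrib sum_distrib_left)
  finally have "feasible_layout P L \<longleftrightarrow>
      rat_of_nat (\<Sum>e \<in> E. W e * (\<Sum>i = 1..m. C i * L e i)) / (of_nat \<Delta> * of_nat \<Delta>) \<le> of_nat B / of_nat \<Delta>"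
    unfolding feasible_layout_def budget by simp
  also have "\<dots> \<longleftrightarrow> rat_of_nat (\<Sum>e \<in> E. W e * (\<Sum>i = 1..m. C i * L e i)) \<le> of_nat (B * \<Delta>)"
    using scale by (simp add: divide_le_eq field_simps)
  finally show ?thesis by (simp only: of_nat_le_iff)
qed

lemma cap_iff:
  assumes "i \<in> {1..m}" "1 \<le> q"
  shows "(s / real q \<le> of_rat (capacity P i) * real l) \<longleftrightarrow> real \<Delta> * s \<le> real (Q i * l * q)"
proof -
  have c: "real_of_rat (capacity P i) = real (Q i) / real \<Delta>" using real_data(4) assms(1) by simp
  show ?thesis unfolding c using assms(2) scale by (simp add: field_simps)
qed

lemma time_eq:
  "(\<Sum>e \<in> E. of_rat (weight P e) * (\<Sum>i = 0..m. of_rat (travel_time P i) * s e i)) =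
     (\<Sum>e \<in> E. real (W e) * (\<Sum>i = 0..m. real (T i) * s e i)) / (real \<Delta> * real \<Delta>)"
proof -
  have "(\<Sum>e \<in> E. of_rat (weight P e) * (\<Sum>i = 0..m. of_rat (travel_time P i) * s e i)) =
      (\<Sum>e \<in> E. (real (W e) / real \<Delta>) * (\<Sum>i = 0..m. (real (T i) / real \<Delta>) * s e i))"
    by (rule sum.cong[OF refl]) (simp add: real_data)
  also have "\<dots> = (\<Sum>e \<in> E. real (W e) * (\<Sum>i = 0..m. real (T i) * s e i)) / (real \<Delta> * real \<Delta>)"
    by (simp add: sum_divide_distrib sum_distrib_left)
  finally show ?thesis .
qed

lemma energy_eq:
  "(\<Sum>e \<in> E. of_rat (weight P e) * (of_rat (energy P 0) * s e + (\<Sum>i = 1..m. of_rat (energy P i) * real (L e i)))) =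
     (\<Sum>e \<in> E. real (W e) * (real (H 0) * s e + (\<Sum>i = 1..m. real (H i) * real (L e i)))) / (real \<Delta> * real \<Delta>)"
proof -
  have "(\<Sum>e \<in> E. of_rat (weight P e) * (of_rat (energy P 0) * s e + (\<Sum>i = 1..m. of_rat (energy P i) * real (L e i)))) =
      (\<Sum>e \<in> E. (real (W e) / real \<Delta>) * ((real (H 0) / real \<Delta>) * s e + (\<Sum>i = 1..m. (real (H i) / real \<Delta>) * real (L e i))))"
    by (rule sum.cong[OF refl]) (simp add: real_data)
  also have "\<dots> = (\<Sum>e \<in> E. real (W e) * (real (H 0) * s e + (\<Sum>i = 1..m. real (H i) * real (L e i)))) / (real \<Delta> * real \<Delta>)"
    by (simp add: sum_divide_distrib sum_distrib_left distrib_left add_divide_distrib)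
  finally show ?thesis .
qed

lemma mode_flow_iff_int_solution:
  assumes q: "1 \<le> q"
  shows "mode_flow P L (\<lambda>\<kappa> e i. real (g \<kappa> e i) / real q) \<longleftrightarrow> int_solution q L g"
proof -
  have D: "real \<Delta> > 0" and q0: "real q > 0" using scale q by auto
  have 1: "net_flow E (\<lambda>e. \<Sum>i = 0..m. real (g \<kappa> e i) / real q) v =
      (if v = snd \<kappa> then real (demand P \<kappa>) else if v = fst \<kappa> then - real (demand P \<kappa>) else 0) \<longleftrightarrow>
    int (\<Sum>e \<in> {e \<in> E. snd e = v}. \<Sum>i = 0..m. g \<kappa> e i) - int (\<Sum>e \<in> {e \<in> E. fst e = v}. \<Sum>i = 0..m. g \<kappa> e i) =
      (if v = snd \<kappa> then int (demand P \<kappa> * q) else if v = fst \<kappa> then - int (demand P \<kappa> * q) else 0)"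
    (is "?l = ?r \<longleftrightarrow> ?l' = ?r'") for \<kappa> v
  proof -
    have l: "?l = real_of_int ?l' / real q"
      by (simp add: net_flow_def diff_divide_distrib sum_divide_distrib)
    have r: "?r = real_of_int ?r' / real q" using q0 by simp
    show ?thesis unfolding l r using q0 by (simp del: of_int_of_nat_eq of_int_diff)
  qed
  have 2: "(\<Sum>\<kappa> \<in> K. real (g \<kappa> e i) / real q) = real (\<Sum>\<kappa> \<in> K. g \<kappa> e i) / real q" for e i
    by (simp add: sum_divide_distrib)
  have 3: "((\<Sum>\<kappa> \<in> K. real (g \<kappa> e i) / real q) \<le> of_rat (capacity P i) * real (L e i)) \<longleftrightarrow>
      \<Delta> * (\<Sum>\<kappa> \<in> K. g \<kappa> e i) \<le> Q i * L e i * q" if "i \<in> {1..m}" for e i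
    unfolding 2 cap_iff[OF that q] of_nat_mult[symmetric] by (rule of_nat_le_iff)
  have 4: "((\<Sum>e \<in> E. of_rat (weight P e) * (\<Sum>i = 0..m. of_rat (travel_time P i) * (\<Sum>\<kappa> \<in> K. real (g \<kappa> e i) / real q)))
      \<le> real_of_rat (time_bound P)) \<longleftrightarrow> (\<Sum>e \<in> E. W e * (\<Sum>i = 0..m. T i * (\<Sum>\<kappa> \<in> K. g \<kappa> e i))) \<le> a * \<Delta> * q"
  proof -
    have "(\<Sum>e \<in> E. real (W e) * (\<Sum>i = 0..m. real (T i) * (real (s e i) / real q))) / (real \<Delta> * real \<Delta>) =
        real (\<Sum>e \<in> E. W e * (\<Sum>i = 0..m. T i * s e i)) / (real q * (real \<Delta> * real \<Delta>))" for s
      by (simp add: sum_divide_distrib sum_distrib_left)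
    from this[of "\<lambda>e i. \<Sum>\<kappa> \<in> K. g \<kappa> e i"]
    have "(\<Sum>e \<in> E. real (W e) * (\<Sum>i = 0..m. real (T i) * (real (\<Sum>\<kappa> \<in> K. g \<kappa> e i) / real q))) / (real \<Delta> * real \<Delta>) =
        real (\<Sum>e \<in> E. W e * (\<Sum>i = 0..m. T i * (\<Sum>\<kappa> \<in> K. g \<kappa> e i))) / (real q * (real \<Delta> * real \<Delta>))" .
    also have "\<dots> \<le> real a / real \<Delta> \<longleftrightarrow>
        real (\<Sum>e \<in> E. W e * (\<Sum>i = 0..m. T i * (\<Sum>\<kappa> \<in> K. g \<kappa> e i))) \<le> real (a * \<Delta> * q)"
      using D q0 by (simp add: divide_le_eq del: of_nat_sum) (simp add: field_simps del: of_nat_sum)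
    finally show ?thesis unfolding 2 time_eq real_data of_nat_le_iff .
  qed
  have 5: "((\<Sum>e \<in> E. of_rat (weight P e) * (of_rat (energy P 0) * (\<Sum>\<kappa> \<in> K. real (g \<kappa> e 0) / real q) +
       (\<Sum>i = 1..m. of_rat (energy P i) * real (L e i)))) \<le> real_of_rat (energy_bound P)) \<longleftrightarrow>
     (\<Sum>e \<in> E. W e * (H 0 * (\<Sum>\<kappa> \<in> K. g \<kappa> e 0) + (\<Sum>i = 1..m. H i * L e i * q))) \<le> b * \<Delta> * q"
  proof -
    have i: "real (H 0) * (real x / real q) + (\<Sum>i = 1..m. real (H i) * real (L e i)) =
        real (H 0 * x + (\<Sum>i = 1..m. H i * L e i * q)) / real q" for x e
      using q0 by (simp add: add_divide_distrib sum_divide_distrib)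
    have "(\<Sum>e \<in> E. real (W e) * (real (H 0) * (real (\<Sum>\<kappa> \<in> K. g \<kappa> e 0) / real q) + (\<Sum>i = 1..m. real (H i) * real (L e i)))) / (real \<Delta> * real \<Delta>) =
        real (\<Sum>e \<in> E. W e * (H 0 * (\<Sum>\<kappa> \<in> K. g \<kappa> e 0) + (\<Sum>i = 1..m. H i * L e i * q))) / (real q * (real \<Delta> * real \<Delta>))"
      (is "?x = ?y")
      unfolding i of_nat_sum[of _ E] of_nat_mult[of "W _"] sum_divide_distrib by simp
    then have xy: "(?x \<le> z) = (?y \<le> z)" for z by (simp only:)
    have yz: "?y \<le> real b / real \<Delta> \<longleftrightarrow>
        real (\<Sum>e \<in> E. W e * (H 0 * (\<Sum>\<kappa> \<in> K. g \<kappa> e 0) + (\<Sum>i = 1..m. H i * L e i * q))) \<le> real (b * \<Delta> * q)"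
      using D q0 by (simp add: divide_le_eq del: of_nat_sum of_nat_add) (simp add: field_simps del: of_nat_sum of_nat_add)
    show ?thesis unfolding 2 energy_eq real_data(6) xy yz of_nat_le_iff ..
  qed
  have 6: "(\<forall>\<kappa> \<in> K. \<forall>e \<in> E. \<forall>i \<in> {0..m}. 0 \<le> real (g \<kappa> e i) / real q)" by simp
  show ?thesis
    unfolding mode_flow_def int_solution_def 1 4 5 layout_iff using 3 6 by blast
qed

text \<open>With \<open>L\<close> fixed only the flows are unknown. \<open>n\<close> bounds the
  number of unknowns plus that of rows, and each coefficient or right-hand side is at most a product
  of two data, whence \<open>N ^ 2\<close>.\<close>

lemma exists_small_int_solution:
  fixes N :: nat
  assumes LG: "mode_flow P L G" and N: "\<Delta> \<le> N" "\<forall>e \<in> E. W e \<le> N" "\<forall>i \<le> m. T i \<le> N \<and> H i \<le> N \<and> Q i \<le> N"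
    "a \<le> N" "b \<le> N" "\<forall>\<kappa> \<in> K. demand P \<kappa> \<le> N" "\<forall>e \<in> E. \<forall>i \<in> {1..m}. L e i \<le> N" "1 \<le> N"
  defines "n \<equiv> card K * card E * Suc m + (card K * card (pverts (graph P)) + card E * m + 2)"
  defines "S \<equiv> fact n * (n * (N ^ 2) ^ 2 + 1) ^ n"
  shows "\<exists>q g. 1 \<le> q \<and> q \<le> S \<and> (\<forall>\<kappa> \<in> K. \<forall>e \<in> E. \<forall>i \<le> m. g \<kappa> e i \<le> S) \<and> int_solution q L g"
proof -
  note G = LG[unfolded mode_flow_def]
  interpret pair_fin_digraph "graph P" using valid by (simp add: valid_instance_def)
  have fin: "finite E" "finite K" "finite (pverts (graph P))"
    using pair_finite_arcs pair_finite_verts finite_commodities[OF valid] by auto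
  let ?V = "pverts (graph P)"
  define X where "X = K \<times> E \<times> {0..m}"
  define Fr where "Fr = (\<lambda>(\<kappa>, v). Flow_row \<kappa> v) ` (K \<times> ?V)"
  define Cr where "Cr = (\<lambda>(e, i). Cap_row e i) ` (E \<times> {1..m})"
  define Le where "Le = Cr \<union> {Time_row, Energy_row}"
  define R where "R = Fr \<union> Le"
  define A where "A r x = (case r of
      Flow_row \<kappa> v \<Rightarrow> (if fst x = \<kappa> then of_bool (snd (fst (snd x)) = v) - of_bool (fst (fst (snd x)) = v) else 0)
    | Cap_row e i \<Rightarrow> (if snd x = (e, i) then int \<Delta> else 0)
    | Time_row \<Rightarrow> int (W (fst (snd x)) * T (snd (snd x)))
    | Energy_row \<Rightarrow> (if snd (snd x) = 0 then int (W (fst (snd x)) * H 0) else 0))"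
    for r and x :: "('v \<times> 'v) \<times> ('v \<times> 'v) \<times> nat"
  \<comment> \<open>The energy of the layout is a constant here and moves to the right-hand
    side.\<close>
  define rhs where "rhs r = (case r of
      Flow_row \<kappa> v \<Rightarrow> (if v = snd \<kappa> then int (demand P \<kappa>) else if v = fst \<kappa> then - int (demand P \<kappa>) else 0)
    | Cap_row e i \<Rightarrow> int (Q i * L e i)
    | Time_row \<Rightarrow> int (a * \<Delta>)
    | Energy_row \<Rightarrow> int (b * \<Delta>) - int (\<Sum>e \<in> E. W e * (\<Sum>i = 1..m. H i * L e i)))" for r
  have fX: "finite X" using fin by (simp add: X_def)
  have fR: "finite R" using fin by (simp add: R_def Fr_def Cr_def Le_def)
  have sX: "(\<Sum>x \<in> X. f x) = (\<Sum>\<kappa> \<in> K. \<Sum>e \<in> E. \<Sum>i = 0..m. f (\<kappa>, e, i))" for f :: "_ \<Rightarrow> 'c::comm_monoid_add"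
    unfolding X_def using fin by (simp add: sum.cartesian_product case_prod_beta)
  have row_flow: "(\<Sum>x \<in> X. of_int (A (Flow_row \<kappa> v) x) * f x) =
      (\<Sum>e \<in> {e \<in> E. snd e = v}. \<Sum>i = 0..m. f (\<kappa>, e, i)) - (\<Sum>e \<in> {e \<in> E. fst e = v}. \<Sum>i = 0..m. f (\<kappa>, e, i))"
    if "\<kappa> \<in> K" for \<kappa> v and f :: "_ \<Rightarrow> 'c::comm_ring_1"
  proof -
    have "(\<Sum>x \<in> X. of_int (A (Flow_row \<kappa> v) x) * f x) =
        (\<Sum>\<kappa>' \<in> K. if \<kappa>' = \<kappa> then (\<Sum>e \<in> E. \<Sum>i = 0..m. (of_bool (snd e = v) - of_bool (fst e = v)) * f (\<kappa>, e, i)) else 0)"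
      unfolding sX A_def by (intro sum.cong refl) (auto split: if_splits)
    also have "\<dots> = (\<Sum>e \<in> E. \<Sum>i = 0..m. (of_bool (snd e = v) - of_bool (fst e = v)) * f (\<kappa>, e, i))"
      using fin that by (simp add: sum.delta)
    also have "\<dots> = (\<Sum>e \<in> E. (if snd e = v then \<Sum>i = 0..m. f (\<kappa>, e, i) else 0) - (if fst e = v then \<Sum>i = 0..m. f (\<kappa>, e, i) else 0))"
      by (intro sum.cong refl) (simp add: sum_negf)
    also have "\<dots> = (\<Sum>e \<in> {e \<in> E. snd e = v}. \<Sum>i = 0..m. f (\<kappa>, e, i)) - (\<Sum>e \<in> {e \<in> E. fst e = v}. \<Sum>i = 0..m. f (\<kappa>, e, i))"
      unfolding sum_subtractf using fin by (simp add: sum.inter_filter)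
    finally show ?thesis .
  qed
  have row_cap: "(\<Sum>x \<in> X. of_int (A (Cap_row e i) x) * f x) = of_nat \<Delta> * (\<Sum>\<kappa> \<in> K. f (\<kappa>, e, i))"
    if "e \<in> E" "i \<in> {1..m}" for e i and f :: "_ \<Rightarrow> 'c::comm_ring_1"
  proof -
    have "(\<Sum>x \<in> X. of_int (A (Cap_row e i) x) * f x) =
        (\<Sum>\<kappa> \<in> K. \<Sum>e' \<in> E. \<Sum>i' = 0..m. if e' = e then (if i' = i then of_nat \<Delta> * f (\<kappa>, e, i) else 0) else 0)"
      unfolding sX A_def by (intro sum.cong refl) auto
    also have "\<dots> = (\<Sum>\<kappa> \<in> K. \<Sum>e' \<in> E. if e' = e then (\<Sum>i' = 0..m. if i' = i then of_nat \<Delta> * f (\<kappa>, e, i) else 0) else 0)"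
      by (intro sum.cong refl) auto
    also have "\<dots> = (\<Sum>\<kappa> \<in> K. of_nat \<Delta> * f (\<kappa>, e, i))"
      using fin that by (simp add: sum.delta)
    finally show ?thesis by (simp add: sum_distrib_left)
  qed
  have swap: "(\<Sum>\<kappa> \<in> K. \<Sum>e \<in> E. h \<kappa> e) = (\<Sum>e \<in> E. \<Sum>\<kappa> \<in> K. h \<kappa> e)" for h :: "_ \<Rightarrow> _ \<Rightarrow> 'c::comm_ring_1"
    by (rule sum.swap)
  have row_time: "(\<Sum>x \<in> X. of_int (A Time_row x) * f x) =
      (\<Sum>e \<in> E. of_nat (W e) * (\<Sum>i = 0..m. of_nat (T i) * (\<Sum>\<kappa> \<in> K. f (\<kappa>, e, i))))" for f :: "_ \<Rightarrow> 'c::comm_ring_1"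
  proof -
    have "(\<Sum>x \<in> X. of_int (A Time_row x) * f x) = (\<Sum>e \<in> E. \<Sum>\<kappa> \<in> K. \<Sum>i = 0..m. of_nat (W e) * (of_nat (T i) * f (\<kappa>, e, i)))"
      unfolding sX swap A_def by (simp add: mult.assoc)
    also have "\<dots> = (\<Sum>e \<in> E. of_nat (W e) * (\<Sum>i = 0..m. of_nat (T i) * (\<Sum>\<kappa> \<in> K. f (\<kappa>, e, i))))"
      unfolding sum_distrib_left by (intro sum.cong refl) (rule sum.swap)
    finally show ?thesis .
  qed
  have row_energy: "(\<Sum>x \<in> X. of_int (A Energy_row x) * f x) = (\<Sum>e \<in> E. of_nat (W e) * (of_nat (H 0) * (\<Sum>\<kappa> \<in> K. f (\<kappa>, e, 0))))"
    for f :: "_ \<Rightarrow> 'c::comm_ring_1"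
  proof -
    have "(\<Sum>x \<in> X. of_int (A Energy_row x) * f x) =
        (\<Sum>e \<in> E. \<Sum>\<kappa> \<in> K. \<Sum>i = 0..m. if i = 0 then of_nat (W e) * (of_nat (H 0) * f (\<kappa>, e, 0)) else 0)"
      unfolding sX swap A_def by (intro sum.cong refl) (auto simp: mult.assoc)
    also have "\<dots> = (\<Sum>e \<in> E. \<Sum>\<kappa> \<in> K. of_nat (W e) * (of_nat (H 0) * f (\<kappa>, e, 0)))"
      by (simp only: sum.delta finite_atLeastAtMost) simp
    finally show ?thesis by (simp add: sum_distrib_left)
  qed
  define x where "x = (\<lambda>(\<kappa>, e, i). G \<kappa> e i)"
  have x0: "\<forall>j \<in> X. 0 \<le> x j" using G by (auto simp: X_def x_def)
  have D: "real \<Delta> > 0" using scale by simp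
  have DD: "s / (real \<Delta> * real \<Delta>) \<le> real k / real \<Delta> \<longleftrightarrow> s \<le> real (k * \<Delta>)" for s k
    using D by (simp add: divide_le_eq field_simps)
  have eq: "\<forall>r \<in> R - Le. (\<Sum>j \<in> X. real_of_int (A r j) * x j) = real_of_int (rhs r)"
  proof
    fix r assume "r \<in> R - Le"
    then obtain \<kappa> v where r: "r = Flow_row \<kappa> v" "\<kappa> \<in> K" "v \<in> ?V" by (auto simp: R_def Fr_def)
    show "(\<Sum>j \<in> X. real_of_int (A r j) * x j) = real_of_int (rhs r)"
      unfolding r(1) row_flow[OF r(2)] using G r(2,3) by (simp add: x_def rhs_def net_flow_def)
  qed
  have energy_le: "(\<Sum>e \<in> E. real (W e) * (real (H 0) * (\<Sum>\<kappa> \<in> K. G \<kappa> e 0))) + real (\<Sum>e \<in> E. W e * (\<Sum>i = 1..m. H i * L e i)) \<le> real (b * \<Delta>)"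
  proof -
    have "(\<Sum>e \<in> E. real (W e) * (real (H 0) * (\<Sum>\<kappa> \<in> K. G \<kappa> e 0) + (\<Sum>i = 1..m. real (H i) * real (L e i)))) \<le> real (b * \<Delta>)"
      using G unfolding energy_eq real_data DD by blast
    then show ?thesis by (simp add: distrib_left sum.distrib)
  qed
  have le: "\<forall>r \<in> Le. (\<Sum>j \<in> X. real_of_int (A r j) * x j) \<le> real_of_int (rhs r)"
  proof
    fix r assume "r \<in> Le"
    then consider (c) e i where "r = Cap_row e i" "e \<in> E" "i \<in> {1..m}" | (t) "r = Time_row" | (h) "r = Energy_row"
      by (auto simp: Le_def Cr_def)
    then show "(\<Sum>j \<in> X. real_of_int (A r j) * x j) \<le> real_of_int (rhs r)"
    proof cases
      case c
      have "(\<Sum>\<kappa> \<in> K. G \<kappa> e i) / real 1 \<le> of_rat (capacity P i) * real (L e i)" using G c by simp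
      then have "real \<Delta> * (\<Sum>\<kappa> \<in> K. G \<kappa> e i) \<le> real (Q i * L e i * 1)"
        by (subst (asm) cap_iff) (use c in auto)
      then show ?thesis unfolding c(1) row_cap[OF c(2,3)] by (simp add: x_def rhs_def)
    next
      case t
      have "(\<Sum>e \<in> E. real (W e) * (\<Sum>i = 0..m. real (T i) * (\<Sum>\<kappa> \<in> K. G \<kappa> e i))) \<le> real (a * \<Delta>)"
        using G unfolding time_eq real_data DD by blast
      then show ?thesis unfolding t row_time by (simp add: x_def rhs_def)
    next
      case h
      then show ?thesis using energy_le unfolding h row_energy by (simp add: x_def rhs_def)
    qed
  qed
  have N2: "x * y \<le> N ^ 2" if "x \<le> N" "y \<le> N" for x y
    unfolding power2_eq_square using that by (rule mult_le_mono)
  have N1: "N \<le> N ^ 2" using N(8) by (simp add: power2_eq_square)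
  have bA: "\<forall>r \<in> R. \<forall>j \<in> X. \<bar>A r j\<bar> \<le> int (N ^ 2)"
  proof (intro ballI)
    fix r j assume "r \<in> R" and j: "j \<in> X"
    obtain \<kappa> e i where ji: "j = (\<kappa>, e, i)" "e \<in> E" "i \<le> m" using j by (auto simp: X_def)
    have 1: "1 \<le> N ^ 2" using N(8) N1 by linarith
    have "W e * T i \<le> N ^ 2" "W e * H 0 \<le> N ^ 2" "\<Delta> \<le> N ^ 2"
      using N ji N1 by (auto intro!: N2)
    then show "\<bar>A r j\<bar> \<le> int (N ^ 2)"
      using 1 unfolding A_def ji(1)
      by (cases r) (auto simp: of_bool_def simp flip: of_nat_mult of_nat_power)
  qed
  have bb: "\<forall>r \<in> R. \<bar>rhs r\<bar> \<le> int (N ^ 2)"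
  proof
    fix r assume "r \<in> R"
    then consider (f) \<kappa> v where "r = Flow_row \<kappa> v" "\<kappa> \<in> K" | (c) e i where "r = Cap_row e i" "e \<in> E" "i \<in> {1..m}" | (t) "r = Time_row" | (h) "r = Energy_row"
      by (auto simp: R_def Fr_def Le_def Cr_def)
    then show "\<bar>rhs r\<bar> \<le> int (N ^ 2)"
    proof cases
      case f
      then have "demand P \<kappa> \<le> N ^ 2" using N(6) N1 le_trans by blast
      then show ?thesis using f by (auto simp: rhs_def simp flip: of_nat_power)
    next
      case c
      then have "Q i * L e i \<le> N ^ 2" using N by (intro N2) auto
      then show ?thesis using c by (simp add: rhs_def flip: of_nat_mult of_nat_power)
    next
      case t
      then show ?thesis using N2[OF N(4,1)] by (simp add: rhs_def flip: of_nat_mult of_nat_power)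
    next
      case h
      \<comment> \<open>Private transport contributes a nonnegative energy, so the layout alone
        respects the bound. The right-hand side thus lies between 0 and
        \<open>b * \<Delta>\<close>.\<close>
      have "0 \<le> (\<Sum>e \<in> E. real (W e) * (real (H 0) * (\<Sum>\<kappa> \<in> K. G \<kappa> e 0)))"
        using G by (intro sum_nonneg mult_nonneg_nonneg) auto
      then have "real (\<Sum>e \<in> E. W e * (\<Sum>i = 1..m. H i * L e i)) \<le> real (b * \<Delta>)" using energy_le by linarith
      then have "(\<Sum>e \<in> E. W e * (\<Sum>i = 1..m. H i * L e i)) \<le> b * \<Delta>" by (simp only: of_nat_le_iff)
      then have "0 \<le> rhs r" "rhs r \<le> int (b * \<Delta>)" unfolding h rhs_def row.case by linarith+
      then show ?thesis using N2[OF N(5,1)] by linarith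
    qed
  qed
  have LeR: "Le \<subseteq> R" by (auto simp: R_def)
  have U1: "1 \<le> N ^ 2" using N(8) N1 by linarith
  obtain p q where pq: "1 \<le> q" "q \<le> fact (card X + card R) * (card R * (N ^ 2) ^ 2 + 1) ^ (card X + card R)"
    "\<forall>j \<in> X. p j \<le> fact (card X + card R) * (card R * (N ^ 2) ^ 2 + 1) ^ (card X + card R)"
    "\<forall>r \<in> R - Le. (\<Sum>j \<in> X. A r j * int (p j)) = rhs r * int q"
    "\<forall>r \<in> Le. (\<Sum>j \<in> X. A r j * int (p j)) \<le> rhs r * int q"
    using small_rational_solution_le[OF fX fR LeR x0 eq le bA bb U1] by (elim exE conjE) (rule that)
  have cX: "card X = card K * card E * Suc m" by (simp add: X_def card_cartesian_product algebra_simps)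
  have "card R \<le> card Fr + card Le" unfolding R_def by (rule card_Un_le)
  moreover have "card Fr \<le> card (K \<times> ?V)" unfolding Fr_def by (rule card_image_le) (use fin in simp)
  moreover have "card Le \<le> card Cr + card {Time_row, Energy_row :: 'v row}" unfolding Le_def by (rule card_Un_le)
  moreover have "card Cr \<le> card (E \<times> {1..m})" unfolding Cr_def by (rule card_image_le) (use fin in simp)
  ultimately have cR: "card R \<le> card K * card ?V + card E * m + 2"
    by (simp add: card_cartesian_product)
  have n: "card X + card R \<le> n" "card R \<le> n" unfolding n_def cX using cR by auto
  have S: "fact (card X + card R) * (card R * (N ^ 2) ^ 2 + 1) ^ (card X + card R) \<le> S"
  proof -
    have "(card R * (N ^ 2) ^ 2 + 1) ^ (card X + card R) \<le> (n * (N ^ 2) ^ 2 + 1) ^ (card X + card R)"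
      using n by (intro power_mono) auto
    also have "\<dots> \<le> (n * (N ^ 2) ^ 2 + 1) ^ n" using n by (intro power_increasing) auto
    finally show ?thesis unfolding S_def using n by (intro mult_le_mono fact_mono) auto
  qed
  define g where "g \<kappa> e i = p (\<kappa>, e, i)" for \<kappa> e i
  have gS: "g \<kappa> e i \<le> S" if "\<kappa> \<in> K" "e \<in> E" "i \<le> m" for \<kappa> e i
    using pq(3) that unfolding g_def by (intro le_trans[OF _ S]) (simp add: X_def)
  have "int_solution q L g"
    unfolding int_solution_def
  proof (intro conjI ballI)
    fix \<kappa> v assume k: "\<kappa> \<in> K" and v: "v \<in> ?V"
    have "Flow_row \<kappa> v \<in> R - Le" using k v by (auto simp: R_def Fr_def Le_def Cr_def)
    then have "(\<Sum>j \<in> X. of_int (A (Flow_row \<kappa> v) j) * int (p j)) = rhs (Flow_row \<kappa> v) * int q" using pq(4) by simp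
    then show "int (\<Sum>e \<in> {e \<in> E. snd e = v}. \<Sum>i = 0..m. g \<kappa> e i) - int (\<Sum>e \<in> {e \<in> E. fst e = v}. \<Sum>i = 0..m. g \<kappa> e i) =
        (if v = snd \<kappa> then int (demand P \<kappa> * q) else if v = fst \<kappa> then - int (demand P \<kappa> * q) else 0)"
      unfolding row_flow[OF k] by (auto simp: g_def rhs_def)
  next
    show "(\<Sum>e \<in> E. W e * (\<Sum>i = 1..m. C i * L e i)) \<le> B * \<Delta>" using G layout_iff by blast
  next
    fix e i assume c: "e \<in> E" "i \<in> {1..m}"
    have "Cap_row e i \<in> Le" using c by (auto simp: Le_def Cr_def)
    then have "(\<Sum>j \<in> X. of_int (A (Cap_row e i) j) * int (p j)) \<le> rhs (Cap_row e i) * int q" using pq(5) by simp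
    then have "int (\<Delta> * (\<Sum>\<kappa> \<in> K. g \<kappa> e i)) \<le> int (Q i * L e i * q)"
      unfolding row_cap[OF c] by (simp add: g_def rhs_def)
    then show "\<Delta> * (\<Sum>\<kappa> \<in> K. g \<kappa> e i) \<le> Q i * L e i * q" by (simp only: of_nat_le_iff)
  next
    have "Time_row \<in> Le" by (simp add: Le_def)
    then have "(\<Sum>j \<in> X. of_int (A Time_row j) * int (p j)) \<le> rhs Time_row * int q" using pq(5) by simp
    then have "int (\<Sum>e \<in> E. W e * (\<Sum>i = 0..m. T i * (\<Sum>\<kappa> \<in> K. g \<kappa> e i))) \<le> int (a * \<Delta> * q)"
      unfolding row_time by (simp add: g_def rhs_def)
    then show "(\<Sum>e \<in> E. W e * (\<Sum>i = 0..m. T i * (\<Sum>\<kappa> \<in> K. g \<kappa> e i))) \<le> a * \<Delta> * q" by (simp only: of_nat_le_iff)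
  next
    have "Energy_row \<in> Le" by (simp add: Le_def)
    then have "(\<Sum>j \<in> X. of_int (A Energy_row j) * int (p j)) \<le> rhs Energy_row * int q" using pq(5) by simp
    then have "int (\<Sum>e \<in> E. W e * (H 0 * (\<Sum>\<kappa> \<in> K. g \<kappa> e 0))) \<le> (int (b * \<Delta>) - int (\<Sum>e \<in> E. W e * (\<Sum>i = 1..m. H i * L e i))) * int q"
      unfolding row_energy by (simp add: g_def rhs_def)
    then have "int ((\<Sum>e \<in> E. W e * (H 0 * (\<Sum>\<kappa> \<in> K. g \<kappa> e 0))) + (\<Sum>e \<in> E. W e * (\<Sum>i = 1..m. H i * L e i)) * q) \<le> int (b * \<Delta> * q)"
      by (simp add: left_diff_distrib)
    then have "(\<Sum>e \<in> E. W e * (H 0 * (\<Sum>\<kappa> \<in> K. g \<kappa> e 0))) + (\<Sum>e \<in> E. W e * (\<Sum>i = 1..m. H i * L e i)) * q \<le> b * \<Delta> * q"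
      by (simp only: of_nat_le_iff)
    then show "(\<Sum>e \<in> E. W e * (H 0 * (\<Sum>\<kappa> \<in> K. g \<kappa> e 0) + (\<Sum>i = 1..m. H i * L e i * q))) \<le> b * \<Delta> * q"
      by (simp add: distrib_left sum.distrib sum_distrib_right mult.assoc)
  qed
  then show ?thesis using pq(1) le_trans[OF pq(2) S] gS by (intro exI[of _ q] exI[of _ g]) simp
qed

end

section \<open>The verifier\<close>

text \<open>A rational is certified by its reduced numerator and denominator, its numerator over the common
  denominator of the instance, and two numbers \<open>u\<close>, \<open>v\<close> with \<open>num * u = den * v + 1\<close> that witness
  that the fraction is reduced.\<close>

type_synonym frac = "nat \<times> nat \<times> nat \<times> nat \<times> nat"

abbreviation num :: "frac \<Rightarrow> nat" where "num r \<equiv> fst r"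
abbreviation den :: "frac \<Rightarrow> nat" where "den r \<equiv> fst (snd r)"
abbreviation scaled :: "frac \<Rightarrow> nat" where "scaled r \<equiv> fst (snd (snd r))"

text \<open>The alternative \<open>den r = 1\<close> covers the fraction 0/1, for which there is no
  identity of the required form.\<close>

definition good_frac :: "nat \<Rightarrow> frac \<Rightarrow> bool" where
  "good_frac D r \<longleftrightarrow> num r * D = scaled r * den r \<and> 1 \<le> den r \<and>
     (num r * fst (snd (snd (snd r))) = den r * snd (snd (snd (snd r))) + 1 \<or> den r = 1)"

text \<open>The numbers of vertices and of public modes are given in unary, as lists of units, so
  that ranges up to them are no longer than the certificate. The third component of the first triple
  is the common denominator.\<close>

type_synonym data = "(unit list \<times> unit list \<times> nat) \<times>
  (bool \<times> frac \<times> nat) list list \<times> (frac \<times> frac \<times> frac \<times> frac) list \<times> frac \<times> frac \<times> frac"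

definition d_n :: "data \<Rightarrow> nat list" where "d_n d = [0..<length (fst (fst d))]"
definition d_m :: "data \<Rightarrow> nat list" where "d_m d = [0..<length (fst (snd (fst d)))]"
definition d_D :: "data \<Rightarrow> nat" where "d_D d = snd (snd (fst d))"
definition d_entry :: "data \<Rightarrow> nat \<Rightarrow> nat \<Rightarrow> bool \<times> frac \<times> nat" where
  "d_entry d u v = nth_default (False, (0, 0, 0, 0, 0), 0) (nth_default [] (fst (snd d)) u) v"
definition d_mode :: "data \<Rightarrow> nat \<Rightarrow> frac \<times> frac \<times> frac \<times> frac" where
  "d_mode d i = nth_default ((0, 0, 0, 0, 0), (0, 0, 0, 0, 0), (0, 0, 0, 0, 0), (0, 0, 0, 0, 0)) (fst (snd (snd d))) i"
definition d_params :: "data \<Rightarrow> frac \<times> frac \<times> frac" where "d_params d = snd (snd (snd d))"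

abbreviation "d_arc d u v \<equiv> fst (d_entry d u v)"
abbreviation "d_weight d u v \<equiv> fst (snd (d_entry d u v))"
abbreviation "d_demand d u v \<equiv> snd (snd (d_entry d u v))"
abbreviation "d_time d i \<equiv> fst (d_mode d i)"
abbreviation "d_energy d i \<equiv> fst (snd (d_mode d i))"
abbreviation "d_cost d i \<equiv> fst (snd (snd (d_mode d i)))"
abbreviation "d_capacity d i \<equiv> snd (snd (snd (d_mode d i)))"
abbreviation "d_budget d \<equiv> fst (d_params d)"
abbreviation "d_time_bound d \<equiv> fst (snd (d_params d))"
abbreviation "d_energy_bound d \<equiv> snd (snd (d_params d))"

definition frac_value :: "nat \<Rightarrow> frac \<Rightarrow> rat" where
  "frac_value D r = of_nat (scaled r) / of_nat D"

definition d_instance :: "data \<Rightarrow> nat msp_instance" where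
  "d_instance d = \<lparr>graph = \<lparr>pverts = {..<length (fst (fst d))},
       parcs = {e \<in> {..<length (fst (fst d))} \<times> {..<length (fst (fst d))}. d_arc d (fst e) (snd e)}\<rparr>,
     weight = (\<lambda>e. frac_value (d_D d) (d_weight d (fst e) (snd e))),
     budget = frac_value (d_D d) (d_budget d),
     demand = (\<lambda>e. d_demand d (fst e) (snd e)),
     modes = length (fst (snd (fst d))),
     travel_time = (\<lambda>i. frac_value (d_D d) (d_time d i)),
     energy = (\<lambda>i. frac_value (d_D d) (d_energy d i)),
     cost = (\<lambda>i. frac_value (d_D d) (d_cost d i)),
     capacity = (\<lambda>i. frac_value (d_D d) (d_capacity d i)),
     time_bound = frac_value (d_D d) (d_time_bound d),
     energy_bound = frac_value (d_D d) (d_energy_bound d)\<rparr>"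

definition d_modes :: "data \<Rightarrow> nat list" where "d_modes d = 0 # map Suc (d_m d)"

abbreviation frac_list :: "frac \<Rightarrow> nat list" where "frac_list r \<equiv> [num r, den r]"

definition d_serialise :: "data \<Rightarrow> nat list" where
  "d_serialise d = [length (fst (fst d)), length (fst (snd (fst d)))] @
     concat (map (\<lambda>u. concat (map (\<lambda>v. (if d_arc d u v then 1 # frac_list (d_weight d u v) else [0]) @ [d_demand d u v]) (d_n d))) (d_n d)) @
     concat (map (\<lambda>i. frac_list (d_time d i) @ frac_list (d_energy d i) @ frac_list (d_cost d i) @ frac_list (d_capacity d i)) (d_modes d)) @
     frac_list (d_budget d) @ frac_list (d_time_bound d) @ frac_list (d_energy_bound d)"

definition d_valid :: "data \<Rightarrow> bool" where
  "d_valid d \<longleftrightarrow> 1 \<le> d_D d \<and>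
     (\<forall>u \<in> set (d_n d). \<forall>v \<in> set (d_n d). (d_arc d u v \<longrightarrow> good_frac (d_D d) (d_weight d u v)) \<and> (u = v \<longrightarrow> d_demand d u v = 0)) \<and>
     (\<forall>i \<in> set (d_modes d). good_frac (d_D d) (d_time d i) \<and> good_frac (d_D d) (d_energy d i) \<and>
        good_frac (d_D d) (d_cost d i) \<and> good_frac (d_D d) (d_capacity d i) \<and> 1 \<le> scaled (d_capacity d i)) \<and>
     good_frac (d_D d) (d_budget d) \<and> good_frac (d_D d) (d_time_bound d) \<and> good_frac (d_D d) (d_energy_bound d) \<and>
     1 \<le> scaled (d_budget d) \<and> scaled (d_cost d 0) = 0 \<and> scaled (d_capacity d 0) = d_D d"

definition d_restricted :: "data \<Rightarrow> bool" where
  "d_restricted d \<longleftrightarrow> (\<forall>u \<in> set (d_n d). \<forall>v \<in> set (d_n d). (d_arc d u v \<longrightarrow> scaled (d_weight d u v) = d_D d) \<and>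
       (u \<noteq> v \<longrightarrow> d_demand d u v = 1)) \<and>
     length (fst (snd (fst d))) = 1 \<and> scaled (d_energy d 1) = d_D d \<and> scaled (d_time d 1) = d_D d"

type_synonym cert = "data \<times> nat \<times> nat list list list \<times> nat list list list list list"

definition c_L :: "cert \<Rightarrow> nat \<Rightarrow> nat \<Rightarrow> nat \<Rightarrow> nat" where
  "c_L c u v i = nth_default 0 (nth_default [] (nth_default [] (fst (snd (snd c))) u) v) i"

definition c_g :: "cert \<Rightarrow> nat \<Rightarrow> nat \<Rightarrow> nat \<Rightarrow> nat \<Rightarrow> nat \<Rightarrow> nat" where
  "c_g c s t u v i = nth_default 0 (nth_default [] (nth_default [] (nth_default [] (nth_default [] (snd (snd (snd c))) s) t) u) v) i"

abbreviation list_sum :: "nat list \<Rightarrow> (nat \<Rightarrow> nat) \<Rightarrow> nat" where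
  "list_sum xs f \<equiv> sum_list (map f xs)"

definition c_sum :: "cert \<Rightarrow> nat \<Rightarrow> nat \<Rightarrow> nat \<Rightarrow> nat" where
  "c_sum c u v i = list_sum (d_n (fst c)) (\<lambda>s. list_sum (d_n (fst c)) (\<lambda>t. if 0 < d_demand (fst c) s t then c_g c s t u v i else 0))"

definition c_in :: "cert \<Rightarrow> nat \<Rightarrow> nat \<Rightarrow> nat \<Rightarrow> nat" where
  "c_in c s t v = list_sum (d_n (fst c)) (\<lambda>u. if d_arc (fst c) u v then list_sum (d_modes (fst c)) (\<lambda>i. c_g c s t u v i) else 0)"

definition c_out :: "cert \<Rightarrow> nat \<Rightarrow> nat \<Rightarrow> nat \<Rightarrow> nat" where
  "c_out c s t v = list_sum (d_n (fst c)) (\<lambda>u. if d_arc (fst c) v u then list_sum (d_modes (fst c)) (\<lambda>i. c_g c s t v u i) else 0)"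

definition c_flow :: "cert \<Rightarrow> bool" where
  "c_flow c \<longleftrightarrow> (\<forall>s \<in> set (d_n (fst c)). \<forall>t \<in> set (d_n (fst c)). 0 < d_demand (fst c) s t \<longrightarrow> (\<forall>v \<in> set (d_n (fst c)).
     if v = t then c_in c s t v = c_out c s t v + d_demand (fst c) s t * fst (snd c)
     else if v = s then c_in c s t v + d_demand (fst c) s t * fst (snd c) = c_out c s t v
     else c_in c s t v = c_out c s t v))"

definition c_arc_sum :: "cert \<Rightarrow> (nat \<Rightarrow> nat \<Rightarrow> nat) \<Rightarrow> nat" where
  "c_arc_sum c f = list_sum (d_n (fst c)) (\<lambda>u. list_sum (d_n (fst c)) (\<lambda>v. if d_arc (fst c) u v then scaled (d_weight (fst c) u v) * f u v else 0))"

definition c_layout :: "cert \<Rightarrow> bool" where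
  "c_layout c \<longleftrightarrow> c_arc_sum c (\<lambda>u v. list_sum (map Suc (d_m (fst c))) (\<lambda>i. scaled (d_cost (fst c) i) * c_L c u v i))
     \<le> scaled (d_budget (fst c)) * d_D (fst c)"

definition c_capacity :: "cert \<Rightarrow> bool" where
  "c_capacity c \<longleftrightarrow> (\<forall>u \<in> set (d_n (fst c)). \<forall>v \<in> set (d_n (fst c)). d_arc (fst c) u v \<longrightarrow> (\<forall>i \<in> set (map Suc (d_m (fst c))).
     d_D (fst c) * c_sum c u v i \<le> scaled (d_capacity (fst c) i) * c_L c u v i * fst (snd c)))"

definition c_time :: "cert \<Rightarrow> bool" where
  "c_time c \<longleftrightarrow> c_arc_sum c (\<lambda>u v. list_sum (d_modes (fst c)) (\<lambda>i. scaled (d_time (fst c) i) * c_sum c u v i))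
     \<le> scaled (d_time_bound (fst c)) * d_D (fst c) * fst (snd c)"

definition c_energy :: "cert \<Rightarrow> bool" where
  "c_energy c \<longleftrightarrow> c_arc_sum c (\<lambda>u v. scaled (d_energy (fst c) 0) * c_sum c u v 0 +
      list_sum (map Suc (d_m (fst c))) (\<lambda>i. scaled (d_energy (fst c) i) * c_L c u v i * fst (snd c)))
     \<le> scaled (d_energy_bound (fst c)) * d_D (fst c) * fst (snd c)"

definition c_solution :: "cert \<Rightarrow> bool" where
  "c_solution c \<longleftrightarrow> 1 \<le> fst (snd c) \<and> c_flow c \<and> c_layout c \<and> c_capacity c \<and> c_time c \<and> c_energy c"

text \<open>The instance comes from the certificate; comparing its serialisation with the input
  replaces a parser. The flag \<open>r\<close> adds the test for the restricted problem.\<close>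

definition verify :: "bool \<Rightarrow> bool list \<times> cert \<Rightarrow> bool" where
  "verify r xc \<longleftrightarrow> fst xc = concat (map (\<lambda>k. delimit (binary k)) (d_serialise (fst (snd xc)))) \<and>
     d_valid (fst (snd xc)) \<and> (r \<longrightarrow> d_restricted (fst (snd xc))) \<and> c_solution (snd xc)"

section \<open>Polynomial-time computability of the verifier\<close>

lemma fp_delimit[fp_intro]: "fp f \<Longrightarrow> fp (\<lambda>x. delimit (f x))"
  unfolding delimit_def by (intro fp_intro)

lemma fp_d_n[fp_intro]: "fp f \<Longrightarrow> fp (\<lambda>x. d_n (f x))"
  unfolding d_n_def by (intro fp_index_list fp_intro)

lemma fp_d_m[fp_intro]: "fp f \<Longrightarrow> fp (\<lambda>x. d_m (f x))"
  unfolding d_m_def by (intro fp_index_list fp_intro)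

lemma fp_d_modes[fp_intro]: "fp f \<Longrightarrow> fp (\<lambda>x. d_modes (f x))"
  unfolding d_modes_def by (intro fp_intro)

lemma fp_d_D[fp_intro]: "fp f \<Longrightarrow> fp (\<lambda>x. d_D (f x))"
  unfolding d_D_def by (intro fp_intro)

lemma fp_d_params[fp_intro]: "fp f \<Longrightarrow> fp (\<lambda>x. d_params (f x))"
  unfolding d_params_def by (intro fp_intro)

lemma fp_d_entry[fp_intro]: "fp f \<Longrightarrow> fp u \<Longrightarrow> fp v \<Longrightarrow> fp (\<lambda>x. d_entry (f x) (u x) (v x))"
  unfolding d_entry_def by (intro fp_intro)

lemma fp_d_mode[fp_intro]: "fp f \<Longrightarrow> fp i \<Longrightarrow> fp (\<lambda>x. d_mode (f x) (i x))"
  unfolding d_mode_def by (intro fp_intro)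

lemma fp_good_frac[fp_intro]: "fp f \<Longrightarrow> fp r \<Longrightarrow> fp (\<lambda>x. good_frac (f x) (r x))"
  unfolding good_frac_def by (intro fp_intro)

lemma fp_c_L[fp_intro]: "fp f \<Longrightarrow> fp u \<Longrightarrow> fp v \<Longrightarrow> fp i \<Longrightarrow> fp (\<lambda>x. c_L (f x) (u x) (v x) (i x))"
  unfolding c_L_def by (intro fp_intro)

lemma fp_c_g[fp_intro]: "fp f \<Longrightarrow> fp s \<Longrightarrow> fp t \<Longrightarrow> fp u \<Longrightarrow> fp v \<Longrightarrow> fp i \<Longrightarrow> fp (\<lambda>x. c_g (f x) (s x) (t x) (u x) (v x) (i x))"
  unfolding c_g_def by (intro fp_intro)

text \<open>It reduces a claim about composed arguments to one about the projections of a tuple.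
  There the variables bound by nested sums and maps only extend the tuple, as the rules in
  \<open>fp_intro\<close> expect.\<close>

lemma fp_comp4:
  assumes "fp (\<lambda>z. f (fst z) (fst (snd z)) (fst (snd (snd z))) (snd (snd (snd z))))" "fp a" "fp b" "fp c" "fp d"
  shows "fp (\<lambda>x. f (a x) (b x) (c x) (d x))"
  using fp_comp[OF assms(1), of "\<lambda>x. (a x, b x, c x, d x)"] assms(2-) by (simp add: fp_Pair)

lemma fp_c_sum[fp_intro]: "fp f \<Longrightarrow> fp u \<Longrightarrow> fp v \<Longrightarrow> fp i \<Longrightarrow> fp (\<lambda>x. c_sum (f x) (u x) (v x) (i x))"
  by (rule fp_comp4[of c_sum]) (unfold c_sum_def, intro fp_intro)

lemma fp_c_in[fp_intro]: "fp f \<Longrightarrow> fp u \<Longrightarrow> fp v \<Longrightarrow> fp i \<Longrightarrow> fp (\<lambda>x. c_in (f x) (u x) (v x) (i x))"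
  by (rule fp_comp4[of c_in]) (unfold c_in_def, intro fp_intro)

lemma fp_c_out[fp_intro]: "fp f \<Longrightarrow> fp u \<Longrightarrow> fp v \<Longrightarrow> fp i \<Longrightarrow> fp (\<lambda>x. c_out (f x) (u x) (v x) (i x))"
  by (rule fp_comp4[of c_out]) (unfold c_out_def, intro fp_intro)

lemma fp_d_valid: "fp d_valid"
  unfolding d_valid_def by (intro fp_intro)

lemma fp_d_restricted: "fp d_restricted"
  unfolding d_restricted_def by (intro fp_intro)

lemma fp_c_solution: "fp c_solution"
  unfolding c_solution_def c_flow_def c_layout_def c_capacity_def c_time_def c_energy_def c_arc_sum_def
  by (intro fp_intro)

lemma fp_d_serialise: "fp d_serialise"
  unfolding d_serialise_def by (intro fp_intro)

lemma fp_verify: "fp (verify r)"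
  unfolding verify_def
  by (intro fp_intro fp_comp[OF fp_d_serialise] fp_comp[OF fp_d_valid] fp_comp[OF fp_d_restricted] fp_comp[OF fp_c_solution])

section \<open>Correctness of the verifier\<close>

lemma fraction_frac_value:
  assumes "good_frac D r" "1 \<le> D"
  shows "fraction (frac_value D r) = frac_list r"
proof -
  have c: "coprime (num r) (den r)"
  proof -
    consider u v where "num r * u = den r * v + 1" | "den r = 1" using assms(1) unfolding good_frac_def by blast
    then show ?thesis
    proof cases
      case 1
      show ?thesis
      proof (rule coprimeI)
        fix k assume k: "k dvd num r" "k dvd den r"
        then have "k dvd den r * v + 1" using 1 by (metis dvd_mult2)
        then show "is_unit k" using k(2) by (metis dvd_add_right_iff dvd_mult2)
      qed
    qed simp
  qed
  have "frac_value D r = of_nat (num r) / of_nat (den r)"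
  proof -
    have "rat_of_nat (scaled r) * of_nat (den r) = of_nat (num r) * of_nat D"
      using assms(1) unfolding good_frac_def by (metis of_nat_mult)
    then show ?thesis using assms unfolding frac_value_def good_frac_def by (simp add: field_simps)
  qed
  also have "\<dots> = Rat.Fract (int (num r)) (int (den r))" by (simp add: Fract_of_int_quotient)
  finally have "quotient_of (frac_value D r) = (int (num r), int (den r))"
    using c assms(1) by (simp add: quotient_of_Fract normalize_stable good_frac_def)
  then show ?thesis by (simp add: fraction_def)
qed

lemma d_modes_eq: "d_modes d = [0..<Suc (length (fst (snd (fst d))))]"
  unfolding d_modes_def d_m_def map_Suc_upt by (simp add: upt_conv_Cons del: upt_Suc)

lemma list_sum_modes: "list_sum (d_modes d) f = (\<Sum>i = 0..length (fst (snd (fst d))). f i)"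
  unfolding d_modes_eq interv_sum_list_conv_sum_set_nat by (simp add: atLeastLessThanSuc_atLeastAtMost del: upt_Suc)

lemma list_sum_modes1: "list_sum (map Suc (d_m d)) f = (\<Sum>i = 1..length (fst (snd (fst d))). f i)"
  unfolding d_m_def map_Suc_upt interv_sum_list_conv_sum_set_nat by (simp add: atLeastLessThanSuc_atLeastAtMost del: upt_Suc)

lemma list_sum_n: "list_sum (d_n d) f = (\<Sum>i < length (fst (fst d)). f i)"
  unfolding d_n_def interv_sum_list_conv_sum_set_nat by (simp add: atLeast0LessThan)

lemma sum_pairs:
  fixes f :: "nat \<times> nat \<Rightarrow> 'c::comm_monoid_add"
  shows "(\<Sum>e \<in> {e \<in> {..<n} \<times> {..<n}. p (fst e) (snd e)}. f e) = (\<Sum>u<n. \<Sum>v<n. if p u v then f (u, v) else 0)"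
  by (simp add: sum.inter_filter sum.cartesian_product case_prod_beta cong: if_cong)

lemma concat_map_product:
  "concat (map f (List.product xs ys)) = concat (map (\<lambda>u. concat (map (\<lambda>v. f (u, v)) ys)) xs)"
  by (induction xs) (simp_all add: comp_def)

lemma sum_in_arcs:
  fixes f :: "nat \<times> nat \<Rightarrow> 'c::comm_monoid_add"
  assumes "v < n"
  shows "(\<Sum>e \<in> {e \<in> {e \<in> {..<n} \<times> {..<n}. p (fst e) (snd e)}. snd e = v}. f e) = (\<Sum>u<n. if p u v then f (u, v) else 0)"
proof -
  have "{e \<in> {e \<in> {..<n} \<times> {..<n}. p (fst e) (snd e)}. snd e = v} = (\<lambda>u. (u, v)) ` {u \<in> {..<n}. p u v}"
    using assms by auto
  moreover have "(\<Sum>u \<in> {u \<in> {..<n}. p u v}. f (u, v)) = (\<Sum>u<n. if p u v then f (u, v) else 0)"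
    by (rule sum.inter_filter) simp
  ultimately show ?thesis by (simp only: sum.reindex inj_on_def prod.inject comp_def) (simp add: sum.reindex inj_on_def)
qed

lemma sum_out_arcs:
  fixes f :: "nat \<times> nat \<Rightarrow> 'c::comm_monoid_add"
  assumes "v < n"
  shows "(\<Sum>e \<in> {e \<in> {e \<in> {..<n} \<times> {..<n}. p (fst e) (snd e)}. fst e = v}. f e) = (\<Sum>u<n. if p v u then f (v, u) else 0)"
proof -
  have "{e \<in> {e \<in> {..<n} \<times> {..<n}. p (fst e) (snd e)}. fst e = v} = (\<lambda>u. (v, u)) ` {u \<in> {..<n}. p v u}"
    using assms by auto
  moreover have "(\<Sum>u \<in> {u \<in> {..<n}. p v u}. f (v, u)) = (\<Sum>u<n. if p v u then f (v, u) else 0)"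
    by (rule sum.inter_filter) simp
  ultimately show ?thesis by (simp only: sum.reindex inj_on_def prod.inject comp_def) (simp add: sum.reindex inj_on_def)
qed

lemma d_instance_simps[simp]:
  "pverts (graph (d_instance d)) = {..<length (fst (fst d))}"
  "parcs (graph (d_instance d)) = {e \<in> {..<length (fst (fst d))} \<times> {..<length (fst (fst d))}. d_arc d (fst e) (snd e)}"
  "weight (d_instance d) = (\<lambda>e. frac_value (d_D d) (d_weight d (fst e) (snd e)))"
  "budget (d_instance d) = frac_value (d_D d) (d_budget d)"
  "demand (d_instance d) = (\<lambda>e. d_demand d (fst e) (snd e))"
  "modes (d_instance d) = length (fst (snd (fst d)))"
  "travel_time (d_instance d) = (\<lambda>i. frac_value (d_D d) (d_time d i))"
  "energy (d_instance d) = (\<lambda>i. frac_value (d_D d) (d_energy d i))"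
  "cost (d_instance d) = (\<lambda>i. frac_value (d_D d) (d_cost d i))"
  "capacity (d_instance d) = (\<lambda>i. frac_value (d_D d) (d_capacity d i))"
  "time_bound (d_instance d) = frac_value (d_D d) (d_time_bound d)"
  "energy_bound (d_instance d) = frac_value (d_D d) (d_energy_bound d)"
  by (simp_all add: d_instance_def)

lemma commodities_d_instance:
  "commodities (d_instance d) = {e \<in> {..<length (fst (fst d))} \<times> {..<length (fst (fst d))}. 0 < d_demand d (fst e) (snd e)}"
  by (auto simp: commodities_def)

lemma frac_value_simps:
  assumes "1 \<le> D"
  shows "0 \<le> frac_value D r" "0 < frac_value D r \<longleftrightarrow> 1 \<le> scaled r" "frac_value D r = 0 \<longleftrightarrow> scaled r = 0" "frac_value D r = 1 \<longleftrightarrow> scaled r = D"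
  using assms by (auto simp: frac_value_def zero_less_divide_iff)

lemma valid_d_instance:
  assumes "d_valid d" shows "valid_instance (d_instance d)"
proof -
  have D: "1 \<le> d_D d" using assms by (simp add: d_valid_def)
  have "pair_fin_digraph (graph (d_instance d))"
    by unfold_locales auto
  moreover have "d_demand d v v = 0" if "v < length (fst (fst d))" for v
    using assms that by (auto simp: d_valid_def d_n_def)
  moreover have "1 \<le> scaled (d_capacity d i)" if "i \<le> length (fst (snd (fst d)))" for i
    using assms that unfolding d_valid_def d_modes_eq by auto
  ultimately show ?thesis
    using assms unfolding valid_instance_def d_valid_def by (auto simp: frac_value_simps[OF D])
qed

lemma scaled_d_instance:
  assumes "d_valid d"
  shows "scaled_msp (d_instance d) (d_D d) (\<lambda>e. scaled (d_weight d (fst e) (snd e))) (\<lambda>i. scaled (d_time d i))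
    (\<lambda>i. scaled (d_energy d i)) (\<lambda>i. scaled (d_cost d i)) (\<lambda>i. scaled (d_capacity d i))
    (scaled (d_budget d)) (scaled (d_time_bound d)) (scaled (d_energy_bound d))"
  using valid_d_instance[OF assms] assms by unfold_locales (simp_all add: d_valid_def frac_value_def)

lemma c_solution_iff:
  assumes v: "d_valid (fst c)"
  shows "c_solution c \<longleftrightarrow> 1 \<le> fst (snd c) \<and>
    scaled_msp.int_solution (d_instance (fst c)) (d_D (fst c)) (\<lambda>e. scaled (d_weight (fst c) (fst e) (snd e)))
      (\<lambda>i. scaled (d_time (fst c) i)) (\<lambda>i. scaled (d_energy (fst c) i)) (\<lambda>i. scaled (d_cost (fst c) i))
      (\<lambda>i. scaled (d_capacity (fst c) i)) (scaled (d_budget (fst c))) (scaled (d_time_bound (fst c)))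
      (scaled (d_energy_bound (fst c))) (fst (snd c)) (\<lambda>e. c_L c (fst e) (snd e))
      (\<lambda>\<kappa> e. c_g c (fst \<kappa>) (snd \<kappa>) (fst e) (snd e))"
proof -
  interpret scaled_msp "d_instance (fst c)" "d_D (fst c)" "\<lambda>e. scaled (d_weight (fst c) (fst e) (snd e))"
      "\<lambda>i. scaled (d_time (fst c) i)" "\<lambda>i. scaled (d_energy (fst c) i)" "\<lambda>i. scaled (d_cost (fst c) i)"
      "\<lambda>i. scaled (d_capacity (fst c) i)" "scaled (d_budget (fst c))" "scaled (d_time_bound (fst c))"
      "scaled (d_energy_bound (fst c))"
    by (rule scaled_d_instance[OF v])
  let ?n = "length (fst (fst (fst c)))" and ?m = "length (fst (snd (fst (fst c))))"
  have arc: "c_arc_sum c f = (\<Sum>e \<in> E. scaled (d_weight (fst c) (fst e) (snd e)) * f (fst e) (snd e))" for f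
    unfolding c_arc_sum_def list_sum_n d_instance_simps sum_pairs[where p = "d_arc (fst c)"] by (simp cong: if_cong)
  have S: "c_sum c u v i = (\<Sum>\<kappa> \<in> K. c_g c (fst \<kappa>) (snd \<kappa>) u v i)" for u v i
    unfolding c_sum_def list_sum_n commodities_d_instance sum_pairs[where p = "\<lambda>s t. 0 < d_demand (fst c) s t"] by (simp cong: if_cong)
  have inn: "(\<Sum>e \<in> {e \<in> E. snd e = v}. \<Sum>i = 0..m. c_g c s t (fst e) (snd e) i) = c_in c s t v"
    and out: "(\<Sum>e \<in> {e \<in> E. fst e = v}. \<Sum>i = 0..m. c_g c s t (fst e) (snd e) i) = c_out c s t v" if "v < ?n" for s t v
    unfolding c_in_def c_out_def list_sum_n list_sum_modes d_instance_simps sum_in_arcs[OF that, where p = "d_arc (fst c)"] sum_out_arcs[OF that, where p = "d_arc (fst c)"]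
    by (simp_all cong: if_cong)
  have flow: "c_flow c \<longleftrightarrow> (\<forall>\<kappa> \<in> K. \<forall>v \<in> pverts (graph (d_instance (fst c))).
      int (\<Sum>e \<in> {e \<in> E. snd e = v}. \<Sum>i = 0..m. c_g c (fst \<kappa>) (snd \<kappa>) (fst e) (snd e) i) -
      int (\<Sum>e \<in> {e \<in> E. fst e = v}. \<Sum>i = 0..m. c_g c (fst \<kappa>) (snd \<kappa>) (fst e) (snd e) i) =
        (if v = snd \<kappa> then int (demand (d_instance (fst c)) \<kappa> * fst (snd c))
         else if v = fst \<kappa> then - int (demand (d_instance (fst c)) \<kappa> * fst (snd c)) else 0))"
    (is "_ \<longleftrightarrow> ?R")
  proof -
    have "?R \<longleftrightarrow> (\<forall>s<?n. \<forall>t<?n. 0 < d_demand (fst c) s t \<longrightarrow> (\<forall>v<?n.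
        int (c_in c s t v) - int (c_out c s t v) = (if v = t then int (d_demand (fst c) s t * fst (snd c))
          else if v = s then - int (d_demand (fst c) s t * fst (snd c)) else 0)))"
      unfolding commodities_d_instance using inn out by (auto simp del: of_nat_mult of_nat_sum d_instance_simps(2,6))
    also have "\<dots> \<longleftrightarrow> c_flow c"
      unfolding c_flow_def d_n_def
      by (simp add: Ball_def atLeast0LessThan del: of_nat_mult) (intro all_cong1 imp_cong refl, auto simp del: of_nat_mult)
    finally show ?thesis by blast
  qed
  have cap: "c_capacity c \<longleftrightarrow> (\<forall>e \<in> E. \<forall>i \<in> {1..m}. d_D (fst c) * (\<Sum>\<kappa> \<in> K. c_g c (fst \<kappa>) (snd \<kappa>) (fst e) (snd e) i) \<le>
      scaled (d_capacity (fst c) i) * c_L c (fst e) (snd e) i * fst (snd c))"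
  proof -
    have M1: "set [Suc 0..<Suc ?m] = {1..?m}" by auto
    show ?thesis unfolding c_capacity_def S d_n_def d_m_def map_Suc_upt M1 by auto
  qed
  show ?thesis
    unfolding c_solution_def int_solution_def flow cap c_layout_def c_time_def c_energy_def arc S list_sum_modes list_sum_modes1
    by simp
qed

lemma serialise_d_instance:
  assumes "d_valid d" shows "serialise (d_instance d) = d_serialise d"
proof -
  have D: "1 \<le> d_D d" using assms by (simp add: d_valid_def)
  let ?n = "length (fst (fst d))" and ?m = "length (fst (snd (fst d)))"
  have w: "fraction (frac_value (d_D d) (d_weight d u v)) = frac_list (d_weight d u v)" if "u < ?n" "v < ?n" "d_arc d u v" for u v
    using assms that by (intro fraction_frac_value D) (auto simp: d_valid_def d_n_def)
  have mo: "fraction (frac_value (d_D d) (d_time d i)) = frac_list (d_time d i)"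
      "fraction (frac_value (d_D d) (d_energy d i)) = frac_list (d_energy d i)"
      "fraction (frac_value (d_D d) (d_cost d i)) = frac_list (d_cost d i)"
      "fraction (frac_value (d_D d) (d_capacity d i)) = frac_list (d_capacity d i)" if "i < Suc ?m" for i
    using assms that by (auto intro!: fraction_frac_value D simp: d_valid_def d_modes_eq simp del: upt_Suc)
  have pa: "fraction (frac_value (d_D d) (d_budget d)) = frac_list (d_budget d)"
      "fraction (frac_value (d_D d) (d_time_bound d)) = frac_list (d_time_bound d)"
      "fraction (frac_value (d_D d) (d_energy_bound d)) = frac_list (d_energy_bound d)"
    using assms by (auto intro!: fraction_frac_value D simp: d_valid_def)
  have 1: "concat (map (\<lambda>e. (if e \<in> parcs (graph (d_instance d)) then 1 # fraction (weight (d_instance d) e) else [0]) @ [demand (d_instance d) e])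
        (List.product [0..<?n] [0..<?n])) =
      concat (map (\<lambda>u. concat (map (\<lambda>v. (if d_arc d u v then 1 # frac_list (d_weight d u v) else [0]) @ [d_demand d u v]) (d_n d))) (d_n d))"
    unfolding concat_map_product d_n_def
    by (intro arg_cong[of _ _ concat] map_cong refl) (simp add: w)
  have 2: "concat (map (\<lambda>i. fraction (travel_time (d_instance d) i) @ fraction (energy (d_instance d) i) @
                       fraction (cost (d_instance d) i) @ fraction (capacity (d_instance d) i)) [0..<Suc ?m]) =
     concat (map (\<lambda>i. frac_list (d_time d i) @ frac_list (d_energy d i) @ frac_list (d_cost d i) @ frac_list (d_capacity d i)) (d_modes d))"
    unfolding d_modes_eq by (intro arg_cong[of _ _ concat] map_cong refl) (simp add: mo del: upt_Suc)
  show ?thesis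
    unfolding serialise_def d_serialise_def Let_def
    using 1 2 by (simp add: pa del: upt_Suc d_instance_simps(2))
qed

lemma d_restricted_iff:
  assumes "d_valid d" shows "d_restricted d \<longleftrightarrow> restricted_instance (d_instance d)"
proof -
  have D: "1 \<le> d_D d" using assms by (simp add: d_valid_def)
  show ?thesis
    unfolding d_restricted_def restricted_instance_def by (auto simp: d_n_def frac_value_simps[OF D])
qed

text \<open>One parameter for both languages, so that membership in NP is proved once.\<close>

definition msp_language :: "bool \<Rightarrow> bool list set" where
  "msp_language r = encode ` {P \<in> instances. (r \<longrightarrow> restricted_instance P) \<and> yes_instance P}"

lemma verify_sound:
  assumes "verify r (x, c)" shows "x \<in> msp_language r"
proof -
  let ?d = "fst c"
  have v: "d_valid ?d" and x: "x = concat (map (\<lambda>k. delimit (binary k)) (d_serialise ?d))"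
    and r: "r \<longrightarrow> d_restricted ?d" and s: "c_solution c" using assms by (auto simp: verify_def)
  have "encode (d_instance ?d) = x" unfolding encode_def serialise_d_instance[OF v] x ..
  moreover have "d_instance ?d \<in> instances" using valid_d_instance[OF v] by (auto simp: instances_def)
  moreover have "r \<longrightarrow> restricted_instance (d_instance ?d)" using r d_restricted_iff[OF v] by blast
  moreover have "yes_instance (d_instance ?d)"
    using s unfolding c_solution_iff[OF v] yes_instance_iff_mode_flow[OF valid_d_instance[OF v]]
    using scaled_msp.mode_flow_iff_int_solution[OF scaled_d_instance[OF v]] by blast
  ultimately show ?thesis unfolding msp_language_def by blast
qed

text \<open>A certificate stores layout and flows as finite lists, which agree with the original
  functions on relevant arguments only.\<close>

lemma (in scaled_msp) int_solution_cong:
  assumes L: "\<And>e i. e \<in> E \<Longrightarrow> i \<in> {1..m} \<Longrightarrow> L e i = L' e i"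
    and g: "\<And>\<kappa> e i. \<kappa> \<in> K \<Longrightarrow> e \<in> E \<Longrightarrow> i \<le> m \<Longrightarrow> g \<kappa> e i = g' \<kappa> e i"
    and s: "int_solution q L g"
  shows "int_solution q L' g'"
proof -
  have 1: "(\<Sum>e \<in> {e \<in> E. p e}. \<Sum>i = 0..m. g' \<kappa> e i) = (\<Sum>e \<in> {e \<in> E. p e}. \<Sum>i = 0..m. g \<kappa> e i)" if "\<kappa> \<in> K" for \<kappa> p
    using that by (intro sum.cong refl) (simp add: g)
  have 2: "(\<Sum>\<kappa> \<in> K. g' \<kappa> e i) = (\<Sum>\<kappa> \<in> K. g \<kappa> e i)" if "e \<in> E" "i \<le> m" for e i
    using that by (intro sum.cong refl) (simp add: g)
  have 3: "(\<Sum>e \<in> E. W e * (\<Sum>i = 1..m. C i * L' e i)) = (\<Sum>e \<in> E. W e * (\<Sum>i = 1..m. C i * L e i))"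
    by (rule sum.cong[OF refl]) (simp add: L)
  have 4: "(\<Sum>e \<in> E. W e * (\<Sum>i = 0..m. T i * (\<Sum>\<kappa> \<in> K. g' \<kappa> e i))) = (\<Sum>e \<in> E. W e * (\<Sum>i = 0..m. T i * (\<Sum>\<kappa> \<in> K. g \<kappa> e i)))"
    by (rule sum.cong[OF refl]) (simp add: 2)
  have 5: "(\<Sum>e \<in> E. W e * (H 0 * (\<Sum>\<kappa> \<in> K. g' \<kappa> e 0) + (\<Sum>i = 1..m. H i * L' e i * q))) =
      (\<Sum>e \<in> E. W e * (H 0 * (\<Sum>\<kappa> \<in> K. g \<kappa> e 0) + (\<Sum>i = 1..m. H i * L e i * q)))"
    by (rule sum.cong[OF refl]) (simp add: 2 L)
  show ?thesis
    using s unfolding int_solution_def 3 4 5 by (simp add: 1 2 L)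
qed

section \<open>Short certificates\<close>

lemma length_delimit: "length (delimit x) = 2 * length x + 1"
  unfolding delimit_def by (induction x) auto

lemma serialise_bounds:
  "length (serialise P) \<le> length (encode P)"
  "k \<in> set (serialise P) \<Longrightarrow> k < 2 ^ length (encode P)"
proof -
  have L: "length (encode P) = sum_list (map (\<lambda>k. 2 * length (binary k) + 1) (serialise P))"
    unfolding encode_def length_concat by (simp add: length_delimit comp_def)
  have "length xs \<le> sum_list (map (\<lambda>k. 2 * length (binary k) + 1) xs)" for xs
    by (induction xs) auto
  then show "length (serialise P) \<le> length (encode P)" unfolding L .
  assume "k \<in> set (serialise P)"
  moreover have "2 * length (binary k) + 1 \<le> sum_list (map (\<lambda>k. 2 * length (binary k) + 1) xs)" if "k \<in> set xs" for xs
    using that by (induction xs) auto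
  ultimately have "2 * length (binary k) + 1 \<le> length (encode P)" unfolding L by blast
  then have "length (binary k) \<le> length (encode P)" by simp
  then show "k < 2 ^ length (encode P)" unfolding length_binary_le .
qed

lemma serialise_members:
  assumes V: "pverts (graph P) = {..<n}"
  shows "n * n \<le> length (serialise P)" "modes P < length (serialise P)"
    "u < n \<Longrightarrow> v < n \<Longrightarrow> demand P (u, v) \<in> set (serialise P)"
    "u < n \<Longrightarrow> v < n \<Longrightarrow> (u, v) \<in> parcs (graph P) \<Longrightarrow> set (fraction (weight P (u, v))) \<subseteq> set (serialise P)"
    "i \<le> modes P \<Longrightarrow> set (fraction (travel_time P i)) \<union> set (fraction (energy P i)) \<union> set (fraction (cost P i)) \<union>
      set (fraction (capacity P i)) \<subseteq> set (serialise P)"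
    "set (fraction (budget P)) \<union> set (fraction (time_bound P)) \<union> set (fraction (energy_bound P)) \<subseteq> set (serialise P)"
proof -
  have len: "length xs \<le> length (concat (map f xs))" if "\<And>x. 1 \<le> length (f x)" for f :: "'x \<Rightarrow> nat list" and xs
  proof (induction xs)
    case (Cons a xs)
    then show ?case using that[of a] by simp
  qed simp
  have "n * n \<le> length (concat (map (\<lambda>e. (if e \<in> parcs (graph P) then 1 # fraction (weight P e) else [0]) @ [demand P e])
        (List.product [0..<n] [0..<n])))"
    using len[of "\<lambda>e. (if e \<in> parcs (graph P) then 1 # fraction (weight P e) else [0]) @ [demand P e]" "List.product [0..<n] [0..<n]"] by simp
  then show "n * n \<le> length (serialise P)" unfolding serialise_def V by (simp add: Let_def del: upt_Suc)
  have "Suc (modes P) \<le> length (concat (map (\<lambda>i. fraction (travel_time P i) @ fraction (energy P i) @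
                       fraction (cost P i) @ fraction (capacity P i)) [0..<Suc (modes P)]))"
    using len[of "\<lambda>i. fraction (travel_time P i) @ fraction (energy P i) @ fraction (cost P i) @ fraction (capacity P i)" "[0..<Suc (modes P)]"]
    by (simp add: fraction_def split: prod.splits)
  then show "modes P < length (serialise P)" unfolding serialise_def V by (simp add: Let_def del: upt_Suc)
  show "u < n \<Longrightarrow> v < n \<Longrightarrow> demand P (u, v) \<in> set (serialise P)"
    unfolding serialise_def V by (force simp: Let_def simp del: upt_Suc)
  show "u < n \<Longrightarrow> v < n \<Longrightarrow> (u, v) \<in> parcs (graph P) \<Longrightarrow> set (fraction (weight P (u, v))) \<subseteq> set (serialise P)"
    unfolding serialise_def V by (force simp: Let_def simp del: upt_Suc)
  show "i \<le> modes P \<Longrightarrow> set (fraction (travel_time P i)) \<union> set (fraction (energy P i)) \<union> set (fraction (cost P i)) \<union>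
      set (fraction (capacity P i)) \<subseteq> set (serialise P)"
    unfolding serialise_def V by (force simp: Let_def simp del: upt_Suc)
  show "set (fraction (budget P)) \<union> set (fraction (time_bound P)) \<union> set (fraction (energy_bound P)) \<subseteq> set (serialise P)"
    unfolding serialise_def V by (force simp: Let_def simp del: upt_Suc)
qed

definition to_frac :: "nat \<Rightarrow> rat \<Rightarrow> frac" where
  "to_frac D q = (let a = fraction q ! 0; b = fraction q ! 1;
     w = (SOME w. a * fst w = b * snd w + 1 \<and> fst w \<le> b \<and> snd w \<le> a) in
     (a, b, a * (D div b), if b = 1 then 0 else fst w, if b = 1 then 0 else snd w))"

lemma to_frac:
  assumes q: "0 \<le> q" and D: "1 \<le> D" and dvd: "\<And>b. b \<in> set (fraction q) \<Longrightarrow> b \<noteq> 0 \<Longrightarrow> b dvd D" and M: "\<forall>k \<in> set (fraction q). k \<le> M"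
  shows "good_frac D (to_frac D q)" "frac_value D (to_frac D q) = q" "scaled (to_frac D q) \<le> M * D"
    "num (to_frac D q) \<le> M" "den (to_frac D q) \<le> M" "fst (snd (snd (snd (to_frac D q)))) \<le> M" "snd (snd (snd (snd (to_frac D q)))) \<le> M"
proof -
  obtain x y where xy: "quotient_of q = (x, y)" by force
  define a where "a = nat x" define b where "b = nat y"
  have f: "fraction q = [a, b]" by (simp add: fraction_def xy a_def b_def)
  have y: "y > 0" "coprime x y" "q = of_int x / of_int y"
    using xy quotient_of_denom_pos quotient_of_coprime quotient_of_div by blast+
  have x: "x \<ge> 0" using q y by (simp add: zero_le_divide_iff)
  have ab: "x = int a" "y = int b" using x y by (simp_all add: a_def b_def)
  have b1: "1 \<le> b" and cop: "coprime a b" and qab: "q = of_nat a / of_nat b" using y unfolding ab by auto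
  have bD: "b dvd D" using dvd[of b] f b1 by simp
  have w: "\<exists>w. a * fst w = b * snd w + 1 \<and> fst w \<le> b \<and> snd w \<le> a" if "b \<noteq> 1"
  proof -
    have b2: "b \<ge> 2" using that b1 by simp
    then have "a \<noteq> 0" using cop by (metis coprime_0_left_iff nat_dvd_1_iff_1 that)
    then obtain u v where uv: "a * u = b * v + 1" using bezout_nat[of a b] cop by (auto simp: coprime_iff_gcd_eq_1)
    \<comment> \<open>Reducing \<open>u\<close> modulo \<open>b\<close> keeps the identity and
      bounds both coefficients, so that the witness is as short as the fraction.\<close>
    have "a * (u mod b) mod b = (b * v + 1) mod b" unfolding uv[symmetric] by (simp add: mod_mult_right_eq)
    also have "\<dots> = 1" using mod_mult_self2[of 1 b v] b2 by (simp add: add.commute)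
    finally have 1: "a * (u mod b) = b * (a * (u mod b) div b) + 1" by (metis mult_div_mod_eq)
    have "a * (u mod b) div b \<le> a"
      using div_le_mono[of "a * (u mod b)" "a * b" b] b1 by (simp add: less_imp_le)
    then show ?thesis using 1 b1 by (intro exI[of _ "(u mod b, a * (u mod b) div b)"]) (simp add: less_imp_le)
  qed
  define w where "w = (SOME w. a * fst w = b * snd w + 1 \<and> fst w \<le> b \<and> snd w \<le> a)"
  have w: "a * fst w = b * snd w + 1 \<and> fst w \<le> b \<and> snd w \<le> a" if "b \<noteq> 1"
    unfolding w_def by (rule someI_ex[OF w[OF that]])
  have t: "to_frac D q = (a, b, a * (D div b), if b = 1 then 0 else fst w, if b = 1 then 0 else snd w)"
    by (simp add: to_frac_def f w_def Let_def)
  have "a * D = a * (D div b) * b" using bD by simp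
  then show "good_frac D (to_frac D q)" using b1 w by (auto simp: good_frac_def t)
  have "(a * (D div b)) * b = a * D" using bD by simp
  then have e: "rat_of_nat (a * (D div b)) * of_nat b = of_nat a * of_nat D" by (metis of_nat_mult)
  have "frac_value D (to_frac D q) = rat_of_nat (a * (D div b)) / of_nat D" unfolding frac_value_def t by simp
  also have "\<dots> = of_nat a / of_nat b" using e b1 D by (simp add: frac_eq_eq del: of_nat_mult)
  finally show "frac_value D (to_frac D q) = q" unfolding qab .
  have M': "a \<le> M" "b \<le> M" using M f by auto
  show "scaled (to_frac D q) \<le> M * D" unfolding t using M' by (auto intro: mult_le_mono)
  show "num (to_frac D q) \<le> M" "den (to_frac D q) \<le> M" using M' by (simp_all add: t)
  show "fst (snd (snd (snd (to_frac D q)))) \<le> M" "snd (snd (snd (snd (to_frac D q)))) \<le> M"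
    using w M' by (auto simp: t intro: le_trans)
qed

text \<open>The product of all nonzero numbers of the serialisation is a crude multiple of all
  denominators, but its length is at most the square of that of the input. \<open>max 1\<close>
  skips the zeros.\<close>

definition common_den :: "nat msp_instance \<Rightarrow> nat" where
  "common_den P = prod_list (map (max 1) (serialise P))"

lemma common_den:
  "1 \<le> common_den P" "k \<in> set (serialise P) \<Longrightarrow> k \<noteq> 0 \<Longrightarrow> k dvd common_den P"
  "common_den P \<le> 2 ^ (length (encode P) * length (encode P))"
proof -
  have p: "1 \<le> prod_list (map (max 1) xs)" for xs :: "nat list" by (induction xs) auto
  then show "1 \<le> common_den P" unfolding common_den_def .
  have d: "k dvd prod_list (map (max 1) xs)" if "k \<in> set xs" "k \<noteq> 0" for xs and k :: nat
    using that by (induction xs) (auto simp: max_def)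
  then show "k \<in> set (serialise P) \<Longrightarrow> k \<noteq> 0 \<Longrightarrow> k dvd common_den P" unfolding common_den_def .
  let ?l = "length (encode P)"
  have b: "prod_list (map (max 1) xs) \<le> (2 ^ ?l) ^ length xs" if "\<forall>k \<in> set xs. k < 2 ^ ?l" for xs :: "nat list"
    using that by (induction xs) (auto intro!: mult_le_mono)
  have "common_den P \<le> (2 ^ ?l) ^ length (serialise P)"
    unfolding common_den_def by (rule b) (use serialise_bounds(2) in auto)
  also have "\<dots> \<le> (2 ^ ?l) ^ ?l" by (rule power_increasing[OF serialise_bounds(1)]) simp
  finally show "common_den P \<le> 2 ^ (?l * ?l)" by (simp add: power_mult)
qed

definition to_data :: "nat msp_instance \<Rightarrow> data" where
  "to_data P = (let n = card (pverts (graph P)); D = common_den P in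
     ((replicate n (), replicate (modes P) (), D),
      map (\<lambda>u. map (\<lambda>v. ((u, v) \<in> parcs (graph P), if (u, v) \<in> parcs (graph P) then to_frac D (weight P (u, v)) else (0, 0, 0, 0, 0),
        demand P (u, v))) [0..<n]) [0..<n],
      map (\<lambda>i. (to_frac D (travel_time P i), to_frac D (energy P i), to_frac D (cost P i), to_frac D (capacity P i))) [0..<Suc (modes P)],
      to_frac D (budget P), to_frac D (time_bound P), to_frac D (energy_bound P)))"

lemma to_data:
  assumes P: "P \<in> instances"
  shows "d_valid (to_data P)" "same_data P (d_instance (to_data P))" "encode (d_instance (to_data P)) = encode P"
proof -
  obtain n where V: "pverts (graph P) = {..<n}" and valid: "valid_instance P" using P by (auto simp: instances_def)
  let ?D = "common_den P" and ?d = "to_data P"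
  note mem = serialise_members[OF V]
  interpret pair_fin_digraph "graph P" using valid by (simp add: valid_instance_def)
  have EV: "parcs (graph P) \<subseteq> {..<n} \<times> {..<n}" using in_arcsD1 in_arcsD2 V by auto
  have fr: "good_frac ?D (to_frac ?D q)" "frac_value ?D (to_frac ?D q) = q"
    if "0 \<le> q" "set (fraction q) \<subseteq> set (serialise P)" for q
  proof -
    have "b dvd ?D" if "b \<in> set (fraction q)" "b \<noteq> 0" for b
      using that \<open>set (fraction q) \<subseteq> set (serialise P)\<close> common_den(2) by blast
    then show "good_frac ?D (to_frac ?D q)" "frac_value ?D (to_frac ?D q) = q"
      using to_frac(1,2)[OF that(1) common_den(1), of P "Max (set (fraction q))"] by auto
  qed
  have W: "good_frac ?D (to_frac ?D (weight P e))" "frac_value ?D (to_frac ?D (weight P e)) = weight P e" if eE: "e \<in> parcs (graph P)" for e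
  proof -
    obtain u v where e: "e = (u, v)" "u < n" "v < n" using eE EV by auto
    have "0 \<le> weight P e" using eE valid by (simp add: valid_instance_def)
    moreover have "set (fraction (weight P e)) \<subseteq> set (serialise P)" using mem(4)[OF e(2,3)] eE e(1) by simp
    ultimately show "good_frac ?D (to_frac ?D (weight P e))" "frac_value ?D (to_frac ?D (weight P e)) = weight P e"
      using fr by blast+
  qed
  have M: "good_frac ?D (to_frac ?D (f i)) \<and> frac_value ?D (to_frac ?D (f i)) = f i"
    if "i \<le> modes P" "f \<in> {travel_time P, energy P, cost P, capacity P}" for f i
    using that valid mem(5)[OF that(1)] by (auto intro!: fr simp: valid_instance_def less_imp_le)
  have A: "good_frac ?D (to_frac ?D q) \<and> frac_value ?D (to_frac ?D q) = q"
    if "q \<in> {budget P, time_bound P, energy_bound P}" for q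
    using that valid mem(6) by (auto intro!: fr simp: valid_instance_def less_imp_le)
  have dn: "length (fst (fst ?d)) = n" "length (fst (snd (fst ?d))) = modes P" "d_D ?d = ?D"
    by (simp_all add: to_data_def Let_def V d_D_def)
  have de: "d_entry ?d u v = ((u, v) \<in> parcs (graph P), if (u, v) \<in> parcs (graph P) then to_frac ?D (weight P (u, v)) else (0, 0, 0, 0, 0), demand P (u, v))"
    if "u < n" "v < n" for u v
    using that by (simp add: d_entry_def to_data_def Let_def V nth_default_def)
  have dm: "d_mode ?d i = (to_frac ?D (travel_time P i), to_frac ?D (energy P i), to_frac ?D (cost P i), to_frac ?D (capacity P i))"
    if "i \<le> modes P" for i
    using that by (simp add: d_mode_def to_data_def Let_def nth_default_def del: upt_Suc)
  have dp: "d_params ?d = (to_frac ?D (budget P), to_frac ?D (time_bound P), to_frac ?D (energy_bound P))"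
    by (simp add: d_params_def to_data_def Let_def)
  have "{e \<in> {..<n} \<times> {..<n}. d_arc ?d (fst e) (snd e)} = parcs (graph P)"
    using EV by (auto simp: de)
  then have g: "graph (d_instance ?d) = graph P"
    using V by (intro pair_pre_digraph.equality) (auto simp: dn)
  show same: "same_data P (d_instance ?d)"
    unfolding same_data_def
  proof (intro conjI ballI)
    show "graph P = graph (d_instance ?d)" using g by simp
    show "modes P = modes (d_instance ?d)" by (simp add: dn)
    fix e assume "e \<in> parcs (graph P)"
    then show "weight P e = weight (d_instance ?d) e" using EV W[of e] by (auto simp: dn de)
  next
    fix e assume "e \<in> pverts (graph P) \<times> pverts (graph P)"
    then show "demand P e = demand (d_instance ?d) e" by (auto simp: V de)
  next
    fix i assume "i \<in> {0..modes P}"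
    then show "travel_time P i = travel_time (d_instance ?d) i" "energy P i = energy (d_instance ?d) i"
      "cost P i = cost (d_instance ?d) i" "capacity P i = capacity (d_instance ?d) i"
      using M[of i] by (simp_all add: dm dn)
  next
    show "budget P = budget (d_instance ?d)" "time_bound P = time_bound (d_instance ?d)" "energy_bound P = energy_bound (d_instance ?d)"
      using A by (simp_all add: dp dn)
  qed
  have pos: "1 \<le> scaled r" if "0 < frac_value ?D r" for r
    using that frac_value_simps(2)[OF common_den(1)] by blast
  show "d_valid ?d"
    unfolding d_valid_def
  proof (intro conjI ballI impI)
    show "1 \<le> d_D ?d" using common_den(1) by (simp add: dn)
    fix u v assume uv: "u \<in> set (d_n ?d)" "v \<in> set (d_n ?d)"
    then have l: "u < n" "v < n" by (simp_all add: d_n_def dn)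
    show "d_arc ?d u v \<Longrightarrow> good_frac (d_D ?d) (d_weight ?d u v)" using W[of "(u, v)"] by (simp add: de[OF l] dn)
    show "u = v \<Longrightarrow> d_demand ?d u v = 0" using valid l by (simp add: de valid_instance_def V)
  next
    fix i assume "i \<in> set (d_modes ?d)"
    then have i: "i \<le> modes P" by (auto simp: d_modes_eq dn less_Suc_eq_le simp del: upt_Suc)
    then have "0 < capacity P i" using valid by (simp add: valid_instance_def)
    then have "0 < frac_value ?D (to_frac ?D (capacity P i))" using M[OF i, of "capacity P"] by simp
    then show "1 \<le> scaled (d_capacity ?d i)" using pos by (simp add: dm[OF i])
    show "good_frac (d_D ?d) (d_time ?d i)" "good_frac (d_D ?d) (d_energy ?d i)" "good_frac (d_D ?d) (d_cost ?d i)"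
      "good_frac (d_D ?d) (d_capacity ?d i)" using M[OF i] by (simp_all add: dm[OF i] dn)
  next
    show "good_frac (d_D ?d) (d_budget ?d)" "good_frac (d_D ?d) (d_time_bound ?d)" "good_frac (d_D ?d) (d_energy_bound ?d)"
      using A by (simp_all add: dp dn)
    have "0 < frac_value ?D (to_frac ?D (budget P))" using A[of "budget P"] valid by (simp add: valid_instance_def)
    then show "1 \<le> scaled (d_budget ?d)" using pos by (simp add: dp)
    have "frac_value ?D (to_frac ?D (cost P 0)) = 0" using M[of 0 "cost P"] valid by (simp add: valid_instance_def)
    then show "scaled (d_cost ?d 0) = 0" unfolding frac_value_simps(3)[OF common_den(1)] by (simp add: dm)
    have "frac_value ?D (to_frac ?D (capacity P 0)) = 1" using M[of 0 "capacity P"] valid by (simp add: valid_instance_def)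
    then show "scaled (d_capacity ?d 0) = d_D ?d" unfolding frac_value_simps(4)[OF common_den(1)] by (simp add: dm dn)
  qed
  note s = same[unfolded same_data_def]
  have "concat (map (\<lambda>e. (if e \<in> parcs (graph P) then 1 # fraction (weight P e) else [0]) @ [demand P e]) (List.product [0..<n] [0..<n])) =
      concat (map (\<lambda>e. (if e \<in> parcs (graph P) then 1 # fraction (weight (d_instance ?d) e) else [0]) @ [demand (d_instance ?d) e]) (List.product [0..<n] [0..<n]))"
    using s V by (intro arg_cong[of _ _ concat] map_cong refl) (auto simp del: d_instance_simps)
  moreover have "concat (map (\<lambda>i. fraction (travel_time P i) @ fraction (energy P i) @ fraction (cost P i) @ fraction (capacity P i)) [0..<Suc (modes P)]) =
     concat (map (\<lambda>i. fraction (travel_time (d_instance ?d) i) @ fraction (energy (d_instance ?d) i) @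
                       fraction (cost (d_instance ?d) i) @ fraction (capacity (d_instance ?d) i)) [0..<Suc (modes P)])"
    using s by (intro arg_cong[of _ _ concat] map_cong refl) (auto simp del: d_instance_simps upt_Suc simp: less_Suc_eq_le)
  moreover have "budget P = budget (d_instance ?d)" "time_bound P = time_bound (d_instance ?d)" "energy_bound P = energy_bound (d_instance ?d)"
    "modes (d_instance ?d) = modes P" using s by auto
  ultimately have "serialise P = serialise (d_instance ?d)"
    unfolding serialise_def g V by (simp add: Let_def del: upt_Suc d_instance_simps)
  then show "encode (d_instance ?d) = encode P" unfolding encode_def by simp
qed

section \<open>Sizes of the certificates\<close>

lemma esz_nat_power: "k \<le> 2 ^ p \<Longrightarrow> esz k \<le> 4 * p + 5" for k :: nat
proof -
  assume "k \<le> 2 ^ p"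
  also have "2 ^ p < (2 ^ (p + 1) :: nat)" by simp
  finally have "length (binary k) \<le> p + 1" unfolding length_binary_le .
  then show ?thesis using esz_nat_le[of k] by linarith
qed

definition list_bound :: "nat \<Rightarrow> nat \<Rightarrow> nat" where "list_bound k K = k * (K + 1) + 1"

lemma esz_map_upt: "(\<And>i. i < k \<Longrightarrow> esz (f i) \<le> K) \<Longrightarrow> esz (map f [0..<k]) \<le> list_bound k K"
proof -
  assume f: "\<And>i. i < k \<Longrightarrow> esz (f i) \<le> K"
  have "esz (map f [0..<k]) \<le> length (map f [0..<k]) * (K + 1) + 1" by (rule esz_list_le) (use f in auto)
  then show ?thesis by (simp add: list_bound_def)
qed

lemma list_bound_mono: "k \<le> k' \<Longrightarrow> K \<le> K' \<Longrightarrow> list_bound k K \<le> list_bound k' K'"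
  unfolding list_bound_def by (intro add_le_mono mult_le_mono) auto

lemma polyb_list_bound: "polyb f \<Longrightarrow> polyb g \<Longrightarrow> polyb (\<lambda>n. list_bound (f n) (g n))"
  unfolding list_bound_def by (intro polyb_intros)

text \<open>The exponent is \<open>l * l + 2 * l + 1\<close>: on inputs of length \<open>l\<close>
  an entry of the layout is at most the total demand, below \<open>2 ^ (2 * l)\<close>, times the
  common denominator, at most \<open>2 ^ (l * l)\<close>, plus 1. The scaled data obey the same
  bound.\<close>

definition data_exp :: "nat \<Rightarrow> nat" where "data_exp l = (l + 1) ^ 2"
text \<open>At most \<open>l\<close> commodities, arcs and modes give at most
  \<open>l * l * l\<close> unknowns; the other terms count the flow and capacity rows and the rows
  for time and energy.\<close>

definition dim_bound :: "nat \<Rightarrow> nat" where "dim_bound l = l * l * l + 2 * l * l + 2"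
definition sol_exp :: "nat \<Rightarrow> nat" where
  "sol_exp l = dim_bound l ^ 2 + (dim_bound l + 4 * data_exp l + 1) * dim_bound l"

definition cert_bound :: "nat \<Rightarrow> nat" where
  "cert_bound l = (let Z = 4 * data_exp l + 5; Y = 4 * sol_exp l + 5 in
     (4 * l + 5 + Z) + list_bound l (list_bound l (6 * Z + 9)) + list_bound l (20 * Z + 19) + (15 * Z + 14) +
     Y + list_bound l (list_bound l (list_bound l Y)) + list_bound l (list_bound l (list_bound l (list_bound l (list_bound l Y)))) + 10)"

lemma polyb_cert_bound: "polyb cert_bound"
  unfolding cert_bound_def Let_def data_exp_def sol_exp_def dim_bound_def
  by (intro polyb_list_bound polyb_intros)

lemma solution_exp_bound:
  assumes "n \<le> dim_bound l"
  shows "fact n * (n * ((2 ^ data_exp l) ^ 2) ^ 2 + 1) ^ n \<le> (2 ^ sol_exp l :: nat)"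
proof -
  let ?p = "data_exp l" and ?t = "dim_bound l"
  have n2: "n \<le> 2 ^ n" by (simp add: less_imp_le)
  have "fact n \<le> n ^ n" using fact_le_power[of n, where 'a = nat] by simp
  also have "\<dots> \<le> (2 ^ n) ^ n" by (rule power_mono[OF n2]) simp
  also have "\<dots> \<le> 2 ^ (?t ^ 2)"
    unfolding power_mult[symmetric] power2_eq_square using assms by (intro power_increasing mult_le_mono) auto
  finally have 1: "fact n \<le> (2 ^ (?t ^ 2) :: nat)" .
  have "n * ((2 ^ ?p) ^ 2) ^ 2 + 1 \<le> 2 ^ n * 2 ^ (4 * ?p) + 1"
  proof -
    have "((2 ^ ?p) ^ 2) ^ 2 = (2 ^ (4 * ?p) :: nat)" by (simp flip: power_mult add: mult.commute)
    then show ?thesis using n2 by (simp add: mult_le_mono1)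
  qed
  also have "\<dots> \<le> 2 ^ (n + 4 * ?p + 1)"
    using one_le_power[of "2::nat" "n + 4 * ?p"] by (simp add: power_add)
  also have "\<dots> \<le> 2 ^ (?t + 4 * ?p + 1)" using assms by (intro power_increasing) auto
  finally have "(n * ((2 ^ ?p) ^ 2) ^ 2 + 1) ^ n \<le> (2 ^ (?t + 4 * ?p + 1)) ^ n" by (rule power_mono) simp
  also have "\<dots> \<le> 2 ^ ((?t + 4 * ?p + 1) * ?t)"
    unfolding power_mult[symmetric] using assms by (intro power_increasing mult_le_mono) auto
  finally show ?thesis unfolding sol_exp_def power_add by (intro mult_le_mono 1)
qed

lemma to_frac_bounds:
  assumes q: "0 \<le> q" "set (fraction q) \<subseteq> set (serialise P)"
  defines "p \<equiv> data_exp (length (encode P))" and "r \<equiv> to_frac (common_den P) q"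
  shows "scaled r \<le> 2 ^ p" "esz r \<le> 5 * (4 * p + 5) + 4"
proof -
  let ?l = "length (encode P)"
  have M: "\<forall>k \<in> set (fraction q). k \<le> 2 ^ ?l" using q(2) serialise_bounds(2) by (auto intro: less_imp_le)
  have dvd: "b dvd common_den P" if "b \<in> set (fraction q)" "b \<noteq> 0" for b
    using that q(2) common_den(2) by blast
  note t = to_frac[OF q(1) common_den(1) dvd M, folded r_def]
  have "2 ^ ?l * common_den P \<le> 2 ^ ?l * 2 ^ (?l * ?l)" by (intro mult_le_mono common_den(3)) simp
  also have "\<dots> \<le> 2 ^ p" unfolding p_def data_exp_def power_add[symmetric]
    by (intro power_increasing) (auto simp: power2_eq_square)
  finally show s: "scaled r \<le> 2 ^ p" using t(3) by linarith
  have "(2 :: nat) ^ ?l \<le> 2 ^ p" unfolding p_def data_exp_def by (intro power_increasing) (auto simp: power2_eq_square)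
  then have "num r \<le> 2 ^ p" "den r \<le> 2 ^ p" "fst (snd (snd (snd r))) \<le> 2 ^ p" "snd (snd (snd (snd r))) \<le> 2 ^ p"
    using t(4-7) by linarith+
  then have "esz (num r) \<le> 4 * p + 5" "esz (den r) \<le> 4 * p + 5" "esz (scaled r) \<le> 4 * p + 5"
    "esz (fst (snd (snd (snd r)))) \<le> 4 * p + 5" "esz (snd (snd (snd (snd r)))) \<le> 4 * p + 5"
    using s by (auto intro: esz_nat_power)
  then show "esz r \<le> 5 * (4 * p + 5) + 4" by (cases r) auto
qed

lemma verify_complete:
  assumes "x \<in> msp_language r"
  shows "\<exists>c. esz c \<le> cert_bound (length x) \<and> verify r (x, c)"
proof -
  obtain P where P: "P \<in> instances" "r \<longrightarrow> restricted_instance P" "yes_instance P" and x: "x = encode P"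
    using assms unfolding msp_language_def by auto
  obtain n where V: "pverts (graph P) = {..<n}" and valid: "valid_instance P" using P by (auto simp: instances_def)
  define l where "l = length x"
  define d where "d = to_data P"
  \<comment> \<open>The certificate reproduces \<open>P\<close> only up to irrelevant values. All
    bounds are therefore shown for \<open>Q\<close>, to which the answer carries over.\<close>
  define Q where "Q = d_instance d"
  note td = to_data[OF P(1), folded d_def, folded Q_def]
  note sd = td(2)[unfolded same_data_def]
  note mem = serialise_members[OF V]
  let ?D = "common_den P" and ?p = "data_exp l" and ?m = "modes P"
  have lP: "l = length (encode P)" by (simp add: l_def x)
  interpret pair_fin_digraph "graph P" using valid by (simp add: valid_instance_def)
  have EV: "parcs (graph P) \<subseteq> {..<n} \<times> {..<n}" using in_arcsD1 in_arcsD2 V by auto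
  have nn: "n * n \<le> l" and ml: "Suc ?m \<le> l" using mem(1,2) serialise_bounds(1)[of P] lP by linarith+
  have nl: "n \<le> l" using nn le_square[of n] by linarith
  have VQ: "valid_instance Q" and yQ: "yes_instance Q"
    using valid_d_instance[OF td(1)] same_data_yes_instance[OF td(2) P(3)] by (simp_all add: Q_def)
  have rQ: "r \<longrightarrow> d_restricted d"
    using P(2) sd unfolding d_restricted_iff[OF td(1)] Q_def[symmetric] restricted_instance_def by auto
  interpret Q: scaled_msp Q "d_D d" "\<lambda>e. scaled (d_weight d (fst e) (snd e))" "\<lambda>i. scaled (d_time d i)"
    "\<lambda>i. scaled (d_energy d i)" "\<lambda>i. scaled (d_cost d i)" "\<lambda>i. scaled (d_capacity d i)"
    "scaled (d_budget d)" "scaled (d_time_bound d)" "scaled (d_energy_bound d)"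
    unfolding Q_def by (rule scaled_d_instance[OF td(1)])
  have gQ: "graph Q = graph P" "modes Q = ?m" using sd by auto
  have dD: "d_D d = ?D" by (simp add: d_def to_data_def Let_def d_D_def)
  have dn: "length (fst (fst d)) = n" "length (fst (snd (fst d))) = ?m" by (simp_all add: d_def to_data_def Let_def V)
  have de: "d_entry d u v = ((u, v) \<in> parcs (graph P), if (u, v) \<in> parcs (graph P) then to_frac ?D (weight P (u, v)) else (0, 0, 0, 0, 0), demand P (u, v))"
    if "u < n" "v < n" for u v
    using that by (simp add: d_def d_entry_def to_data_def Let_def V nth_default_def)
  have dm: "d_mode d i = (to_frac ?D (travel_time P i), to_frac ?D (energy P i), to_frac ?D (cost P i), to_frac ?D (capacity P i))"
    if "i \<le> ?m" for i
    using that by (simp add: d_def d_mode_def to_data_def Let_def nth_default_def del: upt_Suc)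
  have dp: "d_params d = (to_frac ?D (budget P), to_frac ?D (time_bound P), to_frac ?D (energy_bound P))"
    by (simp add: d_def d_params_def to_data_def Let_def)
  have fb: "scaled (to_frac ?D q) \<le> 2 ^ ?p \<and> esz (to_frac ?D q) \<le> 5 * (4 * ?p + 5) + 4"
    if "0 \<le> q" "set (fraction q) \<subseteq> set (serialise P)" for q
    using to_frac_bounds[OF that] by (simp add: lP)
  have bw: "scaled (to_frac ?D (weight P (u, v))) \<le> 2 ^ ?p \<and> esz (to_frac ?D (weight P (u, v))) \<le> 5 * (4 * ?p + 5) + 4"
    if "(u, v) \<in> parcs (graph P)" for u v
  proof (rule fb)
    show "0 \<le> weight P (u, v)" using valid that by (simp add: valid_instance_def)
    show "set (fraction (weight P (u, v))) \<subseteq> set (serialise P)" using EV that by (intro mem(4)) auto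
  qed
  have bm: "scaled (to_frac ?D (f i)) \<le> 2 ^ ?p \<and> esz (to_frac ?D (f i)) \<le> 5 * (4 * ?p + 5) + 4"
    if "i \<le> ?m" "f \<in> {travel_time P, energy P, cost P, capacity P}" for f i
    using that valid mem(5)[OF that(1)] by (intro fb) (auto simp: valid_instance_def less_imp_le)
  have bp: "scaled (to_frac ?D q) \<le> 2 ^ ?p \<and> esz (to_frac ?D q) \<le> 5 * (4 * ?p + 5) + 4"
    if "q \<in> {budget P, time_bound P, energy_bound P}" for q
    using that valid mem(6) by (intro fb) (auto simp: valid_instance_def less_imp_le)
  have lp: "l \<le> ?p" "l * l + 2 * l + 1 = ?p" by (simp_all add: data_exp_def power2_eq_square)
  have pow_lp: "(2 :: nat) ^ l \<le> 2 ^ ?p" using lp by (intro power_increasing) auto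
  have bd: "demand P (u, v) \<le> 2 ^ l" if "u < n" "v < n" for u v
    using mem(3)[OF that] serialise_bounds(2)[of _ P] by (auto simp: lP intro: less_imp_le)
  have Dp: "?D \<le> 2 ^ ?p"
  proof -
    have "?D \<le> 2 ^ (l * l)" using common_den(3) lP by simp
    also have "\<dots> \<le> 2 ^ ?p" using lp by (intro power_increasing) auto
    finally show ?thesis .
  qed
  have fin: "finite (parcs (graph P))" by (rule pair_finite_arcs)
  have cE: "card (parcs (graph P)) \<le> l"
    using card_mono[OF _ EV] nn by (simp add: card_cartesian_product)
  have KV: "commodities Q \<subseteq> {..<n} \<times> {..<n}" using gQ V by (auto simp: commodities_def)
  have cK: "card (commodities Q) \<le> l"
    using card_mono[OF _ KV] nn by (simp add: card_cartesian_product)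
  obtain L G where LG: "mode_flow Q L G" and Lb: "\<And>e i. e \<in> parcs (graph Q) \<Longrightarrow> i \<in> {1..modes Q} \<Longrightarrow>
      of_rat (capacity Q i) * real (L e i) \<le> real (\<Sum>\<kappa> \<in> commodities Q. demand Q \<kappa>) + of_rat (capacity Q i)"
    using bounded_mode_flow[OF VQ] yQ unfolding yes_instance_iff_mode_flow[OF VQ] by metis
  have demQ: "demand Q \<kappa> \<le> 2 ^ l" if kQ: "\<kappa> \<in> commodities Q" for \<kappa>
  proof -
    obtain s t where k: "\<kappa> = (s, t)" "s < n" "t < n" using kQ KV by auto
    then have "demand P \<kappa> = demand Q \<kappa>" using sd V by auto
    then show ?thesis using bd[OF k(2,3)] k(1) by simp
  qed
  \<comment> \<open>Scaled capacities are at least 1, so dividing by the capacity costs no more than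
    a factor of the common denominator.\<close>
  have Lp: "L e i \<le> 2 ^ ?p" if e: "e \<in> parcs (graph Q)" and i: "i \<in> {1..modes Q}" for e i
  proof -
    let ?c = "scaled (d_capacity d i)" and ?S = "\<Sum>\<kappa> \<in> commodities Q. demand Q \<kappa>"
    have i': "i \<in> set (d_modes d)" using i unfolding d_modes_eq dn gQ by auto
    have c1: "1 \<le> ?c" using td(1) i' by (simp add: d_valid_def)
    have D1: "1 \<le> d_D d" using td(1) by (simp add: d_valid_def)
    have cap: "real_of_rat (capacity Q i) = real ?c / real (d_D d)"
      using Q.real_data(4) i by simp
    have "real ?c * real (L e i) \<le> real ?S * real (d_D d) + real ?c"
      using Lb[OF e i] D1 unfolding cap by (simp add: field_simps)
    then have "real (?c * L e i) \<le> real (?S * d_D d + ?c)" by (simp del: of_nat_sum)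
    then have "?c * L e i \<le> ?S * d_D d + ?c" by (simp only: of_nat_le_iff)
    also have "\<dots> \<le> ?c * (?S * d_D d + 1)" using mult_le_mono1[OF c1, of "?S * d_D d"] by simp
    finally have "?c * L e i \<le> ?c * (?S * d_D d + 1)" .
    moreover have "0 < ?c" using c1 by linarith
    ultimately have "L e i \<le> ?S * d_D d + 1" unfolding mult_le_cancel1 by blast
    moreover have "?S \<le> 2 ^ l * 2 ^ l"
    proof -
      have "?S \<le> (\<Sum>\<kappa> \<in> commodities Q. 2 ^ l)" by (intro sum_mono demQ)
      also have "\<dots> = card (commodities Q) * 2 ^ l" by simp
      also have "\<dots> \<le> 2 ^ l * 2 ^ l" using cK less_exp[of l] by (intro mult_le_mono1) linarith
      finally show ?thesis .
    qed
    then have "?S * d_D d \<le> 2 ^ l * 2 ^ l * 2 ^ (l * l)"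
      using common_den(3)[of P] unfolding dD lP[symmetric] by (rule mult_le_mono)
    ultimately have "L e i \<le> 2 ^ l * 2 ^ l * 2 ^ (l * l) + 1" by linarith
    also have "\<dots> = 2 ^ (l * l + 2 * l) + 1" by (simp add: power_add mult_2)
    also have "\<dots> \<le> 2 ^ (l * l + 2 * l + 1)" using one_le_power[of "2::nat" "l * l + 2 * l"] by simp
    finally show ?thesis unfolding lp(2) .
  qed
  let ?nn = "card (commodities Q) * card (parcs (graph Q)) * Suc (modes Q) +
     (card (commodities Q) * card (pverts (graph Q)) + card (parcs (graph Q)) * modes Q + 2)"
  have N: "d_D d \<le> 2 ^ ?p" "\<forall>e \<in> parcs (graph Q). scaled (d_weight d (fst e) (snd e)) \<le> 2 ^ ?p"
    "\<forall>i \<le> modes Q. scaled (d_time d i) \<le> 2 ^ ?p \<and> scaled (d_energy d i) \<le> 2 ^ ?p \<and> scaled (d_capacity d i) \<le> 2 ^ ?p"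
    "scaled (d_time_bound d) \<le> 2 ^ ?p" "scaled (d_energy_bound d) \<le> 2 ^ ?p"
    "\<forall>\<kappa> \<in> commodities Q. demand Q \<kappa> \<le> 2 ^ ?p" "\<forall>e \<in> parcs (graph Q). \<forall>i \<in> {1..modes Q}. L e i \<le> 2 ^ ?p" "1 \<le> (2 :: nat) ^ ?p"
  proof -
    show "d_D d \<le> 2 ^ ?p" using Dp dD by simp
    show "\<forall>e \<in> parcs (graph Q). scaled (d_weight d (fst e) (snd e)) \<le> 2 ^ ?p"
      unfolding gQ using EV bw by (force simp: de)
    show "\<forall>i \<le> modes Q. scaled (d_time d i) \<le> 2 ^ ?p \<and> scaled (d_energy d i) \<le> 2 ^ ?p \<and> scaled (d_capacity d i) \<le> 2 ^ ?p"
      unfolding gQ using bm by (simp add: dm)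
    show "scaled (d_time_bound d) \<le> 2 ^ ?p" "scaled (d_energy_bound d) \<le> 2 ^ ?p" using bp by (simp_all add: dp)
    show "\<forall>\<kappa> \<in> commodities Q. demand Q \<kappa> \<le> 2 ^ ?p" using demQ pow_lp le_trans by blast
    show "\<forall>e \<in> parcs (graph Q). \<forall>i \<in> {1..modes Q}. L e i \<le> 2 ^ ?p" using Lp by blast
  qed simp
  from Q.exists_small_int_solution[OF LG N]
  obtain q g where q1: "1 \<le> q" and qS: "q \<le> fact ?nn * (?nn * ((2 ^ ?p) ^ 2) ^ 2 + 1) ^ ?nn"
    and gS: "\<forall>\<kappa> \<in> commodities Q. \<forall>e \<in> parcs (graph Q). \<forall>i \<le> modes Q. g \<kappa> e i \<le> fact ?nn * (?nn * ((2 ^ ?p) ^ 2) ^ 2 + 1) ^ ?nn"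
    and sol: "Q.int_solution q L g" by blast
  have "?nn \<le> dim_bound l"
  proof -
    have "card (commodities Q) * card (parcs (graph Q)) * Suc (modes Q) \<le> l * l * l"
      unfolding gQ using cK cE ml by (intro mult_le_mono) auto
    moreover have "card (commodities Q) * card (pverts (graph Q)) \<le> l * l"
      unfolding gQ V using cK nl by (intro mult_le_mono) auto
    moreover have "card (parcs (graph Q)) * modes Q \<le> l * l"
      unfolding gQ using cE ml by (intro mult_le_mono) auto
    ultimately show ?thesis unfolding dim_bound_def by simp
  qed
  note S = solution_exp_bound[OF this]
  \<comment> \<open>Off the arcs, the commodities and the public modes the given functions are
    unbounded; the entries stored there are 0.\<close>
  define Ls where "Ls = map (\<lambda>u. map (\<lambda>v. map (\<lambda>i. if (u, v) \<in> parcs (graph P) \<and> i \<noteq> 0 then L (u, v) i else 0) [0..<Suc ?m]) [0..<n]) [0..<n]"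
  define Gs where "Gs = map (\<lambda>s. map (\<lambda>t. map (\<lambda>u. map (\<lambda>v. map (\<lambda>i.
    if (s, t) \<in> commodities Q \<and> (u, v) \<in> parcs (graph P) then g (s, t) (u, v) i else 0) [0..<Suc ?m]) [0..<n]) [0..<n]) [0..<n]) [0..<n]"
  define c :: cert where "c = (d, q, Ls, Gs)"
  have cL: "c_L c (fst e) (snd e) i = L e i" if "e \<in> parcs (graph Q)" "i \<in> {1..modes Q}" for e i
    using that EV unfolding gQ by (auto simp: c_L_def c_def Ls_def nth_default_def simp del: upt_Suc)
  have cg: "c_g c (fst \<kappa>) (snd \<kappa>) (fst e) (snd e) i = g \<kappa> e i"
    if "\<kappa> \<in> commodities Q" "e \<in> parcs (graph Q)" "i \<le> modes Q" for \<kappa> e i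
    using that EV KV unfolding gQ by (auto simp: c_g_def c_def Gs_def nth_default_def simp del: upt_Suc)
  have "Q.int_solution q (\<lambda>e. c_L c (fst e) (snd e)) (\<lambda>\<kappa> e. c_g c (fst \<kappa>) (snd \<kappa>) (fst e) (snd e))"
    by (rule Q.int_solution_cong[OF _ _ sol]) (use cL cg in auto)
  then have "c_solution c" using c_solution_iff[of c] td(1) q1 by (simp add: c_def Q_def)
  then have ver: "verify r (x, c)"
    using td(1) rQ td(3) x unfolding verify_def encode_def Q_def by (simp add: c_def serialise_d_instance)
  have expP: "(2::nat) ^ ?p \<le> 2 ^ sol_exp l"
  proof (intro power_increasing)
    have "?p \<le> (dim_bound l + 4 * ?p + 1) * 1" by simp
    also have "\<dots> \<le> (dim_bound l + 4 * ?p + 1) * dim_bound l" by (rule mult_le_mono2) (simp add: dim_bound_def)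
    finally show "?p \<le> sol_exp l" unfolding sol_exp_def by simp
  qed simp
  let ?Z = "4 * ?p + 5" and ?Y = "4 * sol_exp l + 5"
  have z0: "esz (0::nat) \<le> k + 5" for k by (simp add: esz_nat)
  have "esz Ls \<le> list_bound l (list_bound l (list_bound l ?Y))"
  proof -
    have "esz Ls \<le> list_bound n (list_bound n (list_bound (Suc ?m) ?Y))"
    proof -
      have "L (u, v) i \<le> 2 ^ sol_exp l" if "(u, v) \<in> parcs (graph P)" "i < Suc ?m" "i \<noteq> 0" for u v i
        using that Lp[of "(u, v)" i] unfolding gQ by (intro le_trans[OF _ expP]) auto
      then show ?thesis unfolding Ls_def using z0
        by (intro esz_map_upt) (auto intro!: esz_nat_power)
    qed
    also have "\<dots> \<le> list_bound l (list_bound l (list_bound l ?Y))" using nl ml by (intro list_bound_mono) auto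
    finally show ?thesis .
  qed
  moreover have "esz Gs \<le> list_bound l (list_bound l (list_bound l (list_bound l (list_bound l ?Y))))"
  proof -
    have "g \<kappa> e i \<le> 2 ^ sol_exp l" if "\<kappa> \<in> commodities Q" "e \<in> parcs (graph P)" "i < Suc ?m" for \<kappa> e i
      using gS that S unfolding gQ by (meson le_trans less_Suc_eq_le)
    then have "esz Gs \<le> list_bound n (list_bound n (list_bound n (list_bound n (list_bound (Suc ?m) ?Y))))"
      unfolding Gs_def using z0
      by (intro esz_map_upt) (auto intro!: esz_nat_power)
    also have "\<dots> \<le> list_bound l (list_bound l (list_bound l (list_bound l (list_bound l ?Y))))" using nl ml by (intro list_bound_mono) auto
    finally show ?thesis .
  qed
  moreover have "esz q \<le> ?Y" using qS S by (intro esz_nat_power) linarith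
  moreover have "esz d \<le> (4 * l + 5 + ?Z) + list_bound l (list_bound l (6 * ?Z + 9)) + list_bound l (20 * ?Z + 19) + (15 * ?Z + 14) + 3"
  proof -
    have rep: "esz (replicate k ()) = 2 * k + 1" for k by (induction k) (auto simp: esz_def enc_unit_def)
    have "esz (map (\<lambda>u. map (\<lambda>v. ((u, v) \<in> parcs (graph P), if (u, v) \<in> parcs (graph P) then to_frac ?D (weight P (u, v)) else (0, 0, 0, 0, 0),
        demand P (u, v))) [0..<n]) [0..<n]) \<le> list_bound n (list_bound n (6 * ?Z + 9))"
    proof (intro esz_map_upt)
      have s: "Suc (a + Suc (b + c)) \<le> 6 * z + 9" if "a \<le> 3" "b \<le> 5 * z + 4" "c \<le> z" for a b c z :: nat
        using that by linarith
      fix u v assume uv: "u < n" "v < n"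
      have 1: "esz (demand P (u, v)) \<le> ?Z" using bd[OF uv] pow_lp by (intro esz_nat_power) linarith
      have 2: "esz (if (u, v) \<in> parcs (graph P) then to_frac ?D (weight P (u, v)) else (0, 0, 0, 0, 0)) \<le> 5 * ?Z + 4"
        using bw[of u v] by (auto simp: esz_nat)
      have "esz ((u, v) \<in> parcs (graph P)) \<le> 3" by simp
      then show "esz ((u, v) \<in> parcs (graph P), if (u, v) \<in> parcs (graph P) then to_frac ?D (weight P (u, v)) else (0, 0, 0, 0, 0), demand P (u, v)) \<le> 6 * ?Z + 9"
        unfolding esz_Pair by (intro s[OF _ 2 1])
    qed
    also have "\<dots> \<le> list_bound l (list_bound l (6 * ?Z + 9))" using nl by (intro list_bound_mono) auto
    finally have a: "esz (map (\<lambda>u. map (\<lambda>v. ((u, v) \<in> parcs (graph P), if (u, v) \<in> parcs (graph P) then to_frac ?D (weight P (u, v)) else (0, 0, 0, 0, 0),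
        demand P (u, v))) [0..<n]) [0..<n]) \<le> list_bound l (list_bound l (6 * ?Z + 9))" .
    have "esz (map (\<lambda>i. (to_frac ?D (travel_time P i), to_frac ?D (energy P i), to_frac ?D (cost P i), to_frac ?D (capacity P i))) [0..<Suc ?m]) \<le>
        list_bound (Suc ?m) (20 * ?Z + 19)"
    proof (intro esz_map_upt)
      fix i assume "i < Suc ?m"
      then have "i \<le> ?m" by simp
      note b = bm[OF this]
      show "esz (to_frac ?D (travel_time P i), to_frac ?D (energy P i), to_frac ?D (cost P i), to_frac ?D (capacity P i)) \<le> 20 * ?Z + 19"
        unfolding esz_Pair using b[of "travel_time P"] b[of "energy P"] b[of "cost P"] b[of "capacity P"] by simp
    qed
    also have "\<dots> \<le> list_bound l (20 * ?Z + 19)" using ml by (intro list_bound_mono) auto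
    finally have b: "esz (map (\<lambda>i. (to_frac ?D (travel_time P i), to_frac ?D (energy P i), to_frac ?D (cost P i), to_frac ?D (capacity P i))) [0..<Suc ?m]) \<le>
        list_bound l (20 * ?Z + 19)" .
    have e: "esz ?D \<le> ?Z" using Dp by (rule esz_nat_power)
    show ?thesis
      unfolding d_def to_data_def Let_def V card_lessThan esz_Pair rep
      using a b e nl ml bp[of "budget P"] bp[of "time_bound P"] bp[of "energy_bound P"] by simp
  qed
  ultimately have "esz c \<le> cert_bound l"
    unfolding c_def esz_Pair cert_bound_def Let_def by linarith
  then show ?thesis using ver l_def by blast
qed

theorem msp_language_NP: "msp_language r \<in> class_NP"
proof -
  obtain p :: "nat poly" where "\<And>n. cert_bound n \<le> poly p n" using polyb_cert_bound unfolding polyb_def by blast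
  then show ?thesis
    using verify_complete verify_sound by (intro class_NP_I[OF fp_verify, of r _ p]) (blast intro: le_trans)+
qed

lemma msp_language_False: "msp_language False = MSP" and msp_language_True: "msp_language True = restricted_MSP"
  by (simp_all add: msp_language_def MSP_def restricted_MSP_def)

section \<open>From hitting sets to the Modal Split Problem\<close>

text \<open>The vertices are a root, the elements of the ground set, and \<open>M\<close> copies of each set to be hit.
  Public transport halves the travel time, is free of charge, and its layout may use at most \<open>b\<close> arcs.
  The best use of these is to connect the root with the members of a hitting set.\<close>

definition hs_items :: "'l list \<Rightarrow> 'l list list \<Rightarrow> nat \<Rightarrow> (nat \<times> 'l list) list" where
  "hs_items ls cs M = (0, []) # map (\<lambda>l. (1, [l])) ls @ concat (map (\<lambda>c. replicate M (2, c)) cs)"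

text \<open>Tags 0, 1 and 2 mark the root, the elements and the copies of sets. A copy is entered
  from its elements only and left towards the root only, so every route between two copies leads
  through the root.\<close>

definition hs_adjacent :: "nat \<times> 'l list \<Rightarrow> nat \<times> 'l list \<Rightarrow> bool" where
  "hs_adjacent x y \<longleftrightarrow> (fst x = 0 \<and> fst y = 1) \<or> (fst x = 1 \<and> fst y = 0) \<or> (fst x = 2 \<and> fst y = 0) \<or>
     (fst x = 1 \<and> fst y = 2 \<and> hd (snd x) \<in> set (snd y))"

text \<open>One vehicle carries all traffic on an arc: there are at most \<open>n * n\<close>
  commodities, and a route of at most 3 arcs puts at most 3 units on an arc. The time bound grants 5
  units of time per commodity. As private transport takes no energy, \<open>energy_bound\<close>
  limits the number of vehicles.\<close>

definition hs_instance :: "(nat \<times> 'l list) list \<Rightarrow> nat \<Rightarrow> nat msp_instance" where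
  "hs_instance its b = (let n = length its in
    \<lparr>graph = \<lparr>pverts = {..<n}, parcs = {e \<in> {..<n} \<times> {..<n}. hs_adjacent (its ! fst e) (its ! snd e)}\<rparr>,
     weight = (\<lambda>e. 1), budget = 1, demand = (\<lambda>e. if fst e = snd e then 0 else 1), modes = 1,
     travel_time = (\<lambda>i. if i = 0 then 2 else 1), energy = (\<lambda>i. if i = 0 then 0 else 1), cost = (\<lambda>i. 0),
     capacity = (\<lambda>i. if i = 0 then 1 else of_nat (3 * n * n)), time_bound = of_nat (5 * n * n), energy_bound = of_nat b\<rparr>)"

section \<open>Flows along walks, and lower bounds by potentials\<close>

lemma net_flow_walk:
  assumes "finite E" "pcas s p t" "set p \<subseteq> E"
  shows "net_flow E (\<lambda>e. real (count_list p e)) v = of_bool (v = t) - of_bool (v = s)"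
  using assms(2,3)
proof (induction p arbitrary: s)
  case Nil
  then show ?case by (simp add: net_flow_def)
next
  case (Cons a p)
  obtain x y where a: "a = (x, y)" by force
  have "(\<lambda>e. real (count_list (a # p) e)) = (\<lambda>e. real (count_list p e) + of_bool (e = (x, y)))"
    by (auto simp: a)
  moreover have "net_flow E (\<lambda>e. real (count_list p e)) v = of_bool (v = t) - of_bool (v = y)"
    using Cons by (simp add: a)
  moreover have "(x, y) \<in> E" "x = s" using Cons.prems by (simp_all add: a)
  ultimately show ?case using net_flow_arc[OF assms(1), of x y v] by (simp only: net_flow_add)
qed

lemma sum_count_list:
  fixes g :: "'a \<Rightarrow> real"
  assumes "finite E" "set p \<subseteq> E"
  shows "(\<Sum>e \<in> E. g e * real (count_list p e)) = sum_list (map g p)"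
  using assms(2)
proof (induction p)
  case (Cons a p)
  have "(\<Sum>e \<in> E. g e * real (count_list (a # p) e)) = (\<Sum>e \<in> E. g e * real (count_list p e) + (if e = a then g a else 0))"
    by (intro sum.cong) (auto simp: algebra_simps)
  then show ?case using Cons assms(1) by (simp add: sum.distrib)
qed simp

text \<open>Weak duality for shortest paths: summation by parts turns the potential difference
  between \<open>t\<close> and \<open>s\<close> into a sum over arcs, which is estimated arc by
  arc.\<close>

lemma potential_bound:
  fixes \<pi> len :: "_ \<Rightarrow> real"
  assumes fin: "finite E" "finite V" and E: "E \<subseteq> V \<times> V" and f: "\<forall>e \<in> E. 0 \<le> f e"
    and net: "\<forall>v \<in> V. net_flow E f v = (if v = t then 1 else if v = s then - 1 else 0)" and st: "s \<in> V" "t \<in> V" "s \<noteq> t"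
    and \<pi>: "\<forall>e \<in> E. \<pi> (snd e) - \<pi> (fst e) \<le> len e"
  shows "\<pi> t - \<pi> s \<le> (\<Sum>e \<in> E. len e * f e)"
proof -
  have s: "(\<Sum>v \<in> V. \<pi> v * (\<Sum>e \<in> {e \<in> E. g e = v}. f e)) = (\<Sum>e \<in> E. \<pi> (g e) * f e)" if "g ` E \<subseteq> V" for g
  proof -
    have "(\<Sum>v \<in> V. \<pi> v * (\<Sum>e \<in> {e \<in> E. g e = v}. f e)) = (\<Sum>v \<in> V. \<Sum>e \<in> {e \<in> E. g e = v}. \<pi> (g e) * f e)"
      by (simp add: sum_distrib_left)
    also have "\<dots> = (\<Sum>e \<in> E. \<pi> (g e) * f e)" by (rule sum.group[OF fin that])
    finally show ?thesis .
  qed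
  have "(\<Sum>v \<in> V. \<pi> v * net_flow E f v) = (\<Sum>e \<in> E. \<pi> (snd e) * f e) - (\<Sum>e \<in> E. \<pi> (fst e) * f e)"
    unfolding net_flow_def right_diff_distrib sum_subtractf using E by (subst (1 2) s) auto
  also have "\<dots> = (\<Sum>e \<in> E. (\<pi> (snd e) - \<pi> (fst e)) * f e)" by (simp add: left_diff_distrib sum_subtractf)
  also have "\<dots> \<le> (\<Sum>e \<in> E. len e * f e)" using \<pi> f by (intro sum_mono mult_right_mono) auto
  also have "(\<Sum>v \<in> V. \<pi> v * net_flow E f v) = (\<Sum>v \<in> V. (if v = t then \<pi> t else 0) - (if v = s then \<pi> s else 0))"
    using net st(3) by (intro sum.cong) auto
  also have "\<dots> = \<pi> t - \<pi> s" using fin st by (simp add: sum_subtractf)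
  finally show ?thesis .
qed

section \<open>Correctness of the reduction from hitting sets\<close>

locale hitting =
  fixes ls :: "'l list" and cs :: "'l list list" and b :: nat
  assumes dist: "distinct ls" and cs: "cs \<noteq> []" "\<And>c. c \<in> set cs \<Longrightarrow> c \<noteq> [] \<and> set c \<subseteq> set ls" and b: "b \<le> length ls"
begin

text \<open>The factor 64 is a generous choice for the estimate that ends
  \<open>yes_implies_cover\<close>.\<close>

definition M :: nat where "M = 64 * (length ls + 1)"
abbreviation "its \<equiv> hs_items ls cs M"
abbreviation "n \<equiv> length its"
abbreviation "P \<equiv> hs_instance its b"
abbreviation "E \<equiv> parcs (graph P)"
abbreviation "tag v \<equiv> fst (its ! v)"
abbreviation "Ju \<equiv> {v \<in> {..<n}. tag v = 1}"
abbreviation "El \<equiv> {v \<in> {..<n}. tag v = 2}"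

lemma P_simps[simp]:
  "pverts (graph P) = {..<n}" "weight P = (\<lambda>e. 1)" "budget P = 1" "modes P = 1" "cost P = (\<lambda>i. 0)"
  "demand P = (\<lambda>e. if fst e = snd e then 0 else 1)" "travel_time P = (\<lambda>i. if i = 0 then 2 else 1)"
  "energy P = (\<lambda>i. if i = 0 then 0 else 1)" "capacity P = (\<lambda>i. if i = 0 then 1 else of_nat (3 * n * n))"
  "time_bound P = of_nat (5 * n * n)" "energy_bound P = of_nat b"
  by (simp_all add: hs_instance_def Let_def)

lemma E_def: "E = {e \<in> {..<n} \<times> {..<n}. hs_adjacent (its ! fst e) (its ! snd e)}"
  by (simp add: hs_instance_def Let_def)

lemma n_pos: "0 < n" by (simp add: hs_items_def)

lemma its_0: "its ! 0 = (0, [])" by (simp add: hs_items_def)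

lemma item_cases:
  assumes "v < n"
  shows "v = 0 \<or> (\<exists>l \<in> set ls. its ! v = (1, [l])) \<or> (\<exists>c \<in> set cs. its ! v = (2, c))"
proof (cases v)
  case (Suc w)
  then have "its ! v \<in> set (map (\<lambda>l. (1, [l])) ls @ concat (map (\<lambda>c. replicate M (2, c)) cs))"
    using assms unfolding hs_items_def by (simp only: nth_Cons_Suc length_Cons Suc_less_eq nth_mem)
  then show ?thesis by auto
qed simp

lemma count_items: "card {v \<in> {..<n}. p (its ! v)} = length (filter p its)"
  by (simp add: length_filter_conv_card lessThan_def)

lemma card_El: "card El = M * length cs"
proof -
  have "length (filter (\<lambda>x. fst x = 2) (concat (map (\<lambda>c. replicate m (2, c)) cs'))) = m * length cs'" for cs' :: "'l list list" and m
    by (induction cs') auto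
  moreover have "length (filter (\<lambda>x. fst x = 2) (map (\<lambda>l. (1 :: nat, [l])) ls)) = 0" by (auto simp: filter_empty_conv)
  ultimately have "length (filter (\<lambda>x. fst x = 2) its) = M * length cs" unfolding hs_items_def by simp
  then show ?thesis using count_items[of "\<lambda>x. fst x = 2"] by simp
qed

lemma card_copies:
  assumes "c \<in> set cs" shows "M \<le> card {v \<in> El. snd (its ! v) = c}"
proof -
  have "m \<le> length (filter (\<lambda>x. fst x = 2 \<and> snd x = c) (concat (map (\<lambda>c. replicate m (2, c)) cs')))" if "c \<in> set cs'" for cs' m
    using that by (induction cs') (auto simp: trans_le_add2)
  from this[OF assms, of M] have "M \<le> length (filter (\<lambda>x. fst x = 2 \<and> snd x = c) its)" unfolding hs_items_def by simp
  also have "\<dots> = card {v \<in> {..<n}. tag v = 2 \<and> snd (its ! v) = c}"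
    using count_items[of "\<lambda>x. fst x = 2 \<and> snd x = c"] by simp
  also have "{v \<in> {..<n}. tag v = 2 \<and> snd (its ! v) = c} = {v \<in> El. snd (its ! v) = c}" by auto
  finally show ?thesis .
qed

lemma length_its: "n = Suc (length ls + M * length cs)"
  unfolding hs_items_def by (simp add: length_concat comp_def sum_list_triv)

lemma lit_vertex: "i < length ls \<Longrightarrow> Suc i < n \<and> its ! Suc i = (1, [ls ! i])"
  using length_its by (simp add: hs_items_def nth_append)

lemma finE: "finite E" by (simp add: E_def)

lemma EV: "E \<subseteq> {..<n} \<times> {..<n}" by (auto simp: E_def)

lemma valid_P: "valid_instance P"
proof -
  have "pair_fin_digraph (graph P)" by unfold_locales (use EV finE in auto)
  then show ?thesis using n_pos by (simp add: valid_instance_def)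
qed

lemma instances_P: "P \<in> instances"
  using valid_P by (auto simp: instances_def)

lemma restricted_P: "restricted_instance P"
  by (simp add: restricted_instance_def)

lemma commodities_P: "commodities P = {\<kappa> \<in> {..<n} \<times> {..<n}. fst \<kappa> \<noteq> snd \<kappa>}"
  by (auto simp: commodities_def)

lemma card_commodities: "card (commodities P) \<le> n * n"
proof -
  have "card (commodities P) \<le> card ({..<n} \<times> {..<n})" unfolding commodities_P by (rule card_mono) auto
  then show ?thesis by (simp add: card_cartesian_product)
qed

text \<open>Every route passes through the root. It takes at most 2 to get there and at most 3 from
  there on: a copy is reached through a hitting element of its set, by a public arc and a private
  one.\<close>

lemma cover_implies_yes:
  assumes Hs: "Hs \<subseteq> set ls" "card Hs \<le> b" "\<And>c. c \<in> set cs \<Longrightarrow> Hs \<inter> set c \<noteq> {}"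
  shows "yes_instance P"
proof -
  define U where "U = (\<lambda>i. (0 :: nat, Suc i)) ` {i. i < length ls \<and> ls ! i \<in> Hs}"
  have cU: "card U \<le> b"
  proof -
    have "card {i. i < length ls \<and> ls ! i \<in> Hs} = card ((!) ls ` {i. i < length ls \<and> ls ! i \<in> Hs})"
      using dist by (intro card_image[symmetric]) (auto simp: inj_on_def nth_eq_iff_index_eq)
    also have "\<dots> \<le> card Hs" by (rule card_mono) (use Hs(1) finite_subset in auto)
    finally have "card {i. i < length ls \<and> ls ! i \<in> Hs} \<le> b" using Hs(2) by simp
    moreover have "card U \<le> card {i. i < length ls \<and> ls ! i \<in> Hs}" unfolding U_def by (rule card_image_le) simp
    ultimately show ?thesis by simp
  qed
  have UE: "U \<subseteq> E" using lit_vertex its_0 n_pos by (auto simp: U_def E_def hs_adjacent_def)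
  have "\<exists>i. i < length ls \<and> ls ! i \<in> Hs \<and> ls ! i \<in> set (snd (its ! v))" if v: "v \<in> El" for v
  proof -
    obtain c where c: "c \<in> set cs" "its ! v = (2, c)" using item_cases[of v] v its_0 by auto
    then obtain l where "l \<in> Hs" "l \<in> set c" using Hs(3) by blast
    then show ?thesis using Hs(1) c(2) by (metis in_set_conv_nth snd_conv subsetD)
  qed
  then have "\<forall>v \<in> El. \<exists>i. i < length ls \<and> ls ! i \<in> Hs \<and> ls ! i \<in> set (snd (its ! v))" by blast
  from bchoice[OF this] obtain h
    where h: "\<And>v. v \<in> El \<Longrightarrow> h v < length ls \<and> ls ! h v \<in> Hs \<and> ls ! h v \<in> set (snd (its ! v))" by blast
  define to_root where "to_root s = (if s = 0 then [] else [(s, 0 :: nat)])" for s :: nat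
  define from_root where "from_root t = (if t = 0 then [] else if tag t = 1 then [(0 :: nat, t)] else [(0, Suc (h t)), (Suc (h t), t)])" for t
  define path where "path \<kappa> = to_root (fst \<kappa>) @ from_root (snd \<kappa>)" for \<kappa>
  have El_cases: "v = 0 \<or> tag v = 1 \<or> v \<in> El" if "v < n" for v using item_cases[OF that] that by auto
  have pE: "set (path \<kappa>) \<subseteq> E" if k0: "\<kappa> \<in> commodities P" for \<kappa>
  proof -
    obtain s t where k: "\<kappa> = (s, t)" "s < n" "t < n" using k0 unfolding commodities_P by auto
    have "set (to_root s) \<subseteq> E" using k(2) El_cases[OF k(2)] its_0 n_pos by (auto simp: to_root_def E_def hs_adjacent_def)
    moreover have "set (from_root t) \<subseteq> E"
    proof (cases "t = 0 \<or> tag t = 1")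
      case True
      then show ?thesis using k(3) its_0 n_pos by (auto simp: from_root_def E_def hs_adjacent_def)
    next
      case False
      then have "t \<in> El" using El_cases[OF k(3)] by blast
      then show ?thesis using h[of t] lit_vertex[of "h t"] its_0 n_pos k(3) by (auto simp: from_root_def E_def hs_adjacent_def)
    qed
    ultimately show ?thesis by (simp add: path_def k)
  qed
  have walk: "pcas (fst \<kappa>) (path \<kappa>) (snd \<kappa>)" for \<kappa>
    by (auto simp: path_def to_root_def from_root_def)
  define len where "len e = (if e \<in> U then 1 else 2 :: real)" for e
  have cost: "sum_list (map len (path \<kappa>)) \<le> 5" if k0: "\<kappa> \<in> commodities P" for \<kappa>
  proof -
    obtain s t where k: "\<kappa> = (s, t)" "s < n" "t < n" using k0 unfolding commodities_P by auto
    have "sum_list (map len (to_root s)) \<le> 2" by (auto simp: to_root_def len_def)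
    moreover have "sum_list (map len (from_root t)) \<le> 3"
    proof (cases "t = 0 \<or> tag t = 1")
      case True
      then show ?thesis by (auto simp: from_root_def len_def)
    next
      case False
      then have "t \<in> El" using El_cases[OF k(3)] by blast
      then have "(0, Suc (h t)) \<in> U" using h[of t] by (auto simp: U_def)
      then show ?thesis using False by (simp add: from_root_def len_def)
    qed
    ultimately show ?thesis by (simp add: path_def k)
  qed
  have len3: "length (path \<kappa>) \<le> 3" for \<kappa> by (simp add: path_def to_root_def from_root_def)
  define L where "L e i = (if e \<in> U then 1 else 0 :: nat)" for e :: "nat \<times> nat" and i :: nat
  \<comment> \<open>A commodity changes to public transport on exactly the arcs of \<open>U\<close>
    along its route.\<close>
  define G where "G \<kappa> e i = (if (i = 1) = (e \<in> U) then real (count_list (path \<kappa>) e) else 0)" for \<kappa> e and i :: nat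
  have G1: "(\<Sum>i = 0..modes P. G \<kappa> e i) = real (count_list (path \<kappa>) e)" for \<kappa> e
    by (simp add: G_def)
  have finK: "finite (commodities P)" by (rule finite_commodities[OF valid_P])
  have "mode_flow P L G"
    unfolding mode_flow_def
  proof (intro conjI ballI)
    show "0 \<le> G \<kappa> e i" for \<kappa> e i by (simp add: G_def)
    fix \<kappa> v assume k: "\<kappa> \<in> commodities P"
    then have "fst \<kappa> \<noteq> snd \<kappa>" by (simp add: commodities_P)
    then show "net_flow E (\<lambda>e. \<Sum>i = 0..modes P. G \<kappa> e i) v =
        (if v = snd \<kappa> then real (demand P \<kappa>) else if v = fst \<kappa> then - real (demand P \<kappa>) else 0)"
      unfolding G1 net_flow_walk[OF finE walk pE[OF k]] by simp
  next
    show "feasible_layout P L" by (simp add: feasible_layout_def)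
  next
    fix e i assume e: "e \<in> E" and i: "i \<in> {1..modes P}"
    show "(\<Sum>\<kappa> \<in> commodities P. G \<kappa> e i) \<le> of_rat (capacity P i) * real (L e i)"
    proof (cases "e \<in> U")
      case True
      have "(\<Sum>\<kappa> \<in> commodities P. G \<kappa> e i) \<le> (\<Sum>\<kappa> \<in> commodities P. 3)"
        using order_trans[OF count_le_length len3] by (intro sum_mono) (auto simp: G_def)
      also have "\<dots> \<le> 3 * (real n * real n)" using card_commodities by (simp flip: of_nat_mult)
      finally show ?thesis using True i by (simp add: L_def of_rat_mult mult.assoc)
    next
      case False
      then show ?thesis using i by (simp add: G_def L_def)
    qed
  next
    have "(\<Sum>e \<in> E. of_rat (weight P e) * (\<Sum>i = 0..modes P. of_rat (travel_time P i) * (\<Sum>\<kappa> \<in> commodities P. G \<kappa> e i))) =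
        (\<Sum>e \<in> E. \<Sum>\<kappa> \<in> commodities P. len e * real (count_list (path \<kappa>) e))"
      by (intro sum.cong refl) (auto simp: G_def len_def sum_distrib_left)
    also have "\<dots> = (\<Sum>\<kappa> \<in> commodities P. \<Sum>e \<in> E. len e * real (count_list (path \<kappa>) e))" by (rule sum.swap)
    also have "\<dots> \<le> (\<Sum>\<kappa> \<in> commodities P. 5)"
      by (rule sum_mono) (simp add: sum_count_list[OF finE pE] cost)
    also have "\<dots> \<le> real (5 * n * n)" using card_commodities by (simp flip: of_nat_mult add: mult.assoc)
    finally show "(\<Sum>e \<in> E. of_rat (weight P e) * (\<Sum>i = 0..modes P. of_rat (travel_time P i) * (\<Sum>\<kappa> \<in> commodities P. G \<kappa> e i)))
       \<le> real_of_rat (time_bound P)" by (simp add: of_rat_mult)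
  next
    have "(\<Sum>e \<in> E. of_rat (weight P e) * (of_rat (energy P 0) * (\<Sum>\<kappa> \<in> commodities P. G \<kappa> e 0) +
       (\<Sum>i = 1..modes P. of_rat (energy P i) * real (L e i)))) = (\<Sum>e \<in> E. if e \<in> U then 1 else 0)"
      by (intro sum.cong) (auto simp: L_def)
    also have "\<dots> = real (card U)" using UE finE by (simp add: sum.If_cases Int_absorb1 Int_absorb2)
    finally show "(\<Sum>e \<in> E. of_rat (weight P e) * (of_rat (energy P 0) * (\<Sum>\<kappa> \<in> commodities P. G \<kappa> e 0) +
       (\<Sum>i = 1..modes P. of_rat (energy P i) * real (L e i)))) \<le> real_of_rat (energy_bound P)"
      using cU by simp
  qed
  then show ?thesis unfolding yes_instance_iff_mode_flow[OF valid_P] by blast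
qed

text \<open>At most \<open>b\<close> copies are incident with an arc of the layout.  If a set is not hit, then the travel
  time to each other copy of that set exceeds 5, and there are so many copies that this decides.\<close>

lemma yes_implies_cover:
  assumes "yes_instance P"
  shows "\<exists>Hs. Hs \<subseteq> set ls \<and> card Hs \<le> b \<and> (\<forall>c \<in> set cs. Hs \<inter> set c \<noteq> {})"
proof -
  obtain L G where LG: "mode_flow P L G" using assms unfolding yes_instance_iff_mode_flow[OF valid_P] by blast
  note g = LG[unfolded mode_flow_def]
  have finK: "finite (commodities P)" by (rule finite_commodities[OF valid_P])
  \<comment> \<open>The arcs with a vehicle. Each vehicle takes energy 1, so there are at most
    \<open>b\<close> such arcs.\<close>
  define U where "U = {e \<in> E. L e 1 \<noteq> 0}"
  have finU: "finite U" using finE by (simp add: U_def)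
  have "real (\<Sum>e \<in> E. L e 1) \<le> real b" using g by simp
  then have sL: "(\<Sum>e \<in> E. L e 1) \<le> b" by (simp only: of_nat_le_iff)
  have cU: "card U \<le> b"
  proof -
    have "card U = (\<Sum>e \<in> U. 1)" by simp
    also have "\<dots> \<le> (\<Sum>e \<in> U. L e 1)" by (rule sum_mono) (auto simp: U_def)
    also have "\<dots> \<le> (\<Sum>e \<in> E. L e 1)" by (rule sum_mono2[OF finE]) (auto simp: U_def)
    finally show ?thesis using sL by simp
  qed
  define Hs where "Hs = (\<lambda>e. hd (snd (its ! snd e))) ` {e \<in> U. tag (snd e) = 1}"
  have "Hs \<subseteq> set ls"
  proof
    fix l assume "l \<in> Hs"
    then obtain e where e: "e \<in> U" "tag (snd e) = 1" "l = hd (snd (its ! snd e))" by (auto simp: Hs_def)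
    then have "snd e < n" using EV by (auto simp: U_def)
    then show "l \<in> set ls" using item_cases[of "snd e"] e its_0 by auto
  qed
  moreover have "card Hs \<le> b"
  proof -
    have "card Hs \<le> card {e \<in> U. tag (snd e) = 1}" unfolding Hs_def using finU by (intro card_image_le) auto
    also have "\<dots> \<le> card U" using finU by (intro card_mono) auto
    finally show ?thesis using cU by simp
  qed
  moreover have "Hs \<inter> set c \<noteq> {}" if c: "c \<in> set cs" for c
  proof
    assume unhit: "Hs \<inter> set c = {}"
    define len where "len e = (if e \<in> U then 1 else 2 :: real)" for e
    define F where "F \<kappa> e = (\<Sum>i = 0..modes P. G \<kappa> e i)" for \<kappa> e
    have G0: "0 \<le> G \<kappa> e i" if "\<kappa> \<in> commodities P" "e \<in> E" "i \<le> 1" for \<kappa> e i using g that by auto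
    have F0: "0 \<le> F \<kappa> e" if "\<kappa> \<in> commodities P" "e \<in> E" for \<kappa> e unfolding F_def using G0 that by (intro sum_nonneg) auto
    have GU: "G \<kappa> e 1 = 0" if "\<kappa> \<in> commodities P" "e \<in> E" "e \<notin> U" for \<kappa> e
    proof -
      have "(\<Sum>\<kappa> \<in> commodities P. G \<kappa> e 1) \<le> of_rat (capacity P 1) * real (L e 1)" using g that by auto
      then have "(\<Sum>\<kappa> \<in> commodities P. G \<kappa> e 1) = 0" using that G0 by (intro order_antisym sum_nonneg) (auto simp: U_def)
      then show ?thesis using that G0 finK by (subst (asm) sum_nonneg_eq_0_iff) auto
    qed
    have time: "(\<Sum>\<kappa> \<in> commodities P. \<Sum>e \<in> E. len e * F \<kappa> e) \<le> real (5 * n * n)"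
    proof -
      have "(\<Sum>\<kappa> \<in> commodities P. \<Sum>e \<in> E. len e * F \<kappa> e) = (\<Sum>e \<in> E. \<Sum>\<kappa> \<in> commodities P. len e * F \<kappa> e)" by (rule sum.swap)
      also have "\<dots> \<le> (\<Sum>e \<in> E. \<Sum>\<kappa> \<in> commodities P. 2 * G \<kappa> e 0 + G \<kappa> e 1)"
      proof (intro sum_mono)
        fix e \<kappa> assume "e \<in> E" "\<kappa> \<in> commodities P"
        then show "len e * F \<kappa> e \<le> 2 * G \<kappa> e 0 + G \<kappa> e 1" using G0[of \<kappa> e 0] GU[of \<kappa> e] by (auto simp: len_def F_def)
      qed
      also have "\<dots> = (\<Sum>e \<in> E. of_rat (weight P e) * (\<Sum>i = 0..modes P. of_rat (travel_time P i) * (\<Sum>\<kappa> \<in> commodities P. G \<kappa> e i)))"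
        by (simp add: sum.distrib sum_distrib_left)
      also have "\<dots> \<le> real_of_rat (time_bound P)" using g by blast
      finally show ?thesis by (simp add: of_rat_mult)
    qed
    define dirty where "dirty = {v \<in> El. \<exists>e \<in> U. fst e = v \<or> snd e = v}"
    define clean where "clean = El - dirty"
    have finEl: "finite El" by simp
    have cd: "card dirty \<le> b"
    proof -
      \<comment> \<open>No arc joins two copies, so every public arc makes at most one copy
        dirty.\<close>
      have "dirty \<subseteq> (\<lambda>e. if tag (fst e) = 2 then fst e else snd e) ` U"
      proof
        fix v assume "v \<in> dirty"
        then obtain e where e: "e \<in> U" "fst e = v \<or> snd e = v" "tag v = 2" by (auto simp: dirty_def)
        have "\<not> (tag (fst e) = 2 \<and> tag (snd e) = 2)" using e(1) by (auto simp: U_def E_def hs_adjacent_def)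
        then show "v \<in> (\<lambda>e. if tag (fst e) = 2 then fst e else snd e) ` U"
          using e by (intro image_eqI[of _ _ e]) auto
      qed
      then have "card dirty \<le> card U" by (meson finU card_image_le card_mono finite_imageI le_trans)
      then show ?thesis using cU by simp
    qed
    have cc: "M * length cs \<le> card clean + b"
    proof -
      have "card El \<le> card dirty + card clean"
        unfolding clean_def using card_Un_le[of dirty "El - dirty"] by (simp add: dirty_def Un_absorb1 subset_iff)
      then show ?thesis using cd card_El by simp
    qed
    define bad where "bad = {v \<in> clean. snd (its ! v) = c}"
    have cb: "M \<le> card bad + b"
    proof -
      have "{v \<in> El. snd (its ! v) = c} \<subseteq> dirty \<union> bad" by (auto simp: bad_def clean_def)
      then have "card {v \<in> El. snd (its ! v) = c} \<le> card (dirty \<union> bad)"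
        by (rule card_mono[rotated]) (auto simp: dirty_def bad_def clean_def)
      also have "\<dots> \<le> card dirty + card bad" by (rule card_Un_le)
      finally show ?thesis using cd card_copies[OF c] by simp
    qed
    have lower: "(if t \<in> bad then 6 else 5) \<le> (\<Sum>e \<in> E. len e * F (s, t) e)" if st: "s \<in> clean" "t \<in> clean" "s \<noteq> t" for s t
    proof -
      let ?d = "if t \<in> bad then 6 else 5 :: real"
      \<comment> \<open>A lower bound for the time from \<open>s\<close>: 2 for the private arc to
        the root, 1 or 2 more for an element, and 2 more for the clean copy \<open>t\<close>. If the
        set of \<open>t\<close> is not hit, none of its elements is entered by a public arc, so 6 is
        feasible at \<open>t\<close>. Other copies get the value of the root, as their arcs lead
        there.\<close>
      define \<pi> where "\<pi> v = (if v = s then 0 else if v = t then ?d else if tag v = 1 then (if (0, v) \<in> U then 3 else 4) else 2)" for v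
      have tags: "tag s = 2" "tag t = 2" "s < n" "t < n" using st by (auto simp: clean_def)
      have nz: "s \<noteq> 0" "t \<noteq> 0" using tags(1,2) its_0 by (metis fst_conv zero_neq_numeral)+
      have notU: "e \<notin> U" if "fst e = s \<or> snd e = s \<or> fst e = t \<or> snd e = t" for e
        using st that by (auto simp: clean_def dirty_def)
      have k: "(s, t) \<in> commodities P" using st tags by (simp add: commodities_P)
      have root: "v = 0" if "v < n" "tag v = 0" for v using item_cases[OF that(1)] that by auto
      have "\<pi> t - \<pi> s \<le> (\<Sum>e \<in> E. len e * F (s, t) e)"
      proof (rule potential_bound[OF finE _ EV])
        show "\<forall>e \<in> E. 0 \<le> F (s, t) e" using F0 k by blast
        show "\<forall>v \<in> {..<n}. net_flow E (F (s, t)) v = (if v = t then 1 else if v = s then - 1 else 0)"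
          using g k st(3) unfolding F_def by auto
        show "\<forall>e \<in> E. \<pi> (snd e) - \<pi> (fst e) \<le> len e"
        proof
          fix e assume e: "e \<in> E"
          obtain u v where uv: "e = (u, v)" by force
          have l: "u < n" "v < n" using e uv EV by auto
          consider "tag u = 0" "tag v = 1" | "tag u = 1" "tag v = 0" | "tag u = 2" "tag v = 0"
            | "tag u = 1" "tag v = 2" "hd (snd (its ! u)) \<in> set (snd (its ! v))"
            using e unfolding E_def hs_adjacent_def uv by auto
          then show "\<pi> (snd e) - \<pi> (fst e) \<le> len e"
          proof cases
            case 1
            then have "u = 0" using root l by blast
            then show ?thesis using 1 tags nz uv its_0 by (auto simp: \<pi>_def len_def)
          next
            case 2
            then show ?thesis using 2 tags nz uv by (auto simp: \<pi>_def len_def)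
          next
            case 3
            then show ?thesis using 3 tags nz uv notU[of e] by (auto simp: \<pi>_def len_def)
          next
            case 4
            have "\<pi> v - \<pi> u \<le> len e"
            proof (cases "v = t")
              case True
              have le: "len e = 2" using notU[of e] uv True by (simp add: len_def)
              show ?thesis
              proof (cases "t \<in> bad")
                case t: True
                have "(0, u) \<notin> U"
                proof
                  assume "(0, u) \<in> U"
                  then have "hd (snd (its ! u)) \<in> Hs" using 4 by (auto simp: Hs_def intro!: image_eqI[of _ _ "(0, u)"])
                  moreover have "hd (snd (its ! u)) \<in> set c" using 4 t True by (simp add: bad_def)
                  ultimately show False using unhit by blast
                qed
                then show ?thesis using le 4 tags st(3) True by (auto simp: \<pi>_def)
              next
                case False
                then show ?thesis using le 4 tags st(3) True by (auto simp: \<pi>_def)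
              qed
            next
              case False
              then show ?thesis using 4 tags by (auto simp: \<pi>_def len_def)
            qed
            then show ?thesis by (simp add: uv)
          qed
        qed
      qed (use tags st(3) in auto)
      then show ?thesis using st(3) by (simp add: \<pi>_def)
    qed
    define C where "C = {\<kappa> \<in> clean \<times> clean. fst \<kappa> \<noteq> snd \<kappa>}"
    have finc: "finite clean" "finite bad" by (auto simp: clean_def bad_def)
    have badc: "bad \<subseteq> clean" by (auto simp: bad_def)
    have CK: "C \<subseteq> commodities P" by (auto simp: C_def commodities_P clean_def)
    have split: "(\<Sum>\<kappa> \<in> C. f \<kappa>) = (\<Sum>t \<in> clean. \<Sum>s \<in> clean - {t}. f (s, t))" for f :: "nat \<times> nat \<Rightarrow> real"
    proof -
      have "C = (\<lambda>(t, s). (s, t)) ` (Sigma clean (\<lambda>t. clean - {t}))" by (auto simp: C_def)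
      then have "(\<Sum>\<kappa> \<in> C. f \<kappa>) = (\<Sum>\<kappa> \<in> Sigma clean (\<lambda>t. clean - {t}). f (case \<kappa> of (t, s) \<Rightarrow> (s, t)))"
        by (simp add: sum.reindex inj_on_def case_prod_beta)
      also have "\<dots> = (\<Sum>t \<in> clean. \<Sum>s \<in> clean - {t}. f (s, t))"
        using finc by (subst sum.Sigma) (auto simp: case_prod_beta)
      finally show ?thesis .
    qed
    have "(\<Sum>t \<in> clean. \<Sum>s \<in> clean - {t}. (if t \<in> bad then 6 else 5)) \<le> (\<Sum>\<kappa> \<in> C. \<Sum>e \<in> E. len e * F \<kappa> e)"
      unfolding split by (intro sum_mono lower) auto
    also have "\<dots> \<le> (\<Sum>\<kappa> \<in> commodities P. \<Sum>e \<in> E. len e * F \<kappa> e)"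
      by (rule sum_mono2[OF finK CK]) (auto intro!: sum_nonneg mult_nonneg_nonneg F0 simp: len_def)
    also have "\<dots> \<le> real (5 * n * n)" by (rule time)
    also have "(\<Sum>t \<in> clean. \<Sum>s \<in> clean - {t}. (if t \<in> bad then 6 else 5 :: real)) =
        (\<Sum>t \<in> clean. (real (card clean) - 1) * 5 + (if t \<in> bad then real (card clean) - 1 else 0))"
    proof (intro sum.cong refl)
      fix t assume t: "t \<in> clean"
      then have "0 < card clean" using finc by (auto simp: card_gt_0_iff)
      then have "real (card (clean - {t})) = real (card clean) - 1"
        using t finc by (simp add: card_Diff_singleton of_nat_diff)
      then show "(\<Sum>s \<in> clean - {t}. (if t \<in> bad then 6 else 5 :: real)) =
          (real (card clean) - 1) * 5 + (if t \<in> bad then real (card clean) - 1 else 0)"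
        by (auto simp: algebra_simps)
    qed
    also have "\<dots> = real (card clean) * ((real (card clean) - 1) * 5) + real (card bad) * (real (card clean) - 1)"
      using finc badc by (simp add: sum.distrib sum.If_cases Int_absorb1 Int_absorb2)
    finally have main: "real (card clean) * ((real (card clean) - 1) * 5) + real (card bad) * (real (card clean) - 1) \<le> 5 * real n * real n"
      by simp
    \<comment> \<open>\<open>e\<close> is the number of copies and \<open>y\<close> that of the
      remaining vertices, so that \<open>n = e + y\<close> and \<open>M = 64 * y\<close>. At least
      \<open>e - y\<close> copies are clean, and at least \<open>63 * y\<close> of them belong to
      the set that is not hit.\<close>
    define y where "y = real (length ls) + 1"
    define e where "e = real (M * length cs)"
    have y1: "1 \<le> y" and b_le: "real b \<le> y" using b by (simp_all add: y_def)
    have My: "real M = 64 * y" by (simp add: y_def M_def)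
    have "1 \<le> length cs" using cs(1) by (cases cs) auto
    then have "M * 1 \<le> M * length cs" by (rule mult_le_mono2)
    then have ey: "64 * y \<le> e" unfolding e_def My[symmetric] by (simp only: of_nat_le_iff mult_1_right)
    have n: "real n = e + y" unfolding length_its e_def y_def by simp
    have "real (M * length cs) \<le> real (card clean + b)" using cc by (simp only: of_nat_le_iff)
    then have c1: "e - y \<le> real (card clean)" using b_le unfolding e_def by simp
    have c2: "63 * y \<le> real (card bad)" using cb My b_le by linarith
    have "(e - y) * ((e - 2 * y) * 5) \<le> real (card clean) * ((real (card clean) - 1) * 5)"
      using c1 y1 ey by (intro mult_mono) auto
    moreover have "63 * y * (e - 2 * y) \<le> real (card bad) * (real (card clean) - 1)"
      using c1 c2 y1 ey by (intro mult_mono) auto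
    ultimately have "(e - y) * ((e - 2 * y) * 5) + 63 * y * (e - 2 * y) \<le> 5 * (e + y) * (e + y)"
      using main unfolding n by linarith
    \<comment> \<open>The squares of \<open>e\<close> cancel. The copies that are not hit contribute
      \<open>63 * e * y\<close>, which outweighs the \<open>25 * e * y\<close> lost by counting
      clean pairs only; \<open>e\<close> being at least \<open>64 * y\<close> settles the
      rest.\<close>
    then have "38 * (e * y) \<le> 121 * (y * y)" by (simp add: algebra_simps)
    moreover have "64 * y * y \<le> e * y" using ey y1 by (intro mult_right_mono) auto
    moreover have "1 * 1 \<le> y * y" using y1 by (intro mult_mono) auto
    ultimately show False by (simp add: mult.assoc)
  qed
  ultimately show ?thesis by blast
qed

end

section \<open>Satisfiability of clauses\<close>

text \<open>A literal is a pair of a sign and an atom, and a clause is a list of literals.\<close>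

definition satisfies :: "('a \<Rightarrow> bool) \<Rightarrow> (bool \<times> 'a) list \<Rightarrow> bool" where
  "satisfies \<alpha> c \<longleftrightarrow> (\<exists>l \<in> set c. \<alpha> (snd l) = fst l)"

definition implication :: "'a list \<Rightarrow> 'a \<Rightarrow> (bool \<times> 'a) list" where
  "implication as a = map (Pair False) as @ [(True, a)]"

lemma satisfies_implication: "satisfies \<alpha> (implication as a) \<longleftrightarrow> ((\<forall>b \<in> set as. \<alpha> b) \<longrightarrow> \<alpha> a)"
  by (auto simp: satisfies_def implication_def)

lemma satisfies_Cons: "satisfies \<alpha> (l # c) \<longleftrightarrow> \<alpha> (snd l) = fst l \<or> satisfies \<alpha> c"
  and satisfies_Nil: "\<not> satisfies \<alpha> []"
  by (simp_all add: satisfies_def)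

subsection \<open>Computations as satisfying assignments\<close>

text \<open>The atoms \<open>[0, t, q]\<close>, \<open>[1, t, i, p]\<close>, \<open>[2, t, i, p, a]\<close>, \<open>[3, t, i, a]\<close> say about time \<open>t\<close> that
  the state is \<open>q\<close>, that the head of tape \<open>i\<close> is at \<open>p\<close>, that cell \<open>p\<close> of tape \<open>i\<close> contains \<open>a\<close>, and
  that the head of tape \<open>i\<close> scans \<open>a\<close>.  Cells are shifted by the number \<open>\<tau>\<close> of steps.  The atoms \<open>[4, j]\<close>
  and \<open>[5, j]\<close> say that the bit \<open>j\<close> of the certificate is True and that the certificate has at most
  \<open>j\<close> bits.\<close>

definition situation :: "nat \<Rightarrow> nat \<Rightarrow> (nat \<times> nat) list \<Rightarrow> nat list list" where
  "situation t q s = [0, t, q] # map (\<lambda>r. [3, t, fst r, snd r]) s"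

section \<open>Runs of a Turing machine\<close>

locale machine =
  fixes Mt :: tm
  assumes tm: "turing_machine Mt"
begin

abbreviation "k \<equiv> num_tapes Mt"
abbreviation "Q \<equiv> num_states Mt"
abbreviation "S \<equiv> num_symbols Mt"

text \<open>The transition function completed by the identity in the halting state, so that one kind
  of clause covers halted configurations too.\<close>

definition \<delta> :: "nat \<Rightarrow> nat list \<Rightarrow> nat \<times> (nat \<times> direction) list" where
  "\<delta> q rs = (if q = 1 then (1, map (\<lambda>a. (a, Stay)) rs) else transition Mt q rs)"

lemma \<delta>:
  assumes "q < Q" "length rs = k" "set rs \<subseteq> {..<S}"
  shows "fst (\<delta> q rs) < Q" "length (snd (\<delta> q rs)) = k" "i < k \<Longrightarrow> fst (snd (\<delta> q rs) ! i) < S"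
proof -
  have "fst (\<delta> q rs) < Q \<and> length (snd (\<delta> q rs)) = k \<and> fst ` set (snd (\<delta> q rs)) \<subseteq> {..<S}"
  proof (cases "q = 1")
    case True
    then show ?thesis using assms by (auto simp: \<delta>_def)
  next
    case False
    note tm[unfolded turing_machine_def, THEN conjunct2, THEN conjunct2, THEN conjunct2, rule_format,
        OF conjI[OF assms(1) conjI[OF False conjI[OF assms(2,3)]]]]
    then show ?thesis using False by (simp add: \<delta>_def case_prod_beta)
  qed
  then show "fst (\<delta> q rs) < Q" "length (snd (\<delta> q rs)) = k" "i < k \<Longrightarrow> fst (snd (\<delta> q rs) ! i) < S"
    by (auto dest!: subsetD simp: image_iff)
qed

context
  fixes z :: "bool list"
begin

definition conf :: "nat \<Rightarrow> config" where "conf t = (step Mt ^^ t) (initial_config Mt z)"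
definition st :: "nat \<Rightarrow> nat" where "st t = fst (conf t)"
definition tp :: "nat \<Rightarrow> nat \<Rightarrow> tape" where "tp t i = fst (snd (conf t) ! i)"
definition hp :: "nat \<Rightarrow> nat \<Rightarrow> int" where "hp t i = snd (snd (conf t) ! i)"
definition scan :: "nat \<Rightarrow> nat list" where "scan t = map (\<lambda>i. tp t i (hp t i)) [0..<k]"

lemma scan_eq: "length (snd (conf t)) = k \<Longrightarrow> map (\<lambda>(t, h). t h) (snd (conf t)) = scan t"
  by (auto simp: scan_def tp_def hp_def case_prod_beta intro!: nth_equalityI)

lemma conf_Suc:
  assumes "length (snd (conf t)) = k" "length (snd (\<delta> (st t) (scan t))) = k"
  shows "st (Suc t) = fst (\<delta> (st t) (scan t))" "length (snd (conf (Suc t))) = k"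
    "i < k \<Longrightarrow> tp (Suc t) i = (tp t i)(hp t i := fst (snd (\<delta> (st t) (scan t)) ! i))"
    "i < k \<Longrightarrow> hp (Suc t) i = hp t i + offset (snd (snd (\<delta> (st t) (scan t)) ! i))"
proof -
  let ?D = "\<delta> (st t) (scan t)"
  obtain q ts where c: "conf t = (q, ts)" by force
  have q: "st t = q" and l: "length ts = k" using assms(1) by (simp_all add: st_def c)
  have s: "map (\<lambda>(t, h). t h) ts = scan t" using scan_eq[OF assms(1)] by (simp add: c)
  have "conf (Suc t) = step Mt (q, ts)" by (simp add: conf_def flip: c)
  also have "\<dots> = (fst ?D, map2 (\<lambda>(t, h) (a, d). (t(h := a), h + offset d)) ts (snd ?D))"
  proof (cases "q = 1")
    case True
    have "map2 (\<lambda>(t, h) (a, d). (t(h := a), h + offset d)) ts (map (\<lambda>a. (a, Stay)) (scan t)) = ts"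
      unfolding s[symmetric] by (rule nth_equalityI) (auto simp: case_prod_beta)
    then show ?thesis using True q by (simp add: \<delta>_def step_def)
  next
    case False
    then show ?thesis using q by (simp add: \<delta>_def step_def s case_prod_beta)
  qed
  finally have C: "conf (Suc t) = \<dots>" .
  show "st (Suc t) = fst ?D" "length (snd (conf (Suc t))) = k" using assms(2) l by (simp_all add: C st_def)
  show "tp (Suc t) i = (tp t i)(hp t i := fst (snd ?D ! i))" "hp (Suc t) i = hp t i + offset (snd (snd ?D ! i))" if "i < k"
    using that assms(2) l unfolding tp_def hp_def C by (simp_all add: c case_prod_beta)
qed

text \<open>A head moves by at most one cell per step; this is why \<open>2 * \<tau> + 1\<close>
  cells suffice for \<tau> steps.\<close>

lemma conf_valid: "st t < Q" "length (snd (conf t)) = k" "i < k \<Longrightarrow> tp t i j < S" "i < k \<Longrightarrow> \<bar>hp t i\<bar> \<le> int t"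
proof -
  have "st t < Q \<and> length (snd (conf t)) = k \<and> (\<forall>i<k. (\<forall>j. tp t i j < S) \<and> \<bar>hp t i\<bar> \<le> int t)"
  proof (induction t)
    case 0
    have m: "0 < Q" "0 < k" "2 < S" using tm by (auto simp: turing_machine_def)
    then have "tape_of x j < S" for x j by (auto simp: tape_of_def)
    then show ?case using m
      by (auto simp: conf_def st_def tp_def hp_def initial_config_def nth_Cons' split: if_splits)
  next
    case (Suc t)
    let ?D = "\<delta> (st t) (scan t)"
    have s: "length (scan t) = k" "set (scan t) \<subseteq> {..<S}" using Suc by (auto simp: scan_def)
    note d = \<delta>[OF conjunct1[OF Suc] s]
    note c = conf_Suc[OF conjunct1[OF conjunct2[OF Suc]] d(2)]
    have o: "\<bar>offset x\<bar> \<le> 1" for x by (cases x) auto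
    have "\<bar>hp (Suc t) i\<bar> \<le> int (Suc t)" if "i < k" for i
      using c(4)[OF that] o[of "snd (snd ?D ! i)"] Suc that by fastforce
    moreover have "tp (Suc t) i j < S" if "i < k" for i j
      using c(3)[OF that] d(3)[OF that] Suc that by simp
    ultimately show ?case using c(1,2) d(1) by simp
  qed
  then show "st t < Q" "length (snd (conf t)) = k" "i < k \<Longrightarrow> tp t i j < S" "i < k \<Longrightarrow> \<bar>hp t i\<bar> \<le> int t" by auto
qed

lemma scan_valid: "length (scan t) = k" "set (scan t) \<subseteq> {..<S}"
  using conf_valid(3) by (auto simp: scan_def)

lemmas run = conf_Suc(1,3,4)[OF conf_valid(2) \<delta>(2)[OF conf_valid(1) scan_valid]]

lemma run_0: "st 0 = 0" "i < k \<Longrightarrow> tp 0 i = (if i = 0 then tape_of z else tape_of [])" "i < k \<Longrightarrow> hp 0 i = 0"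
  by (auto simp: st_def tp_def hp_def conf_def initial_config_def nth_Cons')

text \<open>A halted configuration persists, so the result can be read off at any fixed later
  time.\<close>

lemma run_result:
  assumes "computes_within Mt f T" "T (length z) \<le> \<tau>"
  shows "tp \<tau> 0 = tape_of (f z)"
proof -
  obtain m h ts where m: "m \<le> T (length z)" "conf m = (1, (tape_of (f z), h) # ts)"
    using assms(1) unfolding computes_within_def conf_def by blast
  have "conf (m + j) = conf m" for j
    by (induction j) (simp_all add: conf_def, simp add: m(2)[unfolded conf_def] step_def)
  from this[of "\<tau> - m"] show ?thesis using m assms(2) by (simp add: tp_def)
qed

end

section \<open>The clauses that describe a computation\<close>

definition moves :: "(nat \<times> nat list) list" where
  "moves = List.product [0..<Q] (List.n_lists k [0..<S])"

lemma moves: "(q, rs) \<in> set moves \<longleftrightarrow> q < Q \<and> length rs = k \<and> set rs \<subseteq> {..<S}"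
  by (auto simp: moves_def set_n_lists)

text \<open>The tables depend on the machine only. In the reduction they are constants, and nothing
  about the transition function has to be computed.\<close>

definition state_table :: "(nat \<times> (nat \<times> nat) list \<times> nat) list" where
  "state_table = map (\<lambda>(q, rs). (q, zip [0..<k] rs, fst (\<delta> q rs))) moves"

text \<open>Head movements are stored increased by 1 to be natural numbers, which accounts for the
  \<open>Suc\<close> in the filter of \<open>head_clauses\<close>.\<close>

definition tape_table :: "(nat \<times> (nat \<times> nat) list \<times> nat \<times> nat \<times> nat) list" where
  "tape_table = concat (map (\<lambda>(q, rs). map (\<lambda>i. (q, zip [0..<k] rs, i, fst (snd (\<delta> q rs) ! i),
     nat (offset (snd (snd (\<delta> q rs) ! i)) + 1))) [0..<k]) moves)"

definition state_clauses :: "nat list \<Rightarrow> (bool \<times> nat list) list list" where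
  "state_clauses ts = map (\<lambda>e. implication (situation (fst e) (fst (snd e)) (fst (snd (snd e)))) [0, Suc (fst e), snd (snd (snd e))])
     (List.product ts state_table)"

definition write_clauses :: "nat list \<Rightarrow> nat list \<Rightarrow> (bool \<times> nat list) list list" where
  "write_clauses ts ps = map (\<lambda>e. implication
       ([1, fst e, fst (snd (snd (snd (snd e)))), fst (snd e)] # situation (fst e) (fst (snd (snd e))) (fst (snd (snd (snd e)))))
       [2, Suc (fst e), fst (snd (snd (snd (snd e)))), fst (snd e), fst (snd (snd (snd (snd (snd e)))))])
     (List.product ts (List.product ps tape_table))"

definition head_clauses :: "nat list \<Rightarrow> nat list \<Rightarrow> (bool \<times> nat list) list list" where
  "head_clauses ts ps = map (\<lambda>e. implication
       ([1, fst (snd e), fst (snd (snd (snd (snd (snd e))))), fst (snd (snd e))] #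
         situation (fst (snd e)) (fst (snd (snd (snd e)))) (fst (snd (snd (snd (snd e))))))
       [1, Suc (fst (snd e)), fst (snd (snd (snd (snd (snd e))))), fst e])
     (filter (\<lambda>e. Suc (fst e) = fst (snd (snd e)) + snd (snd (snd (snd (snd (snd (snd e)))))))
       (List.product ps (List.product ts (List.product ps tape_table))))"

definition scan_clauses :: "nat list \<Rightarrow> nat list \<Rightarrow> (bool \<times> nat list) list list" where
  "scan_clauses ts ps = map (\<lambda>e. implication
       [[1, fst e, fst (snd (snd e)), fst (snd e)], [2, fst e, fst (snd (snd e)), fst (snd e), snd (snd (snd e))]]
       [3, fst e, fst (snd (snd e)), snd (snd (snd e))])
     (List.product ts (List.product ps (List.product [0..<k] [0..<S])))"

text \<open>That the head is elsewhere is expressed by its actual position \<open>p'\<close> rather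
  than by a negated atom, so the clause remains an implication from atoms of the run.\<close>

definition frame_clauses :: "nat list \<Rightarrow> nat list \<Rightarrow> (bool \<times> nat list) list list" where
  "frame_clauses ts ps = map (\<lambda>e. implication
       [[1, fst (snd e), fst (snd (snd (snd e))), fst e],
        [2, fst (snd e), fst (snd (snd (snd e))), fst (snd (snd e)), snd (snd (snd (snd e)))]]
       [2, Suc (fst (snd e)), fst (snd (snd (snd e))), fst (snd (snd e)), snd (snd (snd (snd e)))])
     (filter (\<lambda>e. fst e \<noteq> fst (snd (snd e)))
       (List.product ps (List.product ts (List.product ps (List.product [0..<k] [0..<S])))))"

definition initial_clauses :: "nat \<Rightarrow> nat list \<Rightarrow> bool list \<Rightarrow> nat list \<Rightarrow> (bool \<times> nat list) list list" where
  "initial_clauses \<tau> ps d js = [implication [] [0, 0, 0]] @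
     map (\<lambda>i. implication [] [1, 0, i, \<tau>]) [0..<k] @
     map (\<lambda>e. implication [] [2, 0, fst e, snd e, 0]) (List.product [1..<k] ps) @
     map (\<lambda>p. implication [] [2, 0, 0, p, 0]) (filter (\<lambda>p. p < \<tau> \<or> \<tau> + (length d + length js) \<le> p) ps) @
     map (\<lambda>j. implication [] [2, 0, 0, \<tau> + j, if nth_default False d j then 2 else 1]) [0..<length d]"

definition certificate_clauses :: "nat \<Rightarrow> bool list \<Rightarrow> nat list \<Rightarrow> (bool \<times> nat list) list list" where
  "certificate_clauses \<tau> d js = concat (map (\<lambda>j.
     [implication [[5, j]] [5, Suc j],
      implication [[5, j]] [2, 0, 0, \<tau> + (length d + j), 0],
      [(True, [5, j]), (False, [4, j]), (True, [2, 0, 0, \<tau> + (length d + j), 2])],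
      [(True, [5, j]), (True, [4, j]), (True, [2, 0, 0, \<tau> + (length d + j), 1])]]) js)"

text \<open>Apart from the choice of the certificate, the clauses only force atoms of the run to be
  true; no clause says that states or symbols are unique. This suffices, since the first clause
  forbids the rejecting output: symbol 1 in cell 0, which is shifted to \<tau>.\<close>

definition clauses :: "nat \<Rightarrow> nat list \<Rightarrow> nat list \<Rightarrow> bool list \<Rightarrow> nat list \<Rightarrow> (bool \<times> nat list) list list" where
  "clauses \<tau> ts ps d js = [(False, [2, \<tau>, 0, \<tau>, 1])] # state_clauses ts @ write_clauses ts ps @ head_clauses ts ps @
     scan_clauses ts ps @ frame_clauses ts ps @ initial_clauses \<tau> ps d js @ certificate_clauses \<tau> d js"

lemma clauses_nonempty: "c \<in> set (clauses \<tau> ts ps d js) \<Longrightarrow> c \<noteq> []"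
  by (auto simp: clauses_def state_clauses_def write_clauses_def head_clauses_def scan_clauses_def
      frame_clauses_def initial_clauses_def certificate_clauses_def implication_def)

lemma tape_table: "(q, s, i, a, d) \<in> set tape_table \<longleftrightarrow> (\<exists>rs. (q, rs) \<in> set moves \<and> s = zip [0..<k] rs \<and> i < k \<and>
    a = fst (snd (\<delta> q rs) ! i) \<and> d = nat (offset (snd (snd (\<delta> q rs) ! i)) + 1))"
  unfolding tape_table_def by fastforce

lemma state_table: "(q, s, q') \<in> set state_table \<longleftrightarrow> (\<exists>rs. (q, rs) \<in> set moves \<and> s = zip [0..<k] rs \<and> q' = fst (\<delta> q rs))"
  unfolding state_table_def by fastforce

lemma state_clause_mem:
  "t \<in> set ts \<Longrightarrow> (q, s, q') \<in> set state_table \<Longrightarrow> implication (situation t q s) [0, Suc t, q'] \<in> set (state_clauses ts)"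
  unfolding state_clauses_def set_map by (rule image_eqI[of _ _ "(t, q, s, q')"]) simp_all

lemma write_clause_mem:
  "t \<in> set ts \<Longrightarrow> p \<in> set ps \<Longrightarrow> (q, s, i, a, m) \<in> set tape_table \<Longrightarrow>
    implication ([1, t, i, p] # situation t q s) [2, Suc t, i, p, a] \<in> set (write_clauses ts ps)"
  unfolding write_clauses_def set_map by (rule image_eqI[of _ _ "(t, p, q, s, i, a, m)"]) simp_all

lemma head_clause_mem:
  "t \<in> set ts \<Longrightarrow> p \<in> set ps \<Longrightarrow> p' \<in> set ps \<Longrightarrow> (q, s, i, a, m) \<in> set tape_table \<Longrightarrow> Suc p' = p + m \<Longrightarrow>
    implication ([1, t, i, p] # situation t q s) [1, Suc t, i, p'] \<in> set (head_clauses ts ps)"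
  unfolding head_clauses_def set_map by (rule image_eqI[of _ _ "(p', t, p, q, s, i, a, m)"]) simp_all

lemma scan_clause_mem:
  "t \<in> set ts \<Longrightarrow> p \<in> set ps \<Longrightarrow> i < k \<Longrightarrow> a < S \<Longrightarrow>
    implication [[1, t, i, p], [2, t, i, p, a]] [3, t, i, a] \<in> set (scan_clauses ts ps)"
  unfolding scan_clauses_def set_map by (rule image_eqI[of _ _ "(t, p, i, a)"]) simp_all

lemma frame_clause_mem:
  "t \<in> set ts \<Longrightarrow> p \<in> set ps \<Longrightarrow> p' \<in> set ps \<Longrightarrow> p' \<noteq> p \<Longrightarrow> i < k \<Longrightarrow> a < S \<Longrightarrow>
    implication [[1, t, i, p'], [2, t, i, p, a]] [2, Suc t, i, p, a] \<in> set (frame_clauses ts ps)"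
  unfolding frame_clauses_def set_map by (rule image_eqI[of _ _ "(p', t, p, i, a)"]) simp_all

section \<open>Satisfying assignments and accepting runs\<close>

context
  fixes \<tau> P :: nat and d :: "bool list"
begin

abbreviation "formula \<equiv> clauses \<tau> [0..<\<tau>] [0..<Suc (2 * \<tau>)] d [0..<P]"

lemma accepting_run_satisfies:
  assumes u: "length u \<le> P" and acc: "tp (d @ u) \<tau> 0 0 \<noteq> 1"
  shows "\<exists>\<alpha>. \<forall>c \<in> set formula. satisfies \<alpha> c"
proof -
  let ?z = "d @ u"
  define \<alpha> where "\<alpha> a \<longleftrightarrow> (\<exists>t q. a = [0, t, q] \<and> st ?z t = q) \<or>
    (\<exists>t i p. a = [1, t, i, p] \<and> hp ?z t i = int p - int \<tau>) \<or>
    (\<exists>t i p b. a = [2, t, i, p, b] \<and> tp ?z t i (int p - int \<tau>) = b) \<or>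
    (\<exists>t i b. a = [3, t, i, b] \<and> tp ?z t i (hp ?z t i) = b) \<or>
    (\<exists>j. a = [4, j] \<and> j < length u \<and> u ! j) \<or> (\<exists>j. a = [5, j] \<and> length u \<le> j)" for a
  have \<alpha>: "\<alpha> [0, t, q] \<longleftrightarrow> st ?z t = q" "\<alpha> [1, t, i, p] \<longleftrightarrow> hp ?z t i = int p - int \<tau>"
    "\<alpha> [Suc 0, t, i, p] \<longleftrightarrow> hp ?z t i = int p - int \<tau>"
    "\<alpha> [2, t, i, p, b] \<longleftrightarrow> tp ?z t i (int p - int \<tau>) = b" "\<alpha> [3, t, i, b] \<longleftrightarrow> tp ?z t i (hp ?z t i) = b"
    "\<alpha> [4, j] \<longleftrightarrow> j < length u \<and> u ! j" "\<alpha> [5, j] \<longleftrightarrow> length u \<le> j" for t q i p b j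
    by (simp_all add: \<alpha>_def)
  have scan: "q = st ?z t \<and> rs = scan ?z t" if "\<forall>b \<in> set (situation t q (zip [0..<k] rs)). \<alpha> b" "length rs = k" for t q rs
  proof -
    have "tp ?z t i (hp ?z t i) = rs ! i" if i: "i < k" for i
    proof -
      have "(i, rs ! i) \<in> set (zip [0..<k] rs)" using i \<open>length rs = k\<close> by (force simp: set_zip)
      then show ?thesis using \<open>\<forall>b \<in> set (situation t q (zip [0..<k] rs)). \<alpha> b\<close> by (force simp: situation_def \<alpha>)
    qed
    then have "rs = scan ?z t" using that(2) by (auto simp: scan_def intro!: nth_equalityI)
    then show ?thesis using that(1) by (simp add: situation_def \<alpha>)
  qed
  have "satisfies \<alpha> c" if c: "c \<in> set (state_clauses [0..<\<tau>])" for c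
  proof -
    obtain t q rs where e: "(q, rs) \<in> set moves" "c = implication (situation t q (zip [0..<k] rs)) [0, Suc t, fst (\<delta> q rs)]"
      using c by (auto simp: state_clauses_def state_table)
    show ?thesis using scan[of t q rs] e(1) run(1) unfolding e(2) satisfies_implication by (auto simp: \<alpha> moves)
  qed
  moreover have "satisfies \<alpha> c" if c: "c \<in> set (write_clauses [0..<\<tau>] [0..<Suc (2 * \<tau>)])" for c
  proof -
    obtain t p q rs i where e: "(q, rs) \<in> set moves" "i < k"
      "c = implication ([1, t, i, p] # situation t q (zip [0..<k] rs)) [2, Suc t, i, p, fst (snd (\<delta> q rs) ! i)]"
      using c by (auto simp: write_clauses_def tape_table simp del: upt_Suc)
    show ?thesis
      using scan[of t q rs] e(1) run(2)[OF e(2), of ?z t] unfolding e(3) satisfies_implication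
      by (auto simp: \<alpha> moves)
  qed
  moreover have "satisfies \<alpha> c" if c: "c \<in> set (head_clauses [0..<\<tau>] [0..<Suc (2 * \<tau>)])" for c
  proof -
    obtain t p p' q rs i where e: "(q, rs) \<in> set moves" "i < k" "Suc p' = p + nat (offset (snd (snd (\<delta> q rs) ! i)) + 1)"
      "c = implication ([1, t, i, p] # situation t q (zip [0..<k] rs)) [1, Suc t, i, p']"
      using c by (auto simp: head_clauses_def tape_table simp del: upt_Suc)
    have o: "0 \<le> offset x + 1" for x by (cases x) auto
    have "int p' = int p + offset (snd (snd (\<delta> q rs) ! i))"
      using e(3) o[of "snd (snd (\<delta> q rs) ! i)"] by linarith
    then show ?thesis
      using scan[of t q rs] e(1) run(3)[OF e(2), of ?z t] unfolding e(4) satisfies_implication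
      by (auto simp: \<alpha> moves)
  qed
  moreover have "satisfies \<alpha> c" if c: "c \<in> set (scan_clauses [0..<\<tau>] [0..<Suc (2 * \<tau>)])" for c
  proof -
    obtain t p i a where e: "c = implication [[1, t, i, p], [2, t, i, p, a]] [3, t, i, a]"
      using c by (auto simp: scan_clauses_def simp del: upt_Suc)
    show ?thesis unfolding e satisfies_implication by (auto simp: \<alpha>)
  qed
  moreover have "satisfies \<alpha> c" if c: "c \<in> set (frame_clauses [0..<\<tau>] [0..<Suc (2 * \<tau>)])" for c
  proof -
    obtain t p p' i a where e: "p' \<noteq> p" "i < k" "c = implication [[1, t, i, p'], [2, t, i, p, a]] [2, Suc t, i, p, a]"
      using c by (auto simp: frame_clauses_def simp del: upt_Suc)
    show ?thesis using e(1) run(2)[OF e(2), of ?z t] unfolding e(3) satisfies_implication by (auto simp: \<alpha>)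
  qed
  moreover have "satisfies \<alpha> c" if c: "c \<in> set (initial_clauses \<tau> [0..<Suc (2 * \<tau>)] d [0..<P])" for c
  proof -
    have k: "0 < k" using tm by (auto simp: turing_machine_def)
    show ?thesis using c u k unfolding initial_clauses_def
      by (auto simp: satisfies_implication \<alpha> run_0 tape_of_def nth_default_def nth_append simp del: upt_Suc)
  qed
  moreover have "satisfies \<alpha> c" if c: "c \<in> set (certificate_clauses \<tau> d [0..<P])" for c
  proof -
    have k: "0 < k" using tm by (auto simp: turing_machine_def)
    show ?thesis using c u k unfolding certificate_clauses_def
      by (auto simp: satisfies_implication satisfies_Cons \<alpha> run_0 tape_of_def nth_append nat_add_distrib)
  qed
  moreover have "satisfies \<alpha> [(False, [2, \<tau>, 0, \<tau>, 1])]" using acc by (simp add: satisfies_Cons \<alpha>)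
  ultimately show ?thesis unfolding clauses_def by (intro exI[of _ \<alpha>]) auto
qed

text \<open>The certificate is read off the assignment. By induction on time all atoms of the actual
  run are true; that others may be true as well does no harm, because the final output is excluded
  by a negative literal.\<close>

lemma satisfies_accepting_run:
  assumes sat: "\<forall>c \<in> set formula. satisfies \<alpha> c"
  shows "\<exists>u. length u \<le> P \<and> tp (d @ u) \<tau> 0 0 \<noteq> 1"
proof -
  \<comment> \<open>The certificate ends at the first \<open>j\<close> with \<open>[5, j]\<close>,
    or at \<open>P\<close> if there is none; the clauses then propagate \<open>[5, j]\<close> to all
    later positions.\<close>
  define m where "m = (LEAST j. \<alpha> [5, j] \<or> j = P)"
  define u where "u = map (\<lambda>j. \<alpha> [4, j]) [0..<m]"
  let ?z = "d @ u"
  have mP: "m \<le> P" unfolding m_def by (rule Least_le) simp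
  have m: "\<alpha> [5, m] \<or> m = P" unfolding m_def by (rule LeastI[of _ P]) simp
  have before: "\<not> \<alpha> [5, j]" if "j < m" for j using not_less_Least[of j] that unfolding m_def by blast
  have k: "0 < k" using tm by (auto simp: turing_machine_def)
  have s: "\<And>c. c \<in> set (state_clauses [0..<\<tau>]) \<Longrightarrow> satisfies \<alpha> c"
    "\<And>c. c \<in> set (write_clauses [0..<\<tau>] [0..<Suc (2 * \<tau>)]) \<Longrightarrow> satisfies \<alpha> c"
    "\<And>c. c \<in> set (head_clauses [0..<\<tau>] [0..<Suc (2 * \<tau>)]) \<Longrightarrow> satisfies \<alpha> c"
    "\<And>c. c \<in> set (scan_clauses [0..<\<tau>] [0..<Suc (2 * \<tau>)]) \<Longrightarrow> satisfies \<alpha> c"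
    "\<And>c. c \<in> set (frame_clauses [0..<\<tau>] [0..<Suc (2 * \<tau>)]) \<Longrightarrow> satisfies \<alpha> c"
    "\<And>c. c \<in> set (initial_clauses \<tau> [0..<Suc (2 * \<tau>)] d [0..<P]) \<Longrightarrow> satisfies \<alpha> c"
    "\<And>c. c \<in> set (certificate_clauses \<tau> d [0..<P]) \<Longrightarrow> satisfies \<alpha> c"
    using sat unfolding clauses_def by auto
  have cert: "\<alpha> [5, j] \<Longrightarrow> \<alpha> [5, Suc j]" "\<alpha> [5, j] \<Longrightarrow> \<alpha> [2, 0, 0, \<tau> + (length d + j), 0]"
    "\<not> \<alpha> [5, j] \<Longrightarrow> \<alpha> [2, 0, 0, \<tau> + (length d + j), if \<alpha> [4, j] then 2 else 1]" if "j < P" for j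
  proof -
    have "satisfies \<alpha> (implication [[5, j]] [5, Suc j])" "satisfies \<alpha> (implication [[5, j]] [2, 0, 0, \<tau> + (length d + j), 0])"
      "satisfies \<alpha> [(True, [5, j]), (False, [4, j]), (True, [2, 0, 0, \<tau> + (length d + j), 2])]"
      "satisfies \<alpha> [(True, [5, j]), (True, [4, j]), (True, [2, 0, 0, \<tau> + (length d + j), 1])]"
      using that by (auto intro!: s(7) bexI[of _ j] simp: certificate_clauses_def)
    then show "\<alpha> [5, j] \<Longrightarrow> \<alpha> [5, Suc j]" "\<alpha> [5, j] \<Longrightarrow> \<alpha> [2, 0, 0, \<tau> + (length d + j), 0]"
      "\<not> \<alpha> [5, j] \<Longrightarrow> \<alpha> [2, 0, 0, \<tau> + (length d + j), if \<alpha> [4, j] then 2 else 1]"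
      by (auto simp: satisfies_implication satisfies_Cons satisfies_Nil)
  qed
  have after: "\<alpha> [5, j]" if "m \<le> j" "j < P" for j
    using that(1,2)
  proof (induction j rule: dec_induct)
    case base
    then show ?case using m by simp
  next
    case (step j)
    then show ?case using cert(1)[of j] by simp
  qed
  have "\<forall>c \<in> set (initial_clauses \<tau> [0..<Suc (2 * \<tau>)] d [0..<P]). satisfies \<alpha> c" using s(6) by blast
  then have init: "\<alpha> [0, 0, 0]" "\<And>i. i < k \<Longrightarrow> \<alpha> [1, 0, i, \<tau>]"
    "\<And>i p. 1 \<le> i \<Longrightarrow> i < k \<Longrightarrow> p \<le> 2 * \<tau> \<Longrightarrow> \<alpha> [2, 0, i, p, 0]"
    "\<And>p. p \<le> 2 * \<tau> \<Longrightarrow> p < \<tau> \<or> \<tau> + (length d + P) \<le> p \<Longrightarrow> \<alpha> [2, 0, 0, p, 0]"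
    "\<And>j. j < length d \<Longrightarrow> \<alpha> [2, 0, 0, \<tau> + j, if nth_default False d j then 2 else 1]"
    unfolding initial_clauses_def
    by (auto simp: ball_Un satisfies_implication less_Suc_eq_le simp del: upt_Suc)
  have tape0: "\<alpha> [2, 0, 0, p, tape_of ?z (int p - int \<tau>)]" if p: "p \<le> 2 * \<tau>" for p
  proof -
    consider "p < \<tau> \<or> \<tau> + (length d + P) \<le> p" | j where "j < length d" "p = \<tau> + j" | j where "j < P" "p = \<tau> + (length d + j)"
    proof (cases "p < \<tau> \<or> \<tau> + (length d + P) \<le> p \<or> p < \<tau> + length d")
      case True
      then show ?thesis using that(1) that(2)[of "p - \<tau>"] by fastforce
    next
      case False
      then show ?thesis using that(3)[of "p - \<tau> - length d"] by fastforce
    qed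
    then show ?thesis
    proof cases
      case 1
      then have "tape_of ?z (int p - int \<tau>) = 0" using mP by (auto simp: tape_of_def u_def)
      then show ?thesis using init(4)[OF p 1] by simp
    next
      case 2
      then have "tape_of ?z (int p - int \<tau>) = (if nth_default False d j then 2 else 1)"
        by (simp add: tape_of_def nth_default_def nth_append)
      then show ?thesis using init(5)[OF 2(1)] 2 by simp
    next
      case 3
      show ?thesis
      proof (cases "j < m")
        case True
        then have "tape_of ?z (int p - int \<tau>) = (if \<alpha> [4, j] then 2 else 1)"
          using 3 by (simp add: tape_of_def u_def nth_append nat_add_distrib)
        then show ?thesis using cert(3)[OF 3(1) before[OF True]] 3 by simp
      next
        case False
        then have "tape_of ?z (int p - int \<tau>) = 0" using 3 by (simp add: tape_of_def u_def)
        then show ?thesis using cert(2)[OF 3(1)] after[OF _ 3(1)] False 3 by simp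
      qed
    qed
  qed
  \<comment> \<open>Up to time \<tau> every head stays within \<tau> cells of the origin, so the
    shifted cells 0 to \<open>2 * \<tau>\<close> contain all cells that are visited.\<close>
  have "\<alpha> [0, t, st ?z t] \<and> (\<forall>i<k. \<forall>p \<le> 2 * \<tau>. \<alpha> [2, t, i, p, tp ?z t i (int p - int \<tau>)] \<and>
      (int p = hp ?z t i + int \<tau> \<longrightarrow> \<alpha> [1, t, i, p]))" if "t \<le> \<tau>" for t
    using that
  proof (induction t)
    case 0
    have "\<alpha> [2, 0, i, p, tp ?z 0 i (int p - int \<tau>)]" if "i < k" "p \<le> 2 * \<tau>" for i p
    proof -
      have "tape_of [] x = 0" for x by (simp add: tape_of_def)
      then show ?thesis using tape0[OF that(2)] init(3)[of i p] that by (cases "i = 0") (simp_all add: run_0)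
    qed
    moreover have "\<alpha> [1, 0, i, p]" if "i < k" "int p = hp ?z 0 i + int \<tau>" for i p
      using init(2)[OF that(1)] that by (simp add: run_0)
    ultimately show ?case using init(1) by (simp add: run_0)
  next
    case (Suc t)
    let ?D = "\<delta> (st ?z t) (scan ?z t)"
    have t: "t < \<tau>" using Suc by simp
    have IH: "\<alpha> [0, t, st ?z t]" "\<And>i p. i < k \<Longrightarrow> p \<le> 2 * \<tau> \<Longrightarrow> \<alpha> [2, t, i, p, tp ?z t i (int p - int \<tau>)]"
      "\<And>i p. i < k \<Longrightarrow> p \<le> 2 * \<tau> \<Longrightarrow> int p = hp ?z t i + int \<tau> \<Longrightarrow> \<alpha> [1, t, i, p]"
      using Suc by auto
    define pos where "pos i = nat (hp ?z t i + int \<tau>)" for i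
    have pos: "int (pos i) = hp ?z t i + int \<tau>" "pos i \<le> 2 * \<tau>" if "i < k" for i
      using conf_valid(4)[OF that, of ?z t] t by (auto simp: pos_def)
    note H = IH(3)[OF _ pos(2) pos(1)]
    have mv: "(st ?z t, scan ?z t) \<in> set moves"
      using conf_valid(1) scan_valid by (simp add: moves)
    have "\<alpha> [3, t, i, scan ?z t ! i]" if i: "i < k" for i
    proof -
      have "scan ?z t ! i = tp ?z t i (hp ?z t i)" using i by (simp add: scan_def)
      then have a: "scan ?z t ! i = tp ?z t i (int (pos i) - int \<tau>)" using pos(1)[OF i] by simp
      have "scan ?z t ! i < S" using scan_valid[of ?z t] i by (metis lessThan_iff nth_mem subsetD)
      then have "satisfies \<alpha> (implication [[1, t, i, pos i], [2, t, i, pos i, scan ?z t ! i]] [3, t, i, scan ?z t ! i])"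
        using t i pos(2)[OF i] by (intro s(4) scan_clause_mem) auto
      then show ?thesis using H[OF i i i] IH(2)[OF i pos(2)[OF i]] unfolding satisfies_implication a by simp
    qed
    then have sit: "\<forall>b \<in> set (situation t (st ?z t) (zip [0..<k] (scan ?z t))). \<alpha> b"
      using IH(1) by (auto simp: situation_def set_zip scan_valid)
    have "(st ?z t, zip [0..<k] (scan ?z t), fst ?D) \<in> set state_table"
      unfolding state_table using mv by blast
    then have "satisfies \<alpha> (implication (situation t (st ?z t) (zip [0..<k] (scan ?z t))) [0, Suc t, fst ?D])"
      using t by (intro s(1) state_clause_mem) auto
    then have "\<alpha> [0, Suc t, st ?z (Suc t)]" using sit unfolding satisfies_implication run(1) by blast
    moreover have "\<alpha> [2, Suc t, i, p, tp ?z (Suc t) i (int p - int \<tau>)] \<and>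
        (int p = hp ?z (Suc t) i + int \<tau> \<longrightarrow> \<alpha> [1, Suc t, i, p])" if i: "i < k" and p: "p \<le> 2 * \<tau>" for i p
    proof -
      let ?a = "fst (snd ?D ! i)" and ?o = "offset (snd (snd ?D ! i))"
      have tt: "(st ?z t, zip [0..<k] (scan ?z t), i, ?a, nat (?o + 1)) \<in> set tape_table"
        unfolding tape_table using mv i by blast
      have "\<alpha> [2, Suc t, i, p, tp ?z (Suc t) i (int p - int \<tau>)]"
      proof (cases "p = pos i")
        case True
        have "satisfies \<alpha> (implication ([1, t, i, p] # situation t (st ?z t) (zip [0..<k] (scan ?z t))) [2, Suc t, i, p, ?a])"
          using t p by (intro s(2) write_clause_mem[OF _ _ tt]) auto
        then have "\<alpha> [2, Suc t, i, p, ?a]" using sit H[OF i i i] True unfolding satisfies_implication by simp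
        moreover have "tp ?z (Suc t) i (int p - int \<tau>) = ?a" using True pos(1)[OF i] run(2)[OF i] by simp
        ultimately show ?thesis by simp
      next
        case False
        let ?b = "tp ?z t i (int p - int \<tau>)"
        have "?b < S" using conf_valid(3)[OF i] by blast
        then have "satisfies \<alpha> (implication [[1, t, i, pos i], [2, t, i, p, ?b]] [2, Suc t, i, p, ?b])"
          using t p i pos(2)[OF i] False
          by (intro s(5) frame_clause_mem) auto
        then have "\<alpha> [2, Suc t, i, p, ?b]" using H[OF i i i] IH(2)[OF i p] unfolding satisfies_implication by simp
        moreover have "int p - int \<tau> \<noteq> hp ?z t i" using False pos(1)[OF i] by linarith
        then have "tp ?z (Suc t) i (int p - int \<tau>) = ?b" using run(2)[OF i] by simp
        ultimately show ?thesis by simp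
      qed
      moreover have "\<alpha> [1, Suc t, i, p]" if hp: "int p = hp ?z (Suc t) i + int \<tau>"
      proof -
        have o: "0 \<le> offset x + 1" for x by (cases x) auto
        have "int p = int (pos i) + ?o" using hp pos(1)[OF i] run(3)[OF i, of ?z t] by simp
        then have "Suc p = pos i + nat (?o + 1)" using o[of "snd (snd ?D ! i)"] by linarith
        then have "satisfies \<alpha> (implication ([1, t, i, pos i] # situation t (st ?z t) (zip [0..<k] (scan ?z t))) [1, Suc t, i, p])"
          using t p pos(2)[OF i] by (intro s(3) head_clause_mem[OF _ _ _ tt]) auto
        then show ?thesis using sit H[OF i i i] unfolding satisfies_implication by simp
      qed
      ultimately show ?thesis by blast
    qed
    ultimately show ?case by blast
  qed
  from this[of \<tau>] k have "\<alpha> [2, \<tau>, 0, \<tau>, tp ?z \<tau> 0 (int \<tau> - int \<tau>)]" by (simp only: order_refl)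
  moreover have "\<not> \<alpha> [2, \<tau>, 0, \<tau>, 1]" using sat by (simp add: clauses_def satisfies_Cons satisfies_Nil)
  ultimately have "tp ?z \<tau> 0 0 \<noteq> 1" by auto
  then show ?thesis using mP by (intro exI[of _ u]) (simp add: u_def)
qed

end

text \<open>\<tau> is fixed before the certificate is known, so it has to bound the running time for
  every admissible length of the certificate.\<close>

theorem cook_levin:
  assumes "computes_within Mt (\<lambda>z. [z \<in> R]) T" "\<And>j. j \<le> length d + P \<Longrightarrow> T j \<le> \<tau>"
  shows "(\<exists>\<alpha>. \<forall>c \<in> set (clauses \<tau> [0..<\<tau>] [0..<Suc (2 * \<tau>)] d [0..<P]). satisfies \<alpha> c) \<longleftrightarrow>
    (\<exists>u. length u \<le> P \<and> d @ u \<in> R)"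
proof -
  have "tp (d @ u) \<tau> 0 0 \<noteq> 1 \<longleftrightarrow> d @ u \<in> R" if "length u \<le> P" for u
    using run_result[OF assms(1) assms(2), of "d @ u"] that by (simp add: tape_of_def)
  then show ?thesis using accepting_run_satisfies satisfies_accepting_run by blast
qed

end

section \<open>NP-hardness\<close>

subsection \<open>From satisfiability to hitting sets\<close>

text \<open>A fold whose step tests membership by a bounded quantifier, matching the rules
  \<open>fp_fold_add\<close> and \<open>fp_list_ex\<close>.\<close>

definition dedup :: "'a list \<Rightarrow> 'a list" where
  "dedup as = fold (\<lambda>a bs. if \<exists>b \<in> set bs. b = a then bs else a # bs) as []"

lemma dedup: "set (dedup as) = set as" "distinct (dedup as)"
proof -
  have "set (fold (\<lambda>a bs. if \<exists>b \<in> set bs. b = a then bs else a # bs) as bs) = set as \<union> set bs \<and>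
      (distinct bs \<longrightarrow> distinct (fold (\<lambda>a bs. if \<exists>b \<in> set bs. b = a then bs else a # bs) as bs))" for bs
    by (induction as arbitrary: bs) auto
  from this[of "[]"] show "set (dedup as) = set as" "distinct (dedup as)" by (simp_all add: dedup_def)
qed

definition literals :: "'a list \<Rightarrow> (bool \<times> 'a) list" where
  "literals as = map (Pair True) as @ map (Pair False) as"

definition hitting_clauses :: "(bool \<times> 'a) list list \<Rightarrow> 'a list \<Rightarrow> (bool \<times> 'a) list list" where
  "hitting_clauses cl as = map (\<lambda>a. [(True, a), (False, a)]) as @ cl"

text \<open>The pairs demand a literal of each atom, and the size admits only one per atom. A
  hitting set is therefore the graph of an assignment, and it hits a clause just if the assignment
  satisfies it.\<close>

lemma satisfiable_iff_hitting_set: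
  assumes "distinct as" and as: "\<And>c l. c \<in> set cl \<Longrightarrow> l \<in> set c \<Longrightarrow> snd l \<in> set as"
  shows "(\<exists>\<alpha>. \<forall>c \<in> set cl. satisfies \<alpha> c) \<longleftrightarrow>
    (\<exists>H. H \<subseteq> set (literals as) \<and> card H \<le> length as \<and> (\<forall>c \<in> set (hitting_clauses cl as). H \<inter> set c \<noteq> {}))"
proof (intro iffI; elim exE conjE)
  fix \<alpha> assume \<alpha>: "\<forall>c \<in> set cl. satisfies \<alpha> c"
  define H where "H = (\<lambda>a. (\<alpha> a, a)) ` set as"
  have "card H \<le> length as"
    unfolding H_def by (rule order_trans[OF card_image_le card_length]) simp
  moreover have "H \<subseteq> set (literals as)" by (auto simp: H_def literals_def image_iff)
  moreover have "H \<inter> set c \<noteq> {}" if c: "c \<in> set (hitting_clauses cl as)" for c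
    using c unfolding hitting_clauses_def
  proof (elim set_append[THEN equalityD1, THEN subsetD, THEN UnE])
    assume "c \<in> set (map (\<lambda>a. [(True, a), (False, a)]) as)"
    then obtain a where a: "a \<in> set as" "c = [(True, a), (False, a)]" by auto
    then have "(\<alpha> a, a) \<in> H \<inter> set c" by (cases "\<alpha> a") (auto simp: H_def image_iff)
    then show ?thesis by blast
  next
    assume c: "c \<in> set cl"
    then obtain l where l: "l \<in> set c" "\<alpha> (snd l) = fst l" using \<alpha> by (auto simp: satisfies_def)
    then have "l = (\<alpha> (snd l), snd l)" by simp
    then have "l \<in> H" unfolding H_def using as[OF c l(1)] by (rule image_eqI)
    then show ?thesis using l(1) by blast
  qed
  ultimately show "\<exists>H. H \<subseteq> set (literals as) \<and> card H \<le> length as \<and> (\<forall>c \<in> set (hitting_clauses cl as). H \<inter> set c \<noteq> {})"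
    by (intro exI[of _ H]) blast
next
  fix H assume H: "H \<subseteq> set (literals as)" "card H \<le> length as" "\<forall>c \<in> set (hitting_clauses cl as). H \<inter> set c \<noteq> {}"
  have fin: "finite H" using H(1) finite_subset by blast
  have "set as \<subseteq> snd ` H"
  proof
    fix a assume "a \<in> set as"
    then have "H \<inter> set [(True, a), (False, a)] \<noteq> {}"
      by (intro bspec[OF H(3)]) (simp add: hitting_clauses_def)
    then have "(True, a) \<in> H \<or> (False, a) \<in> H" by auto
    then show "a \<in> snd ` H" by force
  qed
  then have "length as \<le> card (snd ` H)"
    using card_mono[of "snd ` H" "set as"] fin distinct_card[OF assms(1)] by simp
  then have "card (snd ` H) = card H" using card_image_le[OF fin, of snd] H(2) by linarith
  then have inj: "inj_on snd H" by (rule eq_card_imp_inj_on[OF fin])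
  have "satisfies (\<lambda>a. (True, a) \<in> H) c" if c: "c \<in> set cl" for c
  proof -
    have "H \<inter> set c \<noteq> {}" by (intro bspec[OF H(3)]) (simp add: hitting_clauses_def c)
    then obtain s a where l: "(s, a) \<in> H" "(s, a) \<in> set c" by auto
    have "(True, a) \<in> H \<longleftrightarrow> s" using inj_onD[OF inj, of "(True, a)" "(s, a)"] l(1) by (cases s) auto
    then show ?thesis using l(2) unfolding satisfies_def by (intro bexI[of _ "(s, a)"]) simp_all
  qed
  then show "\<exists>\<alpha>. \<forall>c \<in> set cl. satisfies \<alpha> c" by blast
qed

definition clause_atoms :: "(bool \<times> 'a) list list \<Rightarrow> 'a list" where
  "clause_atoms cl = dedup (map snd (concat cl))"

definition sat_items :: "(bool \<times> 'a) list list \<Rightarrow> (nat \<times> (bool \<times> 'a) list) list" where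
  "sat_items cl = hs_items (literals (clause_atoms cl)) (hitting_clauses cl (clause_atoms cl))
     (64 * (length (literals (clause_atoms cl)) + 1))"

abbreviation "sat_instance cl \<equiv> hs_instance (sat_items cl) (length (clause_atoms cl))"

lemma sat_instance:
  assumes "cl \<noteq> []" "\<And>c. c \<in> set cl \<Longrightarrow> c \<noteq> []"
  shows "sat_instance cl \<in> instances" "restricted_instance (sat_instance cl)"
    "yes_instance (sat_instance cl) \<longleftrightarrow> (\<exists>\<alpha>. \<forall>c \<in> set cl. satisfies \<alpha> c)"
proof -
  let ?as = "clause_atoms cl"
  have as: "distinct ?as" "c \<in> set cl \<Longrightarrow> l \<in> set c \<Longrightarrow> snd l \<in> set ?as" for c l
    unfolding clause_atoms_def dedup by (auto simp: dedup)
  interpret hitting "literals ?as" "hitting_clauses cl ?as" "length ?as"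
  proof
    show "distinct (literals ?as)" using as(1) by (auto simp: literals_def distinct_map inj_on_def)
    show "hitting_clauses cl ?as \<noteq> []" using assms(1) by (simp add: hitting_clauses_def)
    show "length ?as \<le> length (literals ?as)" by (simp add: literals_def)
    fix c assume "c \<in> set (hitting_clauses cl ?as)"
    then consider a where "a \<in> set ?as" "c = [(True, a), (False, a)]" | "c \<in> set cl"
      by (auto simp: hitting_clauses_def)
    then show "c \<noteq> [] \<and> set c \<subseteq> set (literals ?as)"
    proof cases
      case 1
      then show ?thesis by (simp add: literals_def)
    next
      case 2
      have "l \<in> set (literals ?as)" if "l \<in> set c" for l
        using as(2)[OF 2 that] by (cases l; cases "fst l") (auto simp: literals_def)
      then show ?thesis using assms(2)[OF 2] by blast
    qed
  qed
  have i: "sat_items cl = its" by (simp add: sat_items_def M_def)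
  show "sat_instance cl \<in> instances" "restricted_instance (sat_instance cl)"
    unfolding i by (rule instances_P restricted_P)+
  have "yes_instance (sat_instance cl) \<longleftrightarrow> (\<exists>H. H \<subseteq> set (literals ?as) \<and> card H \<le> length ?as \<and>
      (\<forall>c \<in> set (hitting_clauses cl ?as). H \<inter> set c \<noteq> {}))"
    unfolding i using yes_implies_cover cover_implies_yes by blast
  also have "\<dots> \<longleftrightarrow> (\<exists>\<alpha>. \<forall>c \<in> set cl. satisfies \<alpha> c)"
    by (rule satisfiable_iff_hitting_set[OF as(1), symmetric]) (rule as(2))
  finally show "yes_instance (sat_instance cl) \<longleftrightarrow> (\<exists>\<alpha>. \<forall>c \<in> set cl. satisfies \<alpha> c)" .
qed

subsection \<open>Computing the reduction\<close>

lemma fraction_of_nat: "fraction (of_nat m) = [m, 1]"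
proof -
  have "(of_nat m :: rat) = Rat.Fract (int m) 1" by (simp add: of_nat_rat)
  then show ?thesis unfolding fraction_def by (simp add: quotient_of_Fract Rat.normalize_def)
qed

text \<open>The serialisation with all fractions evaluated, so that the reduction never handles
  rationals. The last list consists of time, energy, cost and capacity of mode 0 and of mode 1,
  followed by budget, time bound and energy bound.\<close>

definition hs_serial :: "(nat \<times> 'l list) list \<Rightarrow> nat \<Rightarrow> nat list" where
  "hs_serial its b = [length its, 1] @
     concat (map (\<lambda>e. (if hs_adjacent (nth_default (0, []) its (fst e)) (nth_default (0, []) its (snd e)) then [1, 1, 1] else [0]) @
         [if fst e = snd e then 0 else 1]) (List.product [0..<length its] [0..<length its])) @
     [2, 1, 0, 1, 0, 1, 1, 1, 1, 1, 1, 1, 0, 1, 3 * length its * length its, 1, 1, 1, 5 * length its * length its, 1, b, 1]"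

lemma serialise_hs_instance: "serialise (hs_instance its b) = hs_serial its b"
proof -
  have m: "concat (map (\<lambda>e. (if e \<in> {e \<in> {..<length its} \<times> {..<length its}. hs_adjacent (its ! fst e) (its ! snd e)} then 1 # fraction 1 else [0]) @
         [if fst e = snd e then 0 else 1]) (List.product [0..<length its] [0..<length its])) =
     concat (map (\<lambda>e. (if hs_adjacent (nth_default (0, []) its (fst e)) (nth_default (0, []) its (snd e)) then [1, 1, 1] else [0]) @
         [if fst e = snd e then 0 else 1]) (List.product [0..<length its] [0..<length its]))"
    using fraction_of_nat[of 1] by (intro arg_cong[where f = concat] map_cong) (auto simp: nth_default_def)
  have f: "fraction 0 = [0, 1]" "fraction 1 = [1, 1]" "fraction 2 = [2, 1]"
    using fraction_of_nat[of 0] fraction_of_nat[of 1] fraction_of_nat[of 2] by simp_all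
  have g: "fraction (of_nat (3 * length its * length its)) = [3 * length its * length its, 1]"
    "fraction (of_nat (5 * length its * length its)) = [5 * length its * length its, 1]"
    by (rule fraction_of_nat)+
  have u: "[0..<Suc 1] = [0, 1]" by (simp add: upt_rec)
  show ?thesis
    unfolding serialise_def hs_instance_def Let_def hs_serial_def msp_instance.simps pair_pre_digraph.simps card_lessThan m u
    by (simp add: f fraction_of_nat g[simplified])
qed

lemma fp_mem[fp_intro]: "fp f \<Longrightarrow> fp l \<Longrightarrow> fp (\<lambda>x. f x \<in> set (l x))"
proof -
  assume f: "fp f" "fp l"
  have "fp (\<lambda>z. f (fst z))" by (rule fp_comp[OF f(1)]) (intro fp_intro)
  then have "fp (\<lambda>x. \<exists>a \<in> set (l x). a = f x)" by (intro fp_intro f)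
  then show ?thesis by simp
qed

lemma fp_hs_adjacent: "fp (\<lambda>z. hs_adjacent (fst z) (snd z))"
  unfolding hs_adjacent_def by (intro fp_intro)

lemma pb_length: "fp l \<Longrightarrow> pb (\<lambda>x. length (l x))"
  by (rule pb_le[OF pb_esz length_le_esz])

lemma fp_dedup[fp_intro]: "fp l \<Longrightarrow> fp (\<lambda>x. dedup (l x))"
proof -
  assume l: "fp l"
  have "fp (\<lambda>x. fold (\<lambda>a bs. if \<exists>b \<in> set bs. b = a then bs else a # bs) (l x) [])"
  proof (rule fp_fold_add[where K = "\<lambda>x. esz (l x) + 1"])
    show "fp (\<lambda>z. if \<exists>b \<in> set (snd (snd z)). b = fst (snd z) then snd (snd z) else fst (snd z) # snd (snd z))"
      by (intro fp_intro)
    show "esz (if \<exists>b \<in> set bs. b = a then bs else a # bs) \<le> esz bs + (esz (l x) + 1)" if "a \<in> set (l x)" for x a bs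
      using esz_mem[OF that] by simp
  qed (intro l fp_intro pb_intros)+
  then show ?thesis unfolding dedup_def .
qed

lemma fp_hs_items:
  assumes "fp ls" "fp cs" "fp M" "pb M"
  shows "fp (\<lambda>x. hs_items (ls x) (cs x) (M x))"
proof -
  have "fp (\<lambda>z. [0..<M (fst z)])" by (rule fp_comp[OF fp_upt[OF assms(3,4)]]) (intro fp_intro)
  then have "fp (\<lambda>x. (0 :: nat, []) # map (\<lambda>l. (1, [l])) (ls x) @ concat (map (\<lambda>c. map (\<lambda>_. (2, c)) [0..<M x]) (cs x)))"
    by (intro fp_intro assms)
  then show ?thesis unfolding hs_items_def by (simp add: map_replicate_const)
qed

lemma fp_clause_atoms[fp_intro]: "fp f \<Longrightarrow> fp (\<lambda>x. clause_atoms (f x))"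
  unfolding clause_atoms_def by (intro fp_intro)

lemma fp_sat_items: "fp sat_items"
  unfolding sat_items_def literals_def hitting_clauses_def
  by (intro fp_hs_items fp_intro pb_intros pb_length)

lemma fp_hs_serial: "fp (\<lambda>z. hs_serial (fst z) (snd z))"
proof -
  have "fp (\<lambda>z. hs_adjacent (nth_default (0, []) (fst (fst z)) (fst (snd z))) (nth_default (0, []) (fst (fst z)) (snd (snd z))))"
    using fp_comp[OF fp_hs_adjacent, of "\<lambda>z. (nth_default (0, []) (fst (fst z)) (fst (snd z)), nth_default (0, []) (fst (fst z)) (snd (snd z)))"]
    by (simp add: fp_intro)
  then show ?thesis unfolding hs_serial_def by (intro fp_intro fp_index_list)
qed

lemma fp_implication[fp_intro]: "fp f \<Longrightarrow> fp g \<Longrightarrow> fp (\<lambda>x. implication (f x) (g x))"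
  unfolding implication_def by (intro fp_intro)

lemma fp_situation_aux: "fp (\<lambda>z. situation (fst z) (fst (snd z)) (snd (snd z)))"
  unfolding situation_def by (intro fp_intro)

lemma fp_situation[fp_intro]: "fp f \<Longrightarrow> fp g \<Longrightarrow> fp h \<Longrightarrow> fp (\<lambda>x. situation (f x) (g x) (h x))"
  using fp_comp[OF fp_situation_aux, of "\<lambda>x. (f x, g x, h x)"] by (simp add: fp_intro)

context machine
begin

text \<open>The ranges are arguments of \<open>clauses\<close>: building them requires polynomial
  bounds on their lengths, which are available only where \<tau> and the length of certificates are
  given.\<close>

lemma fp_clauses_aux:
  "fp (\<lambda>z. clauses (fst z) (fst (snd z)) (fst (snd (snd z))) (fst (snd (snd (snd z)))) (snd (snd (snd (snd z)))))"
  unfolding clauses_def state_clauses_def write_clauses_def head_clauses_def scan_clauses_def frame_clauses_def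
    initial_clauses_def certificate_clauses_def
  by (intro fp_intro fp_index_list)

lemma fp_clauses:
  "fp \<tau> \<Longrightarrow> fp ts \<Longrightarrow> fp ps \<Longrightarrow> fp d \<Longrightarrow> fp js \<Longrightarrow> fp (\<lambda>x. clauses (\<tau> x) (ts x) (ps x) (d x) (js x))"
  using fp_comp[OF fp_clauses_aux, of "\<lambda>x. (\<tau> x, ts x, ps x, d x, js x)"] by (simp add: fp_intro)

end

lemma fp_poly[fp_intro]: "fp f \<Longrightarrow> fp (\<lambda>x. poly p (f x))" for p :: "nat poly"
  by (induction p) (simp_all add: fp_intro)

text \<open>The conclusion supplies the instances and not only their codes, so that the same
  reduction serves the full and the restricted problem.\<close>

theorem restricted_MSP_hard:
  assumes "B \<in> class_NP"
  obtains f P where "polytime_computable f" "\<And>x. P x \<in> instances" "\<And>x. restricted_instance (P x)"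
    "\<And>x. f x = encode (P x)" "\<And>x. yes_instance (P x) \<longleftrightarrow> x \<in> B"
proof -
  obtain R p where R: "R \<in> class_P" and B: "\<And>x. x \<in> B \<longleftrightarrow> (\<exists>u. length u \<le> poly p (length x) \<and> delimit x @ u \<in> R)"
    using assms unfolding class_NP_def by auto
  obtain Mt T where Mt: "turing_machine Mt" and T: "computes_within Mt (\<lambda>z. [z \<in> R]) (poly T)"
    using R unfolding class_P_def polytime_computable_def by auto
  interpret machine Mt by unfold_locales (rule Mt)
  define n where "n x = poly p (length x)" for x :: "bool list"
  \<comment> \<open>\<open>2 * length x + 1\<close> is the length of \<open>delimit x\<close>, so
    the argument bounds the length of everything the verifier can be run on.\<close>
  define \<tau> where "\<tau> x = poly T (2 * length x + 1 + n x)" for x :: "bool list"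
  define cl where "cl x = clauses (\<tau> x) [0..<\<tau> x] [0..<Suc (2 * \<tau> x)] (delimit x) [0..<n x]" for x
  have fp_n: "fp n" "pb n" unfolding n_def by (intro fp_intro pb_intros pb_length)+
  have fp_t: "fp \<tau>" "pb \<tau>" unfolding \<tau>_def by (intro fp_intro fp_n pb_intros pb_length)+
  have fp_cl: "fp cl" unfolding cl_def by (intro fp_clauses fp_upt fp_intro fp_t fp_n pb_intros)
  have its: "fp (\<lambda>x. sat_items (cl x))" by (rule fp_comp[OF fp_sat_items fp_cl])
  have at: "fp (\<lambda>x. length (clause_atoms (cl x)))" by (intro fp_intro fp_cl)
  have ser: "fp (\<lambda>x. hs_serial (sat_items (cl x)) (length (clause_atoms (cl x))))"
    using fp_comp[OF fp_hs_serial fp_Pair[OF its at]] by simp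
  have "fp (\<lambda>x. encode (sat_instance (cl x)))"
    unfolding encode_def serialise_hs_instance by (intro fp_intro ser)
  then have pc: "polytime_computable (\<lambda>x. encode (sat_instance (cl x)))" by (rule polytime_computable_if_fp)
  have ne: "cl x \<noteq> []" "\<And>c. c \<in> set (cl x) \<Longrightarrow> c \<noteq> []" for x
    unfolding cl_def by (simp add: clauses_def) (rule clauses_nonempty)
  have si: "sat_instance (cl x) \<in> instances" "restricted_instance (sat_instance (cl x))"
    "yes_instance (sat_instance (cl x)) \<longleftrightarrow> (\<exists>\<alpha>. \<forall>c \<in> set (cl x). satisfies \<alpha> c)" for x
    by (rule sat_instance, rule ne(1), erule ne(2))+
  have "yes_instance (sat_instance (cl x)) \<longleftrightarrow> x \<in> B" for x
  proof -
    have "poly T j \<le> \<tau> x" if "j \<le> length (delimit x) + n x" for j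
      unfolding \<tau>_def using that by (intro poly_nat_mono) (simp add: length_delimit)
    then show ?thesis unfolding si(3) unfolding B cl_def n_def[symmetric] by (rule cook_levin[OF T])
  qed
  then show ?thesis using si(1,2)
    by (intro that[of "\<lambda>x. encode (sat_instance (cl x))" "\<lambda>x. sat_instance (cl x)", OF pc]) simp_all
qed

theorem theorem3p2:
  shows "NP_complete MSP \<and> NP_complete restricted_MSP"
proof -
  have "polytime_reducible B MSP \<and> polytime_reducible B restricted_MSP" if "B \<in> class_NP" for B
  proof -
    obtain f P where f: "polytime_computable f" "\<And>x. P x \<in> instances" "\<And>x. restricted_instance (P x)"
      "\<And>x. f x = encode (P x)" "\<And>x. yes_instance (P x) \<longleftrightarrow> x \<in> B"
      by (rule restricted_MSP_hard[OF \<open>B \<in> class_NP\<close>]) (rule that)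
    have 1: "x \<in> B \<longleftrightarrow> f x \<in> MSP" for x using encode_in_MSP_iff[OF f(2)] f(4,5) by simp
    have "x \<in> B \<longleftrightarrow> f x \<in> restricted_MSP" for x
    proof
      assume "x \<in> B"
      then show "f x \<in> restricted_MSP" unfolding restricted_MSP_def f(4) using f(2,3,5) by blast
    next
      assume "f x \<in> restricted_MSP"
      \<comment> \<open>The restricted language is contained in \<open>MSP\<close>, so the
        equivalence for \<open>MSP\<close>, which rests on the faithfulness of the encoding, settles
        this direction too.\<close>
      then show "x \<in> B" unfolding 1 by (auto simp: MSP_def restricted_MSP_def)
    qed
    then show ?thesis using f(1) 1 unfolding polytime_reducible_def by blast
  qed
  then show ?thesis
    using msp_language_NP[of False] msp_language_NP[of True]
    unfolding NP_complete_def msp_language_False msp_language_True by blast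
qed

end
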